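(* Let $N\in\mathbb N^*$, $\gamma>0$ and $\tau=\tau_1+\frac{i\pi N}{\gamma^2}$ with $\tau_1\in\mathbb R$. The equation $i\partial_tu=\Pi(|u|^2u)$, $u(0,\cdot)=u_0$, is globally well-posed in $\mathcal E_{\tau,\gamma}$: for all $u_0\in\mathcal E_{\tau,\gamma}$ there exists a unique solution $u\in\mathcal C^\infty(\mathbb R;\mathcal E_{\tau,\gamma})$, which depends smoothly on $u_0$. Moreover, for all $t\in\mathbb R$, $$\int_{K_{\tau,\gamma}}|u(t,z)|^2dL(z)=\int_{K_{\tau,\gamma}}|u_0(z)|^2dL(z),\qquad \int_{K_{\tau,\gamma}}|u(t,z)|^4dL(z)=\int_{K_{\tau,\gamma}}|u_0(z)|^4dL(z).$$ Furthermore, the solution can be represented in any of the following forms. (i) Assume that $(z_{j,0})_{1\le j\le N}$ satisfy $\sum_{j=1}^Nz_{j,0}=\frac\gamma2(\tau-1)N-k\tau\gamma+\ell\gamma$ for some $k,\ell\in\mathbb Z$. Then the solution with data $$u_0(z)=\mu_0\exp\Big(\tfrac12z^2+\tfrac{i\pi}\gamma(-N+2k)z-\tfrac12|z|^2\Big)\prod_{j=1}^N\Theta_\tau\Big(\tfrac1\gamma(z-z_{j,0})\Big)$$ takes the form $$u(t,z)=\mu(t)\exp\Big(\tfrac12z^2+\tfrac{i\pi}\gamma(-N+2k)z-\tfrac12|z|^2\Big)\prod_{j=1}^N\Theta_\tau\Big(\tfrac1\gamma(z-z_j(t))\Big),$$ and for all $t\in\mathbb R$, $$\sum_{j=1}^Nz_j(t)=\sum_{j=1}^Nz_{j,0}=\frac\gamma2(\tau-1)N-k\tau\gamma+\ell\gamma.$$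 (ii) Assume that $u_0=\sum_{j=0}^{N-1}\lambda_{j,0}\Phi_j$ with $(\lambda_{j,0})_{0\le j\le N-1}\in\mathbb C^N$. Then $u(t,z)=\sum_{j=0}^{N-1}\lambda_j(t)\Phi_j(z)$, where for all $0\le j\le N-1$ $$i\dot\lambda_j=C_N\sum_{\substack{0\le k,\ell,m\le N-1\\k-\ell+m\equiv j\ [N]}}\Big(\int_{K_{\tau,\gamma}}\Phi_k(z)\overline{\Phi_\ell(z)}\Phi_m(z)\overline{\Phi_j(z)}\,dL(z)\Big)\lambda_k\overline{\lambda_\ell}\lambda_m,$$ with $C_N=\Big(\int_{K_{\tau,\gamma}}|\Phi_j(z)|^2dL(z)\Big)^{-1}=\frac1{\gamma N}\sqrt{\frac2\pi}\exp\big(-\frac{\pi^2}{2\gamma^2}\big)$, and for all $t\in\mathbb R$, $\sum_{j=0}^{N-1}|\lambda_j(t)|^2=\sum_{j=0}^{N-1}|\lambda_{j,0}|^2$.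
   Context: $L$ is Lebesgue measure on $\mathbb C$. For a function $u$ on $\mathbb C$ of at most polynomial growth, $[\Pi u](z)=\frac1\pi e^{-|z|^2/2}\int_{\mathbb C}e^{\overline w z-|w|^2/2}u(w)\,dL(w)$. $\widetilde{\mathcal E}$ is the set of functions $u(z)=e^{-|z|^2/2}f(z)$ with $f$ entire such that $|u(z)|\lesssim\langle z\rangle^M$ for some $M$. For $\alpha\in\mathbb C$, $R_\alpha u(z)=e^{(\alpha\overline z-\overline\alpha z)/2}u(z+\alpha)$. Set $$\mathcal E_{\tau,\gamma}=\{u\in\widetilde{\mathcal E}:R_\gamma u=u,\ R_{\gamma\tau}u=u\},\qquad K_{\tau,\gamma}=\{\gamma(r_1+r_2\tau):r_1,r_2\in[0,1]\}.$$ For $\mathrm{Im}\,\tau>0$, $\Theta_\tau(z)=-i\sum_{n\in\mathbb Z}(-1)^n\exp\big(i\pi\tau(n+\tfrac12)^2+i(2n+1)\pi z\big)$. Set $$\Phi_0(z)=\exp\Big(\tfrac12z^2-\tfrac{i\pi}\gamma z-\tfrac12|z|^2\Big)\Theta_{\tau/N}\Big(\frac{z-z_0}\gamma\Big),\quad z_0=\frac\gamma2\Big(\frac\tau N-1\Big),\qquad \Phi_k=R_{k\gamma/N}\Phi_0,\ 0\le k\le N-1.$$ (The $\Phi_k$, $0\le k\le N-1$, form a basis of the $N$-dimensional space $\mathcal E_{\tau,\gamma}$.) The notation $k-\ell+m\equiv j\ [N]$ means congruence modulo $N$. *)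

theory Defs
  imports
    "HOL-Complex_Analysis.Complex_Analysis"
    "HOL-Library.Function_Algebras"
    "HOL-Number_Theory.Cong"
begin

text \<open>Pointwise real vector space structure on functions (the additive structure comes from
  \<^theory>\<open>HOL-Library.Function_Algebras\<close>); it is used only to speak about differentiability of maps
  with values in, or defined on, a space of functions.\<close>

instantiation "fun" :: (type, real_vector) real_vector
begin

definition scaleR_fun :: "real \<Rightarrow> ('a \<Rightarrow> 'b) \<Rightarrow> 'a \<Rightarrow> 'b" where
  "scaleR_fun r f = (\<lambda>x. r *\<^sub>R f x)"

instance
  by standard (simp_all add: scaleR_fun_def fun_eq_iff scaleR_add_right scaleR_add_left)

end

text \<open>\<open>F\<close> is a \<open>C\<^sup>\<infinity>\<close> map from \<open>V\<close> to \<open>W\<close>, where \<open>V\<close> and \<open>W\<close> are finite-dimensional real subspaces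
  normed by \<open>p\<close> and \<open>q\<close>.  The value \<open>D [h\<^sub>n, \<dots>, h\<^sub>1] x\<close> is the \<open>n\<close>-th Frechet derivative of \<open>F\<close>
  at \<open>x\<close> evaluated on \<open>(h\<^sub>1, \<dots>, h\<^sub>n)\<close>: for all fixed directions it is again Frechet
  differentiable in \<open>x\<close>, its differential being the linear map \<open>h \<mapsto> D (h # hs) x\<close>.
  As \<open>V\<close> is finite-dimensional, linear maps on it are bounded, and differentiability in the
  operator norm is the same as differentiability on each tuple of directions.\<close>

definition frechet_smooth ::
  "'a::real_vector set \<Rightarrow> ('a \<Rightarrow> real) \<Rightarrow> 'b::real_vector set \<Rightarrow> ('b \<Rightarrow> real) \<Rightarrow> ('a \<Rightarrow> 'b) \<Rightarrow> bool"
where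
  "frechet_smooth V p W q F \<longleftrightarrow>
    (\<exists>D :: 'a list \<Rightarrow> 'a \<Rightarrow> 'b.
      (\<forall>x\<in>V. D [] x = F x) \<and>
      (\<forall>hs\<in>lists V. \<forall>x\<in>V.
        D hs x \<in> W \<and>
        (\<forall>h\<in>V. \<forall>k\<in>V. D ((h + k) # hs) x = D (h # hs) x + D (k # hs) x) \<and>
        (\<forall>h\<in>V. \<forall>r::real. D ((r *\<^sub>R h) # hs) x = r *\<^sub>R D (h # hs) x) \<and>
        (\<forall>\<epsilon>>0. \<exists>\<delta>>0. \<forall>h\<in>V. p h < \<delta> \<longrightarrow>
            q (D hs (x + h) - D hs x - D (h # hs) x) \<le> \<epsilon> * p h)))"

definition LLL_proj :: "(complex \<Rightarrow> complex) \<Rightarrow> complex \<Rightarrow> complex" where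
  "LLL_proj u z = of_real (1 / pi) * exp (- of_real ((cmod z)\<^sup>2) / 2) *
     (LINT w|lborel. exp (cnj w * z - of_real ((cmod w)\<^sup>2) / 2) * u w)"

definition LLL_space :: "(complex \<Rightarrow> complex) set" where
  "LLL_space = {u. (\<exists>f. f holomorphic_on UNIV \<and>
                        (\<forall>z. u z = exp (- of_real ((cmod z)\<^sup>2) / 2) * f z)) \<and>
                   (\<exists>M C::real. \<forall>z. cmod (u z) \<le> C * sqrt (1 + (cmod z)\<^sup>2) powr M)}"

definition mag_trans :: "complex \<Rightarrow> (complex \<Rightarrow> complex) \<Rightarrow> complex \<Rightarrow> complex" where
  "mag_trans \<alpha> u z = exp ((\<alpha> * cnj z - cnj \<alpha> * z) / 2) * u (z + \<alpha>)"

definition lattice_space :: "complex \<Rightarrow> real \<Rightarrow> (complex \<Rightarrow> complex) set" where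
  "lattice_space \<tau> \<gamma> =
     {u \<in> LLL_space. mag_trans (of_real \<gamma>) u = u \<and> mag_trans (of_real \<gamma> * \<tau>) u = u}"

definition cell :: "complex \<Rightarrow> real \<Rightarrow> complex set" where
  "cell \<tau> \<gamma> = {of_real \<gamma> * (of_real r\<^sub>1 + of_real r\<^sub>2 * \<tau>) | r\<^sub>1 r\<^sub>2. r\<^sub>1 \<in> {0..1} \<and> r\<^sub>2 \<in> {0..1}}"

definition theta :: "complex \<Rightarrow> complex \<Rightarrow> complex" where
  "theta \<tau> z = - \<i> * (\<Sum>\<^sub>\<infinity>n::int. (-1) powi n *
     exp (\<i> * of_real pi * \<tau> * (of_int n + 1/2)\<^sup>2 + \<i> * (2 * of_int n + 1) * of_real pi * z))"

definition Phi0 :: "nat \<Rightarrow> complex \<Rightarrow> real \<Rightarrow> complex \<Rightarrow> complex" where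
  "Phi0 N \<tau> \<gamma> z =
     (let z\<^sub>0 = of_real \<gamma> / 2 * (\<tau> / of_nat N - 1)
      in exp (z\<^sup>2 / 2 - \<i> * of_real pi / of_real \<gamma> * z - of_real ((cmod z)\<^sup>2) / 2) *
         theta (\<tau> / of_nat N) ((z - z\<^sub>0) / of_real \<gamma>))"

definition Phi :: "nat \<Rightarrow> complex \<Rightarrow> real \<Rightarrow> nat \<Rightarrow> complex \<Rightarrow> complex" where
  "Phi N \<tau> \<gamma> k = mag_trans (of_nat k * of_real \<gamma> / of_nat N) (Phi0 N \<tau> \<gamma>)"

text \<open>The \<open>L\<^sup>2\<close> norm on a fundamental cell. It is a norm on the finite-dimensional space
  \<^const>\<open>lattice_space\<close>, where it induces the only Hausdorff vector space topology.\<close>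

definition cell_norm :: "complex \<Rightarrow> real \<Rightarrow> (complex \<Rightarrow> complex) \<Rightarrow> real" where
  "cell_norm \<tau> \<gamma> u = sqrt (LINT z:cell \<tau> \<gamma>|lborel. (cmod (u z))\<^sup>2)"

definition LLL_solution ::
  "complex \<Rightarrow> real \<Rightarrow> (complex \<Rightarrow> complex) \<Rightarrow> (real \<Rightarrow> complex \<Rightarrow> complex) \<Rightarrow> bool"
where
  "LLL_solution \<tau> \<gamma> u\<^sub>0 u \<longleftrightarrow>
     frechet_smooth UNIV abs (lattice_space \<tau> \<gamma>) (cell_norm \<tau> \<gamma>) u \<and>
     u 0 = u\<^sub>0 \<and>
     (\<forall>t z. ((\<lambda>s. \<i> * u s z) has_vector_derivative
              LLL_proj (\<lambda>w. of_real ((cmod (u t w))\<^sup>2) * u t w) z) (at t))"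

definition LLL_flow ::
  "complex \<Rightarrow> real \<Rightarrow> real \<times> (complex \<Rightarrow> complex) \<Rightarrow> complex \<Rightarrow> complex"
where
  "LLL_flow \<tau> \<gamma> = (\<lambda>(t, u\<^sub>0). (THE u. LLL_solution \<tau> \<gamma> u\<^sub>0 u) t)"

definition theta_product ::
  "nat \<Rightarrow> complex \<Rightarrow> real \<Rightarrow> int \<Rightarrow> complex \<Rightarrow> (nat \<Rightarrow> complex) \<Rightarrow> complex \<Rightarrow> complex"
where
  "theta_product N \<tau> \<gamma> k \<mu> zs z =
     \<mu> * exp (z\<^sup>2 / 2 + \<i> * of_real pi / of_real \<gamma> * (- of_nat N + 2 * of_int k) * z
              - of_real ((cmod z)\<^sup>2) / 2) *
     (\<Prod>j=1..N. theta \<tau> ((z - zs j) / of_real \<gamma>))"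

end

(* For u = exp(z^2/2 - |z|^2/2) G(z/gamma), membership of u in the space E means that the entire
   function G is quasi-periodic of level N for the lattice generated by 1 and tau.  Theta has exactly
   the lattice points as zeros, all simple, and a function of level n >= 1 has a zero (else G'/G would
   have a doubly periodic, hence constant, derivative), so dividing by thetas one zero at a time writes
   G as an exponential times a product of N thetas.  The functions Phi_k are eigenvectors of the
   translation by gamma tau / N with distinct eigenvalues, hence orthogonal; unfolding the cell in one
   direction turns their norm into a Gaussian integral.
   Gaussian averaging shows that the projection fixes E, and unfolding both lattice directions that it
   is self-adjoint on quasi-periodic functions over a cell.  In the basis Phi_k the equation becomes
   i lambda' = C_N times a cubic form whose coefficients vanish off the resonant set by translation
   invariance.  Conservation of the l^2 norm makes the flow of this cubic system global.  It is
   analytic: complexify, treating lambda and its conjugate as independent variables; the power series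
   in time then converges on an interval whose length depends on the norm only, and the flow up to
   time t is an n-fold composition of short steps.  Smoothness in the Frechet sense is read off from
   the analytic extension.  Finally every u(t) in E is again a theta product. *)
theory Submission
  imports Defs "HOL-Probability.Distributions"
begin

subsection \<open>Entire functions that are quasi-periodic with respect to a lattice\<close>

text \<open>The condition Im \<tau> = pi N / \<gamma>^2 gives the cell the area pi N. This is what
  turns invariance under the two magnetic translations into an integer level N, so that zeros can be
  split off one by one. The zeros of the theta series cannot be read off from the series; they are
  found by comparison with an auxiliary level one function built as a product, of which the
  factorization theorem shows theta to be a translate up to an exponential factor. Smooth dependence
  has to be shown to all orders, on a space of functions, so it calls for a class of maps stable
  under directional derivatives. Bounded functions that are holomorphic along every holomorphic
  curve form such a class, with the radius halved at each derivative, and substitution is immediate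
  in it. The conjugate in the cubic term is what forces the doubling of the variables. Away from the
  real points the l^2 norm is no longer conserved, so the size of complex iterates must be
  controlled by continuity from the real ones, where it is. The length of a time step can then be
  kept fixed near given time and data.\<close>

definition quasi_periodic :: "complex \<Rightarrow> nat \<Rightarrow> complex \<Rightarrow> complex \<Rightarrow> (complex \<Rightarrow> complex) \<Rightarrow> bool" where
  "quasi_periodic \<tau> n a b G \<longleftrightarrow> G holomorphic_on UNIV \<and> a \<noteq> 0 \<and> b \<noteq> 0 \<and> (\<forall>x. G (x + 1) = a * G x) \<and>
     (\<forall>x. G (x + \<tau>) = b * exp (- (2 * of_real pi * \<i> * of_nat n * x)) * G x)"

lemma quasi_periodicD:
  assumes "quasi_periodic \<tau> n a b G"
  shows "G holomorphic_on UNIV" "a \<noteq> 0" "b \<noteq> 0" "G (x + 1) = a * G x"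
    "G (x + \<tau>) = b * exp (- (2 * of_real pi * \<i> * of_nat n * x)) * G x"
  using assms by (auto simp: quasi_periodic_def)

lemma exp_minus_solve:
  fixes b X Y A :: complex
  assumes "Y = b * exp (- A) * X" "b \<noteq> 0"
  shows "X = exp A * Y / b"
  using assms by (simp add: exp_minus)

lemma quasi_periodic_shift_int:
  assumes "quasi_periodic \<tau> n a b G"
  shows "\<exists>c. c \<noteq> 0 \<and> (\<forall>x. G (x + of_int m) = c * G x)"
proof (induction m rule: int_induct[where k=0])
  case base then show ?case by (intro exI[of _ 1]) auto
next
  case (step1 i)
  then obtain c where c: "c \<noteq> 0" "\<And>x. G (x + of_int i) = c * G x" by blast
  have "G (x + of_int (i + 1)) = a * c * G x" for x
    using quasi_periodicD(4)[OF assms, of "x + of_int i"] c(2)[of x] by (simp add: algebra_simps)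
  then show ?case using c(1) quasi_periodicD(2)[OF assms] by (intro exI[of _ "a * c"]) auto
next
  case (step2 i)
  then obtain c where c: "c \<noteq> 0" "\<And>x. G (x + of_int i) = c * G x" by blast
  have "G (x + of_int (i - 1)) = c / a * G x" for x
    using quasi_periodicD(4)[OF assms, of "x + of_int (i - 1)"] c(2)[of x] quasi_periodicD(2)[OF assms]
    by (simp add: algebra_simps divide_simps)
  then show ?case using c(1) quasi_periodicD(2)[OF assms] by (intro exI[of _ "c / a"]) auto
qed

text \<open>Iterating the shift also produces terms in the exponent that are quadratic in m; they do
  not involve x and are absorbed by the constant.\<close>

lemma quasi_periodic_shift_tau:
  assumes "quasi_periodic \<tau> n a b G"
  shows "\<exists>c. c \<noteq> 0 \<and> (\<forall>x. G (x + of_int m * \<tau>) = c * exp (- (2 * of_real pi * \<i> * of_nat n * of_int m * x)) * G x)"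
proof (induction m rule: int_induct[where k=0])
  case base then show ?case by (intro exI[of _ 1]) auto
next
  case (step1 i)
  then obtain c where c: "c \<noteq> 0"
    "\<And>x. G (x + of_int i * \<tau>) = c * exp (- (2 * of_real pi * \<i> * of_nat n * of_int i * x)) * G x" by blast
  have "G (x + of_int (i + 1) * \<tau>) = (b * c * exp (- (2 * of_real pi * \<i> * of_nat n * of_int i * \<tau>))) *
    exp (- (2 * of_real pi * \<i> * of_nat n * of_int (i + 1) * x)) * G x" for x
  proof -
    have "G (x + of_int (i + 1) * \<tau>) = G ((x + of_int i * \<tau>) + \<tau>)" by (simp add: algebra_simps)
    also have "\<dots> = b * c * (exp (- (2 * of_real pi * \<i> * of_nat n * (x + of_int i * \<tau>))) *
        exp (- (2 * of_real pi * \<i> * of_nat n * of_int i * x))) * G x"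
      unfolding quasi_periodicD(5)[OF assms] c(2) by simp
    also have "\<dots> = b * c * (exp (- (2 * of_real pi * \<i> * of_nat n * of_int i * \<tau>)) *
        exp (- (2 * of_real pi * \<i> * of_nat n * of_int (i + 1) * x))) * G x"
      by (simp only: exp_add[symmetric]) (simp add: algebra_simps)
    finally show ?thesis by simp
  qed
  then show ?case using c(1) quasi_periodicD(3)[OF assms]
    by (intro exI[of _ "b * c * exp (- (2 * of_real pi * \<i> * of_nat n * of_int i * \<tau>))"]) auto
next
  case (step2 i)
  then obtain c where c: "c \<noteq> 0"
    "\<And>x. G (x + of_int i * \<tau>) = c * exp (- (2 * of_real pi * \<i> * of_nat n * of_int i * x)) * G x" by blast
  have "G (x + of_int (i - 1) * \<tau>) = (c / b * exp (2 * of_real pi * \<i> * of_nat n * of_int (i - 1) * \<tau>)) *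
    exp (- (2 * of_real pi * \<i> * of_nat n * of_int (i - 1) * x)) * G x" for x
  proof -
    have "G (x + of_int i * \<tau>) = G ((x + of_int (i - 1) * \<tau>) + \<tau>)" by (simp add: algebra_simps)
    also have "\<dots> = b * exp (- (2 * of_real pi * \<i> * of_nat n * (x + of_int (i - 1) * \<tau>))) * G (x + of_int (i - 1) * \<tau>)"
      unfolding quasi_periodicD(5)[OF assms] by simp
    finally have "c * exp (- (2 * of_real pi * \<i> * of_nat n * of_int i * x)) * G x =
      b * exp (- (2 * of_real pi * \<i> * of_nat n * (x + of_int (i - 1) * \<tau>))) * G (x + of_int (i - 1) * \<tau>)"
      unfolding c(2) .
    then have "G (x + of_int (i - 1) * \<tau>) = exp (2 * of_real pi * \<i> * of_nat n * (x + of_int (i - 1) * \<tau>)) *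
        (c * exp (- (2 * of_real pi * \<i> * of_nat n * of_int i * x)) * G x) / b"
      using quasi_periodicD(3)[OF assms] by (rule exp_minus_solve)
    also have "\<dots> = c / b * (exp (- (2 * of_real pi * \<i> * of_nat n * of_int i * x)) *
       exp (2 * of_real pi * \<i> * of_nat n * (x + of_int (i - 1) * \<tau>))) * G x"
      by simp
    also have "\<dots> = c / b * (exp (2 * of_real pi * \<i> * of_nat n * of_int (i - 1) * \<tau>) *
        exp (- (2 * of_real pi * \<i> * of_nat n * of_int (i - 1) * x))) * G x"
      by (simp only: exp_add[symmetric]) (simp add: algebra_simps)
    finally show ?thesis by simp
  qed
  then show ?case using c(1) quasi_periodicD(3)[OF assms]
    by (intro exI[of _ "c / b * exp (2 * of_real pi * \<i> * of_nat n * of_int (i - 1) * \<tau>)"]) auto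
qed

text \<open>Serves to carry zeros, and derivatives at zeros, from one lattice point to another. For
  this it is enough that the constant is nonzero.\<close>

lemma quasi_periodic_shift:
  assumes "quasi_periodic \<tau> n a b G"
  shows "\<exists>c. c \<noteq> 0 \<and> (\<forall>x. G (x + (of_int l + of_int m * \<tau>)) = c * exp (- (2 * of_real pi * \<i> * of_nat n * of_int m * x)) * G x)"
proof -
  obtain c where c: "c \<noteq> 0" "\<And>x. G (x + of_int l) = c * G x"
    using quasi_periodic_shift_int[OF assms] by blast
  obtain d where d: "d \<noteq> 0"
    "\<And>x. G (x + of_int m * \<tau>) = d * exp (- (2 * of_real pi * \<i> * of_nat n * of_int m * x)) * G x"
    using quasi_periodic_shift_tau[OF assms] by blast
  have "G (x + (of_int l + of_int m * \<tau>)) = (c * d) * exp (- (2 * of_real pi * \<i> * of_nat n * of_int m * x)) * G x" for x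
    using c(2)[of "x + of_int m * \<tau>"] d(2)[of x] by (simp add: algebra_simps)
  then show ?thesis using c d by (intro exI[of _ "c * d"]) auto
qed

section \<open>Liouville's theorem modulo the lattice\<close>

lemma lattice_reduction:
  fixes \<tau> x :: complex assumes "Im \<tau> > 0"
  obtains m n :: int and r s :: real where "0 \<le> r" "r \<le> 1" "0 \<le> s" "s \<le> 1"
    "x = (of_real r + of_real s * \<tau>) + (of_int m + of_int n * \<tau>)"
proof -
  define S where "S = Im x / Im \<tau>"
  define R where "R = Re x - S * Re \<tau>"
  have "x = of_real R + of_real S * \<tau>"
    using assms by (simp add: complex_eq_iff R_def S_def)
  also have "\<dots> = (of_real (frac R) + of_real (frac S) * \<tau>) + (of_int \<lfloor>R\<rfloor> + of_int \<lfloor>S\<rfloor> * \<tau>)"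
    by (simp add: frac_def algebra_simps)
  finally show thesis
    using that[of "frac R" "frac S"] frac_lt_1[of R] frac_lt_1[of S] frac_ge_0[of R] frac_ge_0[of S] by auto
qed

text \<open>Only the modulus is assumed periodic, so that multipliers of modulus one are allowed.
  The bound on the compact parallelogram spreads to the whole plane, and Liouville's theorem
  applies.\<close>

lemma entire_norm_periodic_constant:
  fixes H :: "complex \<Rightarrow> complex"
  assumes "Im \<tau> > 0" "H holomorphic_on UNIV"
    "\<And>x. norm (H (x + 1)) = norm (H x)" "\<And>x. norm (H (x + \<tau>)) = norm (H x)"
  shows "\<exists>c. \<forall>x. H x = c"
proof -
  have sh1: "norm (H (x + of_int m)) = norm (H x)" for m x
  proof (induction m rule: int_induct[where k=0])
    case (step1 i) then show ?case using assms(3)[of "x + of_int i"] by (simp add: algebra_simps)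
  next
    case (step2 i) then show ?case using assms(3)[of "x + of_int (i - 1)"] by (simp add: algebra_simps)
  qed auto
  have sh2: "norm (H (x + of_int m * \<tau>)) = norm (H x)" for m x
  proof (induction m rule: int_induct[where k=0])
    case (step1 i) then show ?case using assms(4)[of "x + of_int i * \<tau>"] by (simp add: algebra_simps)
  next
    case (step2 i) then show ?case using assms(4)[of "x + of_int (i - 1) * \<tau>"] by (simp add: algebra_simps)
  qed auto
  define K where "K = (\<lambda>(r, s). of_real r + of_real s * \<tau>) ` ({0..1} \<times> {0..1})"
  have "compact K" unfolding K_def
    by (intro compact_continuous_image compact_Times) (auto simp: case_prod_beta intro!: continuous_intros)
  then have "bounded (H ` K)"
    using assms(2) by (intro compact_imp_bounded compact_continuous_image)
      (auto intro: holomorphic_on_imp_continuous_on holomorphic_on_subset)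
  then obtain B where "\<forall>y\<in>H ` K. norm y \<le> B" unfolding bounded_iff ..
  then have B: "norm (H x) \<le> B" if "x \<in> K" for x using that by auto
  have "norm (H x) \<le> B" for x
  proof -
    obtain m n r s where *: "0 \<le> r" "r \<le> 1" "0 \<le> s" "s \<le> 1"
      "x = (of_real r + of_real s * \<tau>) + (of_int m + of_int n * \<tau>)"
      by (rule lattice_reduction[OF assms(1)])
    have "norm (H x) = norm (H ((of_real r + of_real s * \<tau>) + of_int m))"
      using sh2[of "(of_real r + of_real s * \<tau>) + of_int m" n] *(5) by (simp add: algebra_simps)
    also have "\<dots> \<le> B" unfolding sh1 using * by (intro B) (auto simp: K_def)
    finally show ?thesis .
  qed
  then have "bounded (range H)" unfolding bounded_iff by auto
  then obtain c where "\<forall>z\<in>UNIV. H z = c" using Liouville_theorem[OF assms(2)] unfolding constant_on_def by auto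
  then show ?thesis by (intro exI[of _ c]) auto
qed

text \<open>At level 0 both multipliers are constants. Dividing by a suitable exponential gives both
  of them modulus one: two real equations for the two unknowns Re s and Im s.\<close>

lemma quasi_periodic_0:
  assumes "Im \<tau> > 0" "quasi_periodic \<tau> 0 a b G"
  shows "\<exists>c s. \<forall>x. G x = c * exp (s * x)"
proof -
  note q = quasi_periodicD[OF assms(2)]
  define s1 where "s1 = ln (norm a)"
  \<comment> \<open>With Re s = ln |a|, this is the solution of Re (s \<tau>) = ln |b|; it exists
    because Im \<tau> is nonzero.\<close>
  define s2 where "s2 = (s1 * Re \<tau> - ln (norm b)) / Im \<tau>"
  define s where "s = Complex s1 s2"
  define H where "H = (\<lambda>x. exp (- (s * x)) * G x)"
  have n1: "norm (exp (- s) * a) = 1"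
    using q(2) by (simp only: norm_mult norm_exp_eq_Re) (simp add: s_def s1_def exp_minus)
  have n2: "norm (exp (- (s * \<tau>)) * b) = 1"
    using q(3) assms(1) by (simp only: norm_mult norm_exp_eq_Re) (simp add: s_def s2_def exp_minus)
  have "H holomorphic_on UNIV" unfolding H_def by (intro holomorphic_intros q)
  moreover have "norm (H (x + 1)) = norm (H x)" for x
  proof -
    have "H (x + 1) = (exp (- s) * a) * H x"
      unfolding H_def q(4) by (simp add: distrib_left exp_diff exp_minus divide_inverse mult_ac)
    then show ?thesis using n1 by (simp add: norm_mult)
  qed
  moreover have "norm (H (x + \<tau>)) = norm (H x)" for x
  proof -
    have "H (x + \<tau>) = (exp (- (s * \<tau>)) * b) * H x"
      unfolding H_def q(5) by (simp add: distrib_left exp_diff exp_minus divide_inverse mult_ac)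
    then show ?thesis using n2 by (simp add: norm_mult)
  qed
  ultimately have "\<exists>c. \<forall>x. H x = c" by (rule entire_norm_periodic_constant[OF assms(1)])
  then obtain c where c: "\<And>x. H x = c" by auto
  have "G x = c * exp (s * x)" for x using c[of x] by (simp add: H_def exp_minus field_simps)
  then show ?thesis by (intro exI[of _ c] exI[of _ s] allI)
qed

text \<open>At a zero of P the derivative of each product reduces to the other factor times the
  nonzero number P' x, which can be cancelled. This transfers functional equations to a quotient
  even at the zeros of the divisor.\<close>

lemma entire_cancel_simple_zeros:
  fixes F K P :: "complex \<Rightarrow> complex"
  assumes "F holomorphic_on UNIV" "K holomorphic_on UNIV" "P holomorphic_on UNIV"
    "\<And>x. P x = 0 \<Longrightarrow> deriv P x \<noteq> 0" "\<And>x. F x * P x = K x * P x"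
  shows "F x = K x"
proof (cases "P x = 0")
  case True
  have d: "(f has_field_derivative deriv f x) (at x)" if "f holomorphic_on UNIV" for f
    using holomorphic_derivI[OF that] by auto
  have "((\<lambda>x. F x * P x) has_field_derivative F x * deriv P x) (at x)"
    using d[OF assms(1)] d[OF assms(3)] True by (auto intro!: derivative_eq_intros)
  moreover have "((\<lambda>x. K x * P x) has_field_derivative K x * deriv P x) (at x)"
    using d[OF assms(2)] d[OF assms(3)] True by (auto intro!: derivative_eq_intros)
  ultimately have "F x * deriv P x = K x * deriv P x"
    unfolding assms(5) by (rule DERIV_unique)
  then show ?thesis using assms(4) True by auto
qed (use assms(5)[of x] in auto)

text \<open>Near a zero p of P the quotient equals the quotient of the difference quotients of G and
  P at p. These are entire, their singularities being removable, and the lower one takes the nonzero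
  value P' p at p.\<close>

lemma entire_divide_simple_zeros:
  fixes G P :: "complex \<Rightarrow> complex"
  assumes G: "G holomorphic_on UNIV" and P: "P holomorphic_on UNIV"
    and simple: "\<And>x. P x = 0 \<Longrightarrow> deriv P x \<noteq> 0 \<and> G x = 0"
  shows "\<exists>H. H holomorphic_on UNIV \<and> (\<forall>x. G x = H x * P x)"
proof -
  define H where "H = (\<lambda>x. if P x = 0 then deriv G x / deriv P x else G x / P x)"
  have "H field_differentiable at p" for p
  proof (cases "P p = 0")
    case False
    have o: "open {x. P x \<noteq> 0}"
      using P by (intro open_Collect_neq) (auto intro: holomorphic_on_imp_continuous_on)
    have "(\<lambda>x. G x / P x) holomorphic_on {x. P x \<noteq> 0}"
      by (intro holomorphic_on_divide holomorphic_on_subset[OF G] holomorphic_on_subset[OF P]) auto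
    then have "H holomorphic_on {x. P x \<noteq> 0}"
      by (rule holomorphic_transform) (auto simp: H_def)
    then show ?thesis using o False by (auto intro: holomorphic_on_imp_differentiable_at)
  next
    case True
    define G1 where "G1 = (\<lambda>z. if z = p then deriv G p else (G z - G p) / (z - p))"
    define P1 where "P1 = (\<lambda>z. if z = p then deriv P p else (P z - P p) / (z - p))"
    have h: "G1 holomorphic_on UNIV" "P1 holomorphic_on UNIV"
      unfolding G1_def P1_def using G P by (auto intro: pole_lemma)
    have o: "open {x. P1 x \<noteq> 0}"
      using h(2) by (intro open_Collect_neq) (auto intro: holomorphic_on_imp_continuous_on)
    have "(\<lambda>x. G1 x / P1 x) holomorphic_on {x. P1 x \<noteq> 0}"
      by (intro holomorphic_on_divide holomorphic_on_subset[OF h(1)] holomorphic_on_subset[OF h(2)]) auto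
    then have "H holomorphic_on {x. P1 x \<noteq> 0}"
      by (rule holomorphic_transform) (use True simple in \<open>auto simp: H_def G1_def P1_def divide_simps\<close>)
    moreover have "P1 p \<noteq> 0" using True simple by (auto simp: P1_def)
    ultimately show ?thesis using o by (auto intro: holomorphic_on_imp_differentiable_at)
  qed
  then have "H holomorphic_on UNIV" by (simp add: holomorphic_on_def)
  moreover have "G x = H x * P x" for x using simple by (auto simp: H_def)
  ultimately show ?thesis by (intro exI[of _ H] conjI allI)
qed

lemma quasi_periodic_has_zero:
  assumes "Im \<tau> > 0" "quasi_periodic \<tau> n a b G" "n \<ge> 1"
  obtains x where "G x = 0"
proof -
  note q = quasi_periodicD[OF assms(2)]
  have False if nz: "\<And>x. G x \<noteq> 0"
  proof -
    define L where "L = (\<lambda>x. deriv G x / G x)"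
    have dG: "(G has_field_derivative deriv G x) (at x)" for x
      using holomorphic_derivI[OF q(1)] by auto
    have Lh: "L holomorphic_on UNIV" unfolding L_def
      using q(1) nz by (intro holomorphic_intros) (auto intro: holomorphic_deriv)
    have dL: "(L has_field_derivative deriv L x) (at x)" for x
      using holomorphic_derivI[OF Lh] by auto
    have L1: "L (x + 1) = L x" for x
    proof -
      have "((\<lambda>x. G (x + 1)) has_field_derivative deriv G (x + 1)) (at x)"
        using dG[of "x + 1"] by (simp add: DERIV_shift)
      then have "((\<lambda>x. a * G x) has_field_derivative deriv G (x + 1)) (at x)" using q(4) by simp
      moreover have "((\<lambda>x. a * G x) has_field_derivative a * deriv G x) (at x)"
        using dG by (auto intro!: derivative_eq_intros)
      ultimately have "deriv G (x + 1) = a * deriv G x" by (rule DERIV_unique)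
      then show ?thesis using q(2,4) by (simp add: L_def)
    qed
    let ?k = "2 * of_real pi * \<i> * of_nat n :: complex"
    have L2: "L (x + \<tau>) = L x - ?k" for x
    proof -
      have "((\<lambda>x. G (x + \<tau>)) has_field_derivative deriv G (x + \<tau>)) (at x)"
        using dG[of "x + \<tau>"] by (simp add: DERIV_shift)
      then have 1: "((\<lambda>x. b * exp (- (?k * x)) * G x) has_field_derivative deriv G (x + \<tau>)) (at x)" using q(5) by simp
      have 2: "((\<lambda>x. b * exp (- (?k * x)) * G x) has_field_derivative
         b * exp (- (?k * x)) * deriv G x - ?k * (b * exp (- (?k * x)) * G x)) (at x)"
        using dG by (auto intro!: derivative_eq_intros)
      have "deriv G (x + \<tau>) = b * exp (- (?k * x)) * deriv G x - ?k * (b * exp (- (?k * x)) * G x)"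
        using 1 2 by (rule DERIV_unique)
      then show ?thesis using q(3) nz[of x] unfolding L_def q(5) by (simp add: field_simps)
    qed
    have D1: "deriv L (x + 1) = deriv L x" for x
    proof -
      have "((\<lambda>x. L (x + 1)) has_field_derivative deriv L (x + 1)) (at x)"
        using dL[of "x + 1"] by (simp add: DERIV_shift)
      then show ?thesis using dL[of x] unfolding L1 by (rule DERIV_unique)
    qed
    have D2: "deriv L (x + \<tau>) = deriv L x" for x
    proof -
      have "((\<lambda>x. L (x + \<tau>)) has_field_derivative deriv L (x + \<tau>)) (at x)"
        using dL[of "x + \<tau>"] by (simp add: DERIV_shift)
      moreover have "((\<lambda>x. L x - ?k) has_field_derivative deriv L x) (at x)"
        using dL[of x] by (auto intro!: derivative_eq_intros)
      ultimately show ?thesis unfolding L2 by (rule DERIV_unique)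
    qed
    have "\<exists>c. \<forall>x. deriv L x = c"
      by (rule entire_norm_periodic_constant[OF assms(1)])
         (use Lh D1 D2 in \<open>auto intro: holomorphic_deriv\<close>)
    then obtain c where c: "\<And>x. deriv L x = c" by auto
    \<comment> \<open>A constant derivative makes the logarithmic derivative affine. Its period 1
      forces the slope to be 0, whereas the shift by \<tau> changes it by -2 pi i n, which is
      nonzero for n \<ge> 1.\<close>
    define M where "M = (\<lambda>x. L x - c * x)"
    have "(M has_field_derivative 0) (at x)" for x
      unfolding M_def using dL[of x] c[of x] by (auto intro!: derivative_eq_intros)
    then have "\<exists>d. \<forall>x\<in>UNIV. M x = d" by (intro has_field_derivative_zero_constant) auto
    then obtain d where d: "\<And>x. M x = d" by auto
    have Lx: "L x = d + c * x" for x using d[of x] by (simp add: M_def diff_eq_eq)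
    have "c = 0" using L1[of 0] by (simp add: Lx)
    then have "?k = 0" using L2[of 0] by (simp add: Lx)
    then show False using assms(3) by simp
  qed
  then show thesis using that by blast
qed

text \<open>For a quasi-periodic P the value 0 at the origin makes every lattice point a zero, so
  the inclusion of the zeros in the lattice becomes an equality.\<close>

definition simple_on_lattice :: "complex \<Rightarrow> (complex \<Rightarrow> complex) \<Rightarrow> bool" where
  "simple_on_lattice \<tau> P \<longleftrightarrow> P 0 = 0 \<and>
    (\<forall>x. P x = 0 \<longrightarrow> deriv P x \<noteq> 0 \<and> (\<exists>m n :: int. x = of_int m + of_int n * \<tau>))"

text \<open>The zeros of P(x - x0) lie in x0 plus the lattice, and quasi-periodicity makes G vanish
  there once G x0 = 0; so the quotient is entire. Its level drops by one and its multipliers change,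
  hence the induction varies a and b. P is left general because the lemma is used twice: with an
  auxiliary product, to locate the zeros of theta, and then with theta itself.\<close>

lemma quasi_periodic_factorization:
  assumes tau: "Im \<tau> > 0" and P: "quasi_periodic \<tau> 1 a\<^sub>0 b\<^sub>0 P" and sP: "simple_on_lattice \<tau> P"
    and G: "quasi_periodic \<tau> n a b G"
  shows "\<exists>c s xs. \<forall>x. G x = c * exp (s * x) * (\<Prod>j=1..n. P (x - xs j))"
  using G
proof (induction n arbitrary: a b G)
  case 0
  obtain c s where "\<forall>x. G x = c * exp (s * x)" using quasi_periodic_0[OF tau 0] by (elim exE)
  then have "\<forall>x. G x = c * exp (s * x) * (\<Prod>j=1..0::nat. P (x - 0))" by simp
  then show ?case by (intro exI[of _ c] exI[of _ s] exI[of _ "\<lambda>_. 0"])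
next
  case (Suc n)
  note q = quasi_periodicD[OF Suc.prems] and p = quasi_periodicD[OF P]
  obtain x0 where x0: "G x0 = 0" using quasi_periodic_has_zero[OF tau Suc.prems] by auto
  define Q where "Q = (\<lambda>x. P (x - x0))"
  have Qh: "Q holomorphic_on UNIV"
    unfolding Q_def by (rule holomorphic_on_compose_gen[OF _ p(1), unfolded o_def]) (auto intro!: holomorphic_intros)
  have Qs: "deriv Q x \<noteq> 0" if "Q x = 0" for x
  proof -
    have "(P has_field_derivative deriv P (x - x0)) (at (x - x0))"
      using holomorphic_derivI[OF p(1)] by auto
    then have "(P has_field_derivative deriv P (x - x0)) (at (x + - x0))" by simp
    then have "(Q has_field_derivative deriv P (x - x0)) (at x)"
      unfolding DERIV_shift Q_def by simp
    then show ?thesis using that sP by (auto simp: simple_on_lattice_def Q_def DERIV_imp_deriv)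
  qed
  have Qz: "G x = 0" if z: "Q x = 0" for x
  proof -
    obtain l m where "x - x0 = of_int l + of_int m * \<tau>"
      using z sP by (auto simp: simple_on_lattice_def Q_def)
    then have "x = x0 + (of_int l + of_int m * \<tau>)" by (simp add: algebra_simps)
    then show ?thesis using quasi_periodic_shift[OF Suc.prems, of l m] x0 by auto
  qed
  have "\<exists>H. H holomorphic_on UNIV \<and> (\<forall>x. G x = H x * Q x)"
    by (rule entire_divide_simple_zeros[OF q(1) Qh]) (use Qs Qz in auto)
  then obtain H where H: "H holomorphic_on UNIV" "\<And>x. G x = H x * Q x" by auto
  have Hsh: "(\<lambda>x. H (x + y)) holomorphic_on UNIV" for y
    by (rule holomorphic_on_compose_gen[OF _ H(1), unfolded o_def]) (auto intro!: holomorphic_intros)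
  \<comment> \<open>The functional equations hold after multiplication by Q, which has zeros; their
    simplicity allows cancelling Q everywhere.\<close>
  have H1: "H (x + 1) = a / a\<^sub>0 * H x" for x
  proof (rule entire_cancel_simple_zeros[of "\<lambda>x. H (x + 1)" "\<lambda>x. a / a\<^sub>0 * H x" Q])
    fix x
    have "Q (x + 1) = a\<^sub>0 * Q x" using p(4)[of "x - x0"] by (simp add: Q_def algebra_simps)
    then show "H (x + 1) * Q x = a / a\<^sub>0 * H x * Q x"
      using q(4)[of x] p(2) unfolding H(2) by (simp add: field_simps)
  qed (use Qh Qs H Hsh in \<open>auto intro!: holomorphic_intros\<close>)
  let ?k = "2 * of_real pi * \<i> :: complex"
  \<comment> \<open>The centre x0 enters the multiplier of Q through exp (2 pi i x0), a constant
    that the quotient has to compensate.\<close>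
  define b' where "b' = b / b\<^sub>0 * exp (- (?k * x0))"
  have H2: "H (x + \<tau>) = b' * exp (- (?k * of_nat n * x)) * H x" for x
  proof (rule entire_cancel_simple_zeros[of "\<lambda>x. H (x + \<tau>)" "\<lambda>x. b' * exp (- (?k * of_nat n * x)) * H x" Q])
    fix x
    have "Q (x + \<tau>) = b\<^sub>0 * exp (- (?k * (x - x0))) * Q x"
      using p(5)[of "x - x0"] by (simp add: Q_def algebra_simps)
    then have "H (x + \<tau>) * Q x * (b\<^sub>0 * exp (- (?k * (x - x0)))) = b * exp (- (?k * of_nat (Suc n) * x)) * H x * Q x"
      using q(5)[of x] unfolding H(2) by (simp add: mult_ac)
    then have "b * exp (- (?k * of_nat (Suc n) * x)) * H x * Q x = b\<^sub>0 * exp (- (?k * (x - x0))) * (H (x + \<tau>) * Q x)"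
      by (simp only: mult_ac)
    from exp_minus_solve[OF this p(3)]
    have "H (x + \<tau>) * Q x = b / b\<^sub>0 * (exp (- (?k * of_nat (Suc n) * x)) * exp (?k * (x - x0))) * H x * Q x"
      by (simp only: times_divide_eq_left times_divide_eq_right mult_ac)
    also have "exp (- (?k * of_nat (Suc n) * x)) * exp (?k * (x - x0)) = exp (- (?k * x0)) * exp (- (?k * of_nat n * x))"
      by (simp only: exp_add[symmetric]) (simp add: algebra_simps)
    finally show "H (x + \<tau>) * Q x = b' * exp (- (?k * of_nat n * x)) * H x * Q x" by (simp add: b'_def)
  qed (use Qh Qs H Hsh in \<open>auto intro!: holomorphic_intros\<close>)
  have "quasi_periodic \<tau> n (a / a\<^sub>0) b' H"
    unfolding quasi_periodic_def using H1 H2 H(1) q(2,3) p(2,3) by (auto simp: b'_def)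
  from Suc.IH[OF this] obtain c s xs where IH: "\<And>x. H x = c * exp (s * x) * (\<Prod>j=1..n. P (x - xs j))" by auto
  have "G x = c * exp (s * x) * (\<Prod>j=1..Suc n. P (x - (xs(Suc n := x0)) j))" for x
    by (auto simp: H(2) IH Q_def intro!: prod.cong)
  then show ?case by (intro exI[of _ c] exI[of _ s] exI[of _ "xs(Suc n := x0)"]) simp
qed

subsection \<open>A level one function with simple zeros\<close>

text \<open>E is the product of all factors 1 - q^i w, i \<ge> 0, taken in the form of Euler's power
  series. The series makes it entire by the ratio test, and the functional equation replaces the
  product in the discussion of the zeros.\<close>

lemma euler_function_exists:
  fixes q :: complex assumes q: "norm q < 1"
  shows "\<exists>E. E holomorphic_on UNIV \<and> E 0 = 1 \<and> (\<forall>w. E w = (1 - w) * E (q * w)) \<and>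
    (\<forall>w. E w = 0 \<longrightarrow> (\<exists>n. q ^ n * w = 1))"
proof -
  define e where "e n = (\<Prod>i<n. - (q ^ i) / (1 - q ^ Suc i))" for n
  have nz: "1 - q ^ Suc n \<noteq> 0" for n
  proof
    assume "1 - q ^ Suc n = 0"
    then have "norm (q ^ Suc n) = 1" by simp
    then have "norm q ^ Suc n = 1" by (simp add: norm_power norm_mult)
    then show False using q power_Suc_less_one[of "norm q" n] by (cases "norm q = 0") auto
  qed
  \<comment> \<open>This recursion is the comparison of coefficients in E w = (1 - w) E (q w); the
    coefficients e were defined to satisfy it.\<close>
  have e_Suc: "e (Suc n) = e (Suc n) * q ^ Suc n - e n * q ^ n" for n
    using nz[of n] by (simp add: e_def field_simps)
  have summ: "summable (\<lambda>n. e n * w ^ n)" for w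
  proof -
    have "(\<lambda>n. norm q ^ n * norm w / (1 - norm q)) \<longlonglongrightarrow> 0 * norm w / (1 - norm q)"
      by (intro tendsto_intros LIMSEQ_power_zero) (use q in auto)
    then have "eventually (\<lambda>n. norm q ^ n * norm w / (1 - norm q) < 1/2) sequentially"
      by (intro order_tendstoD(2)) auto
    then obtain M where M: "\<And>n. n \<ge> M \<Longrightarrow> norm q ^ n * norm w / (1 - norm q) < 1/2"
      by (auto simp: eventually_sequentially)
    show ?thesis
    proof (rule summable_ratio_test[of "1/2" M])
      fix n assume n: "n \<ge> M"
      have "norm (q ^ Suc n) \<le> norm q"
        using power_le_one[of "norm q" n] q mult_left_le[of "norm q ^ n" "norm q"] by (simp add: norm_power norm_mult)
      then have *: "1 - norm q \<le> norm (1 - q ^ Suc n)"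
        using norm_triangle_ineq2[of 1 "q ^ Suc n"] by simp
      have "norm (e (Suc n) * w ^ Suc n) = norm (e n * w ^ n) * (norm q ^ n * norm w / norm (1 - q ^ Suc n))"
        by (simp add: e_def norm_mult norm_divide norm_power)
      also have "\<dots> \<le> norm (e n * w ^ n) * (norm q ^ n * norm w / (1 - norm q))"
        using * q nz[of n] by (intro mult_left_mono divide_left_mono mult_pos_pos) auto
      also have "\<dots> \<le> norm (e n * w ^ n) * (1/2)"
        using M[OF n] by (intro mult_left_mono) auto
      finally show "norm (e (Suc n) * w ^ Suc n) \<le> 1/2 * norm (e n * w ^ n)" by simp
    qed auto
  qed
  define E where "E w = (\<Sum>n. e n * w ^ n)" for w
  have hol: "E holomorphic_on UNIV"
    unfolding E_def[abs_def] holomorphic_on_def field_differentiable_def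
    using termdiffs_strong_converges_everywhere[OF summ] by auto
  have E0: "E 0 = 1" unfolding E_def by (subst powser_zero) (simp add: e_def)
  have fe: "E w = (1 - w) * E (q * w)" for w
  proof -
    have head: "E w - 1 = (\<Sum>n. e (Suc n) * w ^ Suc n)" for w
      using suminf_split_head[OF summ[of w]] by (simp add: E_def e_def)
    have s1: "summable (\<lambda>n. e (Suc n) * (q * w) ^ Suc n)"
      using summ[of "q * w"] by (subst summable_Suc_iff)
    have s2: "summable (\<lambda>n. w * (e n * (q * w) ^ n))"
      using summ[of "q * w"] by (intro summable_mult)
    have eq: "e (Suc n) * w ^ Suc n = e (Suc n) * (q * w) ^ Suc n - w * (e n * (q * w) ^ n)" for n
      by (subst e_Suc) (simp add: algebra_simps power_mult_distrib)
    have "E w - 1 = (\<Sum>n. e (Suc n) * (q * w) ^ Suc n - w * (e n * (q * w) ^ n))"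
      unfolding head eq ..
    also have "\<dots> = (\<Sum>n. e (Suc n) * (q * w) ^ Suc n) - (\<Sum>n. w * (e n * (q * w) ^ n))"
      using suminf_diff[OF s1 s2] by simp
    also have "(\<Sum>n. w * (e n * (q * w) ^ n)) = w * E (q * w)"
      unfolding E_def using suminf_mult[OF summ[of "q * w"]] by simp
    finally show ?thesis unfolding head[symmetric] by (simp add: algebra_simps)
  qed
  have iter: "E w = (\<Prod>i<n. 1 - q ^ i * w) * E (q ^ n * w)" for w n
  proof (induction n)
    case (Suc n)
    have "E (q ^ n * w) = (1 - q ^ n * w) * E (q ^ Suc n * w)" by (subst fe) (simp add: mult_ac)
    then show ?case using Suc by simp
  qed simp
  \<comment> \<open>q^n w tends to 0, where E equals 1. Hence E (q^n w) is nonzero for some n, and a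
    zero of E at w must come from one of the n factors split off.\<close>
  have zeros: "\<exists>n. q ^ n * w = 1" if z: "E w = 0" for w
  proof -
    have "(\<lambda>n. q ^ n * w) \<longlonglongrightarrow> 0 * w" by (intro tendsto_intros LIMSEQ_power_zero q)
    then have lim: "(\<lambda>n. q ^ n * w) \<longlonglongrightarrow> 0" by simp
    have "isCont E 0"
      using holomorphic_on_imp_continuous_on[OF hol] by (simp add: continuous_on_eq_continuous_at)
    then have "(\<lambda>n. E (q ^ n * w)) \<longlonglongrightarrow> E 0" using lim by (rule isCont_tendsto_compose)
    then have "eventually (\<lambda>n. E (q ^ n * w) \<noteq> 0) sequentially"
      using E0 by (intro tendsto_imp_eventually_ne) auto
    then obtain n where "E (q ^ n * w) \<noteq> 0" by (auto simp: eventually_sequentially)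
    then have "(\<Prod>i<n. 1 - q ^ i * w) = 0" using iter[of w n] z by auto
    then show ?thesis by auto
  qed
  show ?thesis using hol E0 fe zeros by (intro exI[of _ E] conjI allI impI)
qed

text \<open>This is the Jacobi triple product up to its constant factor, with X = exp (2 pi i x) and
  q = exp (2 pi i \<tau>): the factors 1 - q^i X for i \<ge> 0 and 1 - q^i / X for i \<ge> 1. The
  zeros are visible in it, which they are not in the theta series.\<close>

lemma simple_theta_exists:
  assumes tau: "Im \<tau> > 0"
  obtains P where "quasi_periodic \<tau> 1 1 (-1) P" "simple_on_lattice \<tau> P"
proof -
  let ?k = "2 * of_real pi * \<i> :: complex"
  define q where "q = exp (?k * \<tau>)"
  have q: "norm q < 1" using tau by (simp add: q_def norm_exp_eq_Re)
  obtain E where E': "E holomorphic_on UNIV \<and> E 0 = 1 \<and> (\<forall>w. E w = (1 - w) * E (q * w)) \<and>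
    (\<forall>w. E w = 0 \<longrightarrow> (\<exists>n. q ^ n * w = 1))" using euler_function_exists[OF q] ..
  have E: "E holomorphic_on UNIV" "E 0 = 1" "\<And>w. E w = (1 - w) * E (q * w)"
    "\<And>w. E w = 0 \<Longrightarrow> \<exists>n. q ^ n * w = 1" using E' by blast+
  define P where "P x = E (exp (?k * x)) * E (q * exp (- (?k * x)))" for x
  have Eg: "(\<lambda>x. E (g x)) holomorphic_on UNIV" if "g holomorphic_on UNIV" for g
    by (rule holomorphic_on_compose_gen[OF that E(1), unfolded o_def]) auto
  have Ph: "P holomorphic_on UNIV" unfolding P_def by (intro holomorphic_intros Eg)
  have per: "exp (?k * (x + 1)) = exp (?k * x)" "exp (- (?k * (x + 1))) = exp (- (?k * x))" for x
    by (simp_all add: distrib_left exp_add exp_diff exp_minus divide_inverse)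
  have P1: "P (x + 1) = P x" for x unfolding P_def per ..
  have P2: "P (x + \<tau>) = - exp (- (?k * x)) * P x" for x
  proof -
    have "P (x + \<tau>) = E (q * exp (?k * x)) * E (exp (- (?k * x)))"
      unfolding P_def q_def exp_add[symmetric] by (simp add: algebra_simps)
    also have "E (exp (- (?k * x))) = (1 - exp (- (?k * x))) * E (q * exp (- (?k * x)))" by (rule E(3))
    also have "1 - exp (- (?k * x)) = - exp (- (?k * x)) * (1 - exp (?k * x))"
      by (simp add: exp_minus field_simps)
    also have "E (q * exp (?k * x)) * (- exp (- (?k * x)) * (1 - exp (?k * x)) * E (q * exp (- (?k * x)))) =
       - exp (- (?k * x)) * ((1 - exp (?k * x)) * E (q * exp (?k * x))) * E (q * exp (- (?k * x)))"
      by (simp add: mult_ac)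
    also have "(1 - exp (?k * x)) * E (q * exp (?k * x)) = E (exp (?k * x))" by (rule E(3)[symmetric])
    finally show ?thesis by (simp add: P_def mult_ac)
  qed
  have qp: "quasi_periodic \<tau> 1 1 (-1) P" unfolding quasi_periodic_def using Ph P1 P2 by auto
  have Eq: "E q \<noteq> 0"
  proof
    assume "E q = 0"
    then obtain n where "q ^ n * q = 1" using E(4) by blast
    then have "norm q ^ Suc n = 1" by (metis norm_one norm_power power_Suc2)
    then show False using q power_Suc_less_one[of "norm q" n] by (cases "norm q = 0") auto
  qed
  have P0: "P 0 = 0" unfolding P_def using E(3)[of 1] by simp
  \<comment> \<open>R is P without the factor 1 - X that vanishes at the origin. Thus P' 0 = -2 pi i
    R 0, and R 0 is the square of E q.\<close>
  define R where "R x = E (q * exp (?k * x)) * E (q * exp (- (?k * x)))" for x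
  have Rh: "R holomorphic_on UNIV" unfolding R_def by (intro holomorphic_intros Eg)
  have PR: "P x = (1 - exp (?k * x)) * R x" for x unfolding P_def R_def by (subst E(3)) simp
  have "(R has_field_derivative deriv R 0) (at 0)" using holomorphic_derivI[OF Rh] by auto
  then have "(P has_field_derivative - ?k * R 0) (at 0)"
    unfolding PR[abs_def] by (auto intro!: derivative_eq_intros)
  then have dP0: "deriv P 0 \<noteq> 0" using Eq by (auto simp: DERIV_imp_deriv R_def)
  have lat: "\<exists>m n :: int. x = of_int m + of_int n * \<tau>" if Px: "P x = 0" for x
  proof -
    have ex: "q ^ n = exp (?k * (of_nat n * \<tau>))" for n
      by (simp add: q_def exp_of_nat_mult[symmetric] mult_ac)
    have int: "\<exists>m :: int. y = of_int m" if "exp (?k * y) = 1" for y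
    proof -
      obtain m :: int where "Re (?k * y) = 0" "Im (?k * y) = of_int (2 * m) * pi" using \<open>exp (?k * y) = 1\<close> unfolding exp_eq_1 by blast
      then have "y = of_int m" by (simp add: complex_eq_iff)
      then show ?thesis ..
    qed
    consider "E (exp (?k * x)) = 0" | "E (q * exp (- (?k * x))) = 0" using Px by (auto simp: P_def)
    then show ?thesis
    proof cases
      case 1
      then obtain n where "q ^ n * exp (?k * x) = 1" using E(4) by blast
      then have "exp (?k * (x + of_nat n * \<tau>)) = 1" by (simp add: ex exp_add algebra_simps)
      then obtain m :: int where "x + of_nat n * \<tau> = of_int m" using int by blast
      then show ?thesis by (intro exI[of _ m] exI[of _ "- int n"]) (simp add: algebra_simps)
    next
      case 2
      then obtain n where "q ^ n * (q * exp (- (?k * x))) = 1" using E(4) by blast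
      then have "q ^ Suc n * exp (- (?k * x)) = 1" by (simp add: mult_ac)
      then have "exp (?k * (of_nat (Suc n) * \<tau> - x)) = 1" unfolding ex exp_add[symmetric] by (simp add: algebra_simps)
      then obtain m :: int where "of_nat (Suc n) * \<tau> - x = of_int m" using int by blast
      then show ?thesis by (intro exI[of _ "- m"] exI[of _ "int (Suc n)"]) (simp add: algebra_simps)
    qed
  qed
  \<comment> \<open>Near the lattice point x the function P is a nonvanishing multiple of its
    translate near 0, so simplicity at 0 passes to x.\<close>
  have "deriv P x \<noteq> 0" if z: "P x = 0" for x
  proof -
    obtain l m where x: "x = of_int l + of_int m * \<tau>" using lat[OF z] by blast
    obtain c where c: "c \<noteq> 0" "\<And>y. P (y + x) = c * exp (- (?k * of_int m * y)) * P y"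
      using quasi_periodic_shift[OF qp, of l m] unfolding x by (auto simp: algebra_simps)
    have "(P has_field_derivative deriv P x) (at (0 + x))" using holomorphic_derivI[OF Ph] by auto
    then have "((\<lambda>y. P (y + x)) has_field_derivative deriv P x) (at 0)" unfolding DERIV_shift .
    then have "((\<lambda>y. c * exp (- (?k * of_int m * y)) * P y) has_field_derivative deriv P x) (at 0)" unfolding c(2) .
    moreover have "(P has_field_derivative deriv P 0) (at 0)" using holomorphic_derivI[OF Ph] by auto
    then have "((\<lambda>y. c * exp (- (?k * of_int m * y)) * P y) has_field_derivative c * deriv P 0) (at 0)"
      using P0 by (auto intro!: derivative_eq_intros)
    ultimately have "deriv P x = c * deriv P 0" by (rule DERIV_unique)
    then show ?thesis using c dP0 by simp
  qed
  then have "simple_on_lattice \<tau> P" using lat P0 by (auto simp: simple_on_lattice_def)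
  then show thesis by (rule that[OF qp])
qed

subsection \<open>Functions that are holomorphic along holomorphic curves\<close>

text \<open>An l^1 distance that sees only the coordinates in K: points that agree on K have
  distance 0. Therefore a direction h with \<open>coord_dist K 0 h = 0\<close> is a separate case in
  several estimates.\<close>

definition coord_dist :: "'k set \<Rightarrow> ('k \<Rightarrow> complex) \<Rightarrow> ('k \<Rightarrow> complex) \<Rightarrow> real" where
  "coord_dist K x y = (\<Sum>i\<in>K. cmod (x i - y i))"

definition coord_ball :: "'k set \<Rightarrow> ('k \<Rightarrow> complex) \<Rightarrow> real \<Rightarrow> ('k \<Rightarrow> complex) set" where
  "coord_ball K x r = {y. coord_dist K x y < r}"

text \<open>Plays the part of holomorphy in several variables. Testing on all holomorphic curves,
  and not only on lines, makes the class closed under substitution.\<close>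

definition curve_holomorphic :: "'k set \<Rightarrow> ('k \<Rightarrow> complex) set \<Rightarrow> (('k \<Rightarrow> complex) \<Rightarrow> complex) \<Rightarrow> bool" where
  "curve_holomorphic K U f \<longleftrightarrow> (\<forall>S c. open S \<longrightarrow> (\<forall>i\<in>K. (\<lambda>\<zeta>. c \<zeta> i) holomorphic_on S) \<longrightarrow>
     (\<forall>\<zeta>\<in>S. c \<zeta> \<in> U) \<longrightarrow> (\<lambda>\<zeta>. f (c \<zeta>)) holomorphic_on S)"

definition line :: "('k \<Rightarrow> complex) \<Rightarrow> ('k \<Rightarrow> complex) \<Rightarrow> complex \<Rightarrow> 'k \<Rightarrow> complex" where
  "line y h \<zeta> = (\<lambda>i. y i + \<zeta> * h i)"

definition dir_deriv :: "(('k \<Rightarrow> complex) \<Rightarrow> complex) \<Rightarrow> ('k \<Rightarrow> complex) \<Rightarrow> ('k \<Rightarrow> complex) \<Rightarrow> complex" where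
  "dir_deriv f h y = deriv (\<lambda>\<zeta>. f (line y h \<zeta>)) 0"

definition analytic_bounded :: "'k set \<Rightarrow> ('k \<Rightarrow> complex) \<Rightarrow> real \<Rightarrow> real \<Rightarrow> (('k \<Rightarrow> complex) \<Rightarrow> complex) \<Rightarrow> bool" where
  "analytic_bounded K x r M f \<longleftrightarrow> r > 0 \<and> M \<ge> 0 \<and> curve_holomorphic K (coord_ball K x r) f \<and>
     (\<forall>y\<in>coord_ball K x r. cmod (f y) \<le> M)"

lemma coord_dist_nonneg: "coord_dist K x y \<ge> 0"
  by (simp add: coord_dist_def sum_nonneg)

lemma coord_dist_triangle: "coord_dist K x z \<le> coord_dist K x y + coord_dist K y z"
  unfolding coord_dist_def sum.distrib[symmetric]
  by (intro sum_mono) (metis dist_norm dist_triangle)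

lemma coord_dist_line: "coord_dist K y (line y h \<zeta>) = cmod \<zeta> * coord_dist K 0 h"
  by (simp add: coord_dist_def line_def norm_mult sum_distrib_left)

lemma coord_dist_self: "coord_dist K x x = 0" by (simp add: coord_dist_def)

lemma curve_holomorphicD:
  assumes "curve_holomorphic K U f" "open S" "\<And>i. i \<in> K \<Longrightarrow> (\<lambda>\<zeta>. c \<zeta> i) holomorphic_on S"
    "\<And>\<zeta>. \<zeta> \<in> S \<Longrightarrow> c \<zeta> \<in> U"
  shows "(\<lambda>\<zeta>. f (c \<zeta>)) holomorphic_on S"
  using assms unfolding curve_holomorphic_def by auto

lemma curve_holomorphic_subset:
  assumes "curve_holomorphic K U f" "V \<subseteq> U"
  shows "curve_holomorphic K V f"
  using assms unfolding curve_holomorphic_def by (meson subsetD)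

section \<open>Cauchy estimates along complex lines\<close>

lemma analytic_bounded_line:
  assumes f: "analytic_bounded K x r M f" and y: "coord_dist K x y + R * coord_dist K 0 h \<le> r" "R > 0"
    and lt: "coord_dist K x y < r"
  shows "(\<lambda>\<zeta>. f (line y h \<zeta>)) holomorphic_on ball 0 R" "\<And>\<zeta>. \<zeta> \<in> ball 0 R \<Longrightarrow> cmod (f (line y h \<zeta>)) \<le> M"
proof -
  have mem: "line y h \<zeta> \<in> coord_ball K x r" if "\<zeta> \<in> ball 0 R" for \<zeta>
  proof (cases "coord_dist K 0 h = 0")
    case True
    then show ?thesis using lt coord_dist_triangle[of K x "line y h \<zeta>" y] by (simp add: coord_ball_def coord_dist_line)
  next
    case False
    then have "coord_dist K 0 h > 0" using coord_dist_nonneg[of K 0 h] by linarith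
    then have "cmod \<zeta> * coord_dist K 0 h < R * coord_dist K 0 h" using that by auto
    then show ?thesis using y coord_dist_triangle[of K x "line y h \<zeta>" y] by (simp add: coord_ball_def coord_dist_line)
  qed
  show "(\<lambda>\<zeta>. f (line y h \<zeta>)) holomorphic_on ball 0 R"
    by (rule curve_holomorphicD[of K "coord_ball K x r" f])
       (use f mem in \<open>auto simp: analytic_bounded_def line_def intro!: holomorphic_intros\<close>)
  show "\<And>\<zeta>. \<zeta> \<in> ball 0 R \<Longrightarrow> cmod (f (line y h \<zeta>)) \<le> M"
    using mem f by (auto simp: analytic_bounded_def)
qed

text \<open>Cauchy's inequality on the circle of radius R/2, because nothing is assumed on the
  boundary of the disc; hence the factor 2.\<close>

lemma holomorphic_deriv_bound:
  assumes "g holomorphic_on ball 0 R" "\<And>\<zeta>. \<zeta> \<in> ball 0 R \<Longrightarrow> cmod (g \<zeta>) \<le> M" "R > 0"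
  shows "cmod (deriv g 0) \<le> 2 * M / R"
proof -
  have sub: "cball 0 (R/2) \<subseteq> ball (0::complex) R" using assms(3) by auto
  have "cmod ((deriv ^^ 1) g 0) \<le> fact 1 * M / (R/2) ^ 1"
  proof (rule Cauchy_inequality)
    show "g holomorphic_on ball 0 (R/2)" using assms(1) by (rule holomorphic_on_subset) (use assms(3) in auto)
    show "continuous_on (cball 0 (R/2)) g"
      using assms(1) sub by (intro holomorphic_on_imp_continuous_on) (auto intro: holomorphic_on_subset)
    show "cmod (g \<zeta>) \<le> M" if "cmod (0 - \<zeta>) = R/2" for \<zeta>
      using that assms(2)[of \<zeta>] assms(3) by auto
  qed (use assms(3) in auto)
  then show ?thesis by (simp add: mult.commute)
qed

text \<open>Around any point of the disc of radius R/2 a circle of radius R/3 stays inside. Cauchy's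
  inequality there bounds the second derivative by 2 * 9 M / R^2, the origin of the 18.\<close>

lemma holomorphic_remainder_bound:
  assumes g: "g holomorphic_on ball 0 R" "\<And>\<zeta>. \<zeta> \<in> ball 0 R \<Longrightarrow> cmod (g \<zeta>) \<le> M" "R > 0" and s: "cmod s \<le> R / 2"
  shows "cmod (g s - g 0 - s * deriv g 0) \<le> 18 * M * (cmod s)\<^sup>2 / R\<^sup>2"
proof -
  have o: "open (ball (0::complex) R)" by simp
  define F where "F = (\<lambda>i::nat. (deriv ^^ i) g)"
  have der: "(F i has_field_derivative F (Suc i) z) (at z within cball 0 (R/2))" if "z \<in> cball 0 (R/2)" for i z
  proof -
    have "(F i) holomorphic_on ball 0 R" unfolding F_def using g(1) by (intro holomorphic_higher_deriv) auto
    then have "(F i has_field_derivative deriv (F i) z) (at z)"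
      using that g(3) by (intro holomorphic_derivI[OF _ o]) auto
    then show ?thesis by (auto simp: F_def intro: has_field_derivative_at_within)
  qed
  have bd: "cmod (F (Suc 1) z) \<le> 18 * M / R\<^sup>2" if "z \<in> cball 0 (R/2)" for z
  proof -
    have sub: "cball z (R/3) \<subseteq> ball 0 R"
    proof
      fix w assume "w \<in> cball z (R/3)"
      then have "dist 0 w \<le> R/2 + R/3" using that dist_triangle[of 0 w z] by auto
      then show "w \<in> ball 0 R" using g(3) by auto
    qed
    have "cmod ((deriv ^^ 2) g z) \<le> fact 2 * M / (R/3) ^ 2"
    proof (rule Cauchy_inequality)
      show "g holomorphic_on ball z (R/3)"
        by (rule holomorphic_on_subset[OF g(1)]) (use sub in \<open>auto simp: subset_eq\<close>)
      show "continuous_on (cball z (R/3)) g"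
        using g(1) sub by (intro holomorphic_on_imp_continuous_on) (auto intro: holomorphic_on_subset)
      show "cmod (g \<zeta>) \<le> M" if "cmod (z - \<zeta>) = R/3" for \<zeta>
        using that sub by (intro g(2)) (auto simp: dist_norm subset_eq)
    qed (use g(3) in auto)
    then show ?thesis by (simp add: F_def numeral_2_eq_2 power2_eq_square field_simps)
  qed
  have "cmod (F 0 s - (\<Sum>i\<le>1. F i 0 * (s - 0) ^ i / fact i)) \<le> (18 * M / R\<^sup>2) * cmod (s - 0) ^ Suc 1 / fact 1"
    by (rule complex_Taylor[of "cball 0 (R/2)"]) (use der bd s g(3) in auto)
  then show ?thesis by (simp add: F_def power2_eq_square algebra_simps)
qed

lemma dir_deriv_bound:
  assumes "analytic_bounded K x r M f" "coord_dist K x y < r / 2"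
  shows "cmod (dir_deriv f h y) \<le> 4 * M * (coord_dist K 0 h + 1) / r"
proof -
  have r: "r > 0" using assms(1) by (simp add: analytic_bounded_def)
  \<comment> \<open>The summand 1 avoids a division by zero for a direction that vanishes on
    K.\<close>
  define R where "R = r / (2 * (coord_dist K 0 h + 1))"
  have R: "R > 0" "R * coord_dist K 0 h \<le> r / 2"
    using r coord_dist_nonneg[of K 0 h] by (auto simp: R_def field_simps)
  have "cmod (deriv (\<lambda>\<zeta>. f (line y h \<zeta>)) 0) \<le> 2 * M / R"
    by (rule holomorphic_deriv_bound; (rule analytic_bounded_line[OF assms(1), of _ R])?) (use R assms(2) r in auto)
  then show ?thesis by (simp add: dir_deriv_def R_def mult_ac)
qed

text \<open>The line through y stays in the ball for parameters up to R = r / (2 |h|), and the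
  one-variable remainder at parameter 1 is 18 M / R^2 = 72 M |h|^2 / r^2. The condition |h| \<le>
  r/4 says that R \<ge> 2.\<close>

lemma dir_deriv_remainder:
  assumes "analytic_bounded K x r M f" "coord_dist K x y < r / 2" "coord_dist K 0 h \<le> r / 4"
  shows "cmod (f (line y h 1) - f y - dir_deriv f h y) \<le> 72 * M * (coord_dist K 0 h)\<^sup>2 / r\<^sup>2"
proof -
  have r: "r > 0" and M: "M \<ge> 0" using assms(1) by (auto simp: analytic_bounded_def)
  have l0: "line y h 0 = y" by (simp add: line_def)
  have gen: "cmod (f (line y h 1) - f y - dir_deriv f h y) \<le> 18 * M / R\<^sup>2" if R: "R \<ge> 2" "R * coord_dist K 0 h \<le> r / 2" for R
  proof -
    have "cmod ((\<lambda>\<zeta>. f (line y h \<zeta>)) 1 - (\<lambda>\<zeta>. f (line y h \<zeta>)) 0 - 1 * deriv (\<lambda>\<zeta>. f (line y h \<zeta>)) 0) \<le> 18 * M * (cmod 1)\<^sup>2 / R\<^sup>2"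
      by (rule holomorphic_remainder_bound; (rule analytic_bounded_line[OF assms(1), of _ R])?) (use R assms(2) r in auto)
    then show ?thesis by (simp add: dir_deriv_def l0)
  qed
  show ?thesis
  proof (cases "coord_dist K 0 h = 0")
    case True
    \<comment> \<open>If h vanishes on K, every R \<ge> 2 is admissible; letting R grow shows that
      the remainder is 0.\<close>
    have "(\<lambda>n. 18 * M / (real n)\<^sup>2) \<longlonglongrightarrow> 0" by real_asymp
    moreover have "\<forall>n\<ge>2. cmod (f (line y h 1) - f y - dir_deriv f h y) \<le> 18 * M / (real n)\<^sup>2"
      using gen True r by auto
    ultimately have "cmod (f (line y h 1) - f y - dir_deriv f h y) \<le> 0"
      by (intro LIMSEQ_le_const) auto
    then show ?thesis using True by simp
  next
    case False
    then have pos: "coord_dist K 0 h > 0" using coord_dist_nonneg[of K 0 h] by linarith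
    have "cmod (f (line y h 1) - f y - dir_deriv f h y) \<le> 18 * M / (r / (2 * coord_dist K 0 h))\<^sup>2"
      by (rule gen) (use pos assms(3) in \<open>auto simp: field_simps\<close>)
    then show ?thesis by (simp add: power2_eq_square field_simps)
  qed
qed

lemma line_scale: "line y (\<lambda>i. c * h i) \<zeta> = line y h (\<zeta> * c)"
  by (simp add: line_def mult_ac)

lemma dir_deriv_at:
  assumes "analytic_bounded K x r M f" "coord_dist K x y < r / 2"
  shows "((\<lambda>\<zeta>. f (line y h \<zeta>)) has_field_derivative dir_deriv f h y) (at 0)"
proof -
  have r: "r > 0" using assms(1) by (simp add: analytic_bounded_def)
  define R where "R = r / (2 * (coord_dist K 0 h + 1))"
  have R: "R > 0" "R * coord_dist K 0 h \<le> r / 2"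
    using r coord_dist_nonneg[of K 0 h] by (auto simp: R_def field_simps)
  have "(\<lambda>\<zeta>. f (line y h \<zeta>)) holomorphic_on ball 0 R"
    by (rule analytic_bounded_line[OF assms(1)]) (use R assms(2) r in auto)
  then show ?thesis unfolding dir_deriv_def using R by (intro holomorphic_derivI[of _ "ball 0 R"]) auto
qed

lemma dir_deriv_scale:
  assumes "analytic_bounded K x r M f" "coord_dist K x y < r / 2"
  shows "dir_deriv f (\<lambda>i. c * h i) y = c * dir_deriv f h y"
proof -
  have "((\<lambda>\<zeta>. f (line y h (\<zeta> * c))) has_field_derivative dir_deriv f h y * c) (at 0)"
    by (rule DERIV_chain2[of "\<lambda>\<zeta>. f (line y h \<zeta>)"])
       (use dir_deriv_at[OF assms, of h] in \<open>auto intro!: derivative_eq_intros\<close>)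
  then show ?thesis unfolding dir_deriv_def line_scale by (simp add: DERIV_imp_deriv mult.commute)
qed

text \<open>The rate at which difference quotients converge does not depend on y. This uniformity is
  what lets holomorphy pass to the limit.\<close>

lemma dir_deriv_limit_bound:
  assumes "analytic_bounded K x r M f" "coord_dist K x y < r / 2" "n > 0" "coord_dist K 0 h \<le> r / 4 * real n"
  shows "cmod (of_nat n * (f (line y h (1 / of_nat n)) - f y) - dir_deriv f h y) \<le> 72 * M * (coord_dist K 0 h)\<^sup>2 / r\<^sup>2 / real n"
proof -
  have h: "coord_dist K 0 (\<lambda>i. 1 / of_nat n * h i) = coord_dist K 0 h / real n"
    using assms(3) by (simp add: coord_dist_def norm_mult norm_divide sum_divide_distrib)
  have "cmod (f (line y (\<lambda>i. 1 / of_nat n * h i) 1) - f y - dir_deriv f (\<lambda>i. 1 / of_nat n * h i) y) \<le> 72 * M * (coord_dist K 0 h / real n)\<^sup>2 / r\<^sup>2"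
    using dir_deriv_remainder[OF assms(1,2), of "\<lambda>i. 1 / of_nat n * h i"] assms(3,4) unfolding h by (simp add: field_simps)
  then have *: "cmod (f (line y h (1 / of_nat n)) - f y - 1 / of_nat n * dir_deriv f h y) \<le> 72 * M * (coord_dist K 0 h / real n)\<^sup>2 / r\<^sup>2"
    unfolding dir_deriv_scale[OF assms(1,2)] line_scale by simp
  have "of_nat n * (f (line y h (1 / of_nat n)) - f y) - dir_deriv f h y = of_nat n * (f (line y h (1 / of_nat n)) - f y - 1 / of_nat n * dir_deriv f h y)"
    using assms(3) by (simp add: algebra_simps)
  then have "cmod (of_nat n * (f (line y h (1 / of_nat n)) - f y) - dir_deriv f h y) \<le> real n * (72 * M * (coord_dist K 0 h / real n)\<^sup>2 / r\<^sup>2)"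
    using mult_left_mono[OF *, of "real n"] by (simp add: norm_mult)
  then show ?thesis using assms(3) by (simp add: power2_eq_square field_simps)
qed

text \<open>Along a holomorphic curve the directional derivative is a uniform limit of difference
  quotients, each of them holomorphic along the curve. Stability under differentiation gives
  derivatives of every order by iteration.\<close>

lemma analytic_bounded_dir_deriv:
  assumes f: "analytic_bounded K x r M f"
  shows "analytic_bounded K x (r / 2) (4 * M * (coord_dist K 0 h + 1) / r) (dir_deriv f h)"
proof -
  have r: "r > 0" and M: "M \<ge> 0" using f by (auto simp: analytic_bounded_def)
  have "(\<lambda>\<zeta>. dir_deriv f h (c \<zeta>)) holomorphic_on S"
    if S: "open S" "\<And>i. i \<in> K \<Longrightarrow> (\<lambda>\<zeta>. c \<zeta> i) holomorphic_on S" "\<And>\<zeta>. \<zeta> \<in> S \<Longrightarrow> c \<zeta> \<in> coord_ball K x (r / 2)" for S c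
  proof -
    obtain n0 where n0: "coord_dist K 0 h / (r / 4) \<le> real n0" using real_arch_simple by auto
    \<comment> \<open>The index is shifted by n0 + 1 so that the displaced points lie in the ball
      from the first term on.\<close>
    define G where "G n \<zeta> = of_nat (n + n0 + 1) * (f (line (c \<zeta>) h (1 / of_nat (n + n0 + 1))) - f (c \<zeta>))" for n \<zeta>
    have hn: "coord_dist K 0 h \<le> r / 4 * real (n + n0 + 1)" for n
    proof -
      have "coord_dist K 0 h \<le> r / 4 * real n0" using n0 r by (simp add: field_simps)
      also have "\<dots> \<le> r / 4 * real (n + n0 + 1)" using r by (intro mult_left_mono) auto
      finally show ?thesis .
    qed
    have in1: "line (c \<zeta>) h (1 / of_nat (n + n0 + 1)) \<in> coord_ball K x r" if "\<zeta> \<in> S" for n \<zeta>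
    proof -
      have "cmod (1 / of_nat (n + n0 + 1)) * coord_dist K 0 h \<le> r / 4"
        unfolding norm_divide norm_one norm_of_nat using hn[of n] by (simp add: field_simps)
      then show ?thesis using S(3)[OF that] r coord_dist_triangle[of K x "line (c \<zeta>) h (1 / of_nat (n + n0 + 1))" "c \<zeta>"]
        unfolding coord_dist_line by (simp add: coord_ball_def)
    qed
    have in2: "c \<zeta> \<in> coord_ball K x r" if "\<zeta> \<in> S" for \<zeta>
      using S(3)[OF that] r by (simp add: coord_ball_def)
    have ch: "curve_holomorphic K (coord_ball K x r) f" using f by (simp add: analytic_bounded_def)
    have Gh: "G n holomorphic_on S" for n
      unfolding G_def
      by (intro holomorphic_intros curve_holomorphicD[OF ch S(1)]) (use S in1 in2 in \<open>auto simp: line_def intro!: holomorphic_intros\<close>)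
    have lim: "uniform_limit S G (\<lambda>\<zeta>. dir_deriv f h (c \<zeta>)) sequentially"
    proof (rule uniform_limitI)
      fix e :: real assume e: "e > 0"
      define B where "B = 72 * M * (coord_dist K 0 h)\<^sup>2 / r\<^sup>2"
      have "(\<lambda>n. B / real (n + n0 + 1)) \<longlonglongrightarrow> 0" by real_asymp
      then have "eventually (\<lambda>n. B / real (n + n0 + 1) < e) sequentially" using e by (rule order_tendstoD(2))
      then show "\<forall>\<^sub>F n in sequentially. \<forall>\<zeta>\<in>S. dist (G n \<zeta>) (dir_deriv f h (c \<zeta>)) < e"
      proof eventually_elim
        case (elim n)
        show ?case
        proof
          fix \<zeta> assume "\<zeta> \<in> S"
          then have "cmod (G n \<zeta> - dir_deriv f h (c \<zeta>)) \<le> B / real (n + n0 + 1)"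
            unfolding G_def B_def using S(3) by (intro dir_deriv_limit_bound[OF f _ _ hn]) (auto simp: coord_ball_def)
          then show "dist (G n \<zeta>) (dir_deriv f h (c \<zeta>)) < e" using elim by (simp add: dist_norm)
        qed
      qed
    qed
    show ?thesis
    proof (rule holomorphic_uniform_sequence[OF S(1) Gh])
      fix z assume "z \<in> S"
      then obtain d where "d > 0" "cball z d \<subseteq> S" using S(1) open_contains_cball by blast
      then show "\<exists>d>0. cball z d \<subseteq> S \<and> uniform_limit (cball z d) G (\<lambda>\<zeta>. dir_deriv f h (c \<zeta>)) sequentially"
        using lim by (intro exI[of _ d]) (auto intro: uniform_limit_on_subset)
    qed
  qed
  then have "curve_holomorphic K (coord_ball K x (r / 2)) (dir_deriv f h)" unfolding curve_holomorphic_def by simp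
  moreover have "cmod (dir_deriv f h y) \<le> 4 * M * (coord_dist K 0 h + 1) / r" if "y \<in> coord_ball K x (r / 2)" for y
    using that dir_deriv_bound[OF f] by (simp add: coord_ball_def)
  ultimately show ?thesis using r M coord_dist_nonneg[of K 0 h] by (simp add: analytic_bounded_def)
qed

text \<open>Derivatives along single lines do not add up by themselves. The displacement by h + k is
  made in two steps, h and then k from the moved point; the derivative in direction k is continuous
  along the first step because it is analytic again. Using this on the ball of
  \<open>analytic_bounded_dir_deriv\<close> explains the quarter radius.\<close>

lemma dir_deriv_add:
  assumes f: "analytic_bounded K x r M f" and y: "coord_dist K x y < r / 4"
  shows "dir_deriv f (\<lambda>i. h i + k i) y = dir_deriv f h y + dir_deriv f k y"
proof -
  have r: "r > 0" and M: "M \<ge> 0" using f by (auto simp: analytic_bounded_def)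
  let ?s = "\<lambda>n. 1 / of_nat n :: complex"
  have lim: "(\<lambda>n. of_nat n * (f (line (y' n) l (?s n)) - f (y' n)) - dir_deriv f l (y' n)) \<longlonglongrightarrow> 0"
    if "\<forall>\<^sub>F n in sequentially. coord_dist K x (y' n) < r / 2" for l y'
  proof (rule Lim_null_comparison)
    obtain n0 where n0: "coord_dist K 0 l / (r / 4) \<le> real n0" using real_arch_simple by auto
    show "\<forall>\<^sub>F n in sequentially. cmod (of_nat n * (f (line (y' n) l (?s n)) - f (y' n)) - dir_deriv f l (y' n))
       \<le> 72 * M * (coord_dist K 0 l)\<^sup>2 / r\<^sup>2 / real n"
      using that eventually_ge_at_top[of "n0 + 1"]
    proof eventually_elim
      case (elim n)
      have "coord_dist K 0 l \<le> r / 4 * real n0" using n0 r by (simp add: field_simps)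
      also have "\<dots> \<le> r / 4 * real n" using r elim by (intro mult_left_mono) auto
      finally show ?case using elim by (intro dir_deriv_limit_bound[OF f]) auto
    qed
    have "(\<lambda>n. B / real n) \<longlonglongrightarrow> 0" for B by real_asymp
    then show "(\<lambda>n. 72 * M * (coord_dist K 0 l)\<^sup>2 / r\<^sup>2 / real n) \<longlonglongrightarrow> 0" .
  qed
  have ev: "\<forall>\<^sub>F n in sequentially. coord_dist K x (line y h (?s n)) < r / 2"
  proof -
    have "(\<lambda>n. B / real n) \<longlonglongrightarrow> 0" for B by real_asymp
    then have "(\<lambda>n. coord_dist K 0 h / real n) \<longlonglongrightarrow> 0" .
    then have "\<forall>\<^sub>F n in sequentially. coord_dist K 0 h / real n < r / 4" using r by (intro order_tendstoD(2)) auto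
    then show ?thesis
    proof eventually_elim
      case (elim n)
      have "coord_dist K x (line y h (?s n)) \<le> coord_dist K x y + coord_dist K 0 h / real n"
        using coord_dist_triangle[of K x "line y h (?s n)" y]
        unfolding coord_dist_line norm_divide norm_one norm_of_nat by simp
      then show ?case using y elim by linarith
    qed
  qed
  have A: "(\<lambda>n. of_nat n * (f (line y h (?s n)) - f y) - dir_deriv f h y) \<longlonglongrightarrow> 0"
    using y r by (intro lim) auto
  have B: "(\<lambda>n. of_nat n * (f (line y (\<lambda>i. h i + k i) (?s n)) - f y) - dir_deriv f (\<lambda>i. h i + k i) y) \<longlonglongrightarrow> 0"
    using y r by (intro lim) auto
  have C: "(\<lambda>n. of_nat n * (f (line (line y h (?s n)) k (?s n)) - f (line y h (?s n))) - dir_deriv f k (line y h (?s n))) \<longlonglongrightarrow> 0"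
    by (rule lim[OF ev])
  have l: "line (line y h (?s n)) k (?s n) = line y (\<lambda>i. h i + k i) (?s n)" for n
    by (simp add: line_def algebra_simps)
  have D: "(\<lambda>n. dir_deriv f k (line y h (?s n))) \<longlonglongrightarrow> dir_deriv f k y"
  proof -
    have "((\<lambda>\<zeta>. dir_deriv f k (line y h \<zeta>)) has_field_derivative dir_deriv (dir_deriv f k) h y) (at 0)"
      by (rule dir_deriv_at[OF analytic_bounded_dir_deriv[OF f]]) (use y in simp)
    then have "isCont (\<lambda>\<zeta>. dir_deriv f k (line y h \<zeta>)) 0" by (rule DERIV_isCont)
    moreover have "?s \<longlonglongrightarrow> 0" by (rule lim_1_over_n)
    ultimately have "(\<lambda>n. dir_deriv f k (line y h (?s n))) \<longlonglongrightarrow> dir_deriv f k (line y h 0)"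
      by (rule isCont_tendsto_compose)
    then show ?thesis by (simp add: line_def)
  qed
  \<comment> \<open>Three remainders that tend to 0 are combined so that the values of f at all
    moved points cancel.\<close>
  have "(\<lambda>n. (of_nat n * (f (line y h (?s n)) - f y) - dir_deriv f h y) +
     (of_nat n * (f (line (line y h (?s n)) k (?s n)) - f (line y h (?s n))) - dir_deriv f k (line y h (?s n))) -
     (of_nat n * (f (line y (\<lambda>i. h i + k i) (?s n)) - f y) - dir_deriv f (\<lambda>i. h i + k i) y) +
     dir_deriv f k (line y h (?s n))) \<longlonglongrightarrow> 0 + 0 - 0 + dir_deriv f k y"
    by (intro tendsto_add tendsto_diff A B C D)
  moreover have "(of_nat n * (f (line y h (?s n)) - f y) - dir_deriv f h y) +
     (of_nat n * (f (line (line y h (?s n)) k (?s n)) - f (line y h (?s n))) - dir_deriv f k (line y h (?s n))) -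
     (of_nat n * (f (line y (\<lambda>i. h i + k i) (?s n)) - f y) - dir_deriv f (\<lambda>i. h i + k i) y) +
     dir_deriv f k (line y h (?s n)) = dir_deriv f (\<lambda>i. h i + k i) y - dir_deriv f h y" for n
    unfolding l by (simp add: algebra_simps)
  ultimately have "(\<lambda>n::nat. dir_deriv f (\<lambda>i. h i + k i) y - dir_deriv f h y) \<longlonglongrightarrow> dir_deriv f k y" by simp
  then show ?thesis by (simp add: LIMSEQ_const_iff algebra_simps)
qed

subsection \<open>Smoothness of real slices of analytic functions\<close>

text \<open>\<open>e\<close> is an affine map into complex coordinates and \<open>L\<close> its
  linear part. They are kept apart because the curve of a fixed datum has an embedding in which the
  data coordinates are constant and only time moves.\<close>

locale complexification =
  fixes V :: "'a::real_vector set" and p :: "'a \<Rightarrow> real" and K :: "'k set"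
    and e L :: "'a \<Rightarrow> 'k \<Rightarrow> complex" and B :: real
  assumes V_add: "x \<in> V \<Longrightarrow> h \<in> V \<Longrightarrow> x + h \<in> V" and V_scale: "x \<in> V \<Longrightarrow> r *\<^sub>R x \<in> V"
    and e_add: "x \<in> V \<Longrightarrow> h \<in> V \<Longrightarrow> e (x + h) = (\<lambda>i. e x i + L h i)"
    and L_add: "x \<in> V \<Longrightarrow> h \<in> V \<Longrightarrow> L (x + h) = (\<lambda>i. L x i + L h i)"
    and L_scale: "x \<in> V \<Longrightarrow> L (r *\<^sub>R x) = (\<lambda>i. of_real r * L x i)"
    and L_bound: "h \<in> V \<Longrightarrow> coord_dist K 0 (L h) \<le> B * p h" and B_nonneg: "B \<ge> 0"
    and p_nonneg: "h \<in> V \<Longrightarrow> p h \<ge> 0"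
begin

definition real_analytic :: "('a \<Rightarrow> complex) \<Rightarrow> bool" where
  "real_analytic G \<longleftrightarrow> (\<forall>x\<in>V. \<exists>r M f. analytic_bounded K (e x) r M f \<and>
     (\<forall>y\<in>V. coord_dist K (e x) (e y) < r \<longrightarrow> G y = f (e y)))"

text \<open>Defined from G alone and not from a local analytic extension, so that derivatives
  computed with extensions around different points agree automatically.\<close>

definition slice_deriv :: "('a \<Rightarrow> complex) \<Rightarrow> 'a \<Rightarrow> 'a \<Rightarrow> complex" where
  "slice_deriv G h x = vector_derivative (\<lambda>s::real. G (x + s *\<^sub>R h)) (at 0)"

fun slice_derivs :: "('a \<Rightarrow> complex) \<Rightarrow> 'a list \<Rightarrow> 'a \<Rightarrow> complex" where
  "slice_derivs G [] = G"
| "slice_derivs G (h # hs) = slice_deriv (slice_derivs G hs) h"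

lemma e_line: "x \<in> V \<Longrightarrow> h \<in> V \<Longrightarrow> e (x + s *\<^sub>R h) = line (e x) (L h) (of_real s)"
  by (simp add: e_add V_scale L_scale line_def)

lemma slice_deriv_eq:
  assumes f: "analytic_bounded K x0 r M f" "\<And>y. y \<in> V \<Longrightarrow> coord_dist K x0 (e y) < r \<Longrightarrow> G y = f (e y)"
    and y: "y \<in> V" "h \<in> V" "coord_dist K x0 (e y) < r / 2"
  shows "slice_deriv G h y = dir_deriv f (L h) (e y)"
proof -
  have r: "r > 0" using f by (auto simp: analytic_bounded_def)
  have "((\<lambda>s::real. f (line (e y) (L h) (of_real s))) has_vector_derivative dir_deriv f (L h) (e y)) (at 0)"
    using dir_deriv_at[OF f(1) y(3), of "L h"]
    by (intro has_vector_derivative_real_field[of "\<lambda>\<zeta>. f (line (e y) (L h) \<zeta>)", simplified]) auto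
  moreover have "\<forall>\<^sub>F s :: real in nhds 0. f (line (e y) (L h) (of_real s)) = G (y + s *\<^sub>R h)"
  proof -
    have "\<forall>\<^sub>F s :: real in nhds 0. \<bar>s\<bar> * coord_dist K 0 (L h) < r / 2"
    proof -
      have "((\<lambda>s::real. \<bar>s\<bar> * coord_dist K 0 (L h)) \<longlongrightarrow> \<bar>0\<bar> * coord_dist K 0 (L h)) (nhds 0)"
        by (intro tendsto_intros filterlim_ident)
      then show ?thesis using r by (intro order_tendstoD(2)[of _ "\<bar>0\<bar> * coord_dist K 0 (L h)"]) auto
    qed
    then show ?thesis
    proof eventually_elim
      case (elim s)
      have "coord_dist K x0 (e (y + s *\<^sub>R h)) < r"
        using elim y coord_dist_triangle[of K x0 "e (y + s *\<^sub>R h)" "e y"] by (simp add: e_line coord_dist_line)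
      then show ?case using f(2)[of "y + s *\<^sub>R h"] y by (simp add: V_add V_scale e_line)
    qed
  qed
  ultimately have "((\<lambda>s::real. G (y + s *\<^sub>R h)) has_vector_derivative dir_deriv f (L h) (e y)) (at 0)"
    by (subst has_vector_derivative_cong_ev[of _ "\<lambda>s::real. f (line (e y) (L h) (of_real s))", symmetric])
       (auto simp: line_def f(2)[OF y(1)] y(3) eventually_mono dest!: eventually_nhds_x_imp_x)
  then show ?thesis unfolding slice_deriv_def by (rule vector_derivative_at)
qed

lemma real_analytic_slice_deriv:
  assumes "real_analytic G" "h \<in> V"
  shows "real_analytic (slice_deriv G h)"
  unfolding real_analytic_def
proof
  fix x assume x: "x \<in> V"
  then obtain r M f where f: "analytic_bounded K (e x) r M f" "\<And>y. y \<in> V \<Longrightarrow> coord_dist K (e x) (e y) < r \<Longrightarrow> G y = f (e y)"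
    using assms(1) unfolding real_analytic_def by metis
  show "\<exists>r M f. analytic_bounded K (e x) r M f \<and> (\<forall>y\<in>V. coord_dist K (e x) (e y) < r \<longrightarrow> slice_deriv G h y = f (e y))"
    using analytic_bounded_dir_deriv[OF f(1), of "L h"] slice_deriv_eq[OF f _ assms(2)]
    by (intro exI[of _ "r/2"] exI[of _ "4 * M * (coord_dist K 0 (L h) + 1) / r"] exI[of _ "dir_deriv f (L h)"]) auto
qed

lemma slice_deriv_linear:
  assumes "real_analytic G" "x \<in> V" "h \<in> V" "k \<in> V"
  shows "slice_deriv G (h + k) x = slice_deriv G h x + slice_deriv G k x"
    "slice_deriv G (s *\<^sub>R h) x = of_real s * slice_deriv G h x"
proof -
  obtain r M f where f: "analytic_bounded K (e x) r M f" "\<And>y. y \<in> V \<Longrightarrow> coord_dist K (e x) (e y) < r \<Longrightarrow> G y = f (e y)"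
    using assms unfolding real_analytic_def by metis
  have r: "r > 0" using f by (auto simp: analytic_bounded_def)
  note eq = slice_deriv_eq[OF f assms(2)]
  show "slice_deriv G (h + k) x = slice_deriv G h x + slice_deriv G k x"
    using assms r by (simp add: eq V_add coord_dist_self L_add dir_deriv_add[OF f(1)])
  show "slice_deriv G (s *\<^sub>R h) x = of_real s * slice_deriv G h x"
    using assms r by (simp add: eq V_scale coord_dist_self L_scale dir_deriv_scale[OF f(1)])
qed

lemma slice_deriv_remainder:
  assumes "real_analytic G" "x \<in> V" "\<epsilon> > 0"
  shows "\<exists>\<delta>>0. \<forall>h\<in>V. p h < \<delta> \<longrightarrow> cmod (G (x + h) - G x - slice_deriv G h x) \<le> \<epsilon> * p h"
proof -
  obtain r M f where f: "analytic_bounded K (e x) r M f" "\<And>y. y \<in> V \<Longrightarrow> coord_dist K (e x) (e y) < r \<Longrightarrow> G y = f (e y)"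
    using assms unfolding real_analytic_def by metis
  have r: "r > 0" and M: "M \<ge> 0" using f by (auto simp: analytic_bounded_def)
  define A where "A = 72 * M * B\<^sup>2 / r\<^sup>2"
  have A: "A \<ge> 0" using M by (simp add: A_def)
  \<comment> \<open>The first bound brings the displacement within r/4, where the remainder estimate
    holds; the second turns the quadratic remainder A (p h)^2 into at most \<epsilon> p h.\<close>
  define \<delta> where "\<delta> = min (r / 4 / (B + 1)) (\<epsilon> / (A + 1))"
  have d: "\<delta> > 0" using r B_nonneg A assms(3) by (simp add: \<delta>_def)
  have "cmod (G (x + h) - G x - slice_deriv G h x) \<le> \<epsilon> * p h" if h: "h \<in> V" "p h < \<delta>" for h
  proof -
    have ph: "p h < r / 4 / (B + 1)" "p h < \<epsilon> / (A + 1)" using h by (auto simp: \<delta>_def)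
    have small: "coord_dist K 0 (L h) \<le> r / 4"
    proof -
      have "B * p h \<le> (B + 1) * p h" using p_nonneg[OF h(1)] by (simp add: algebra_simps)
      also have "\<dots> < r / 4" using ph(1) B_nonneg by (simp add: field_simps)
      finally show ?thesis using L_bound[OF h(1)] by linarith
    qed
    have el: "e (x + h) = line (e x) (L h) 1" using e_line[OF assms(2) h(1), of 1] by simp
    have "coord_dist K (e x) (e (x + h)) < r" unfolding el coord_dist_line using small r by simp
    then have "G (x + h) = f (line (e x) (L h) 1)" using f(2)[of "x + h"] h assms(2) by (simp add: V_add el)
    moreover have "G x = f (e x)" using f(2)[of x] assms(2) r by (simp add: coord_dist_self)
    moreover have "slice_deriv G h x = dir_deriv f (L h) (e x)"
      using slice_deriv_eq[OF f assms(2) h(1)] r by (simp add: coord_dist_self)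
    ultimately have "cmod (G (x + h) - G x - slice_deriv G h x) \<le> 72 * M * (coord_dist K 0 (L h))\<^sup>2 / r\<^sup>2"
      using dir_deriv_remainder[OF f(1) _ small, of "e x"] r by (simp add: coord_dist_self)
    also have "\<dots> \<le> 72 * M * (B * p h)\<^sup>2 / r\<^sup>2"
      using L_bound[OF h(1)] M coord_dist_nonneg[of K 0 "L h"] by (intro divide_right_mono mult_left_mono power_mono) auto
    also have "\<dots> = A * (p h * p h)" by (simp add: A_def power_mult_distrib power2_eq_square)
    also have "\<dots> \<le> \<epsilon> * p h"
    proof -
      have p0: "p h \<ge> 0" using p_nonneg h(1) .
      have "A * p h \<le> (A + 1) * p h" using p0 by (simp add: algebra_simps)
      also have "\<dots> \<le> \<epsilon>" using ph(2) A by (simp add: field_simps)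
      finally have "A * p h * p h \<le> \<epsilon> * p h" using p0 by (rule mult_right_mono)
      then show ?thesis by (simp add: mult_ac)
    qed
    finally show ?thesis .
  qed
  then show ?thesis using d by blast
qed

lemma real_analytic_slice_derivs:
  "real_analytic G \<Longrightarrow> hs \<in> lists V \<Longrightarrow> real_analytic (slice_derivs G hs)"
  by (induction hs) (auto intro: real_analytic_slice_deriv)

text \<open>Everything reduces to the N coefficient functions: iterated slice derivatives of these
  supply the required derivatives, and q is controlled by the sum of the moduli of the
  coefficients.\<close>

lemma frechet_smooth_real_analytic:
  fixes G :: "nat \<Rightarrow> 'a \<Rightarrow> complex" and b :: "nat \<Rightarrow> complex \<Rightarrow> complex"
  assumes G: "\<And>j. j < N \<Longrightarrow> real_analytic (G j)" and F: "\<And>x. x \<in> V \<Longrightarrow> F x = (\<lambda>z. \<Sum>j<N. G j x * b j z)"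
    and W: "\<And>c. (\<lambda>z. \<Sum>j<N. c j * b j z) \<in> W"
    and q: "\<And>c. q (\<lambda>z. \<Sum>j<N. c j * b j z) \<le> C * (\<Sum>j<N. cmod (c j))" and C: "C \<ge> 0"
  shows "frechet_smooth V p W q F"
proof -
  define D where "D hs x = (if hs = [] then F x else (\<lambda>z. \<Sum>j<N. slice_derivs (G j) hs x * b j z))" for hs x
  have D: "D hs x = (\<lambda>z. \<Sum>j<N. slice_derivs (G j) hs x * b j z)" if "x \<in> V" for hs x
    using F[OF that] by (auto simp: D_def)
  have ra: "real_analytic (slice_derivs (G j) hs)" if "j < N" "hs \<in> lists V" for j hs
    using real_analytic_slice_derivs[OF G] that by blast
  have "\<exists>\<delta>>0. \<forall>h\<in>V. p h < \<delta> \<longrightarrow> q (D hs (x + h) - D hs x - D (h # hs) x) \<le> \<epsilon> * p h"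
    if hs: "hs \<in> lists V" and x: "x \<in> V" and e: "\<epsilon> > 0" for hs x \<epsilon>
  proof -
    \<comment> \<open>Summing N coefficient errors and passing to q costs a factor C N; the 1 keeps
      the denominator positive.\<close>
    define \<epsilon>' where "\<epsilon>' = \<epsilon> / (C * real N + 1)"
    have e': "\<epsilon>' > 0" using e C by (simp add: \<epsilon>'_def add_nonneg_pos)
    define d where "d j = (SOME \<delta>. \<delta> > 0 \<and> (\<forall>h\<in>V. p h < \<delta> \<longrightarrow>
       cmod (slice_derivs (G j) hs (x + h) - slice_derivs (G j) hs x - slice_derivs (G j) (h # hs) x) \<le> \<epsilon>' * p h))" for j
    have d: "d j > 0 \<and> (\<forall>h\<in>V. p h < d j \<longrightarrow>
       cmod (slice_derivs (G j) hs (x + h) - slice_derivs (G j) hs x - slice_derivs (G j) (h # hs) x) \<le> \<epsilon>' * p h)" if "j < N" for j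
    proof -
      have "\<exists>\<delta>>0. \<forall>h\<in>V. p h < \<delta> \<longrightarrow>
         cmod (slice_derivs (G j) hs (x + h) - slice_derivs (G j) hs x - slice_derivs (G j) (h # hs) x) \<le> \<epsilon>' * p h"
        using slice_deriv_remainder[OF ra[OF that hs] x e'] by simp
      then show ?thesis unfolding d_def by (rule someI_ex)
    qed
    define \<delta> where "\<delta> = Min (insert 1 (d ` {..<N}))"
    have "\<delta> > 0" unfolding \<delta>_def using d by (subst Min_gr_iff) auto
    moreover have "q (D hs (x + h) - D hs x - D (h # hs) x) \<le> \<epsilon> * p h" if h: "h \<in> V" "p h < \<delta>" for h
    proof -
      have dj: "p h < d j" if "j < N" for j
        using h(2) that unfolding \<delta>_def by (subst (asm) Min_gr_iff) auto
      define c where "c j = slice_derivs (G j) hs (x + h) - slice_derivs (G j) hs x - slice_derivs (G j) (h # hs) x" for j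
      have "D hs (x + h) - D hs x - D (h # hs) x = (\<lambda>z. \<Sum>j<N. c j * b j z)"
        using x h by (auto simp: D V_add c_def fun_eq_iff sum_subtractf sum.distrib algebra_simps)
      then have "q (D hs (x + h) - D hs x - D (h # hs) x) \<le> C * (\<Sum>j<N. cmod (c j))" using q by simp
      also have "\<dots> \<le> C * (\<Sum>j<N. \<epsilon>' * p h)"
        using C d dj h(1) by (intro mult_left_mono sum_mono) (auto simp: c_def)
      also have "\<dots> = (C * real N) * \<epsilon>' * p h" by simp
      also have "\<dots> \<le> (C * real N + 1) * \<epsilon>' * p h"
        using e' p_nonneg[OF h(1)] by (intro mult_right_mono) auto
      also have "(C * real N + 1) * \<epsilon>' = \<epsilon>"
      proof -
        have "C * real N + 1 > 0" using C by (simp add: add_nonneg_pos)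
        then show ?thesis by (simp add: \<epsilon>'_def)
      qed
      finally show ?thesis .
    qed
    ultimately show ?thesis by blast
  qed
  moreover have "D ((h + k) # hs) x = D (h # hs) x + D (k # hs) x" if "hs \<in> lists V" "x \<in> V" "h \<in> V" "k \<in> V" for hs x h k
    using that ra by (simp add: D fun_eq_iff slice_deriv_linear sum.distrib[symmetric] distrib_right)
  moreover have "D ((r *\<^sub>R h) # hs) x = r *\<^sub>R D (h # hs) x" if "hs \<in> lists V" "x \<in> V" "h \<in> V" for hs x h r
    using that ra by (simp add: D fun_eq_iff slice_deriv_linear(2)[OF _ _ _ that(3)] scaleR_fun_def scaleR_sum_right scaleR_conv_of_real mult.assoc sum_distrib_left)
  ultimately show ?thesis
    unfolding frechet_smooth_def by (intro exI[of _ D]) (auto simp: D W F)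
qed

end

subsection \<open>A conservative cubic system\<close>

text \<open>A Cauchy product has n + 1 terms. When a differential equation is solved for the next
  coefficient, the division by n + 1 cancels exactly this factor.\<close>

lemma fps_mult_geometric_bound:
  fixes f g :: "complex fps"
  assumes "\<And>i. i \<le> n \<Longrightarrow> cmod (fps_nth f i) \<le> a * \<kappa> ^ i" "\<And>i. i \<le> n \<Longrightarrow> cmod (fps_nth g i) \<le> b * \<kappa> ^ i"
    "a \<ge> 0" "\<kappa> \<ge> 0"
  shows "cmod (fps_nth (f * g) n) \<le> real (Suc n) * (a * b * \<kappa> ^ n)"
proof -
  have "cmod (fps_nth (f * g) n) \<le> (\<Sum>i=0..n. cmod (fps_nth f i) * cmod (fps_nth g (n - i)))"
    unfolding fps_mult_nth by (rule order.trans[OF norm_sum]) (simp add: norm_mult)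
  also have "\<dots> \<le> (\<Sum>i=0..n. a * b * \<kappa> ^ n)"
  proof (rule sum_mono)
    fix i assume i: "i \<in> {0..n}"
    have "cmod (fps_nth f i) * cmod (fps_nth g (n - i)) \<le> (a * \<kappa> ^ i) * (b * \<kappa> ^ (n - i))"
      using assms i by (intro mult_mono) auto
    also have "\<dots> = a * b * (\<kappa> ^ i * \<kappa> ^ (n - i))" by (simp add: mult_ac)
    also have "\<kappa> ^ i * \<kappa> ^ (n - i) = \<kappa> ^ n" using i by (simp add: power_add[symmetric])
    finally show "cmod (fps_nth f i) * cmod (fps_nth g (n - i)) \<le> a * b * \<kappa> ^ n" .
  qed
  finally show ?thesis by simp
qed

lemma sum4_bij:
  fixes f g :: "nat \<Rightarrow> nat \<Rightarrow> nat \<Rightarrow> nat \<Rightarrow> complex"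
  shows "(\<Sum>k<N. \<Sum>l<N. \<Sum>m<N. \<Sum>j<N. f k l m j) = (\<Sum>k<N. \<Sum>l<N. \<Sum>m<N. \<Sum>j<N. f m l k j)"
    "(\<Sum>k<N. \<Sum>l<N. \<Sum>m<N. \<Sum>j<N. f k l m j) = (\<Sum>k<N. \<Sum>l<N. \<Sum>m<N. \<Sum>j<N. f l k j m)"
    "(\<Sum>k<N. \<Sum>l<N. \<Sum>m<N. \<Sum>j<N. f k l m j) = (\<Sum>k<N. \<Sum>l<N. \<Sum>m<N. \<Sum>j<N. f k j m l)"
    "(\<Sum>k<N. \<Sum>l<N. \<Sum>m<N. \<Sum>j<N. f k l m j) = (\<Sum>j<N. \<Sum>k<N. \<Sum>l<N. \<Sum>m<N. f k l m j)"
proof -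
  have e: "(\<Sum>k<N. \<Sum>l<N. \<Sum>m<N. \<Sum>j<N. g k l m j) = (\<Sum>(k, l, m, j)\<in>{..<N} \<times> {..<N} \<times> {..<N} \<times> {..<N}. g k l m j)" for g :: "nat \<Rightarrow> nat \<Rightarrow> nat \<Rightarrow> nat \<Rightarrow> complex"
    by (simp add: sum.cartesian_product)
  show "(\<Sum>k<N. \<Sum>l<N. \<Sum>m<N. \<Sum>j<N. f k l m j) = (\<Sum>k<N. \<Sum>l<N. \<Sum>m<N. \<Sum>j<N. f m l k j)"
    unfolding e by (rule sum.reindex_bij_witness[of _ "\<lambda>(k,l,m,j). (m,l,k,j)" "\<lambda>(k,l,m,j). (m,l,k,j)"]) auto
  show "(\<Sum>k<N. \<Sum>l<N. \<Sum>m<N. \<Sum>j<N. f k l m j) = (\<Sum>k<N. \<Sum>l<N. \<Sum>m<N. \<Sum>j<N. f l k j m)"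
    unfolding e by (rule sum.reindex_bij_witness[of _ "\<lambda>(k,l,m,j). (l,k,j,m)" "\<lambda>(k,l,m,j). (l,k,j,m)"]) auto
  show "(\<Sum>k<N. \<Sum>l<N. \<Sum>m<N. \<Sum>j<N. f k l m j) = (\<Sum>k<N. \<Sum>l<N. \<Sum>m<N. \<Sum>j<N. f k j m l)"
    unfolding e by (rule sum.reindex_bij_witness[of _ "\<lambda>(k,l,m,j). (k,j,m,l)" "\<lambda>(k,l,m,j). (k,j,m,l)"]) auto
  have e2: "(\<Sum>j<N. \<Sum>k<N. \<Sum>l<N. \<Sum>m<N. f k l m j) = (\<Sum>(j, k, l, m)\<in>{..<N} \<times> {..<N} \<times> {..<N} \<times> {..<N}. f k l m j)"
    by (simp add: sum.cartesian_product)
  show "(\<Sum>k<N. \<Sum>l<N. \<Sum>m<N. \<Sum>j<N. f k l m j) = (\<Sum>j<N. \<Sum>k<N. \<Sum>l<N. \<Sum>m<N. f k l m j)"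
    unfolding e e2 by (rule sum.reindex_bij_witness[of _ "\<lambda>(j,k,l,m). (k,l,m,j)" "\<lambda>(k,l,m,j). (j,k,l,m)"]) auto
qed

lemma has_real_derivative_Re_Im:
  assumes "(f has_vector_derivative d) (at t)"
  shows "((\<lambda>s. Re (f s)) has_real_derivative Re d) (at t)" "((\<lambda>s. Im (f s)) has_real_derivative Im d) (at t)"
  unfolding has_real_derivative_iff_has_vector_derivative
  by (rule bounded_linear.has_vector_derivative[OF bounded_linear_Re assms]
        bounded_linear.has_vector_derivative[OF bounded_linear_Im assms])+

lemma has_real_derivative_cmod_square:
  assumes "(f has_vector_derivative d) (at t)"
  shows "((\<lambda>s. (cmod (f s))\<^sup>2) has_real_derivative 2 * Re (cnj (f t) * d)) (at t)"
proof -
  have "((\<lambda>s. (Re (f s))\<^sup>2 + (Im (f s))\<^sup>2) has_real_derivative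
     real 2 * (Re d * Re (f t) ^ (2 - Suc 0)) + real 2 * (Im d * Im (f t) ^ (2 - Suc 0))) (at t)"
    by (rule DERIV_add[OF DERIV_power[OF has_real_derivative_Re_Im(1)[OF assms], of 2] DERIV_power[OF has_real_derivative_Re_Im(2)[OF assms], of 2]])
  then show ?thesis by (simp add: cmod_power2 algebra_simps)
qed

text \<open>The two symmetries are those of the integral of Phi_k conj(Phi_l) Phi_m conj(Phi_j);
  both conservation laws rest on them.\<close>

locale cubic_system =
  fixes N :: nat and C :: real and I :: "nat \<Rightarrow> nat \<Rightarrow> nat \<Rightarrow> nat \<Rightarrow> complex"
  assumes I_swap: "I k l m j = I m l k j" and I_cnj: "cnj (I k l m j) = I l k j m"
begin

definition force_field :: "(nat \<Rightarrow> complex) \<Rightarrow> nat \<Rightarrow> complex" where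
  "force_field y j = (\<Sum>k<N. \<Sum>l<N. \<Sum>m<N. I k l m j * y k * cnj (y l) * y m)"

definition rhs :: "(nat \<Rightarrow> complex) \<Rightarrow> nat \<Rightarrow> complex" where
  "rhs y j = - \<i> * of_real C * force_field y j"

definition energy :: "(nat \<Rightarrow> complex) \<Rightarrow> real" where "energy y = (\<Sum>j<N. (cmod (y j))\<^sup>2)"

definition hamiltonian :: "(nat \<Rightarrow> complex) \<Rightarrow> complex" where
  "hamiltonian y = (\<Sum>k<N. \<Sum>l<N. \<Sum>m<N. \<Sum>j<N. I k l m j * y k * cnj (y l) * y m * cnj (y j))"

text \<open>A segment from 0 treats positive and negative end times alike. The derivative is
  two-sided even at the end points.\<close>

definition solves_on :: "real \<Rightarrow> (real \<Rightarrow> nat \<Rightarrow> complex) \<Rightarrow> bool" where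
  "solves_on t1 y \<longleftrightarrow> (\<forall>t\<in>closed_segment 0 t1. \<forall>j<N. ((\<lambda>s. y s j) has_vector_derivative rhs (y t) j) (at t))"

section \<open>Two conserved quantities\<close>

lemma I_swap2: "I k l m j = I k j m l"
  using I_cnj[of l k j m] I_cnj[of j k l m] I_swap[of l k j m] by simp

lemma hamiltonian_force: "hamiltonian y = (\<Sum>j<N. cnj (y j) * force_field y j)"
  unfolding hamiltonian_def
  by (subst sum4_bij(4)) (simp add: force_field_def sum_distrib_left mult_ac)

lemma hamiltonian_real: "cnj (hamiltonian y) = hamiltonian y"
proof -
  have "cnj (hamiltonian y) = (\<Sum>k<N. \<Sum>l<N. \<Sum>m<N. \<Sum>j<N. I l k j m * cnj (y k) * y l * cnj (y m) * y j)"
    unfolding hamiltonian_def by (simp add: I_cnj)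
  also have "\<dots> = hamiltonian y" unfolding hamiltonian_def
    by (subst sum4_bij(2)) (intro sum.cong refl, simp add: mult_ac)
  finally show ?thesis .
qed

lemma segment_constant:
  fixes f :: "real \<Rightarrow> 'b::real_normed_vector"
  assumes "\<And>t. t \<in> closed_segment 0 t1 \<Longrightarrow> (f has_vector_derivative 0) (at t)"
  shows "f t1 = f 0"
proof -
  have "\<exists>c. \<forall>x\<in>closed_segment 0 t1. f x = c"
    by (rule has_derivative_zero_constant)
       (use assms in \<open>auto simp: has_vector_derivative_def intro: has_derivative_at_withinI\<close>)
  then show ?thesis by auto
qed

text \<open>The derivative of the energy is twice the real part of -i C times the Hamiltonian, and
  the Hamiltonian is real.\<close>

lemma energy_conserved:
  assumes "solves_on t1 y"
  shows "energy (y t1) = energy (y 0)"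
proof (rule segment_constant)
  fix t assume t: "t \<in> closed_segment 0 t1"
  have "((\<lambda>s. \<Sum>j<N. (cmod (y s j))\<^sup>2) has_real_derivative (\<Sum>j<N. 2 * Re (cnj (y t j) * rhs (y t) j))) (at t)"
  proof (rule DERIV_sum)
    fix j assume "j \<in> {..<N}"
    then have d: "((\<lambda>s. y s j) has_vector_derivative rhs (y t) j) (at t)" using assms t by (auto simp: solves_on_def)
    show "((\<lambda>s. (cmod (y s j))\<^sup>2) has_real_derivative 2 * Re (cnj (y t j) * rhs (y t) j)) (at t)"
      using has_real_derivative_cmod_square[OF d] .
  qed
  moreover have "(\<Sum>j<N. 2 * Re (cnj (y t j) * rhs (y t) j)) = 0"
  proof -
    have "(\<Sum>j<N. 2 * Re (cnj (y t j) * rhs (y t) j)) = 2 * Re (\<Sum>j<N. cnj (y t j) * rhs (y t) j)"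
      by (simp add: sum_distrib_left)
    also have "(\<Sum>j<N. cnj (y t j) * rhs (y t) j) = - \<i> * of_real C * hamiltonian (y t)"
      unfolding hamiltonian_force rhs_def sum_distrib_left by (intro sum.cong refl) (simp add: mult_ac)
    also have "Im (hamiltonian (y t)) = 0" using hamiltonian_real[of "y t"] by (simp add: complex_eq_iff)
    then have "Re (- \<i> * of_real C * hamiltonian (y t)) = 0" by simp
    finally show ?thesis by simp
  qed
  ultimately show "((\<lambda>s. energy (y s)) has_vector_derivative 0) (at t)"
    unfolding energy_def has_real_derivative_iff_has_vector_derivative by simp
qed

text \<open>Differentiation yields one sum for each of the four factors. By symmetry S1 = S3, S2 =
  S4 and S3 is the conjugate of S4, while S4 = i C times the sum of |force_field|^2 is purely
  imaginary; so the four sums cancel.\<close>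

lemma hamiltonian_conserved:
  assumes "solves_on t1 y"
  shows "hamiltonian (y t1) = hamiltonian (y 0)"
proof (rule segment_constant[of _ "\<lambda>s. hamiltonian (y s)"])
  fix t assume t: "t \<in> closed_segment 0 t1"
  define r where "r = rhs (y t)"
  define Y where "Y = y t"
  have d: "((\<lambda>s. y s j) has_vector_derivative r j) (at t)" if "j < N" for j
    using assms t that by (auto simp: solves_on_def r_def)
  have dc: "((\<lambda>s. cnj (y s j)) has_vector_derivative cnj (r j)) (at t)" if "j < N" for j
    by (rule bounded_linear.has_vector_derivative[OF bounded_linear_cnj d[OF that]])
  define S1 where "S1 = (\<Sum>k<N. \<Sum>l<N. \<Sum>m<N. \<Sum>j<N. I k l m j * r k * cnj (Y l) * Y m * cnj (Y j))"
  define S2 where "S2 = (\<Sum>k<N. \<Sum>l<N. \<Sum>m<N. \<Sum>j<N. I k l m j * Y k * cnj (r l) * Y m * cnj (Y j))"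
  define S3 where "S3 = (\<Sum>k<N. \<Sum>l<N. \<Sum>m<N. \<Sum>j<N. I k l m j * Y k * cnj (Y l) * r m * cnj (Y j))"
  define S4 where "S4 = (\<Sum>k<N. \<Sum>l<N. \<Sum>m<N. \<Sum>j<N. I k l m j * Y k * cnj (Y l) * Y m * cnj (r j))"
  have "((\<lambda>s. hamiltonian (y s)) has_vector_derivative (\<Sum>k<N. \<Sum>l<N. \<Sum>m<N. \<Sum>j<N.
     I k l m j * Y k * cnj (Y l) * Y m * cnj (r j) + I k l m j * Y k * cnj (Y l) * r m * cnj (Y j) +
     I k l m j * Y k * cnj (r l) * Y m * cnj (Y j) + I k l m j * r k * cnj (Y l) * Y m * cnj (Y j))) (at t)"
    unfolding hamiltonian_def
  proof (intro has_vector_derivative_sum)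
    fix k l m j assume *: "k \<in> {..<N}" "l \<in> {..<N}" "m \<in> {..<N}" "j \<in> {..<N}"
    have "((\<lambda>s. I k l m j * y s k) has_vector_derivative I k l m j * r k) (at t)"
      using d[of k] * by (auto intro: has_vector_derivative_mult_right)
    from has_vector_derivative_mult[OF has_vector_derivative_mult[OF has_vector_derivative_mult[OF this dc[of l]] d[of m]] dc[of j]] *
    show "((\<lambda>s. I k l m j * y s k * cnj (y s l) * y s m * cnj (y s j)) has_vector_derivative
       I k l m j * Y k * cnj (Y l) * Y m * cnj (r j) + I k l m j * Y k * cnj (Y l) * r m * cnj (Y j) +
       I k l m j * Y k * cnj (r l) * Y m * cnj (Y j) + I k l m j * r k * cnj (Y l) * Y m * cnj (Y j)) (at t)"
      by (simp add: Y_def algebra_simps)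
  qed
  moreover have "(\<Sum>k<N. \<Sum>l<N. \<Sum>m<N. \<Sum>j<N.
     I k l m j * Y k * cnj (Y l) * Y m * cnj (r j) + I k l m j * Y k * cnj (Y l) * r m * cnj (Y j) +
     I k l m j * Y k * cnj (r l) * Y m * cnj (Y j) + I k l m j * r k * cnj (Y l) * Y m * cnj (Y j)) = S4 + S3 + S2 + S1"
    by (simp add: S1_def S2_def S3_def S4_def sum.distrib)
  moreover have "S4 + S3 + S2 + S1 = 0"
  proof -
    have 1: "S1 = S3" unfolding S1_def S3_def
      by (subst sum4_bij(1)) (intro sum.cong refl, simp add: I_swap mult_ac)
    have 2: "S2 = S4" unfolding S2_def S4_def
      by (subst sum4_bij(3)) (intro sum.cong refl, simp add: I_swap2[symmetric] mult_ac)
    have 3: "cnj S3 = S4"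
    proof -
      have "cnj S3 = (\<Sum>k<N. \<Sum>l<N. \<Sum>m<N. \<Sum>j<N. I l k j m * cnj (Y k) * Y l * cnj (r m) * Y j)"
        unfolding S3_def by (simp add: I_cnj)
      also have "\<dots> = S4" unfolding S4_def
        by (subst sum4_bij(2)) (intro sum.cong refl, simp add: mult_ac)
      finally show ?thesis .
    qed
    have 4: "S4 = \<i> * of_real (C * (\<Sum>j<N. (cmod (force_field Y j))\<^sup>2))"
    proof -
      have "S4 = (\<Sum>j<N. cnj (r j) * force_field Y j)"
        unfolding S4_def by (subst sum4_bij(4)) (simp add: force_field_def sum_distrib_left mult_ac)
      also have "\<dots> = (\<Sum>j<N. \<i> * of_real C * of_real ((cmod (force_field Y j))\<^sup>2))"
        by (intro sum.cong refl) (simp add: r_def rhs_def Y_def complex_norm_square[symmetric] mult.assoc mult.commute[of "cnj _"] flip: of_real_power)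
      also have "\<dots> = \<i> * of_real (C * (\<Sum>j<N. (cmod (force_field Y j))\<^sup>2))"
        by (simp add: sum_distrib_left mult.assoc)
      finally show ?thesis .
    qed
    have "cnj S4 = - S4" unfolding 4 by simp
    moreover have "S3 = cnj S4" using 3 by (metis complex_cnj_cnj)
    ultimately show ?thesis unfolding 1 2 by simp
  qed
  ultimately show "((\<lambda>s. hamiltonian (y s)) has_vector_derivative 0) (at t)" by simp
qed

text \<open>The l^1 norm of the interaction tensor, used as Lipschitz and growth constant; the 1
  makes it positive for the zero tensor as well.\<close>

definition total :: real where
  "total = 1 + (\<Sum>k<N. \<Sum>l<N. \<Sum>m<N. \<Sum>j<N. cmod (of_real C * I k l m j))"

lemma total_pos: "total > 0" unfolding total_def by (intro add_pos_nonneg sum_nonneg) auto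

lemma total_bound:
  assumes "j < N"
  shows "(\<Sum>k<N. \<Sum>l<N. \<Sum>m<N. cmod (of_real C * I k l m j)) \<le> total"
proof -
  have "(\<Sum>k<N. \<Sum>l<N. \<Sum>m<N. cmod (of_real C * I k l m j)) \<le> (\<Sum>k<N. \<Sum>l<N. \<Sum>m<N. \<Sum>j<N. cmod (of_real C * I k l m j))"
    using assms by (intro sum_mono member_le_sum) auto
  then show ?thesis by (simp add: total_def)
qed

section \<open>Lipschitz bound and uniqueness of solutions\<close>

lemma component_le: "j < N \<Longrightarrow> energy y \<le> R\<^sup>2 \<Longrightarrow> R \<ge> 0 \<Longrightarrow> cmod (y j) \<le> R"
proof -
  assume *: "j < N" "energy y \<le> R\<^sup>2" "R \<ge> 0"
  have "(cmod (y j))\<^sup>2 \<le> energy y" unfolding energy_def using *(1) by (intro member_le_sum) auto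
  then have "(cmod (y j))\<^sup>2 \<le> R\<^sup>2" using *(2) by linarith
  then show ?thesis using *(3) by (rule power2_le_imp_le)
qed

lemma rhs_lipschitz:
  assumes "energy y \<le> R\<^sup>2" "energy z \<le> R\<^sup>2" "R \<ge> 0" "j < N"
  shows "cmod (rhs y j - rhs z j) \<le> 3 * total * R\<^sup>2 * (\<Sum>i<N. cmod (y i - z i))"
proof -
  define s where "s = (\<Sum>i<N. cmod (y i - z i))"
  have s: "cmod (y i - z i) \<le> s" if "i < N" for i unfolding s_def using that by (intro member_le_sum) auto
  have s0: "s \<ge> 0" unfolding s_def by (intro sum_nonneg) auto
  note cy = component_le[OF _ assms(1,3)] and cz = component_le[OF _ assms(2,3)]
  have trm: "cmod (y k * cnj (y l) * y m - z k * cnj (z l) * z m) \<le> 3 * R\<^sup>2 * s" if "k < N" "l < N" "m < N" for k l m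
  proof -
    have "y k * cnj (y l) * y m - z k * cnj (z l) * z m =
      (y k - z k) * cnj (y l) * y m + z k * cnj (y l - z l) * y m + z k * cnj (z l) * (y m - z m)"
      by (simp add: algebra_simps)
    then have "cmod (y k * cnj (y l) * y m - z k * cnj (z l) * z m) \<le>
      cmod ((y k - z k) * cnj (y l) * y m) + cmod (z k * cnj (y l - z l) * y m) + cmod (z k * cnj (z l) * (y m - z m))"
      using norm_triangle_ineq[of "(y k - z k) * cnj (y l) * y m + z k * cnj (y l - z l) * y m" "z k * cnj (z l) * (y m - z m)"]
        norm_triangle_ineq[of "(y k - z k) * cnj (y l) * y m" "z k * cnj (y l - z l) * y m"] by simp
    also have "\<dots> \<le> s * R * R + R * s * R + R * R * s"
      unfolding norm_mult complex_mod_cnj using s s0 cy cz that assms(3)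
      by (intro add_mono mult_mono mult_nonneg_nonneg norm_ge_zero; simp)
    also have "\<dots> = 3 * R\<^sup>2 * s" by (simp add: power2_eq_square)
    finally show ?thesis .
  qed
  have "rhs y j - rhs z j = (\<Sum>k<N. \<Sum>l<N. \<Sum>m<N. - \<i> * (of_real C * I k l m j) * (y k * cnj (y l) * y m - z k * cnj (z l) * z m))"
    by (simp add: rhs_def force_field_def sum_distrib_left sum_subtractf sum_negf right_diff_distrib mult_ac)
  also have "cmod \<dots> \<le> (\<Sum>k<N. \<Sum>l<N. \<Sum>m<N. cmod (of_real C * I k l m j) * (3 * R\<^sup>2 * s))"
    using trm by (intro order.trans[OF norm_sum] sum_mono) (auto simp: norm_mult intro!: mult_left_mono)
  also have "\<dots> = (\<Sum>k<N. \<Sum>l<N. \<Sum>m<N. cmod (of_real C * I k l m j)) * (3 * R\<^sup>2 * s)"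
    by (simp add: sum_distrib_right)
  also have "\<dots> \<le> total * (3 * R\<^sup>2 * s)"
    using total_bound[OF assms(4)] s0 by (intro mult_right_mono) auto
  finally show ?thesis by (simp add: s_def mult_ac)
qed

text \<open>Energy conservation keeps both solutions in a fixed ball, where the cubic field is
  Lipschitz. The squared distance d then satisfies |d'| \<le> Lc d, and Gronwall's argument is the
  monotonicity of exp(-Lc t) d for t \<ge> 0 and of exp(Lc t) d for t \<le> 0.\<close>

lemma solves_on_unique:
  assumes y: "solves_on t1 y" and z: "solves_on t1 z" and init: "\<And>j. j < N \<Longrightarrow> y 0 j = z 0 j" and j: "j < N"
  shows "y t1 j = z t1 j"
proof -
  define R where "R = sqrt (energy (y 0))"
  have R: "R \<ge> 0" "energy (y 0) = R\<^sup>2" "energy (z 0) = R\<^sup>2"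
    using init by (auto simp: R_def energy_def sum_nonneg)
  have sub: "solves_on t y" "solves_on t z" if "t \<in> closed_segment 0 t1" for t
  proof -
    have "closed_segment 0 t \<subseteq> closed_segment 0 t1" using that by (simp add: subset_closed_segment)
    then show "solves_on t y" "solves_on t z" using y z by (auto simp: solves_on_def)
  qed
  have E: "energy (y t) \<le> R\<^sup>2" "energy (z t) \<le> R\<^sup>2" if "t \<in> closed_segment 0 t1" for t
    using energy_conserved[OF sub(1)[OF that]] energy_conserved[OF sub(2)[OF that]] R by auto
  define w where "w t j = y t j - z t j" for t j
  define d where "d t = (\<Sum>j<N. (cmod (w t j))\<^sup>2)" for t
  define d' where "d' t = (\<Sum>j<N. 2 * Re (cnj (w t j) * (rhs (y t) j - rhs (z t) j)))" for t
  \<comment> \<open>6 is 2 from differentiating a square times 3 from the Lipschitz bound; N comes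
    from the Cauchy-Schwarz inequality between the sum of |w_i| and its l^2 counterpart.\<close>
  define Lc where "Lc = 6 * total * R\<^sup>2 * real N"
  have der: "(d has_real_derivative d' t) (at t)" if t: "t \<in> closed_segment 0 t1" for t
    unfolding d_def d'_def
  proof (rule DERIV_sum)
    fix j assume "j \<in> {..<N}"
    then have d: "((\<lambda>s. w s j) has_vector_derivative rhs (y t) j - rhs (z t) j) (at t)"
      using y z t unfolding w_def by (auto simp: solves_on_def intro!: has_vector_derivative_diff)
    show "((\<lambda>s. (cmod (w s j))\<^sup>2) has_real_derivative 2 * Re (cnj (w t j) * (rhs (y t) j - rhs (z t) j))) (at t)"
      using has_real_derivative_cmod_square[OF d] .
  qed
  have bd: "\<bar>d' t\<bar> \<le> Lc * d t" if t: "t \<in> closed_segment 0 t1" for t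
  proof -
    define s where "s = (\<Sum>i<N. cmod (w t i))"
    have "\<bar>d' t\<bar> \<le> (\<Sum>j<N. 2 * (cmod (w t j) * (3 * total * R\<^sup>2 * s)))"
      unfolding d'_def
    proof (rule order.trans[OF sum_abs], rule sum_mono)
      fix j assume j: "j \<in> {..<N}"
      have "\<bar>2 * Re (cnj (w t j) * (rhs (y t) j - rhs (z t) j))\<bar> \<le> 2 * cmod (cnj (w t j) * (rhs (y t) j - rhs (z t) j))"
        using abs_Re_le_cmod by (simp add: abs_mult del: times_complex.sel)
      also have "\<dots> \<le> 2 * (cmod (w t j) * (3 * total * R\<^sup>2 * s))"
        unfolding norm_mult complex_mod_cnj s_def w_def
        using rhs_lipschitz[OF E(1)[OF t] E(2)[OF t] R(1), of j] j by (intro mult_left_mono) auto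
      finally show "\<bar>2 * Re (cnj (w t j) * (rhs (y t) j - rhs (z t) j))\<bar> \<le> 2 * (cmod (w t j) * (3 * total * R\<^sup>2 * s))" .
    qed
    also have "\<dots> = 6 * total * R\<^sup>2 * s\<^sup>2"
      by (simp add: s_def sum_distrib_left[symmetric] sum_distrib_right[symmetric] power2_eq_square)
    also have "\<dots> \<le> 6 * total * R\<^sup>2 * (real N * d t)"
    proof (rule mult_left_mono)
      show "s\<^sup>2 \<le> real N * d t"
        using Cauchy_Schwarz_ineq_sum[of "\<lambda>_. 1" "\<lambda>i. cmod (w t i)" "{..<N}"] by (simp add: s_def d_def)
      show "0 \<le> 6 * total * R\<^sup>2" using total_pos by simp
    qed
    finally show ?thesis by (simp add: Lc_def mult_ac)
  qed
  have d0: "d 0 = 0" using init by (simp add: d_def w_def)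
  have dn: "d t \<ge> 0" for t by (simp add: d_def sum_nonneg)
  have "d t1 \<le> 0"
  proof (cases "t1 \<ge> 0")
    case True
    then have seg: "closed_segment 0 t1 = {0..t1}" by (simp add: closed_segment_eq_real_ivl)
    have "exp (- Lc * t1) * d t1 \<le> exp (- Lc * 0) * d 0"
    proof (rule DERIV_nonpos_imp_nonincreasing[OF True, where f = "\<lambda>t. exp (- Lc * t) * d t"])
      fix t assume "0 \<le> t" "t \<le> t1"
      then have t: "t \<in> closed_segment 0 t1" by (simp add: seg)
      have "((\<lambda>t. exp (- Lc * t) * d t) has_real_derivative exp (- Lc * t) * (d' t - Lc * d t)) (at t)"
        using der[OF t] by (auto intro!: derivative_eq_intros simp: algebra_simps)
      moreover have "exp (- Lc * t) * (d' t - Lc * d t) \<le> 0"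
        using bd[OF t] by (intro mult_nonneg_nonpos) auto
      ultimately show "\<exists>y. ((\<lambda>t. exp (- Lc * t) * d t) has_real_derivative y) (at t) \<and> y \<le> 0" by blast
    qed
    then show ?thesis using d0 by (simp add: mult_le_0_iff)
  next
    case False
    then have seg: "closed_segment 0 t1 = {t1..0}" by (simp add: closed_segment_eq_real_ivl)
    have "exp (Lc * t1) * d t1 \<le> exp (Lc * 0) * d 0"
    proof (rule DERIV_nonneg_imp_nondecreasing[where f = "\<lambda>t. exp (Lc * t) * d t"])
      fix t assume "t1 \<le> t" "t \<le> 0"
      then have t: "t \<in> closed_segment 0 t1" by (simp add: seg)
      have "((\<lambda>t. exp (Lc * t) * d t) has_real_derivative exp (Lc * t) * (d' t + Lc * d t)) (at t)"
        using der[OF t] by (auto intro!: derivative_eq_intros simp: algebra_simps)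
      moreover have "exp (Lc * t) * (d' t + Lc * d t) \<ge> 0"
        using bd[OF t] by (intro mult_nonneg_nonneg) auto
      ultimately show "\<exists>y. ((\<lambda>t. exp (Lc * t) * d t) has_real_derivative y) (at t) \<and> y \<ge> 0" by blast
    qed (use False in simp)
    then show ?thesis using d0 by (simp add: mult_le_0_iff)
  qed
  then have "d t1 = 0" using dn[of t1] by linarith
  then have "(cmod (w t1 j))\<^sup>2 = 0" using j unfolding d_def by (subst (asm) sum_nonneg_eq_0_iff) auto
  then show ?thesis by (simp add: w_def)
qed

end

subsection \<open>The local flow as a power series in time\<close>

lemma fps_conv_radius_geometric:
  fixes f :: "complex fps"
  assumes "\<And>n. cmod (fps_nth f n) \<le> R * \<kappa> ^ n" "\<kappa> > 0" "cmod z * \<kappa> < 1"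
  shows "ereal (cmod z) < fps_conv_radius f"
proof -
  \<comment> \<open>A radius strictly between |z| and 1 / \<kappa>, at which the geometric majorant
    still converges.\<close>
  define r where "r = (cmod z + 1 / \<kappa>) / 2"
  have z: "cmod z < 1 / \<kappa>" using assms(2,3) by (simp add: field_simps)
  have r: "cmod z < r" "r < 1 / \<kappa>" "r \<ge> 0" using z assms(2) by (auto simp: r_def intro!: add_nonneg_nonneg)
  have q: "r * \<kappa> < 1" "r * \<kappa> \<ge> 0" using r assms(2) by (auto simp: field_simps)
  have "summable (\<lambda>n. fps_nth f n * of_real r ^ n)"
  proof (rule summable_comparison_test')
    show "summable (\<lambda>n. R * (r * \<kappa>) ^ n)" using q by (intro summable_mult summable_geometric) auto
    show "cmod (fps_nth f n * of_real r ^ n) \<le> R * (r * \<kappa>) ^ n" if "n \<ge> 0" for n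
      using mult_right_mono[OF assms(1)[of n], of "r ^ n"] r(3) by (simp add: norm_mult norm_power power_mult_distrib mult_ac)
  qed
  then have "ereal (cmod (of_real r)) \<le> fps_conv_radius f" unfolding fps_conv_radius_def by (rule conv_radius_geI)
  moreover have "ereal (cmod z) < ereal (cmod (of_real r :: complex))" using r by simp
  ultimately show ?thesis by (rule less_le_trans[rotated])
qed

context cubic_system
begin

text \<open>The coefficients of the equation itself (\<open>False\<close>) and of the conjugated
  equation (\<open>True\<close>).\<close>

definition tensor :: "bool \<Rightarrow> nat \<Rightarrow> nat \<Rightarrow> nat \<Rightarrow> nat \<Rightarrow> complex" where
  "tensor s k l m j = (if s then cnj (- \<i> * of_real C * I k l m j) else - \<i> * of_real C * I k l m j)"

text \<open>The system is complexified by treating \<open>y\<^sub>j\<close> (index \<open>(j, False)\<close>) and its conjugate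
  (index \<open>(j, True)\<close>) as independent variables.\<close>

function coef :: "(nat \<times> bool \<Rightarrow> complex) \<Rightarrow> nat \<Rightarrow> nat \<times> bool \<Rightarrow> complex" where
  "coef x 0 i = x i"
| "coef x (Suc n) i = (\<Sum>k<N. \<Sum>l<N. \<Sum>m<N. tensor (snd i) k l m (fst i) *
     (\<Sum>a=0..n. (\<Sum>p=0..a. coef x p (k, snd i) * coef x (a - p) (l, \<not> snd i)) * coef x (n - a) (m, snd i))) / of_nat (Suc n)"
  by pat_completeness auto
termination by (relation "Wellfounded.measure (\<lambda>(x, n, i). n)") auto

definition series :: "(nat \<times> bool \<Rightarrow> complex) \<Rightarrow> nat \<times> bool \<Rightarrow> complex fps" where
  "series x i = Abs_fps (\<lambda>n. coef x n i)"

text \<open>The recursion for \<open>coef\<close> is the complexified differential equation read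
  coefficient by coefficient.\<close>

lemma series_deriv:
  "fps_deriv (series x i) = (\<Sum>k<N. \<Sum>l<N. \<Sum>m<N. fps_const (tensor (snd i) k l m (fst i)) *
     (series x (k, snd i) * series x (l, \<not> snd i) * series x (m, snd i)))"
proof (rule fps_ext)
  fix n
  have t: "fps_nth (fps_const c * (series x k * series x l * series x m)) n =
    c * (\<Sum>a=0..n. (\<Sum>p=0..a. coef x p k * coef x (a - p) l) * coef x (n - a) m)" for c k l m
    unfolding fps_mult_left_const_nth by (simp add: fps_mult_nth series_def)
  show "fps_nth (fps_deriv (series x i)) n = fps_nth (\<Sum>k<N. \<Sum>l<N. \<Sum>m<N. fps_const (tensor (snd i) k l m (fst i)) *
     (series x (k, snd i) * series x (l, \<not> snd i) * series x (m, snd i))) n"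
    unfolding fps_sum_nth t fps_deriv_nth by (simp add: series_def del: of_nat_Suc of_nat_add)
qed

definition in_cube :: "real \<Rightarrow> (nat \<times> bool \<Rightarrow> complex) \<Rightarrow> bool" where
  "in_cube R x \<longleftrightarrow> (\<forall>j<N. \<forall>s. cmod (x (j, s)) \<le> R)"

text \<open>The geometric growth rate of the Taylor coefficients in time. The 2 is due to the
  product rule for a product of two series.\<close>

definition rate :: "real \<Rightarrow> real" where "rate R = 2 * total * R\<^sup>2"

lemma rate_pos: "R > 0 \<Longrightarrow> rate R > 0" using total_pos by (simp add: rate_def)

lemma tensor_bound: "j < N \<Longrightarrow> (\<Sum>k<N. \<Sum>l<N. \<Sum>m<N. cmod (tensor s k l m j)) \<le> total"
proof -
  assume "j < N"
  have "cmod (tensor s k l m j) = cmod (of_real C * I k l m j)" for k l m by (simp add: tensor_def norm_mult)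
  then show ?thesis using total_bound[OF \<open>j < N\<close>] by simp
qed

text \<open>A bound for single series is not self-reproducing: a threefold Cauchy product has about
  n^2 / 2 terms, more than the division by n + 1 absorbs. Bounds for products of two series are
  therefore carried along. Three factors are grouped as a pair and one, the four factors in the
  derivative of a pair as two pairs, and each grouping costs a single factor n + 1.\<close>

lemma coef_bounds:
  assumes x: "in_cube R x" and R: "R > 0"
  shows "(\<forall>j<N. \<forall>s. cmod (fps_nth (series x (j, s)) n) \<le> R * rate R ^ n) \<and>
    (\<forall>j<N. \<forall>s. \<forall>k<N. \<forall>s'. cmod (fps_nth (series x (j, s) * series x (k, s')) n) \<le> R\<^sup>2 * rate R ^ n)"
proof (induction n rule: less_induct)
  case (less n)
  let ?\<kappa> = "rate R"
  have \<kappa>: "?\<kappa> > 0" using R by (rule rate_pos)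
  show ?case
  proof (cases n)
    case 0
    have "cmod (x (j, s) * x (k, s')) \<le> R * R" if "j < N" "k < N" for j s k s'
      using that x R unfolding norm_mult in_cube_def by (intro mult_mono) auto
    then show ?thesis using x 0 by (simp add: series_def in_cube_def power2_eq_square fps_mult_nth)
  next
    case (Suc m)
    have IH1: "cmod (fps_nth (series x (j, s)) i) \<le> R * ?\<kappa> ^ i" if "j < N" "i \<le> m" for j s i
      using less.IH[of i] that Suc by auto
    have IH2: "cmod (fps_nth (series x (j, s) * series x (k, s')) i) \<le> R\<^sup>2 * ?\<kappa> ^ i" if "j < N" "k < N" "i \<le> m" for j k s s' i
      using less.IH[of i] that Suc by auto
    have A: "cmod (fps_nth (fps_deriv (series x (j, s))) m) \<le> real (Suc m) * (total * R ^ 3 * ?\<kappa> ^ m)" if j: "j < N" for j s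
    proof -
      have "cmod (fps_nth (fps_deriv (series x (j, s))) m) \<le>
        (\<Sum>k<N. \<Sum>l<N. \<Sum>m'<N. cmod (tensor s k l m' j) * (real (Suc m) * (R\<^sup>2 * R * ?\<kappa> ^ m)))"
        unfolding series_deriv fps_sum_nth fst_conv snd_conv fps_mult_left_const_nth
      proof (intro order.trans[OF norm_sum] sum_mono)
        fix k l m' assume *: "k \<in> {..<N}" "l \<in> {..<N}" "m' \<in> {..<N}"
        have "cmod (fps_nth (series x (k, s) * series x (l, \<not> s) * series x (m', s)) m) \<le> real (Suc m) * (R\<^sup>2 * R * ?\<kappa> ^ m)"
          by (rule fps_mult_geometric_bound) (use * IH1 IH2 R \<kappa> in auto)
        then show "cmod (tensor s k l m' j * fps_nth (series x (k, s) * series x (l, \<not> s) * series x (m', s)) m) \<le>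
          cmod (tensor s k l m' j) * (real (Suc m) * (R\<^sup>2 * R * ?\<kappa> ^ m))"
          unfolding norm_mult by (rule mult_left_mono) simp
      qed
      also have "\<dots> = (\<Sum>k<N. \<Sum>l<N. \<Sum>m'<N. cmod (tensor s k l m' j)) * (real (Suc m) * (R\<^sup>2 * R * ?\<kappa> ^ m))"
        by (simp add: sum_distrib_right)
      also have "\<dots> \<le> total * (real (Suc m) * (R\<^sup>2 * R * ?\<kappa> ^ m))"
        using tensor_bound[OF j] R \<kappa> by (intro mult_right_mono) auto
      finally show ?thesis by (simp add: power2_eq_square power3_eq_cube mult_ac)
    qed
    have B: "cmod (fps_nth (fps_deriv (series x (j, s)) * series x (k, s')) m) \<le> real (Suc m) * (total * R ^ 4 * ?\<kappa> ^ m)"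
      if j: "j < N" "k < N" for j s k s'
    proof -
      have "fps_deriv (series x (j, s)) * series x (k, s') = (\<Sum>k'<N. \<Sum>l<N. \<Sum>m'<N. fps_const (tensor s k' l m' j) *
         ((series x (k', s) * series x (l, \<not> s)) * (series x (m', s) * series x (k, s'))))"
        unfolding series_deriv sum_distrib_right fst_conv snd_conv by (simp add: mult.assoc)
      then have "cmod (fps_nth (fps_deriv (series x (j, s)) * series x (k, s')) m) \<le>
        (\<Sum>k'<N. \<Sum>l<N. \<Sum>m'<N. cmod (tensor s k' l m' j) * (real (Suc m) * (R\<^sup>2 * R\<^sup>2 * ?\<kappa> ^ m)))"
        unfolding \<open>fps_deriv (series x (j, s)) * series x (k, s') = _\<close> fps_sum_nth fps_mult_left_const_nth
      proof (intro order.trans[OF norm_sum] sum_mono)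
        fix k' l m' assume *: "k' \<in> {..<N}" "l \<in> {..<N}" "m' \<in> {..<N}"
        have "cmod (fps_nth ((series x (k', s) * series x (l, \<not> s)) * (series x (m', s) * series x (k, s'))) m) \<le> real (Suc m) * (R\<^sup>2 * R\<^sup>2 * ?\<kappa> ^ m)"
          by (rule fps_mult_geometric_bound) (use * IH1 IH2 R \<kappa> j in auto)
        then show "cmod (tensor s k' l m' j * fps_nth ((series x (k', s) * series x (l, \<not> s)) * (series x (m', s) * series x (k, s'))) m) \<le>
          cmod (tensor s k' l m' j) * (real (Suc m) * (R\<^sup>2 * R\<^sup>2 * ?\<kappa> ^ m))"
          unfolding norm_mult by (rule mult_left_mono) simp
      qed
      also have "\<dots> = (\<Sum>k'<N. \<Sum>l<N. \<Sum>m'<N. cmod (tensor s k' l m' j)) * (real (Suc m) * (R\<^sup>2 * R\<^sup>2 * ?\<kappa> ^ m))"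
        by (simp add: sum_distrib_right)
      also have "\<dots> \<le> total * (real (Suc m) * (R\<^sup>2 * R\<^sup>2 * ?\<kappa> ^ m))"
        using tensor_bound[OF j(1)] R \<kappa> by (intro mult_right_mono) auto
      finally show ?thesis by (simp add: power2_eq_square power4_eq_xxxx mult_ac)
    qed
    have "cmod (fps_nth (series x (j, s)) n) \<le> R * ?\<kappa> ^ n" if j: "j < N" for j s
    proof -
      have "real (Suc m) * cmod (fps_nth (series x (j, s)) n) \<le> real (Suc m) * (total * R ^ 3 * ?\<kappa> ^ m)"
        using A[OF j, of s] unfolding fps_deriv_nth Suc by (simp add: norm_mult del: of_nat_Suc of_nat_add)
      then have "cmod (fps_nth (series x (j, s)) n) \<le> total * R ^ 3 * ?\<kappa> ^ m"
        by (rule mult_left_le_imp_le) simp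
      also have "\<dots> \<le> R * ?\<kappa> ^ n"
        using total_pos R \<kappa> unfolding Suc by (simp add: rate_def power2_eq_square power3_eq_cube mult_ac)
      finally show ?thesis .
    qed
    moreover have "cmod (fps_nth (series x (j, s) * series x (k, s')) n) \<le> R\<^sup>2 * ?\<kappa> ^ n" if j: "j < N" "k < N" for j s k s'
    proof -
      have "fps_deriv (series x (j, s) * series x (k, s')) = fps_deriv (series x (j, s)) * series x (k, s') + fps_deriv (series x (k, s')) * series x (j, s)"
        by (simp add: mult.commute)
      then have "cmod (fps_nth (fps_deriv (series x (j, s) * series x (k, s'))) m) \<le>
         real (Suc m) * (total * R ^ 4 * ?\<kappa> ^ m) + real (Suc m) * (total * R ^ 4 * ?\<kappa> ^ m)"
        unfolding fps_add_nth using B[OF j, of s s'] B[OF j(2,1), of s' s]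
          norm_triangle_ineq[of "fps_nth (fps_deriv (series x (j, s)) * series x (k, s')) m" "fps_nth (fps_deriv (series x (k, s')) * series x (j, s)) m"]
        by (simp only: \<open>fps_deriv (series x (j, s) * series x (k, s')) = _\<close> fps_add_nth)
      then have "real (Suc m) * cmod (fps_nth (series x (j, s) * series x (k, s')) n) \<le> real (Suc m) * (2 * total * R ^ 4 * ?\<kappa> ^ m)"
        unfolding fps_deriv_nth Suc by (simp add: norm_mult del: of_nat_Suc of_nat_add)
      then have "cmod (fps_nth (series x (j, s) * series x (k, s')) n) \<le> 2 * total * R ^ 4 * ?\<kappa> ^ m"
        by (rule mult_left_le_imp_le) simp
      also have "\<dots> = R\<^sup>2 * ?\<kappa> ^ n"
        unfolding Suc by (simp add: rate_def power2_eq_square power4_eq_xxxx mult_ac)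
      finally show ?thesis .
    qed
    ultimately show ?thesis by blast
  qed
qed

section \<open>The local flow for complex time and complex data\<close>

definition cflow :: "complex \<Rightarrow> (nat \<times> bool \<Rightarrow> complex) \<Rightarrow> nat \<times> bool \<Rightarrow> complex" where
  "cflow t x i = (\<Sum>n. coef x n i * t ^ n)"

lemma cflow_eval: "cflow t x i = eval_fps (series x i) t"
  by (simp add: cflow_def eval_fps_def series_def)

lemma series_conv:
  assumes "in_cube R x" "R > 0" "j < N" "cmod t * rate R < 1"
  shows "ereal (cmod t) < fps_conv_radius (series x (j, s))"
  using coef_bounds[OF assms(1,2)] assms(3)
  by (intro fps_conv_radius_geometric[OF _ rate_pos[OF assms(2)] assms(4), of _ R]) blast

lemma coef_bound: "in_cube R x \<Longrightarrow> R > 0 \<Longrightarrow> j < N \<Longrightarrow> cmod (coef x n (j, s)) \<le> R * rate R ^ n"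
  using coef_bounds[of R x n] by (simp add: series_def)

lemma cflow_deriv:
  assumes "in_cube R x" "R > 0" "j < N" "cmod t * rate R < 1"
  shows "((\<lambda>t. cflow t x (j, s)) has_field_derivative (\<Sum>k<N. \<Sum>l<N. \<Sum>m<N. tensor s k l m j *
      (cflow t x (k, s) * cflow t x (l, \<not> s) * cflow t x (m, s)))) (at t)"
proof -
  note conv = series_conv[OF assms(1,2) _ assms(4)]
  have "((\<lambda>t. eval_fps (series x (j, s)) t) has_field_derivative eval_fps (fps_deriv (series x (j, s))) t) (at t)"
    by (rule has_field_derivative_eval_fps) (use conv[OF assms(3)] in auto)
  moreover have ev3: "eval_fps (fps_const c * (series x (k, s) * series x (l, \<not> s) * series x (m, s))) t =
      c * (cflow t x (k, s) * cflow t x (l, \<not> s) * cflow t x (m, s)) \<and>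
      ereal (cmod t) < fps_conv_radius (fps_const c * (series x (k, s) * series x (l, \<not> s) * series x (m, s)))"
    if "k < N" "l < N" "m < N" for k l m c
  proof -
    have r2: "ereal (cmod t) < fps_conv_radius (series x (k, s) * series x (l, \<not> s))"
      using fps_conv_radius_mult[of "series x (k, s)" "series x (l, \<not> s)"] conv[OF that(1), of s] conv[OF that(2), of "\<not> s"]
      by (meson less_le_trans min_less_iff_conj)
    have r3: "ereal (cmod t) < fps_conv_radius (series x (k, s) * series x (l, \<not> s) * series x (m, s))"
      using fps_conv_radius_mult[of "series x (k, s) * series x (l, \<not> s)" "series x (m, s)"] r2 conv[OF that(3), of s]
      by (meson less_le_trans min_less_iff_conj)
    have rc: "ereal (cmod t) < fps_conv_radius (fps_const c :: complex fps)" by simp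
    have r4: "ereal (cmod t) < fps_conv_radius (fps_const c * (series x (k, s) * series x (l, \<not> s) * series x (m, s)))"
      using fps_conv_radius_mult[of "fps_const c" "series x (k, s) * series x (l, \<not> s) * series x (m, s)"] r3 rc
      by (meson less_le_trans min_less_iff_conj)
    show ?thesis using r4 unfolding cflow_eval
      by (simp add: eval_fps_mult[OF rc r3] eval_fps_mult[OF r2 conv[OF that(3)]] eval_fps_mult[OF conv[OF that(1)] conv[OF that(2)]])
  qed
  have sum: "eval_fps (\<Sum>i\<in>A. F i) t = (\<Sum>i\<in>A. eval_fps (F i) t) \<and> ereal (cmod t) < fps_conv_radius (\<Sum>i\<in>A. F i)"
    if "finite A" "\<And>i. i \<in> A \<Longrightarrow> ereal (cmod t) < fps_conv_radius (F i)" for A :: "nat set" and F :: "nat \<Rightarrow> complex fps"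
    using that
  proof (induction A rule: finite_induct)
    case (insert a A)
    have r: "ereal (cmod t) < fps_conv_radius (F a)" "ereal (cmod t) < fps_conv_radius (\<Sum>i\<in>A. F i)" using insert by auto
    have "ereal (cmod t) < fps_conv_radius (F a + (\<Sum>i\<in>A. F i))"
      using fps_conv_radius_add[of "F a" "\<Sum>i\<in>A. F i"] r by (meson less_le_trans min_less_iff_conj)
    then show ?case using insert r by (simp add: eval_fps_add)
  qed simp
  have "eval_fps (fps_deriv (series x (j, s))) t = (\<Sum>k<N. \<Sum>l<N. \<Sum>m<N. tensor s k l m j *
      (cflow t x (k, s) * cflow t x (l, \<not> s) * cflow t x (m, s)))"
  proof -
    define F where "F k l m = fps_const (tensor s k l m j) * (series x (k, s) * series x (l, \<not> s) * series x (m, s))" for k l m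
    have F: "eval_fps (F k l m) t = tensor s k l m j * (cflow t x (k, s) * cflow t x (l, \<not> s) * cflow t x (m, s))"
      "ereal (cmod t) < fps_conv_radius (F k l m)" if "k < N" "l < N" "m < N" for k l m
      using ev3[OF that] by (simp_all add: F_def)
    have s1: "eval_fps (\<Sum>m<N. F k l m) t = (\<Sum>m<N. eval_fps (F k l m) t)" "ereal (cmod t) < fps_conv_radius (\<Sum>m<N. F k l m)"
      if "k < N" "l < N" for k l using sum[of "{..<N}" "F k l"] F that by auto
    have s2: "eval_fps (\<Sum>l<N. \<Sum>m<N. F k l m) t = (\<Sum>l<N. eval_fps (\<Sum>m<N. F k l m) t)" "ereal (cmod t) < fps_conv_radius (\<Sum>l<N. \<Sum>m<N. F k l m)"
      if "k < N" for k using sum[of "{..<N}" "\<lambda>l. \<Sum>m<N. F k l m"] s1 that by auto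
    have "eval_fps (\<Sum>k<N. \<Sum>l<N. \<Sum>m<N. F k l m) t = (\<Sum>k<N. eval_fps (\<Sum>l<N. \<Sum>m<N. F k l m) t)"
      using sum[of "{..<N}" "\<lambda>k. \<Sum>l<N. \<Sum>m<N. F k l m"] s2 by auto
    also have "\<dots> = (\<Sum>k<N. \<Sum>l<N. \<Sum>m<N. tensor s k l m j * (cflow t x (k, s) * cflow t x (l, \<not> s) * cflow t x (m, s)))"
      by (intro sum.cong refl) (simp add: s1 s2 F)
    finally show ?thesis unfolding series_deriv fst_conv snd_conv F_def .
  qed
  ultimately show ?thesis unfolding cflow_eval by simp
qed

text \<open>On half the disc of convergence the coefficients are dominated by a geometric series of
  ratio 1/2, whose sum is 2.\<close>

lemma cflow_bound:
  assumes "in_cube R x" "R > 0" "j < N" "cmod t * rate R \<le> 1 / 2"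
  shows "cmod (cflow t x (j, s)) \<le> 2 * R" "summable (\<lambda>n. coef x n (j, s) * t ^ n)"
proof -
  have b: "cmod (coef x n (j, s) * t ^ n) \<le> R * (1 / 2) ^ n" for n
  proof -
    have "cmod (coef x n (j, s) * t ^ n) \<le> R * rate R ^ n * cmod t ^ n"
      unfolding norm_mult norm_power using coef_bound[OF assms(1-3)] by (intro mult_right_mono) auto
    also have "\<dots> = R * (cmod t * rate R) ^ n" by (simp add: power_mult_distrib)
    also have "\<dots> \<le> R * (1 / 2) ^ n"
      using assms rate_pos[OF assms(2)] by (intro mult_left_mono power_mono) auto
    finally show ?thesis .
  qed
  have sg: "summable (\<lambda>n. R * (1 / 2 :: real) ^ n)" by (intro summable_mult summable_geometric) auto
  show "summable (\<lambda>n. coef x n (j, s) * t ^ n)" using b by (intro summable_comparison_test'[OF sg]) auto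
  have "cmod (cflow t x (j, s)) \<le> (\<Sum>n. R * (1 / 2) ^ n)"
    unfolding cflow_def using b by (intro norm_suminf_le sg) auto
  also have "\<dots> = 2 * R" using suminf_mult[of "\<lambda>n. (1 / 2 :: real) ^ n" R] by (simp add: suminf_geometric summable_geometric)
  finally show "cmod (cflow t x (j, s)) \<le> 2 * R" .
qed

text \<open>Time and data vary together with the parameter. The coefficients are polynomials in the
  data, so the partial sums are holomorphic, and the geometric majorant of ratio 1/2 makes them
  converge uniformly.\<close>

lemma cflow_holomorphic:
  assumes S: "open S" "\<And>j s. j < N \<Longrightarrow> (\<lambda>\<zeta>. a \<zeta> (j, s)) holomorphic_on S" "\<And>\<zeta>. \<zeta> \<in> S \<Longrightarrow> in_cube R (a \<zeta>)"
    and t: "\<tau> holomorphic_on S" "\<And>\<zeta>. \<zeta> \<in> S \<Longrightarrow> cmod (\<tau> \<zeta>) * rate R \<le> 1 / 2" and R: "R > 0" and j: "j < N"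
  shows "(\<lambda>\<zeta>. cflow (\<tau> \<zeta>) (a \<zeta>) (j, s)) holomorphic_on S"
proof -
  have coef: "\<forall>j<N. \<forall>s. (\<lambda>\<zeta>. coef (a \<zeta>) n (j, s)) holomorphic_on S" for n
  proof (induction n rule: less_induct)
    case (less n)
    show ?case
    proof (cases n)
      case 0
      then show ?thesis using S(2) by simp
    next
      case (Suc m)
      have IH: "(\<lambda>\<zeta>. coef (a \<zeta>) p (j, s)) holomorphic_on S" if "p \<le> m" "j < N" for p j s
        using less.IH[of p] that Suc by auto
      show ?thesis unfolding Suc coef.simps fst_conv snd_conv
      proof (intro allI impI)
        fix j s assume "j < N"
        show "(\<lambda>\<zeta>. (\<Sum>k<N. \<Sum>l<N. \<Sum>m'<N. tensor s k l m' j * (\<Sum>b=0..m. (\<Sum>p=0..b. coef (a \<zeta>) p (k, s) * coef (a \<zeta>) (b - p) (l, \<not> s)) * coef (a \<zeta>) (m - b) (m', s))) / of_nat (Suc m)) holomorphic_on S"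
          by (intro holomorphic_on_divide holomorphic_on_sum holomorphic_on_mult holomorphic_on_const IH) (auto simp del: of_nat_Suc)
      qed
    qed
  qed
  define G where "G n \<zeta> = (\<Sum>i<n. coef (a \<zeta>) i (j, s) * \<tau> \<zeta> ^ i)" for n \<zeta>
  have lim: "uniform_limit S G (\<lambda>\<zeta>. cflow (\<tau> \<zeta>) (a \<zeta>) (j, s)) sequentially"
    unfolding G_def cflow_def
  proof (rule Weierstrass_m_test)
    show "summable (\<lambda>n. R * (1 / 2 :: real) ^ n)" by (intro summable_mult summable_geometric) auto
    fix n \<zeta> assume z: "\<zeta> \<in> S"
    have "cmod (coef (a \<zeta>) n (j, s) * \<tau> \<zeta> ^ n) \<le> R * rate R ^ n * cmod (\<tau> \<zeta>) ^ n"
      unfolding norm_mult norm_power using coef_bound[OF S(3)[OF z] R j] by (intro mult_right_mono) auto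
    also have "\<dots> = R * (cmod (\<tau> \<zeta>) * rate R) ^ n" by (simp add: power_mult_distrib)
    also have "\<dots> \<le> R * (1 / 2) ^ n"
      using t(2)[OF z] R rate_pos[OF R] by (intro mult_left_mono power_mono) auto
    finally show "cmod (coef (a \<zeta>) n (j, s) * \<tau> \<zeta> ^ n) \<le> R * (1 / 2) ^ n" .
  qed
  show ?thesis
  proof (rule holomorphic_uniform_sequence[OF S(1)])
    show "G n holomorphic_on S" for n unfolding G_def
      using coef j by (intro holomorphic_on_sum holomorphic_on_mult holomorphic_on_power t) auto
    fix z assume "z \<in> S"
    then obtain d where "d > 0" "cball z d \<subseteq> S" using S(1) open_contains_cball by blast
    then show "\<exists>d>0. cball z d \<subseteq> S \<and> uniform_limit (cball z d) G (\<lambda>\<zeta>. cflow (\<tau> \<zeta>) (a \<zeta>) (j, s)) sequentially"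
      using lim by (intro exI[of _ d]) (auto intro: uniform_limit_on_subset)
  qed
qed

text \<open>The real points of the doubled phase space, where the second copy of the variables is
  the conjugate of the first.\<close>

definition slice :: "(nat \<Rightarrow> complex) \<Rightarrow> nat \<times> bool \<Rightarrow> complex" where
  "slice y i = (if snd i then cnj (y (fst i)) else y (fst i))"

text \<open>Exchanging the two copies and conjugating maps the recursion to itself. Hence for real
  times the complexified flow keeps real points real.\<close>

lemma coef_cnj: "(\<And>j s. j < N \<Longrightarrow> x (j, \<not> s) = cnj (x (j, s))) \<Longrightarrow> \<forall>j<N. \<forall>s. coef x n (j, \<not> s) = cnj (coef x n (j, s))"
proof (induction n rule: less_induct)
  case (less n)
  show ?case
  proof (cases n)
    case 0 then show ?thesis using less.prems by simp
  next
    case (Suc m)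
    have IH: "coef x p (j, \<not> s) = cnj (coef x p (j, s))" if "p \<le> m" "j < N" for p j s
      using less.IH[of p] less.prems that Suc by auto
    have T: "tensor (\<not> s) k l m j = cnj (tensor s k l m j)" for s k l m j by (simp add: tensor_def)
    show ?thesis unfolding Suc coef.simps fst_conv snd_conv T
    proof (intro allI impI)
      fix j s assume "j < N"
      have "coef x p (k, \<not> s) * coef x (a - p) (l, \<not> \<not> s) = cnj (coef x p (k, s) * coef x (a - p) (l, \<not> s))"
        if "p \<in> {0..a}" "a \<in> {0..m}" "k < N" "l < N" for p a k l
      proof -
        have "p \<le> m" "a - p \<le> m" using that by auto
        then show ?thesis using IH[of p k s] IH[of "a - p" l "\<not> s"] that by simp
      qed
      then have "(\<Sum>p=0..a. coef x p (k, \<not> s) * coef x (a - p) (l, \<not> \<not> s)) * coef x (m - a) (m', \<not> s) =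
         cnj ((\<Sum>p=0..a. coef x p (k, s) * coef x (a - p) (l, \<not> s)) * coef x (m - a) (m', s))"
        if "a \<in> {0..m}" "k < N" "l < N" "m' < N" for a k l m'
        using that IH[of "m - a" m' s] by simp
      then show "(\<Sum>k<N. \<Sum>l<N. \<Sum>m'<N. cnj (tensor s k l m' j) * (\<Sum>a=0..m. (\<Sum>p=0..a. coef x p (k, \<not> s) * coef x (a - p) (l, \<not> \<not> s)) * coef x (m - a) (m', \<not> s))) / of_nat (Suc m) =
        cnj ((\<Sum>k<N. \<Sum>l<N. \<Sum>m'<N. tensor s k l m' j * (\<Sum>a=0..m. (\<Sum>p=0..a. coef x p (k, s) * coef x (a - p) (l, \<not> s)) * coef x (m - a) (m', s))) / of_nat (Suc m))"
        by (simp del: of_nat_Suc)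
    qed
  qed
qed

lemma coef_cong: "(\<And>j s. j < N \<Longrightarrow> x (j, s) = x' (j, s)) \<Longrightarrow> \<forall>j<N. \<forall>s. coef x n (j, s) = coef x' n (j, s)"
proof (induction n rule: less_induct)
  case (less n)
  show ?case
  proof (cases n)
    case 0 then show ?thesis using less.prems by simp
  next
    case (Suc m)
    have IH: "coef x p (j, s) = coef x' p (j, s)" if "p \<le> m" "j < N" for p j s
      using less.IH[of p] less.prems that Suc by auto
    have P: "(\<Sum>p=0..a. coef x p (k, s) * coef x (a - p) (l, \<not> s)) = (\<Sum>p=0..a. coef x' p (k, s) * coef x' (a - p) (l, \<not> s))"
      if "a \<in> {0..m}" "k < N" "l < N" for a k l s
      using that IH by (intro sum.cong refl) auto
    show ?thesis unfolding Suc coef.simps fst_conv snd_conv using P IH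
      by (intro allI impI arg_cong2[of _ _ _ _ "(/)"] sum.cong refl arg_cong2[of _ _ _ _ "(*)"]) auto
  qed
qed

lemma cflow_cong: "(\<And>j s. j < N \<Longrightarrow> x (j, s) = x' (j, s)) \<Longrightarrow> j < N \<Longrightarrow> cflow t x (j, s) = cflow t x' (j, s)"
  using coef_cong[of x x'] by (simp add: cflow_def)

lemma slice_cflow:
  assumes "j < N" "summable (\<lambda>n. coef (slice y) n (j, s) * (of_real t :: complex) ^ n)"
  shows "cflow (of_real t) (slice y) (j, \<not> s) = cnj (cflow (of_real t) (slice y) (j, s))"
proof -
  have c: "coef (slice y) n (j, \<not> s) = cnj (coef (slice y) n (j, s))" for n
    using coef_cnj[of "slice y" n] assms(1) by (simp add: slice_def)
  have "(\<lambda>n. coef (slice y) n (j, s) * of_real t ^ n) sums cflow (of_real t) (slice y) (j, s)"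
    unfolding cflow_def using assms(2) by (rule summable_sums)
  then have "(\<lambda>n. cnj (coef (slice y) n (j, s) * of_real t ^ n)) sums cnj (cflow (of_real t) (slice y) (j, s))"
    by (simp only: sums_cnj)
  then have "(\<lambda>n. coef (slice y) n (j, \<not> s) * of_real t ^ n) sums cnj (cflow (of_real t) (slice y) (j, s))"
    by (simp add: c)
  then show ?thesis unfolding cflow_def by (rule sums_unique[symmetric])
qed

end

subsection \<open>The global flow\<close>

context cubic_system
begin

text \<open>Components from N on are set to 0, so that the composition laws below are equalities of
  functions.\<close>

definition lflow :: "real \<Rightarrow> (nat \<Rightarrow> complex) \<Rightarrow> nat \<Rightarrow> complex" where
  "lflow t y j = (if j < N then cflow (of_real t) (slice y) (j, False) else 0)"

text \<open>Half of the guaranteed radius of convergence for data of size at most R.\<close>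

definition small :: "real \<Rightarrow> real \<Rightarrow> bool" where "small R t \<longleftrightarrow> \<bar>t\<bar> * rate R < 1 / 2"

lemma small_mono: "small R t \<Longrightarrow> \<bar>s\<bar> \<le> \<bar>t\<bar> \<Longrightarrow> R > 0 \<Longrightarrow> small R s"
  unfolding small_def using mult_right_mono[of "\<bar>s\<bar>" "\<bar>t\<bar>" "rate R"] rate_pos[of R] by linarith

lemma small_open: "R > 0 \<Longrightarrow> small R (f t) \<Longrightarrow> isCont f t \<Longrightarrow> eventually (\<lambda>s. small R (f s)) (nhds t)" for f :: "real \<Rightarrow> real"
proof -
  assume *: "R > 0" "small R (f t)" "isCont f t"
  have "(f \<longlongrightarrow> f t) (nhds t)" using *(3) by (simp add: isCont_def tendsto_at_iff_tendsto_nhds)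
  then have "((\<lambda>s. \<bar>f s\<bar> * rate R) \<longlongrightarrow> \<bar>f t\<bar> * rate R) (nhds t)" by (intro tendsto_intros)
  then show ?thesis unfolding small_def using *(2) by (intro order_tendstoD(2)) (auto simp: small_def)
qed

lemma slice_in_cube: "energy y \<le> R\<^sup>2 \<Longrightarrow> R > 0 \<Longrightarrow> in_cube R (slice y)"
  using component_le[of _ y R] by (simp add: in_cube_def slice_def)

lemma lflow_0: "j < N \<Longrightarrow> lflow 0 y j = y j"
  by (simp add: lflow_def cflow_def powser_zero slice_def)

lemma rhs_cong: "(\<And>i. i < N \<Longrightarrow> y i = z i) \<Longrightarrow> rhs y j = rhs z j"
  unfolding rhs_def force_field_def by (intro arg_cong2[of _ _ _ _ "(*)"] refl sum.cong) auto

lemma energy_cong: "(\<And>i. i < N \<Longrightarrow> y i = z i) \<Longrightarrow> energy y = energy z"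
  unfolding energy_def by (intro sum.cong) auto

lemma slice_lflow:
  assumes "energy y \<le> R\<^sup>2" "R > 0" "small R t" "j < N"
  shows "cflow (of_real t) (slice y) (j, s) = slice (lflow t y) (j, s)"
proof -
  have "cflow (of_real t) (slice y) (j, \<not> False) = cnj (cflow (of_real t) (slice y) (j, False))"
    by (rule slice_cflow[OF assms(4) cflow_bound(2)[OF slice_in_cube[OF assms(1,2)] assms(2,4)]])
       (use assms(3) in \<open>simp add: small_def\<close>)
  then show ?thesis using assms(4) by (cases s) (auto simp: slice_def lflow_def)
qed

lemma lflow_deriv:
  assumes "energy y \<le> R\<^sup>2" "R > 0" "small R t" "j < N"
  shows "((\<lambda>s. lflow s y j) has_vector_derivative rhs (lflow t y) j) (at t)"
proof -
  have "((\<lambda>t. cflow t (slice y) (j, False)) has_field_derivative (\<Sum>k<N. \<Sum>l<N. \<Sum>m<N. tensor False k l m j *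
      (cflow (of_real t) (slice y) (k, False) * cflow (of_real t) (slice y) (l, \<not> False) * cflow (of_real t) (slice y) (m, False)))) (at (of_real t))"
    by (rule cflow_deriv[OF slice_in_cube[OF assms(1,2)] assms(2,4)]) (use assms(3) in \<open>simp add: small_def\<close>)
  also have "(\<Sum>k<N. \<Sum>l<N. \<Sum>m<N. tensor False k l m j *
      (cflow (of_real t) (slice y) (k, False) * cflow (of_real t) (slice y) (l, \<not> False) * cflow (of_real t) (slice y) (m, False))) =
      rhs (lflow t y) j"
    unfolding rhs_def force_field_def sum_distrib_left
    by (intro sum.cong refl) (simp add: slice_lflow[OF assms(1-3)] slice_def tensor_def mult_ac)
  finally have "((\<lambda>s. cflow (of_real s) (slice y) (j, False)) has_vector_derivative rhs (lflow t y) j) (at t)"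
    by (rule has_vector_derivative_real_field)
  then show ?thesis using assms(4) by (simp add: lflow_def)
qed

lemma lflow_solves:
  assumes "energy y \<le> R\<^sup>2" "R > 0" "small R t"
  shows "solves_on t (\<lambda>s. lflow s y)"
  unfolding solves_on_def
proof (intro ballI allI impI)
  fix s j assume s: "s \<in> closed_segment 0 t" and j: "j < N"
  have "\<bar>s\<bar> \<le> \<bar>t\<bar>" using s by (auto simp: closed_segment_eq_real_ivl split: if_splits)
  then show "((\<lambda>s. lflow s y j) has_vector_derivative rhs (lflow s y) j) (at s)"
    using assms j small_mono by (intro lflow_deriv[of y R]) auto
qed

lemma energy_lflow:
  assumes "energy y \<le> R\<^sup>2" "R > 0" "small R t"
  shows "energy (lflow t y) = energy y"
  using energy_conserved[OF lflow_solves[OF assms]] energy_cong[of "lflow 0 y" y] by (simp add: lflow_0)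

text \<open>As functions of s, both sides solve the equation with the same value at s = 0;
  uniqueness does the rest.\<close>

lemma lflow_add:
  assumes E: "energy y \<le> R\<^sup>2" "R > 0" and sm: "small R s" "small R t" "small R (s + t)"
  shows "lflow s (lflow t y) = lflow (s + t) y"
proof
  fix j
  have E': "energy (lflow t y) \<le> R\<^sup>2" using energy_lflow[OF E sm(2)] E by simp
  show "lflow s (lflow t y) j = lflow (s + t) y j"
  proof (cases "j < N")
    case True
    have "solves_on s (\<lambda>r. lflow (r + t) y)"
      unfolding solves_on_def
    proof (intro ballI allI impI)
      fix r j assume r: "r \<in> closed_segment 0 s" and j: "j < N"
      \<comment> \<open>r + t lies between t and s + t, and both of these are small times.\<close>
      have "\<bar>r + t\<bar> \<le> \<bar>t\<bar> \<or> \<bar>r + t\<bar> \<le> \<bar>s + t\<bar>" using r by (auto simp: closed_segment_eq_real_ivl split: if_splits)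
      then have "small R (r + t)" using small_mono[OF sm(2) _ E(2)] small_mono[OF sm(3) _ E(2)] by blast
      from lflow_deriv[OF E this j]
      have "((\<lambda>s. lflow s y j) has_vector_derivative rhs (lflow (r + t) y) j) (at ((\<lambda>r. r + t) r))" by simp
      moreover have "((\<lambda>r. r + t) has_vector_derivative 1) (at r)" by (auto intro!: derivative_eq_intros)
      ultimately have "((\<lambda>s. lflow s y j) \<circ> (\<lambda>r. r + t) has_vector_derivative (1 *\<^sub>R rhs (lflow (r + t) y) j)) (at r)"
        by (intro vector_diff_chain_at)
      then show "((\<lambda>s. lflow (s + t) y j) has_vector_derivative rhs (lflow (r + t) y) j) (at r)" by (simp add: o_def)
    qed
    from solves_on_unique[OF lflow_solves[OF E' E(2) sm(1)] this _ True] show ?thesis by (simp add: lflow_0)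
  qed (simp add: lflow_def)
qed

section \<open>Iterated short steps\<close>

lemma energy_iter:
  assumes "energy y \<le> R\<^sup>2" "R > 0" "small R t"
  shows "energy ((lflow t ^^ k) y) = energy y"
  by (induction k) (use energy_lflow[OF _ assms(2,3)] assms(1) in auto)

lemma iter_commute:
  assumes "energy y \<le> R\<^sup>2" "R > 0" "small R a" "small R b" "small R (a + b)"
  shows "lflow b ((lflow a ^^ k) y) = (lflow a ^^ k) (lflow b y)"
proof (induction k)
  case (Suc k)
  have E: "energy ((lflow a ^^ k) y) \<le> R\<^sup>2" using energy_iter[OF assms(1-3)] assms(1) by simp
  have "lflow b (lflow a ((lflow a ^^ k) y)) = lflow a (lflow b ((lflow a ^^ k) y))"
    using lflow_add[OF E assms(2,4,3)] lflow_add[OF E assms(2-4)] assms(5) by (simp add: add.commute)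
  then show ?case using Suc by simp
qed simp

lemma iter_add:
  assumes "energy y \<le> R\<^sup>2" "R > 0" "small R a" "small R b" "small R (a + b)"
  shows "(lflow (a + b) ^^ k) y = (lflow a ^^ k) ((lflow b ^^ k) y)"
proof (induction k)
  case (Suc k)
  define w where "w = (lflow b ^^ k) y"
  have Ew: "energy w \<le> R\<^sup>2" using energy_iter[OF assms(1,2,4)] assms(1) by (simp add: w_def)
  have Ez: "energy ((lflow a ^^ k) w) \<le> R\<^sup>2" using energy_iter[OF Ew assms(2,3)] Ew by simp
  have "(lflow (a + b) ^^ Suc k) y = lflow (a + b) ((lflow a ^^ k) w)" using Suc by (simp add: w_def)
  also have "\<dots> = lflow a (lflow b ((lflow a ^^ k) w))" using lflow_add[OF Ez assms(2-5)] by simp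
  also have "\<dots> = lflow a ((lflow a ^^ k) (lflow b w))" using iter_commute[OF Ew assms(2-5)] by simp
  finally show ?case by (simp add: w_def)
qed simp

text \<open>Stated for at least one step: zero steps return y itself, while \<open>lflow\<close> at
  time 0 erases the components from N on.\<close>

lemma iter_Suc:
  assumes "energy y \<le> R\<^sup>2" "R > 0" "small R (real n * h)" "Suc k \<le> n"
  shows "(lflow h ^^ Suc k) y = lflow (real (Suc k) * h) y"
  using assms(4)
proof (induction k)
  case (Suc k)
  have sm: "small R (real m * h)" if "m \<le> n" for m
    by (rule small_mono[OF assms(3) _ assms(2)]) (use that in \<open>simp add: abs_mult mult_right_mono\<close>)
  have "(lflow h ^^ Suc (Suc k)) y = lflow h (lflow (real (Suc k) * h) y)" using Suc by simp
  also have "\<dots> = lflow (h + real (Suc k) * h) y"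
    using sm[of 1] sm[of "Suc k"] sm[of "Suc (Suc k)"] Suc.prems
    by (intro lflow_add[OF assms(1,2)]) (auto simp: algebra_simps)
  finally show ?case by (simp add: algebra_simps)
qed simp

definition iflow :: "nat \<Rightarrow> real \<Rightarrow> (nat \<Rightarrow> complex) \<Rightarrow> nat \<Rightarrow> complex" where
  "iflow n t y = (lflow (t / real n) ^^ n) y"

lemma iflow_small:
  assumes "energy y \<le> R\<^sup>2" "R > 0" "small R h" "n \<ge> 1"
  shows "iflow n h y = lflow h y"
proof -
  obtain k where k: "n = Suc k" using assms(4) by (cases n) auto
  show ?thesis using iter_Suc[OF assms(1,2), of n "h / real n" k] assms(3,4) by (simp add: iflow_def k del: funpow.simps)
qed

text \<open>For s near t, each of the n steps of length s/n is split into t/n and (s - t)/n. As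
  short steps commute, the latter gather into a single step of length s - t starting at the point
  reached at time t, where the derivative at 0 is known.\<close>

lemma iflow_deriv:
  assumes E: "energy y \<le> R\<^sup>2" "R > 0" and n: "n \<ge> 1" and sm: "small R (t / real n)" and j: "j < N"
  shows "((\<lambda>s. iflow n s y j) has_vector_derivative rhs (iflow n t y) j) (at t)"
proof -
  define z where "z = iflow n t y"
  have Ez: "energy z \<le> R\<^sup>2" using energy_iter[OF E sm] E by (simp add: z_def iflow_def)
  have s0: "small R 0" by (simp add: small_def)
  have "\<forall>\<^sub>F s in nhds t. small R (s / real n)"
    using n by (intro small_open[OF E(2), of "\<lambda>s. s / real n"] sm continuous_intros) auto
  moreover have "\<forall>\<^sub>F s in nhds t. small R ((s - t) / real n)"
    using n s0 by (intro small_open[OF E(2), of "\<lambda>s. (s - t) / real n"] continuous_intros) auto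
  moreover have "\<forall>\<^sub>F s in nhds t. small R (s - t)"
    using s0 by (intro small_open[OF E(2), of "\<lambda>s. s - t"] continuous_intros) auto
  ultimately have ev: "\<forall>\<^sub>F s in nhds t. lflow (s - t) z j = iflow n s y j"
  proof eventually_elim
    case (elim s)
    have eq: "(s - t) / real n + t / real n = s / real n" by (simp add: diff_divide_distrib)
    have "iflow n s y = (lflow ((s - t) / real n) ^^ n) z"
      unfolding iflow_def z_def using iter_add[OF E elim(2) sm, of n] elim(1) unfolding eq by simp
    also have "\<dots> = lflow (s - t) z" using iflow_small[OF Ez E(2) elim(3) n] by (simp add: iflow_def)
    finally show ?case by simp
  qed
  have "((\<lambda>s. lflow s z j) has_vector_derivative rhs (lflow 0 z) j) (at ((\<lambda>s. s - t) t))"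
    using lflow_deriv[OF Ez E(2) s0 j] by simp
  moreover have "((\<lambda>s. s - t) has_vector_derivative 1) (at t)" by (auto intro!: derivative_eq_intros)
  ultimately have "((\<lambda>s. lflow s z j) \<circ> (\<lambda>s. s - t) has_vector_derivative (1 *\<^sub>R rhs (lflow 0 z) j)) (at t)"
    by (intro vector_diff_chain_at)
  moreover have "rhs (lflow 0 z) j = rhs z j" by (rule rhs_cong) (simp add: lflow_0)
  ultimately have d: "((\<lambda>s. lflow (s - t) z j) has_vector_derivative rhs z j) (at t)" by (simp add: o_def)
  have x: "lflow (t - t) z j = iflow n t y j" using eventually_nhds_x_imp_x[OF ev] .
  show ?thesis unfolding z_def[symmetric]
    using d by (rule iffD1[OF has_vector_derivative_cong_ev, rotated -1]) (use ev x in \<open>auto elim: eventually_mono\<close>)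
qed

lemma small_div_mono:
  assumes "small R (t / real n)" "R > 0" "s \<in> closed_segment 0 t"
  shows "small R (s / real n)"
proof (rule small_mono[OF assms(1) _ assms(2)])
  have "\<bar>s\<bar> \<le> \<bar>t\<bar>" using assms(3) by (auto simp: closed_segment_eq_real_ivl split: if_splits)
  then show "\<bar>s / real n\<bar> \<le> \<bar>t / real n\<bar>" by (simp add: divide_right_mono)
qed

lemma iflow_solves:
  assumes "energy y \<le> R\<^sup>2" "R > 0" "n \<ge> 1" "small R (t / real n)"
  shows "solves_on t (\<lambda>s. iflow n s y)"
  unfolding solves_on_def using iflow_deriv[OF assms(1-3)] small_div_mono[OF assms(4,2)] by simp

lemma iflow_0:
  assumes "n \<ge> 1" "j < N"
  shows "iflow n 0 y j = y j"
proof -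
  have "energy y \<le> (sqrt (energy y) + 1)\<^sup>2"
    by (simp add: power2_sum energy_def sum_nonneg)
  then have "iflow n 0 y = lflow 0 y"
    using assms by (intro iflow_small[of y "sqrt (energy y) + 1"]) (auto simp: small_def energy_def sum_nonneg add_nonneg_pos)
  then show ?thesis using assms by (simp add: lflow_0)
qed

lemma iflow_outside: "n \<ge> 1 \<Longrightarrow> \<not> j < N \<Longrightarrow> iflow n t y j = 0"
  by (cases n) (auto simp: iflow_def lflow_def)

lemma iflow_unique:
  assumes "energy y \<le> R\<^sup>2" "R > 0" "n \<ge> 1" "small R (t / real n)"
    and "energy y \<le> R'\<^sup>2" "R' > 0" "m \<ge> 1" "small R' (t / real m)"
  shows "iflow n t y = iflow m t y"
proof
  fix j show "iflow n t y j = iflow m t y j"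
  proof (cases "j < N")
    case True
    show ?thesis
      by (rule solves_on_unique[OF iflow_solves[OF assms(1-4)] iflow_solves[OF assms(5-8)] _ True])
         (use assms in \<open>simp add: iflow_0\<close>)
  qed (use assms in \<open>simp add: iflow_outside\<close>)
qed

lemma ex_small: "\<exists>n\<ge>1. small R (t / real n)"
proof -
  obtain n where n: "2 * (\<bar>t\<bar> * \<bar>rate R\<bar>) < real n" using reals_Archimedean2 by auto
  have "real n > 0" using n by (smt (verit) abs_ge_zero mult_nonneg_nonneg)
  have "\<bar>t / real n\<bar> * rate R \<le> \<bar>t\<bar> * \<bar>rate R\<bar> / real n"
    using \<open>real n > 0\<close> by (simp add: divide_right_mono mult_left_mono)
  also have "\<dots> < 1 / 2" using n \<open>real n > 0\<close> by (simp add: field_simps)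
  finally show ?thesis using \<open>real n > 0\<close> by (intro exI[of _ n]) (simp add: small_def)
qed

text \<open>The radius \<open>sqrt (energy y) + 1\<close> stays positive for the zero datum. The
  choice of the number of steps does not matter, by \<open>iflow_unique\<close>.\<close>

definition flow :: "real \<Rightarrow> (nat \<Rightarrow> complex) \<Rightarrow> nat \<Rightarrow> complex" where
  "flow t y = iflow (SOME n. n \<ge> 1 \<and> small (sqrt (energy y) + 1) (t / real n)) t y"

lemma energy_radius: "energy y \<le> (sqrt (energy y) + 1)\<^sup>2" "sqrt (energy y) + 1 > 0"
proof -
  have "energy y \<ge> 0" by (simp add: energy_def sum_nonneg)
  then show "energy y \<le> (sqrt (energy y) + 1)\<^sup>2" "sqrt (energy y) + 1 > 0"
    by (simp_all add: power2_sum add_nonneg_pos)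
qed

text \<open>Any admissible radius and number of steps compute the same flow, so in a neighbourhood
  of given time and data one fixed n can be used throughout.\<close>

lemma flow_eq:
  assumes "energy y \<le> R\<^sup>2" "R > 0" "n \<ge> 1" "small R (t / real n)"
  shows "flow t y = iflow n t y"
proof -
  let ?m = "SOME n. n \<ge> 1 \<and> small (sqrt (energy y) + 1) (t / real n)"
  have "?m \<ge> 1 \<and> small (sqrt (energy y) + 1) (t / real ?m)" by (rule someI_ex) (rule ex_small)
  then show ?thesis unfolding flow_def by (intro iflow_unique[OF energy_radius _ _ assms]) auto
qed

lemma flow_0: "j < N \<Longrightarrow> flow 0 y j = y j"
  using flow_eq[of y "sqrt (energy y) + 1" 1 0] energy_radius[of y] iflow_0[of 1 j y] by (simp add: small_def)

lemma flow_deriv: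
  assumes "j < N"
  shows "((\<lambda>s. flow s y j) has_vector_derivative rhs (flow t y) j) (at t)"
proof -
  obtain n where n: "n \<ge> 1" "small (sqrt (energy y) + 1) (t / real n)" using ex_small by blast
  have "\<forall>\<^sub>F s in nhds t. small (sqrt (energy y) + 1) (s / real n)"
    using n by (intro small_open[of "sqrt (energy y) + 1" "\<lambda>s. s / real n" t] energy_radius continuous_intros) auto
  then have ev: "\<forall>\<^sub>F s in nhds t. iflow n s y j = flow s y j"
    by (rule eventually_mono) (simp add: flow_eq[OF energy_radius n(1)])
  have x: "flow t y = iflow n t y" using flow_eq[OF energy_radius n] .
  have d: "((\<lambda>s. iflow n s y j) has_vector_derivative rhs (iflow n t y) j) (at t)"
    by (rule iflow_deriv[OF energy_radius n assms])
  show ?thesis unfolding x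
    using d by (rule iffD1[OF has_vector_derivative_cong_ev, rotated -1]) (use ev x in \<open>auto elim: eventually_mono\<close>)
qed

lemma flow_solves: "solves_on t (\<lambda>s. flow s y)"
  by (simp add: solves_on_def flow_deriv)

subsection \<open>Analytic dependence on time and data\<close>

text \<open>\<open>None\<close> is the time variable. Treating it as one more coordinate gives
  smoothness jointly in time and data.\<close>

definition index_set :: "(nat \<times> bool) option set" where
  "index_set = insert None (Some ` ({..<N} \<times> UNIV))"

definition embed :: "real \<Rightarrow> (nat \<Rightarrow> complex) \<Rightarrow> (nat \<times> bool) option \<Rightarrow> complex" where
  "embed t y i = (case i of None \<Rightarrow> of_real t | Some i \<Rightarrow> slice y i)"

definition citer :: "nat \<Rightarrow> nat \<Rightarrow> ((nat \<times> bool) option \<Rightarrow> complex) \<Rightarrow> nat \<times> bool \<Rightarrow> complex" where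
  "citer n k y = (cflow (y None / of_nat n) ^^ k) (\<lambda>i. y (Some i))"

lemma finite_index_set: "finite index_set" by (simp add: index_set_def)

lemma coord_le_dist:
  assumes "i \<in> index_set" shows "cmod (x i - y i) \<le> coord_dist index_set x y"
  unfolding coord_dist_def using assms by (intro member_le_sum) (auto simp: finite_index_set)

lemma citer_embed:
  assumes "energy z \<le> R\<^sup>2" "R > 0" "small R (t / real n)" "j < N"
  shows "citer n k (embed t z) (j, s) = slice ((lflow (t / real n) ^^ k) z) (j, s)"
  using assms(4)
proof (induction k arbitrary: j s)
  case 0 then show ?case by (simp add: citer_def embed_def)
next
  case (Suc k)
  have tn: "embed t z None / of_nat n = of_real (t / real n)" by (simp add: embed_def)
  have E: "energy ((lflow (t / real n) ^^ k) z) \<le> R\<^sup>2" using energy_iter[OF assms(1-3)] assms(1) by simp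
  have "citer n (Suc k) (embed t z) (j, s) = cflow (of_real (t / real n)) (citer n k (embed t z)) (j, s)"
    unfolding citer_def funpow.simps o_def tn ..
  also have "\<dots> = cflow (of_real (t / real n)) (slice ((lflow (t / real n) ^^ k) z)) (j, s)"
    using Suc by (intro cflow_cong) auto
  also have "\<dots> = slice (lflow (t / real n) ((lflow (t / real n) ^^ k) z)) (j, s)"
    by (rule slice_lflow[OF E assms(2,3) Suc.prems])
  finally show ?case by simp
qed

text \<open>Boundedness gives continuity at the centre: a point close to x lies on a line along
  which f is bounded on a large parameter disc, and Cauchy's estimates make the change at parameter
  1 small.\<close>

lemma analytic_bounded_continuous:
  assumes f: "analytic_bounded K x r M f" and e: "\<epsilon> > 0"
  shows "\<exists>\<rho>>0. \<rho> \<le> r \<and> (\<forall>y\<in>coord_ball K x \<rho>. cmod (f y - f x) < \<epsilon>)"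
proof -
  have r: "r > 0" and M: "M \<ge> 0" using f by (auto simp: analytic_bounded_def)
  \<comment> \<open>R is the radius of the parameter disc. The quadratic remainder contributes at
    most 18 M / R and the first derivative 2 M / R, whence 20; the remainder estimate at parameter 1
    needs R \<ge> 2.\<close>
  define R where "R = max 2 (20 * M / \<epsilon> + 1)"
  have R: "R \<ge> 2" "20 * M / \<epsilon> < R" by (auto simp: R_def)
  have "cmod (f y - f x) < \<epsilon>" if y: "y \<in> coord_ball K x (r / (2 * R))" for y
  proof -
    define h where "h i = y i - x i" for i
    have d: "coord_dist K 0 h < r / (2 * R)"
      using y by (simp add: coord_ball_def coord_dist_def h_def norm_minus_commute)
    have l: "line x h 1 = y" "line x h 0 = x" by (auto simp: line_def h_def)
    have rd: "R * coord_dist K 0 h \<le> r" using d R(1) r by (simp add: field_simps)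
    note hol = analytic_bounded_line[OF f, of x R h, unfolded coord_dist_self, simplified, OF rd]
    have R0: "R > 0" using R by simp
    have 1: "cmod (f (line x h 1) - f (line x h 0) - 1 * deriv (\<lambda>\<zeta>. f (line x h \<zeta>)) 0) \<le> 18 * M * (cmod 1)\<^sup>2 / R\<^sup>2"
      by (rule holomorphic_remainder_bound[of "\<lambda>\<zeta>. f (line x h \<zeta>)"]) (use hol R r in auto)
    have 2: "cmod (deriv (\<lambda>\<zeta>. f (line x h \<zeta>)) 0) \<le> 2 * M / R"
      by (rule holomorphic_deriv_bound) (use hol R r in auto)
    have "18 * M / R\<^sup>2 \<le> 18 * M / R" using R M by (intro divide_left_mono) (auto simp: power2_eq_square)
    then have "cmod (f y - f x) \<le> 18 * M / R + 2 * M / R"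
      using 1 2 norm_triangle_ineq[of "f y - f x - deriv (\<lambda>\<zeta>. f (line x h \<zeta>)) 0" "deriv (\<lambda>\<zeta>. f (line x h \<zeta>)) 0"]
      unfolding l by simp
    also have "\<dots> = 20 * M / R" by (simp add: field_simps)
    also have "\<dots> < \<epsilon>" using R e by (simp add: field_simps)
    finally show ?thesis .
  qed
  moreover have "r / (2 * R) > 0" "r / (2 * R) \<le> r" using r R by (auto simp: field_simps)
  ultimately show ?thesis by blast
qed

text \<open>One complex step may double the bound on the data, and there is no conserved energy off
  the real points, so naive iteration would shrink the time step. But at the real centre every
  iterate has components bounded by the square root of the energy, which is below R; by continuity
  the bound R returns on a smaller ball. Thus the radius of the ball is adjusted with k, while R and
  the time step stay fixed.\<close>

lemma citer_analytic:
  assumes y0: "sqrt (energy y0) < R" and R: "R > 0" and n: "n \<ge> 1" and t: "(\<bar>t0\<bar> + 1) / real n * rate R < 1 / 2"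
  shows "\<exists>r>0. r \<le> 1 \<and> (\<forall>j<N. \<forall>s. curve_holomorphic index_set (coord_ball index_set (embed t0 y0) r) (\<lambda>y. citer n k y (j, s)) \<and>
     (\<forall>y\<in>coord_ball index_set (embed t0 y0) r. cmod (citer n k y (j, s)) \<le> R))"
proof (induction k)
  case 0
  have comp: "cmod (y0 j) \<le> sqrt (energy y0)" if "j < N" for j
    using that by (intro component_le) (auto simp: energy_def sum_nonneg)
  \<comment> \<open>The margin between the datum and R; the bound 1 keeps the complex time below
    |t0| + 1 in modulus.\<close>
  define r where "r = min 1 (R - sqrt (energy y0))"
  have "r > 0" "r \<le> 1" using y0 by (auto simp: r_def)
  moreover have "curve_holomorphic index_set U (\<lambda>y. citer n 0 y (j, s))" if "j < N" for j s U
    using that by (auto simp: curve_holomorphic_def citer_def index_set_def)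
  moreover have "cmod (citer n 0 y (j, s)) \<le> R" if "j < N" "y \<in> coord_ball index_set (embed t0 y0) r" for j s y
  proof -
    have "cmod (embed t0 y0 (Some (j, s)) - y (Some (j, s))) < r"
      using coord_le_dist[of "Some (j, s)" "embed t0 y0" y] that by (auto simp: coord_ball_def index_set_def)
    moreover have "cmod (embed t0 y0 (Some (j, s))) \<le> sqrt (energy y0)" using comp[OF that(1)] by (simp add: embed_def slice_def)
    ultimately have "cmod (y (Some (j, s))) < r + sqrt (energy y0)"
      using norm_triangle_ineq2[of "y (Some (j, s))" "embed t0 y0 (Some (j, s))"] by (simp add: norm_minus_commute)
    then show ?thesis by (simp add: citer_def r_def)
  qed
  ultimately show ?case by blast
next
  case (Suc k)
  let ?K = index_set and ?c = "embed t0 y0"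
  obtain r where r: "r > 0" "r \<le> 1" and hol: "\<And>j s. j < N \<Longrightarrow> curve_holomorphic ?K (coord_ball ?K ?c r) (\<lambda>y. citer n k y (j, s))"
    and bd: "\<And>j s y. j < N \<Longrightarrow> y \<in> coord_ball ?K ?c r \<Longrightarrow> cmod (citer n k y (j, s)) \<le> R" using Suc by auto
  have cube: "in_cube R (citer n k y)" if "y \<in> coord_ball ?K ?c r" for y using bd that by (simp add: in_cube_def)
  have time: "cmod (y None / of_nat n) * rate R \<le> 1 / 2" if "y \<in> coord_ball ?K ?c r" for y
  proof -
    have "cmod (?c None - y None) < r"
      using coord_le_dist[of None ?c y] that by (auto simp: coord_ball_def index_set_def)
    then have "cmod (y None) \<le> \<bar>t0\<bar> + 1"
      using norm_triangle_ineq2[of "y None" "?c None"] r(2) by (simp add: norm_minus_commute embed_def)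
    then have "cmod (y None) / real n * rate R \<le> (\<bar>t0\<bar> + 1) / real n * rate R"
      using rate_pos[OF R] by (intro mult_right_mono divide_right_mono) auto
    then show ?thesis using t unfolding norm_divide norm_of_nat by linarith
  qed
  have step: "citer n (Suc k) y = cflow (y None / of_nat n) (citer n k y)" for y by (simp add: citer_def)
  have ch: "curve_holomorphic ?K (coord_ball ?K ?c r) (\<lambda>y. citer n (Suc k) y (j, s))" if j: "j < N" for j s
    unfolding curve_holomorphic_def step
  proof (intro allI impI)
    fix S c assume S: "open S" "\<forall>i\<in>?K. (\<lambda>\<zeta>. c \<zeta> i) holomorphic_on S" "\<forall>\<zeta>\<in>S. c \<zeta> \<in> coord_ball ?K ?c r"
    show "(\<lambda>\<zeta>. cflow (c \<zeta> None / of_nat n) (citer n k (c \<zeta>)) (j, s)) holomorphic_on S"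
    proof (rule cflow_holomorphic[OF S(1) _ _ _ _ R j])
      show "(\<lambda>\<zeta>. citer n k (c \<zeta>) (j, s)) holomorphic_on S" if "j < N" for j s
        by (rule curve_holomorphicD[OF hol[OF that] S(1)]) (use S in auto)
      show "(\<lambda>\<zeta>. c \<zeta> None / of_nat n) holomorphic_on S"
        using S(2) n by (intro holomorphic_intros) (auto simp: index_set_def)
    qed (use S cube time in auto)
  qed
  have bd2: "cmod (citer n (Suc k) y (j, s)) \<le> 2 * R" if "j < N" "y \<in> coord_ball ?K ?c r" for j s y
    unfolding step using cflow_bound(1)[OF cube[OF that(2)] R that(1) time[OF that(2)]] .
  have ab: "analytic_bounded ?K ?c r (2 * R) (\<lambda>y. citer n (Suc k) y (j, s))" if "j < N" for j s
    unfolding analytic_bounded_def using r R ch[OF that] bd2[OF that] by auto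
  have E: "energy y0 \<le> R\<^sup>2"
    using y0 by (metis energy_def less_imp_le real_sqrt_le_iff real_sqrt_unique sqrt_le_D)
  have sm: "small R (t0 / real n)"
  proof -
    have "\<bar>t0\<bar> / real n * rate R \<le> (\<bar>t0\<bar> + 1) / real n * rate R"
      using rate_pos[OF R] by (intro mult_right_mono divide_right_mono) auto
    then show ?thesis using t unfolding small_def abs_divide abs_of_nat by linarith
  qed
  \<comment> \<open>At the centre the complex iterate is a real one, for which energy is
    conserved.\<close>
  have center: "cmod (citer n (Suc k) ?c (j, s)) \<le> sqrt (energy y0)" if "j < N" for j s
  proof -
    have "cmod (citer n (Suc k) ?c (j, s)) = cmod ((lflow (t0 / real n) ^^ Suc k) y0 j)"
      unfolding citer_embed[OF E R sm that] by (simp add: slice_def)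
    also have "\<dots> \<le> sqrt (energy y0)"
      using energy_iter[OF E R sm, of "Suc k"] by (intro component_le[OF that]) (auto simp: energy_def sum_nonneg)
    finally show ?thesis .
  qed
  define \<epsilon> where "\<epsilon> = R - sqrt (energy y0)"
  have e: "\<epsilon> > 0" using y0 by (simp add: \<epsilon>_def)
  have "\<forall>i\<in>{..<N} \<times> (UNIV :: bool set). \<exists>\<rho>. \<rho> > 0 \<and> \<rho> \<le> r \<and> (\<forall>y\<in>coord_ball ?K ?c \<rho>. cmod (citer n (Suc k) y i - citer n (Suc k) ?c i) < \<epsilon>)"
  proof
    fix i :: "nat \<times> bool" assume "i \<in> {..<N} \<times> UNIV"
    then obtain j s where i: "i = (j, s)" "j < N" by auto
    show "\<exists>\<rho>. \<rho> > 0 \<and> \<rho> \<le> r \<and> (\<forall>y\<in>coord_ball ?K ?c \<rho>. cmod (citer n (Suc k) y i - citer n (Suc k) ?c i) < \<epsilon>)"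
      using analytic_bounded_continuous[OF ab[OF i(2), of s] e] unfolding i(1) .
  qed
  from bchoice[OF this] obtain \<rho> where \<rho>: "\<forall>i\<in>{..<N} \<times> UNIV. \<rho> i > 0 \<and> \<rho> i \<le> r \<and> (\<forall>y\<in>coord_ball ?K ?c (\<rho> i). cmod (citer n (Suc k) y i - citer n (Suc k) ?c i) < \<epsilon>)" ..
  define r' where "r' = Min (insert r (\<rho> ` ({..<N} \<times> UNIV)))"
  have fin: "finite (insert r (\<rho> ` ({..<N} \<times> UNIV)))" by simp
  have r'0: "r' > 0" unfolding r'_def using \<rho> r(1) fin by (subst Min_gr_iff) auto
  have r'r: "r' \<le> r" unfolding r'_def by (rule Min_le[OF fin]) simp
  have r'\<rho>: "r' \<le> \<rho> (j, s)" if "j < N" for j s unfolding r'_def by (rule Min_le[OF fin]) (use that in auto)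
  have "curve_holomorphic ?K (coord_ball ?K ?c r') (\<lambda>y. citer n (Suc k) y (j, s))" if "j < N" for j s
    by (rule curve_holomorphic_subset[OF ch[OF that]]) (use r'r in \<open>auto simp: coord_ball_def\<close>)
  moreover have "cmod (citer n (Suc k) y (j, s)) \<le> R" if "j < N" "y \<in> coord_ball ?K ?c r'" for j s y
  proof -
    have "y \<in> coord_ball ?K ?c (\<rho> (j, s))" using that r'\<rho>[OF that(1), of s] by (auto simp: coord_ball_def)
    then have "cmod (citer n (Suc k) y (j, s) - citer n (Suc k) ?c (j, s)) < \<epsilon>" using \<rho> that(1) by auto
    then show ?thesis using center[OF that(1), of s] norm_triangle_ineq2[of "citer n (Suc k) y (j, s)" "citer n (Suc k) ?c (j, s)"]
      unfolding \<epsilon>_def by linarith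
  qed
  ultimately show ?case using r'0 r'r r(2) by (intro exI[of _ r']) auto
qed

lemma energy_le_sum: "energy y \<le> (\<Sum>j<N. cmod (y j))\<^sup>2" "sqrt (energy y) \<le> (\<Sum>j<N. cmod (y j))"
proof -
  have "L2_set (\<lambda>j. cmod (y j)) {..<N} \<le> (\<Sum>j<N. cmod (y j))" by (rule L2_set_le_sum) auto
  then show s: "sqrt (energy y) \<le> (\<Sum>j<N. cmod (y j))" by (simp add: L2_set_def energy_def)
  then show "energy y \<le> (\<Sum>j<N. cmod (y j))\<^sup>2" by (rule sqrt_le_D)
qed

lemma flow_analytic:
  "\<exists>r M. \<exists>f. \<forall>j<N. analytic_bounded index_set (embed t0 y0) r M (f j) \<and>
     (\<forall>t z. coord_dist index_set (embed t0 y0) (embed t z) < r \<longrightarrow> flow t z j = f j (embed t z))"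
proof -
  \<comment> \<open>This R also bounds every real datum within l^1 distance 1 of y0, so one number
    of steps serves the whole ball.\<close>
  define R where "R = (\<Sum>j<N. cmod (y0 j)) + 1"
  have R: "R > 0" "sqrt (energy y0) < R"
    using energy_le_sum(2)[of y0] by (auto simp: R_def add_nonneg_pos sum_nonneg)
  obtain n where n: "n \<ge> 1" "small R ((\<bar>t0\<bar> + 1) / real n)" using ex_small by blast
  then have t: "(\<bar>t0\<bar> + 1) / real n * rate R < 1 / 2" by (simp add: small_def)
  obtain r where r: "r > 0" "r \<le> 1" and hol: "\<And>j s. j < N \<Longrightarrow> curve_holomorphic index_set (coord_ball index_set (embed t0 y0) r) (\<lambda>y. citer n n y (j, s))"
    and bd: "\<And>j s y. j < N \<Longrightarrow> y \<in> coord_ball index_set (embed t0 y0) r \<Longrightarrow> cmod (citer n n y (j, s)) \<le> R"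
    using citer_analytic[OF R(2,1) n(1) t, of n] by auto
  have "flow t z j = citer n n (embed t z) (j, False)" if d: "coord_dist index_set (embed t0 y0) (embed t z) < r" and j: "j < N" for t z j
  proof -
    have "(\<Sum>j<N. cmod (y0 j - z j)) \<le> coord_dist index_set (embed t0 y0) (embed t z)"
    proof -
      have "(\<Sum>j<N. cmod (y0 j - z j)) = (\<Sum>i\<in>(\<lambda>j. Some (j, False)) ` {..<N}. cmod (embed t0 y0 i - embed t z i))"
        by (subst sum.reindex) (auto simp: inj_on_def embed_def slice_def)
      also have "\<dots> \<le> coord_dist index_set (embed t0 y0) (embed t z)"
        unfolding coord_dist_def by (rule sum_mono2) (auto simp: finite_index_set index_set_def)
      finally show ?thesis .
    qed
    then have "(\<Sum>j<N. cmod (y0 j - z j)) < 1" using d r by linarith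
    moreover have "(\<Sum>j<N. cmod (z j)) \<le> (\<Sum>j<N. cmod (y0 j) + cmod (y0 j - z j))"
      by (intro sum_mono) (metis norm_minus_commute norm_triangle_sub)
    ultimately have "(\<Sum>j<N. cmod (z j)) \<le> R" by (simp add: R_def sum.distrib)
    then have "(\<Sum>j<N. cmod (z j))\<^sup>2 \<le> R\<^sup>2" by (intro power_mono) (auto simp: sum_nonneg)
    then have E: "energy z \<le> R\<^sup>2" using energy_le_sum(1)[of z] by linarith
    have "\<bar>t0 - t\<bar> < 1"
    proof -
      have "cmod (embed t0 y0 None - embed t z None) < 1"
        using coord_le_dist[of None "embed t0 y0" "embed t z"] d r by (auto simp: index_set_def)
      then show ?thesis by (simp add: embed_def flip: of_real_diff)
    qed
    then have "\<bar>t / real n\<bar> \<le> \<bar>(\<bar>t0\<bar> + 1) / real n\<bar>" by (simp add: divide_right_mono)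
    then have sm: "small R (t / real n)" using small_mono[OF n(2) _ R(1)] by blast
    show ?thesis unfolding citer_embed[OF E R(1) sm j] flow_eq[OF E R(1) n(1) sm] by (simp add: iflow_def slice_def)
  qed
  then show ?thesis using r R hol bd
    by (intro exI[of _ r] exI[of _ R] exI[of _ "\<lambda>j y. citer n n y (j, False)"]) (auto simp: analytic_bounded_def)
qed

end

subsection \<open>Theta series\<close>

lemma summable_exp_minus_abs_int: "(\<lambda>n::int. exp (- \<bar>real_of_int n\<bar>)) summable_on UNIV"
proof -
  have s: "summable (\<lambda>n. norm (exp (- real n)))"
  proof -
    have "summable (\<lambda>n. (exp (- 1) :: real) ^ n)" by (intro summable_geometric) simp
    then show ?thesis by (simp add: exp_of_nat_mult[symmetric])
  qed
  have sn: "(\<lambda>n::nat. exp (- real n)) summable_on UNIV" using s by (rule norm_summable_imp_summable_on)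
  have 1: "(\<lambda>n::int. exp (- \<bar>real_of_int n\<bar>)) summable_on range int"
    by (subst summable_on_reindex) (use sn in \<open>auto simp: o_def\<close>)
  have 2: "(\<lambda>n::int. exp (- \<bar>real_of_int n\<bar>)) summable_on range (\<lambda>n. - int n)"
    by (subst summable_on_reindex) (use sn in \<open>auto simp: o_def inj_on_def\<close>)
  have "(\<lambda>n::int. exp (- \<bar>real_of_int n\<bar>)) summable_on (range int \<union> range (\<lambda>n. - int n))"
    using 1 2 by (rule summable_on_union)
  moreover have "range int \<union> range (\<lambda>n. - int n) = UNIV"
    by (auto simp: image_iff) (metis int_cases2)
  ultimately show ?thesis by simp
qed

text \<open>Jacobi's theta_3. It is even and a genuine Fourier series in x, and it equals
  \<open>theta\<close> up to a translation and an exponential factor.\<close>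

definition theta3_term :: "complex \<Rightarrow> int \<Rightarrow> complex \<Rightarrow> complex" where
  "theta3_term \<tau> n x = exp (\<i> * of_real pi * \<tau> * (of_int n)\<^sup>2 + 2 * of_real pi * \<i> * of_int n * x)"

definition theta3 :: "complex \<Rightarrow> complex \<Rightarrow> complex" where
  "theta3 \<tau> x = (\<Sum>\<^sub>\<infinity>n. theta3_term \<tau> n x)"

text \<open>The Gaussian decay in n beats the exponential growth, uniformly in a horizontal strip.
  The summable majorant exp(-|n|) then allows Weierstrass' test.\<close>

lemma theta3_term_bound:
  assumes "Im \<tau> > 0" "B \<ge> 0"
  shows "\<exists>C\<ge>0. \<forall>x n. \<bar>Im x\<bar> \<le> B \<longrightarrow> cmod (theta3_term \<tau> n x) \<le> C * exp (- \<bar>real_of_int n\<bar>)"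
proof -
  define y where "y = pi * Im \<tau>"
  \<comment> \<open>The maximum over m of -y m^2 + (2 pi B + 1) m, found by completing the
    square.\<close>
  define L where "L = (2 * pi * B + 1)\<^sup>2 / (4 * y)"
  have y: "y > 0" using assms by (simp add: y_def)
  have "cmod (theta3_term \<tau> n x) \<le> exp L * exp (- \<bar>real_of_int n\<bar>)" if x: "\<bar>Im x\<bar> \<le> B" for x n
  proof -
    define m where "m = \<bar>real_of_int n\<bar>"
    have "Re (\<i> * of_real pi * \<tau> * (of_int n)\<^sup>2 + 2 * of_real pi * \<i> * of_int n * x) = - y * m\<^sup>2 + 2 * pi * (- (real_of_int n * Im x))"
      by (simp add: y_def m_def flip: of_int_power)
    also have "\<dots> \<le> - y * m\<^sup>2 + 2 * pi * (m * B)"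
    proof -
      have "- (real_of_int n * Im x) \<le> m * \<bar>Im x\<bar>"
        using abs_ge_minus_self[of "real_of_int n * Im x"] by (simp add: m_def abs_mult)
      also have "\<dots> \<le> m * B" using x by (intro mult_left_mono) (auto simp: m_def)
      finally show ?thesis by (intro add_left_mono mult_left_mono) auto
    qed
    also have "\<dots> \<le> L - m"
    proof -
      have "0 \<le> (2 * y * m - (2 * pi * B + 1))\<^sup>2 / (4 * y)" using y by simp
      also have "\<dots> = L - m * (2 * pi * B + 1) + y * m\<^sup>2"
        using y by (simp add: L_def power2_eq_square field_simps)
      finally show ?thesis by (simp add: algebra_simps)
    qed
    finally show ?thesis
      unfolding theta3_term_def norm_exp_eq_Re exp_add[symmetric] by (simp add: m_def)
  qed
  then show ?thesis by (intro exI[of _ "exp L"]) auto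
qed

lemma theta3_abs_summable:
  assumes "Im \<tau> > 0"
  shows "(\<lambda>n. cmod (theta3_term \<tau> n x)) summable_on UNIV"
proof -
  obtain C where "C \<ge> 0 \<and> (\<forall>y n. \<bar>Im y\<bar> \<le> \<bar>Im x\<bar> \<longrightarrow> cmod (theta3_term \<tau> n y) \<le> C * exp (- \<bar>real_of_int n\<bar>))"
    using theta3_term_bound[OF assms, of "\<bar>Im x\<bar>"] by auto
  then have C: "cmod (theta3_term \<tau> n x) \<le> C * exp (- \<bar>real_of_int n\<bar>)" for n by auto
  show ?thesis
    by (rule summable_on_comparison_test[of "\<lambda>n. C * exp (- \<bar>real_of_int n\<bar>)"])
       (use C in \<open>auto intro: summable_on_cmult_right summable_exp_minus_abs_int\<close>)
qed

lemma theta3_holomorphic: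
  assumes "Im \<tau> > 0"
  shows "theta3 \<tau> holomorphic_on UNIV"
proof -
  have "theta3 \<tau> field_differentiable at z" for z
  proof -
    let ?t = "theta3_term \<tau>"
    obtain C where "C \<ge> 0 \<and> (\<forall>x n. \<bar>Im x\<bar> \<le> \<bar>Im z\<bar> + 1 \<longrightarrow> cmod (?t n x) \<le> C * exp (- \<bar>real_of_int n\<bar>))"
      using theta3_term_bound[OF assms, of "\<bar>Im z\<bar> + 1"] by auto
    then have C: "cmod (?t n x) \<le> C * exp (- \<bar>real_of_int n\<bar>)" if "\<bar>Im x\<bar> \<le> \<bar>Im z\<bar> + 1" for x n using that by auto
    have b: "cmod (?t n x) \<le> C * exp (- \<bar>real_of_int n\<bar>)" if "x \<in> cball z 1" for n x
    proof -
      have "\<bar>Im x - Im z\<bar> \<le> 1" using that abs_Im_le_cmod[of "x - z"] by (simp add: dist_norm norm_minus_commute)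
      then show ?thesis by (intro C) linarith
    qed
    have ul: "uniform_limit (cball z 1) (\<lambda>X y. \<Sum>n\<in>X. ?t n y) (\<lambda>y. \<Sum>\<^sub>\<infinity>n\<in>UNIV. ?t n y) (finite_subsets_at_top UNIV)"
      by (rule Weierstrass_m_test_general[of UNIV _ _ "\<lambda>n. C * exp (- \<bar>real_of_int n\<bar>)"])
         (use b in \<open>auto intro: summable_on_cmult_right summable_exp_minus_abs_int\<close>)
    have th: "?t n holomorphic_on A" for n A unfolding theta3_term_def[abs_def] by (intro holomorphic_intros)
    have "(\<lambda>y. \<Sum>\<^sub>\<infinity>n\<in>UNIV. ?t n y) holomorphic_on ball z 1"
    proof -
      have "\<forall>\<^sub>F X in finite_subsets_at_top UNIV. continuous_on (cball z 1) (\<lambda>y. \<Sum>n\<in>X. ?t n y) \<and> (\<lambda>y. \<Sum>n\<in>X. ?t n y) holomorphic_on ball z 1"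
        by (intro always_eventually allI conjI holomorphic_on_imp_continuous_on holomorphic_on_sum th)
      from holomorphic_uniform_limit[OF this ul] show ?thesis by simp
    qed
    then have "theta3 \<tau> holomorphic_on ball z 1" by (simp add: theta3_def[abs_def])
    then show ?thesis by (rule holomorphic_on_imp_differentiable_at) auto
  qed
  then show ?thesis by (simp add: holomorphic_on_def)
qed

lemma theta3_shift_1: "theta3 \<tau> (x + 1) = theta3 \<tau> x"
proof -
  have "exp (2 * of_real pi * \<i> * of_int n) = 1" for n
    using exp_integer_2pi[of "of_int n"] by (simp add: mult_ac)
  then show ?thesis unfolding theta3_def theta3_term_def by (simp add: distrib_left exp_add)
qed

lemma theta3_shift_tau:
  "theta3 \<tau> (x + of_int m * \<tau>) = exp (- \<i> * of_real pi * \<tau> * (of_int m)\<^sup>2 - 2 * of_real pi * \<i> * of_int m * x) * theta3 \<tau> x"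
proof -
  let ?t = "theta3_term \<tau>"
  let ?c = "exp (- \<i> * of_real pi * \<tau> * (of_int m)\<^sup>2 - 2 * of_real pi * \<i> * of_int m * x)"
  have "?t n (x + of_int m * \<tau>) = ?c * ?t (n + m) x" for n
    unfolding theta3_term_def exp_add[symmetric] by (simp add: power2_eq_square algebra_simps)
  then have "theta3 \<tau> (x + of_int m * \<tau>) = (\<Sum>\<^sub>\<infinity>n. ?c * ?t (n + m) x)" unfolding theta3_def by simp
  also have "\<dots> = ?c * (\<Sum>\<^sub>\<infinity>n. ?t (n + m) x)" by (rule infsum_cmult_right')
  also have "(\<Sum>\<^sub>\<infinity>n. ?t (n + m) x) = (\<Sum>\<^sub>\<infinity>n. ?t n x)"
    by (rule infsum_reindex_bij_betw[of "\<lambda>n. n + m" UNIV UNIV "\<lambda>n. ?t n x"]) (rule bij_plus_right)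
  finally show ?thesis by (simp add: theta3_def)
qed

lemma theta3_minus: "theta3 \<tau> (- x) = theta3 \<tau> x"
proof -
  let ?t = "theta3_term \<tau>"
  have "(\<Sum>\<^sub>\<infinity>n. ?t (- n) x) = (\<Sum>\<^sub>\<infinity>n. ?t n x)"
    by (rule infsum_reindex_bij_betw[of "\<lambda>n. - n" UNIV UNIV "\<lambda>n. ?t n x"]) (simp add: bij_uminus)
  moreover have "?t (- n) x = ?t n (- x)" for n by (simp add: theta3_term_def)
  ultimately show ?thesis by (simp add: theta3_def)
qed

lemma theta_eq_theta3:
  "theta \<tau> z = - \<i> * exp (\<i> * of_real pi * \<tau> / 4 + \<i> * of_real pi * z) * theta3 \<tau> (z + \<tau> / 2 + 1 / 2)"
proof -
  have e: "(-1) powi n = exp (\<i> * of_real pi * of_int n)" for n :: int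
  proof -
    have "exp (\<i> * of_real pi * of_int n) = exp (of_int n * (of_real pi * \<i>))" by (simp add: mult_ac)
    also have "\<dots> = (-1) powi n" unfolding exp_power_int[symmetric] exp_pi_i ..
    finally show ?thesis by simp
  qed
  have "(-1) powi n * exp (\<i> * of_real pi * \<tau> * (of_int n + 1/2)\<^sup>2 + \<i> * (2 * of_int n + 1) * of_real pi * z) =
    exp (\<i> * of_real pi * \<tau> / 4 + \<i> * of_real pi * z) *
    exp (\<i> * of_real pi * \<tau> * (of_int n)\<^sup>2 + 2 * of_real pi * \<i> * of_int n * (z + \<tau> / 2 + 1 / 2))" for n :: int
    unfolding e exp_add[symmetric] by (simp add: power2_eq_square algebra_simps add_divide_distrib)
  then have "theta \<tau> z = - \<i> * (\<Sum>\<^sub>\<infinity>n::int. exp (\<i> * of_real pi * \<tau> / 4 + \<i> * of_real pi * z) *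
    exp (\<i> * of_real pi * \<tau> * (of_int n)\<^sup>2 + 2 * of_real pi * \<i> * of_int n * (z + \<tau> / 2 + 1 / 2)))"
    unfolding theta_def by simp
  also have "\<dots> = - \<i> * (exp (\<i> * of_real pi * \<tau> / 4 + \<i> * of_real pi * z) * theta3 \<tau> (z + \<tau> / 2 + 1 / 2))"
    unfolding theta3_def theta3_term_def by (subst infsum_cmult_right') simp
  finally show ?thesis by simp
qed

text \<open>Orthogonality settles finite sums and uniform convergence the limit. It shows that
  theta_3 does not vanish identically and yields the norm of the functions Phi_k.\<close>

lemma fourier_parseval:
  fixes c :: "int \<Rightarrow> complex"
  assumes "(\<lambda>n. cmod (c n)) summable_on UNIV"
  defines "f \<equiv> \<lambda>a::real. \<Sum>\<^sub>\<infinity>n. c n * exp (2 * of_real pi * \<i> * of_int n * of_real a)"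
  shows "continuous_on {0..1} f" "((\<lambda>n. (cmod (c n))\<^sup>2) has_sum integral {0..1} (\<lambda>a. (cmod (f a))\<^sup>2)) UNIV"
proof -
  let ?e = "\<lambda>(n::int) (a::real). exp (2 * of_real pi * \<i> * of_int n * of_real a)"
  have ne: "cmod (?e n a) = 1" for n a by (simp add: norm_exp_eq_Re)
  define S where "S X a = (\<Sum>n\<in>X. c n * ?e n a)" for X a
  have ul: "uniform_limit {0..1} S f (finite_subsets_at_top UNIV)"
    unfolding S_def f_def
    by (rule Weierstrass_m_test_general[OF _ assms(1)]) (simp add: norm_mult ne)
  have cS: "continuous_on {0..1} (S X)" for X unfolding S_def by (intro continuous_intros)
  show cf: "continuous_on {0..1} f"
    by (rule uniform_limit_theorem[OF _ ul]) (auto simp: cS)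
  have bf: "bounded (f ` {0..1})" using cf by (intro compact_imp_bounded compact_continuous_image) auto
  have bc: "bounded ((\<lambda>a. cnj (f a)) ` {0..1})"
    by (intro compact_imp_bounded compact_continuous_image continuous_intros cf) auto
  have ulm: "uniform_limit {0..1} (\<lambda>X a. S X a * cnj (S X a)) (\<lambda>a. f a * cnj (f a)) (finite_subsets_at_top UNIV)"
    by (intro uniform_lim_mult ul bounded_linear.uniform_limit[OF bounded_linear_cnj]) (use bf bc in auto)
  have cS2: "continuous_on {0..1} (\<lambda>a. S X a * cnj (S X a))" for X by (intro continuous_intros cS)
  obtain I J where I: "\<And>X. ((\<lambda>a. S X a * cnj (S X a)) has_integral I X) {0..1}"
    and J: "((\<lambda>a. f a * cnj (f a)) has_integral J) {0..1}" and lim: "(I \<longlongrightarrow> J) (finite_subsets_at_top UNIV)"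
    by (rule uniform_limit_integral[OF ulm cS2], simp, rule that)
  have ortho: "((\<lambda>a. ?e n a * cnj (?e m a)) has_integral (if n = m then 1 else 0)) {0..1}" for n m
  proof (cases "n = m")
    case True
    have "?e m a * cnj (?e m a) = 1" for a using ne[of m a] by (simp add: complex_norm_square[symmetric])
    then show ?thesis using True has_integral_const_real[of "1::complex" 0 1] by simp
  next
    case False
    define k where "k = 2 * of_real pi * \<i> * of_int (n - m)"
    have k: "k \<noteq> 0" using False by (simp add: k_def)
    have eq: "?e n a * cnj (?e m a) = exp (k * of_real a)" for a
      unfolding exp_cnj exp_add[symmetric] by (simp add: k_def algebra_simps)
    have "((\<lambda>a. exp (k * of_real a)) has_integral (exp (k * of_real 1) / k - exp (k * of_real 0) / k)) {0..1}"
    proof (rule fundamental_theorem_of_calculus)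
      fix a :: real
      have "((\<lambda>z. exp (k * z) / k) has_field_derivative exp (k * of_real a)) (at (of_real a))"
        using k by (auto intro!: derivative_eq_intros)
      then show "((\<lambda>a. exp (k * of_real a) / k) has_vector_derivative exp (k * of_real a)) (at a within {0..1})"
        by (rule has_vector_derivative_real_field)
    qed simp
    moreover have "exp k = 1" using exp_integer_2pi[of "of_int (n - m)"] by (simp add: k_def mult_ac)
    ultimately show ?thesis using False unfolding eq by simp
  qed
  have IX: "I X = of_real (\<Sum>n\<in>X. (cmod (c n))\<^sup>2)" if "finite X" for X
  proof -
    have "((\<lambda>a. \<Sum>n\<in>X. \<Sum>m\<in>X. c n * cnj (c m) * (?e n a * cnj (?e m a))) has_integral
       (\<Sum>n\<in>X. \<Sum>m\<in>X. c n * cnj (c m) * (if n = m then 1 else 0))) {0..1}"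
      by (intro has_integral_sum has_integral_mult_right ortho that)
    moreover have "(\<lambda>a. \<Sum>n\<in>X. \<Sum>m\<in>X. c n * cnj (c m) * (?e n a * cnj (?e m a))) = (\<lambda>a. S X a * cnj (S X a))"
      by (simp add: S_def sum_product mult_ac)
    moreover have "(\<Sum>n\<in>X. \<Sum>m\<in>X. c n * cnj (c m) * (if n = m then 1 else 0)) = of_real (\<Sum>n\<in>X. (cmod (c n))\<^sup>2)"
      using that by (simp add: complex_norm_square[symmetric] if_distrib[of "\<lambda>x. _ * x"] cong: if_cong)
    ultimately have "((\<lambda>a. S X a * cnj (S X a)) has_integral of_real (\<Sum>n\<in>X. (cmod (c n))\<^sup>2)) {0..1}" by simp
    then show ?thesis using I by (rule has_integral_unique[rotated])
  qed
  have "((\<lambda>a. Re (f a * cnj (f a))) has_integral Re J) {0..1}" using has_integral_linear[OF J bounded_linear_Re] by (simp add: o_def)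
  moreover have "(\<lambda>a. Re (f a * cnj (f a))) = (\<lambda>a. (cmod (f a))\<^sup>2)" by (simp add: fun_eq_iff complex_norm_square[symmetric])
  ultimately have J': "integral {0..1} (\<lambda>a. (cmod (f a))\<^sup>2) = Re J" by (simp add: integral_unique)
  have "((\<lambda>X. Re (I X)) \<longlongrightarrow> Re J) (finite_subsets_at_top UNIV)" using lim by (intro tendsto_intros)
  then have "((\<lambda>X. \<Sum>n\<in>X. (cmod (c n))\<^sup>2) \<longlongrightarrow> Re J) (finite_subsets_at_top UNIV)"
    by (rule Lim_transform_eventually) (auto simp: IX intro!: eventually_finite_subsets_at_top_weakI)
  then show "((\<lambda>n. (cmod (c n))\<^sup>2) has_sum integral {0..1} (\<lambda>a. (cmod (f a))\<^sup>2)) UNIV"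
    unfolding has_sum_def J' .
qed

text \<open>The Fourier coefficient at n = 0 is 1, which Parseval's identity forbids for the zero
  function.\<close>

lemma theta3_not_zero:
  assumes "Im \<tau> > 0"
  shows "\<exists>x. theta3 \<tau> x \<noteq> 0"
proof (rule ccontr)
  assume "\<not> (\<exists>x. theta3 \<tau> x \<noteq> 0)"
  then have z: "theta3 \<tau> x = 0" for x by simp
  define c where "c n = exp (\<i> * of_real pi * \<tau> * (of_int n)\<^sup>2)" for n :: int
  have s: "(\<lambda>n. cmod (c n)) summable_on UNIV" using theta3_abs_summable[OF assms, of 0] unfolding c_def theta3_term_def by simp
  have "theta3 \<tau> (of_real a) = (\<Sum>\<^sub>\<infinity>n. c n * exp (2 * of_real pi * \<i> * of_int n * of_real a))" for a
    unfolding theta3_def theta3_term_def c_def exp_add ..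
  then have "((\<lambda>n. (cmod (c n))\<^sup>2) has_sum 0) UNIV" using fourier_parseval(2)[OF s] z by simp
  then have "(cmod (c 0))\<^sup>2 = 0" by (rule nonneg_has_sum_le_0D[of "\<lambda>n. (cmod (c n))\<^sup>2" UNIV 0 0]) auto
  then show False by (simp add: c_def)
qed

section \<open>Multipliers and zeros of theta\<close>

lemma theta_quasi_periodic:
  assumes "Im \<tau> > 0"
  shows "quasi_periodic \<tau> 1 (-1) (- exp (- \<i> * of_real pi * \<tau>)) (theta \<tau>)"
proof -
  have "(\<lambda>z. theta3 \<tau> (z + \<tau> / 2 + 1 / 2)) holomorphic_on UNIV"
    by (rule holomorphic_on_compose_gen[OF _ theta3_holomorphic[OF assms], unfolded o_def]) (auto intro!: holomorphic_intros)
  then have "theta \<tau> holomorphic_on UNIV" unfolding theta_eq_theta3[abs_def] by (intro holomorphic_intros)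
  moreover have "theta \<tau> (x + 1) = - theta \<tau> x" for x
  proof -
    have "theta3 \<tau> (x + 1 + \<tau> / 2 + 1 / 2) = theta3 \<tau> (x + \<tau> / 2 + 1 / 2)"
      using theta3_shift_1[of \<tau> "x + \<tau> / 2 + 1 / 2"] by (simp add: algebra_simps)
    moreover have "exp (\<i> * of_real pi * \<tau> / 4 + \<i> * of_real pi * (x + 1)) = - exp (\<i> * of_real pi * \<tau> / 4 + \<i> * of_real pi * x)"
      by (simp add: distrib_left exp_add)
    ultimately show ?thesis unfolding theta_eq_theta3 by simp
  qed
  moreover have "theta \<tau> (x + \<tau>) = - exp (- \<i> * of_real pi * \<tau>) * exp (- (2 * of_real pi * \<i> * x)) * theta \<tau> x" for x
  proof -
    have "theta3 \<tau> (x + \<tau> + \<tau> / 2 + 1 / 2) = exp (- \<i> * of_real pi * \<tau> - 2 * of_real pi * \<i> * (x + \<tau> / 2 + 1 / 2)) * theta3 \<tau> (x + \<tau> / 2 + 1 / 2)"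
      using theta3_shift_tau[of \<tau> "x + \<tau> / 2 + 1 / 2" 1] by (simp add: algebra_simps)
    moreover have "exp (\<i> * of_real pi * \<tau> / 4 + \<i> * of_real pi * (x + \<tau>)) * exp (- \<i> * of_real pi * \<tau> - 2 * of_real pi * \<i> * (x + \<tau> / 2 + 1 / 2)) =
      - exp (- \<i> * of_real pi * \<tau>) * exp (- (2 * of_real pi * \<i> * x)) * exp (\<i> * of_real pi * \<tau> / 4 + \<i> * of_real pi * x)"
    proof -
      have "exp (\<i> * of_real pi * \<tau> / 4 + \<i> * of_real pi * (x + \<tau>)) * exp (- \<i> * of_real pi * \<tau> - 2 * of_real pi * \<i> * (x + \<tau> / 2 + 1 / 2)) =
         exp (- (\<i> * of_real pi)) * (exp (- \<i> * of_real pi * \<tau>) * exp (- (2 * of_real pi * \<i> * x)) * exp (\<i> * of_real pi * \<tau> / 4 + \<i> * of_real pi * x))"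
        by (simp only: exp_add[symmetric]) (simp add: algebra_simps)
      also have "exp (- (\<i> * of_real pi)) = -1" by (simp add: exp_minus)
      finally show ?thesis by simp
    qed
    ultimately have "theta \<tau> (x + \<tau>) = - \<i> * (- exp (- \<i> * of_real pi * \<tau>) * exp (- (2 * of_real pi * \<i> * x)) * exp (\<i> * of_real pi * \<tau> / 4 + \<i> * of_real pi * x)) * theta3 \<tau> (x + \<tau> / 2 + 1 / 2)"
      unfolding theta_eq_theta3 by (simp only: mult.assoc[symmetric]) (simp only: mult.assoc)
    then show ?thesis unfolding theta_eq_theta3 by (simp add: mult_ac)
  qed
  ultimately show ?thesis unfolding quasi_periodic_def by simp
qed

text \<open>For the half period w = (\<tau> + 1) / 2 the points w and -w differ by the lattice
  vector 1 + \<tau>. theta_3 is even, and the multiplier of this shift at -w is -1, so it vanishes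
  at w.\<close>

lemma theta_0: "theta \<tau> 0 = 0"
proof -
  let ?w = "\<tau> / 2 + 1 / 2"
  have "theta3 \<tau> ?w = theta3 \<tau> (- ?w + 1 + of_int 1 * \<tau>)" by (simp add: field_simps)
  also have "\<dots> = exp (- \<i> * of_real pi * \<tau> * (of_int 1)\<^sup>2 - 2 * of_real pi * \<i> * of_int 1 * (- ?w + 1)) * theta3 \<tau> (- ?w + 1)"
    by (rule theta3_shift_tau)
  also have "- \<i> * of_real pi * \<tau> * (of_int 1)\<^sup>2 - 2 * of_real pi * \<i> * of_int 1 * (- ?w + 1) = - (\<i> * of_real pi)"
    by (simp add: field_simps)
  also have "exp (- (\<i> * of_real pi)) = -1" by (simp add: exp_minus)
  also have "theta3 \<tau> (- ?w + 1) = theta3 \<tau> ?w" unfolding theta3_shift_1 theta3_minus ..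
  finally have "theta3 \<tau> ?w = 0" by simp
  then show ?thesis unfolding theta_eq_theta3 by simp
qed

text \<open>Factorization by the auxiliary product P gives theta as an exponential times a translate
  of P. As theta vanishes at 0, the translation is by a lattice vector, so theta is P times a
  function without zeros.\<close>

lemma theta_simple:
  assumes tau: "Im \<tau> > 0"
  shows "simple_on_lattice \<tau> (theta \<tau>)"
proof -
  obtain P where P: "quasi_periodic \<tau> 1 1 (-1) P" "simple_on_lattice \<tau> P" using simple_theta_exists[OF tau] .
  obtain c s xs where eq: "\<And>x. theta \<tau> x = c * exp (s * x) * (\<Prod>j=1..1::nat. P (x - xs j))"
    using quasi_periodic_factorization[OF tau P theta_quasi_periodic[OF tau]] by auto
  have eq: "theta \<tau> x = c * exp (s * x) * P (x - xs 1)" for x using eq[of x] by simp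
  have c: "c \<noteq> 0"
  proof
    assume "c = 0"
    then have "theta3 \<tau> x = 0" for x using eq[of "x - \<tau> / 2 - 1 / 2"] unfolding theta_eq_theta3 by simp
    then show False using theta3_not_zero[OF tau] by simp
  qed
  have "P (0 - xs 1) = 0" using eq[of 0] theta_0[of \<tau>] c by simp
  then obtain l m :: int where "0 - xs 1 = of_int l + of_int m * \<tau>" using P(2) unfolding simple_on_lattice_def by blast
  then obtain d where d: "d \<noteq> 0" "\<And>x. P (x - xs 1) = d * exp (- (2 * of_real pi * \<i> * of_nat 1 * of_int m * x)) * P x"
    using quasi_periodic_shift[OF P(1), of l m] by (metis diff_0 uminus_add_conv_diff add.commute)
  define t where "t x = c * d * exp (s * x - 2 * of_real pi * \<i> * of_int m * x)" for x
  have tP: "theta \<tau> x = t x * P x" for x unfolding eq d t_def exp_diff by (simp add: exp_minus field_simps)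
  have tnz: "t x \<noteq> 0" for x using c d by (simp add: t_def)
  have "deriv (theta \<tau>) x \<noteq> 0" if "theta \<tau> x = 0" for x
  proof -
    have Px: "P x = 0" using that tP tnz by simp
    have "(P has_field_derivative deriv P x) (at x)" using holomorphic_derivI[OF quasi_periodicD(1)[OF P(1)]] by auto
    then have "((\<lambda>x. t x * P x) has_field_derivative t x * deriv P x) (at x)"
      unfolding t_def using Px by (auto intro!: derivative_eq_intros)
    then have "deriv (theta \<tau>) x = t x * deriv P x" unfolding tP[abs_def] by (rule DERIV_imp_deriv)
    then show ?thesis using tnz P(2) Px by (auto simp: simple_on_lattice_def)
  qed
  moreover have "\<exists>m n :: int. x = of_int m + of_int n * \<tau>" if "theta \<tau> x = 0" for x
    using that tP tnz P(2) by (auto simp: simple_on_lattice_def)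
  ultimately show ?thesis using theta_0 by (auto simp: simple_on_lattice_def)
qed

section \<open>Products of translated theta functions\<close>

lemma exp_eq_1_int:
  assumes "exp (2 * of_real pi * \<i> * y) = (1::complex)"
  shows "\<exists>m :: int. y = of_int m"
proof -
  obtain m :: int where "Re (2 * of_real pi * \<i> * y) = 0" "Im (2 * of_real pi * \<i> * y) = of_int (2 * m) * pi"
    using assms unfolding exp_eq_1 by blast
  then have "y = of_int m" by (simp add: complex_eq_iff)
  then show ?thesis ..
qed

lemma theta_prod_shift:
  assumes tau: "Im \<tau> > 0"
  shows "(\<Prod>j=1..n. theta \<tau> (x + 1 - zs j)) = (-1) ^ n * (\<Prod>j=1..n. theta \<tau> (x - zs j))"
    "(\<Prod>j=1..n. theta \<tau> (x + \<tau> - zs j)) = ((-1) ^ n * exp (- \<i> * of_real pi * of_nat n * \<tau>)) *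
     exp (- (2 * of_real pi * \<i> * of_nat n * x)) * exp (2 * of_real pi * \<i> * (\<Sum>j=1..n. zs j)) * (\<Prod>j=1..n. theta \<tau> (x - zs j))"
proof -
  note th = theta_quasi_periodic[OF tau]
  show "(\<Prod>j=1..n. theta \<tau> (x + 1 - zs j)) = (-1) ^ n * (\<Prod>j=1..n. theta \<tau> (x - zs j))"
  proof -
    have "theta \<tau> (x + 1 - zs j) = (-1) * theta \<tau> (x - zs j)" for j
      using quasi_periodicD(4)[OF th, of "x - zs j"] by (simp add: algebra_simps)
    then show ?thesis by (simp only: prod.distrib) simp
  qed
  show "(\<Prod>j=1..n. theta \<tau> (x + \<tau> - zs j)) = ((-1) ^ n * exp (- \<i> * of_real pi * of_nat n * \<tau>)) *
     exp (- (2 * of_real pi * \<i> * of_nat n * x)) * exp (2 * of_real pi * \<i> * (\<Sum>j=1..n. zs j)) * (\<Prod>j=1..n. theta \<tau> (x - zs j))"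
  proof -
    define A where "A = (-1) * exp (- \<i> * of_real pi * \<tau> - 2 * of_real pi * \<i> * x)"
    have "theta \<tau> (x + \<tau> - zs j) = A * exp (2 * of_real pi * \<i> * zs j) * theta \<tau> (x - zs j)" for j
    proof -
      have "theta \<tau> (x + \<tau> - zs j) = theta \<tau> ((x - zs j) + \<tau>)" by (simp add: algebra_simps)
      also have "\<dots> = - (exp (- \<i> * of_real pi * \<tau>) * exp (- (2 * of_real pi * \<i> * of_nat 1 * (x - zs j)))) * theta \<tau> (x - zs j)"
        unfolding quasi_periodicD(5)[OF th] by simp
      also have "exp (- \<i> * of_real pi * \<tau>) * exp (- (2 * of_real pi * \<i> * of_nat 1 * (x - zs j))) =
         exp (- \<i> * of_real pi * \<tau> - 2 * of_real pi * \<i> * x) * exp (2 * of_real pi * \<i> * zs j)"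
        unfolding exp_add[symmetric] by (simp add: algebra_simps)
      finally show ?thesis by (simp add: A_def)
    qed
    then have "(\<Prod>j=1..n. theta \<tau> (x + \<tau> - zs j)) = A ^ n *
       exp (\<Sum>j=1..n. 2 * of_real pi * \<i> * zs j) * (\<Prod>j=1..n. theta \<tau> (x - zs j))"
      by (simp add: prod.distrib exp_sum)
    also have "A ^ n = (-1) ^ n * (exp (- \<i> * of_real pi * of_nat n * \<tau>) *
       exp (- (2 * of_real pi * \<i> * of_nat n * x)))"
      unfolding A_def power_mult_distrib exp_of_nat_mult[symmetric] exp_add[symmetric] by (simp add: algebra_simps)
    finally show ?thesis by (simp add: sum_distrib_left mult_ac)
  qed
qed

text \<open>The exponential factor and the sum of the zeros can be prescribed subject to the only
  constraint imposed by the multiplier \<open>b\<close>: moving a zero by a lattice vector changes both.\<close>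

lemma theta_factorization:
  assumes tau: "Im \<tau> > 0" and n: "n \<ge> 1" and G: "quasi_periodic \<tau> n 1 b G"
    and b: "b = exp (\<i> * of_real pi * (- of_nat n + 2 * of_int k) * \<tau>) * ((-1) ^ n * exp (- \<i> * of_real pi * of_nat n * \<tau>)) * exp (2 * of_real pi * \<i> * y)"
  shows "\<exists>c xs. (\<Sum>j=1..n. xs j) = y \<and> (\<forall>x. G x = c * exp (\<i> * of_real pi * (- of_nat n + 2 * of_int k) * x) * (\<Prod>j=1..n. theta \<tau> (x - xs j)))"
proof (cases "\<forall>x. G x = 0")
  case True
  have "(\<Sum>j=1..n. if j = 1 then y else 0) = y" using n by simp
  then show ?thesis using True by (intro exI[of _ 0] exI[of _ "\<lambda>j. if j = 1 then y else 0"]) auto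
next
  case False
  then obtain x0 where x0: "G x0 \<noteq> 0" by blast
  note th = theta_quasi_periodic[OF tau]
  obtain c s xs where fac: "\<And>x. G x = c * exp (s * x) * (\<Prod>j=1..n. theta \<tau> (x - xs j))"
    using quasi_periodic_factorization[OF tau th theta_simple[OF tau] G] by auto
  have one: "{1..n} = insert 1 {2..n}" using n by auto
  have upd: "(\<Prod>j=1..n. theta \<tau> (x - (zs(1 := z)) j)) = theta \<tau> (x - z) * (\<Prod>j=2..n. theta \<tau> (x - zs j))" for x z zs
    unfolding one by (subst prod.insert) (auto intro!: prod.cong)
  have upds: "(\<Sum>j=1..n. (zs(1 := z)) j) = z + (\<Sum>j=2..n. zs j)" for z and zs :: "nat \<Rightarrow> complex"
    unfolding one by (subst sum.insert) (auto intro!: sum.cong)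
  note sh1 = theta_prod_shift(1)[OF tau] and sh2 = theta_prod_shift(2)[OF tau]
  have c: "c \<noteq> 0" "(\<Prod>j=1..n. theta \<tau> (x0 - xs j)) \<noteq> 0" using x0 unfolding fac by auto
  \<comment> \<open>Invariance under the shift by 1 leaves only a discrete set of exponents, indexed
    by an integer.\<close>
  obtain k' :: int where k': "s = \<i> * of_real pi * (- of_nat n + 2 * of_int k')"
  proof -
    have "c * exp (s * (x0 + 1)) * ((-1) ^ n * (\<Prod>j=1..n. theta \<tau> (x0 - xs j))) = c * exp (s * x0) * (\<Prod>j=1..n. theta \<tau> (x0 - xs j))"
      using quasi_periodicD(4)[OF G, of x0] unfolding fac sh1 by simp
    then have "exp s * (-1) ^ n = 1" using c by (simp add: distrib_left exp_add)
    moreover have "(-1) ^ n = exp (\<i> * of_real pi * of_nat n)"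
      using exp_of_nat_mult[of n "\<i> * of_real pi"] by (simp add: mult_ac)
    moreover have "2 * of_real pi * \<i> * ((s / (\<i> * of_real pi) + of_nat n) / 2) = s + \<i> * of_real pi * of_nat n"
      by (simp add: field_simps)
    ultimately have "exp (2 * of_real pi * \<i> * ((s / (\<i> * of_real pi) + of_nat n) / 2)) = 1"
      by (simp add: exp_add)
    from exp_eq_1_int[OF this] obtain m :: int where "(s / (\<i> * of_real pi) + of_nat n) / 2 = of_int m" by blast
    then have "s = \<i> * of_real pi * (- of_nat n + 2 * of_int m)" by (simp add: field_simps)
    then show thesis by (rule that)
  qed
  \<comment> \<open>Moving the first zero by m \<tau> multiplies the theta product by an exponential
    linear in x; this m turns the exponent with k' into the one with k.\<close>
  define m where "m = k' - k"
  obtain d where d: "d \<noteq> 0" "\<And>x. theta \<tau> (x + of_int m * \<tau>) = d * exp (- (2 * of_real pi * \<i> * of_nat 1 * of_int m * x)) * theta \<tau> x"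
    using quasi_periodic_shift_tau[OF th, of m] by auto
  define zs where "zs = xs(1 := xs 1 + of_int m * \<tau>)"
  define c' where "c' = c * d * exp (2 * of_real pi * \<i> * of_int m * (xs 1 + of_int m * \<tau>))"
  let ?e = "\<lambda>x. exp (\<i> * of_real pi * (- of_nat n + 2 * of_int k) * x)"
  have fac2: "G x = c' * ?e x * (\<Prod>j=1..n. theta \<tau> (x - zs j))" for x
  proof -
    have "G x = c * exp (s * x) * (theta \<tau> (x - xs 1) * (\<Prod>j=2..n. theta \<tau> (x - xs j)))"
      unfolding fac using upd[of x xs "xs 1"] by simp
    also have "theta \<tau> (x - xs 1) = d * exp (- (2 * of_real pi * \<i> * of_int m * (x - (xs 1 + of_int m * \<tau>)))) * theta \<tau> (x - (xs 1 + of_int m * \<tau>))"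
      using d(2)[of "x - (xs 1 + of_int m * \<tau>)"] by (simp add: algebra_simps)
    also have "c * exp (s * x) * (d * exp (- (2 * of_real pi * \<i> * of_int m * (x - (xs 1 + of_int m * \<tau>)))) * theta \<tau> (x - (xs 1 + of_int m * \<tau>)) * (\<Prod>j=2..n. theta \<tau> (x - xs j))) =
      c * d * (exp (s * x) * exp (- (2 * of_real pi * \<i> * of_int m * (x - (xs 1 + of_int m * \<tau>))))) * (theta \<tau> (x - (xs 1 + of_int m * \<tau>)) * (\<Prod>j=2..n. theta \<tau> (x - xs j)))"
      by (simp add: mult_ac)
    also have "exp (s * x) * exp (- (2 * of_real pi * \<i> * of_int m * (x - (xs 1 + of_int m * \<tau>)))) =
       exp (2 * of_real pi * \<i> * of_int m * (xs 1 + of_int m * \<tau>)) * ?e x"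
      unfolding exp_add[symmetric] k' m_def by (simp add: algebra_simps)
    finally show ?thesis unfolding zs_def upd c'_def by (simp add: mult_ac)
  qed
  have c': "c' \<noteq> 0" "(\<Prod>j=1..n. theta \<tau> (x0 - zs j)) \<noteq> 0" using x0 unfolding fac2 by auto
  \<comment> \<open>Comparing the multipliers of the shift by \<tau> determines the sum of the zeros
    modulo the integers. The integer left over is removed by shifting one zero, which changes theta
    only by a constant.\<close>
  have "exp (2 * of_real pi * \<i> * ((\<Sum>j=1..n. zs j) - y)) = 1"
  proof -
    define E1 E2 E3 where "E1 = exp (\<i> * of_real pi * (- of_nat n + 2 * of_int k) * \<tau>)"
      and "E2 = (-1) ^ n * exp (- \<i> * of_real pi * of_nat n * \<tau>)" and "E3 = exp (- (2 * of_real pi * \<i> * of_nat n * x0))"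
    have nz: "E1 \<noteq> 0" "E2 \<noteq> 0" "E3 \<noteq> 0" by (auto simp: E1_def E2_def E3_def)
    have ex: "?e (x0 + \<tau>) = ?e x0 * E1" unfolding E1_def exp_add[symmetric] by (simp add: algebra_simps)
    have "c' * ?e (x0 + \<tau>) * (E2 * E3 * exp (2 * of_real pi * \<i> * (\<Sum>j=1..n. zs j)) * (\<Prod>j=1..n. theta \<tau> (x0 - zs j))) =
      (E1 * E2 * exp (2 * of_real pi * \<i> * y)) * E3 * (c' * ?e x0 * (\<Prod>j=1..n. theta \<tau> (x0 - zs j)))"
      using quasi_periodicD(5)[OF G, of x0] unfolding fac2 sh2 b E1_def E2_def E3_def by simp
    then have "exp (2 * of_real pi * \<i> * (\<Sum>j=1..n. zs j)) = exp (2 * of_real pi * \<i> * y)"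
      unfolding ex using nz c' by simp
    then show ?thesis by (simp add: right_diff_distrib exp_diff)
  qed
  then obtain l :: int where "(\<Sum>j=1..n. zs j) - y = of_int l" using exp_eq_1_int by blast
  then have l: "(\<Sum>j=1..n. zs j) = y + of_int l" by (simp add: algebra_simps)
  obtain d' where d': "d' \<noteq> 0" "\<And>x. theta \<tau> (x + of_int (- l)) = d' * theta \<tau> x"
    using quasi_periodic_shift_int[OF th, of "- l"] by auto
  define ws where "ws = zs(1 := zs 1 - of_int l)"
  have "(\<Sum>j=1..n. ws j) = y"
  proof -
    have "(\<Sum>j=1..n. zs j) = zs 1 + (\<Sum>j=2..n. zs j)" using upds[of zs "zs 1"] by (simp only: fun_upd_triv)
    then have "zs 1 + (\<Sum>j=2..n. zs j) = y + of_int l" unfolding l ..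
    then have "zs 1 - of_int l + (\<Sum>j=2..n. zs j) = y" by (simp add: algebra_simps)
    then show ?thesis unfolding ws_def upds .
  qed
  moreover have "G x = (c' * d') * ?e x * (\<Prod>j=1..n. theta \<tau> (x - ws j))" for x
  proof -
    have "G x = c' * ?e x * (theta \<tau> (x - zs 1) * (\<Prod>j=2..n. theta \<tau> (x - zs j)))"
      unfolding fac2 using upd[of x zs "zs 1"] by simp
    also have "theta \<tau> (x - zs 1) = d' * theta \<tau> (x - (zs 1 - of_int l))"
      using d'(2)[of "x - (zs 1 - of_int l)"] by (simp add: algebra_simps)
    finally show ?thesis unfolding ws_def upd by (simp add: mult_ac)
  qed
  ultimately show ?thesis by (intro exI[of _ "c' * d'"] exI[of _ ws]) auto
qed

subsection \<open>Lebesgue measure on the complex plane in oblique coordinates\<close>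

lemma lborel_complex_eq: "(lborel :: complex measure) = distr (lborel \<Otimes>\<^sub>M lborel) borel (\<lambda>x. Complex (fst x) (snd x))"
proof (rule lborel_eqI)
  have [measurable]: "(\<lambda>x. Complex (fst x) (snd x)) \<in> borel_measurable (lborel \<Otimes>\<^sub>M lborel)"
    unfolding Complex_eq by measurable
  fix l u :: complex assume le: "\<And>b. b \<in> Basis \<Longrightarrow> l \<bullet> b \<le> u \<bullet> b"
  have "emeasure (distr (lborel \<Otimes>\<^sub>M lborel) borel (\<lambda>x. Complex (fst x) (snd x))) (box l u) =
    emeasure (lborel \<Otimes>\<^sub>M lborel) ({Re l<..<Re u} \<times> {Im l<..<Im u})"
    by (subst emeasure_distr) (auto simp: space_pair_measure in_box_complex_iff intro!: arg_cong[where f = "emeasure _"])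
  also have "\<dots> = emeasure lborel {Re l<..<Re u} * emeasure lborel {Im l<..<Im u}"
    by (rule lborel.emeasure_pair_measure_Times) auto
  also have "\<dots> = ennreal (\<Prod>b\<in>Basis. (u - l) \<bullet> b)"
    using le[of 1] le[of \<i>] by (simp add: Basis_complex_def ennreal_mult[symmetric] inner_complex_def)
  finally show "emeasure (distr (lborel \<Otimes>\<^sub>M lborel) borel (\<lambda>x. Complex (fst x) (snd x))) (box l u) = ennreal (\<Prod>b\<in>Basis. (u - l) \<bullet> b)" .
qed simp

definition oblique :: "complex \<Rightarrow> complex \<Rightarrow> real \<times> real \<Rightarrow> complex" where
  "oblique p q x = of_real (fst x) * p + of_real (snd x) * q"

lemma oblique_measurable [measurable]: "oblique p q \<in> borel_measurable (borel \<Otimes>\<^sub>M borel)"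
  unfolding oblique_def by measurable

lemma nn_integral_complex:
  assumes [measurable]: "f \<in> borel_measurable borel"
  shows "(\<integral>\<^sup>+z. f z \<partial>lborel) = (\<integral>\<^sup>+x. \<integral>\<^sup>+y. f (Complex x y) \<partial>lborel \<partial>lborel)"
proof -
  have [measurable]: "(\<lambda>x. Complex (fst x) (snd x)) \<in> borel_measurable (borel \<Otimes>\<^sub>M borel)"
    unfolding Complex_eq by measurable
  have "(\<integral>\<^sup>+z. f z \<partial>lborel) = (\<integral>\<^sup>+x. f (Complex (fst x) (snd x)) \<partial>(lborel \<Otimes>\<^sub>M lborel))"
    by (subst lborel_complex_eq, subst nn_integral_distr) auto
  also have "\<dots> = (\<integral>\<^sup>+x. \<integral>\<^sup>+y. f (Complex x y) \<partial>lborel \<partial>lborel)"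
    by (subst lborel.nn_integral_fst[symmetric]) auto
  finally show ?thesis .
qed

text \<open>By Tonelli the change of variables is made one real variable at a time: a factor |Re p|
  for the first and |Im (conj(p) q) / Re p| for the second. The case Re p = 0 is later reduced to
  this one by exchanging p and q.\<close>

lemma nn_integral_oblique_Re:
  assumes f [measurable]: "f \<in> borel_measurable borel" and p: "Re p \<noteq> 0" and D: "Im (cnj p * q) \<noteq> 0"
  shows "(\<integral>\<^sup>+z. f z \<partial>lborel) = ennreal \<bar>Im (cnj p * q)\<bar> * (\<integral>\<^sup>+x. f (oblique p q x) \<partial>(lborel \<Otimes>\<^sub>M lborel))"
proof -
  have [measurable]: "(\<lambda>x. Complex (fst x) (snd x)) \<in> borel_measurable (borel \<Otimes>\<^sub>M borel)"
    unfolding Complex_eq by measurable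
  define G where "G b x = f (Complex x ((x - b * Re q) * Im p / Re p + b * Im q))" for b x
  have [measurable]: "(\<lambda>x. G (fst x) (snd x)) \<in> borel_measurable (borel \<Otimes>\<^sub>M borel)"
    unfolding G_def Complex_eq by measurable
  have [measurable]: "(\<lambda>x. G (snd x) (fst x)) \<in> borel_measurable (borel \<Otimes>\<^sub>M borel)"
    unfolding G_def Complex_eq by measurable
  have [measurable]: "G b \<in> borel_measurable borel" for b
    unfolding G_def Complex_eq by measurable
  have "(\<integral>\<^sup>+x. f (oblique p q x) \<partial>(lborel \<Otimes>\<^sub>M lborel)) = (\<integral>\<^sup>+b. \<integral>\<^sup>+a. f (oblique p q (a, b)) \<partial>lborel \<partial>lborel)"
    by (subst lborel_pair.nn_integral_snd[symmetric]) auto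
  moreover have "ennreal \<bar>Re p\<bar> * (\<integral>\<^sup>+a. f (oblique p q (a, b)) \<partial>lborel) = (\<integral>\<^sup>+x. G b x \<partial>lborel)" for b
  proof -
    have "(\<integral>\<^sup>+x. G b x \<partial>lborel) = ennreal \<bar>Re p\<bar> * (\<integral>\<^sup>+a. G b (b * Re q + Re p * a) \<partial>lborel)"
      using p by (intro nn_integral_real_affine) auto
    moreover have "G b (b * Re q + Re p * a) = f (oblique p q (a, b))" for a
    proof -
      have "Complex (b * Re q + Re p * a) ((b * Re q + Re p * a - b * Re q) * Im p / Re p + b * Im q) = oblique p q (a, b)"
        using p by (simp add: oblique_def complex_eq_iff)
      then show ?thesis unfolding G_def by simp
    qed
    ultimately show ?thesis by simp
  qed
  ultimately have "ennreal \<bar>Re p\<bar> * (\<integral>\<^sup>+x. f (oblique p q x) \<partial>(lborel \<Otimes>\<^sub>M lborel)) = (\<integral>\<^sup>+b. \<integral>\<^sup>+x. G b x \<partial>lborel \<partial>lborel)"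
    by (simp add: nn_integral_cmult[symmetric])
  also have "\<dots> = (\<integral>\<^sup>+x. \<integral>\<^sup>+b. G b x \<partial>lborel \<partial>lborel)"
    by (rule lborel_pair.Fubini'[symmetric]) auto
  finally have 1: "ennreal \<bar>Re p\<bar> * (\<integral>\<^sup>+x. f (oblique p q x) \<partial>(lborel \<Otimes>\<^sub>M lborel)) = (\<integral>\<^sup>+x. \<integral>\<^sup>+b. G b x \<partial>lborel \<partial>lborel)" .
  define d where "d = Im (cnj p * q) / Re p"
  have d: "d \<noteq> 0" using p D by (simp add: d_def)
  have 2: "(\<integral>\<^sup>+y. f (Complex x y) \<partial>lborel) = ennreal \<bar>d\<bar> * (\<integral>\<^sup>+b. G b x \<partial>lborel)" for x
  proof -
    have "(\<integral>\<^sup>+y. f (Complex x y) \<partial>lborel) = ennreal \<bar>d\<bar> * (\<integral>\<^sup>+b. f (Complex x (x * Im p / Re p + d * b)) \<partial>lborel)"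
      using d by (intro nn_integral_real_affine) (auto simp: Complex_eq)
    moreover have "x * Im p / Re p + d * b = (x - b * Re q) * Im p / Re p + b * Im q" for b
      using p by (simp add: d_def field_simps)
    ultimately show ?thesis unfolding G_def by simp
  qed
  have "(\<integral>\<^sup>+z. f z \<partial>lborel) = ennreal \<bar>d\<bar> * (\<integral>\<^sup>+x. \<integral>\<^sup>+b. G b x \<partial>lborel \<partial>lborel)"
    unfolding nn_integral_complex[OF f] 2 by (rule nn_integral_cmult) measurable
  also have "\<dots> = (ennreal \<bar>d\<bar> * ennreal \<bar>Re p\<bar>) * (\<integral>\<^sup>+x. f (oblique p q x) \<partial>(lborel \<Otimes>\<^sub>M lborel))"
    unfolding 1[symmetric] by (simp add: mult.assoc)
  also have "ennreal \<bar>d\<bar> * ennreal \<bar>Re p\<bar> = ennreal \<bar>Im (cnj p * q)\<bar>"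
    using p by (simp add: d_def ennreal_mult[symmetric] abs_divide)
  finally show ?thesis .
qed

lemma nn_integral_oblique:
  assumes f [measurable]: "f \<in> borel_measurable borel" and D: "Im (cnj p * q) \<noteq> 0"
  shows "(\<integral>\<^sup>+z. f z \<partial>lborel) = ennreal \<bar>Im (cnj p * q)\<bar> * (\<integral>\<^sup>+x. f (oblique p q x) \<partial>(lborel \<Otimes>\<^sub>M lborel))"
proof (cases "Re p = 0")
  case False then show ?thesis using nn_integral_oblique_Re[OF f _ D] by simp
next
  case True
  then have q: "Re q \<noteq> 0" using D by auto
  have D': "Im (cnj q * p) = - Im (cnj p * q)" by simp
  have "Im (cnj q * p) \<noteq> 0" unfolding D' using D by (simp only: neg_equal_0_iff_equal) simp
  then have "(\<integral>\<^sup>+z. f z \<partial>lborel) = ennreal \<bar>Im (cnj q * p)\<bar> * (\<integral>\<^sup>+x. f (oblique q p x) \<partial>(lborel \<Otimes>\<^sub>M lborel))"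
    by (rule nn_integral_oblique_Re[OF f q])
  also have "(\<integral>\<^sup>+x. f (oblique q p x) \<partial>(lborel \<Otimes>\<^sub>M lborel)) = (\<integral>\<^sup>+a. \<integral>\<^sup>+b. f (oblique q p (a, b)) \<partial>lborel \<partial>lborel)"
    by (subst lborel.nn_integral_fst[symmetric]) auto
  also have "\<dots> = (\<integral>\<^sup>+a. \<integral>\<^sup>+b. f (oblique p q (b, a)) \<partial>lborel \<partial>lborel)" by (simp add: oblique_def add.commute)
  also have "\<dots> = (\<integral>\<^sup>+x. f (oblique p q x) \<partial>(lborel \<Otimes>\<^sub>M lborel))"
    by (subst lborel_pair.nn_integral_snd[symmetric]) auto
  finally show ?thesis unfolding D' by (simp only: abs_minus_cancel)
qed

lemma lborel_oblique:
  assumes "Im (cnj p * q) \<noteq> 0"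
  shows "lborel = density (distr (lborel \<Otimes>\<^sub>M lborel) borel (oblique p q)) (\<lambda>_. ennreal \<bar>Im (cnj p * q)\<bar>)"
proof (rule measure_eqI)
  fix A :: "complex set" assume A: "A \<in> sets lborel"
  then have [measurable]: "A \<in> sets borel" by simp
  have "emeasure lborel A = (\<integral>\<^sup>+z. indicator A z \<partial>lborel)" by simp
  also have "\<dots> = ennreal \<bar>Im (cnj p * q)\<bar> * (\<integral>\<^sup>+x. indicator A (oblique p q x) \<partial>(lborel \<Otimes>\<^sub>M lborel))"
    by (rule nn_integral_oblique[OF _ assms]) simp
  also have "(\<integral>\<^sup>+x. indicator A (oblique p q x) \<partial>(lborel \<Otimes>\<^sub>M lborel)) = (\<integral>\<^sup>+z. indicator A z \<partial>distr (lborel \<Otimes>\<^sub>M lborel) borel (oblique p q))"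
    by (subst nn_integral_distr) auto
  also have "ennreal \<bar>Im (cnj p * q)\<bar> * \<dots> = emeasure (density (distr (lborel \<Otimes>\<^sub>M lborel) borel (oblique p q)) (\<lambda>_. ennreal \<bar>Im (cnj p * q)\<bar>)) A"
    by (subst emeasure_density) (auto simp: nn_integral_cmult)
  finally show "emeasure lborel A = emeasure (density (distr (lborel \<Otimes>\<^sub>M lborel) borel (oblique p q)) (\<lambda>_. ennreal \<bar>Im (cnj p * q)\<bar>)) A" .
qed simp

lemma integral_oblique:
  fixes f :: "complex \<Rightarrow> 'b::{banach, second_countable_topology}"
  assumes f [measurable]: "f \<in> borel_measurable borel" and D: "Im (cnj p * q) \<noteq> 0"
  shows "(LINT z|lborel. f z) = \<bar>Im (cnj p * q)\<bar> *\<^sub>R (LINT x|(lborel \<Otimes>\<^sub>M lborel). f (oblique p q x))"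
  by (subst lborel_oblique[OF D], subst integral_density, simp, simp, simp, subst integral_scaleR_right, subst integral_distr) auto

lemma integrable_oblique:
  fixes f :: "complex \<Rightarrow> 'b::{banach, second_countable_topology}"
  assumes f [measurable]: "f \<in> borel_measurable borel" and D: "Im (cnj p * q) \<noteq> 0"
  shows "integrable lborel f \<longleftrightarrow> integrable (lborel \<Otimes>\<^sub>M lborel) (\<lambda>x. f (oblique p q x))"
proof -
  let ?d = "\<bar>Im (cnj p * q)\<bar>" and ?g = "\<lambda>x. f (oblique p q x)"
  have "integrable lborel f \<longleftrightarrow> integrable (lborel \<Otimes>\<^sub>M lborel) (\<lambda>x. ?d *\<^sub>R ?g x)"
    by (subst lborel_oblique[OF D], subst integrable_density) (auto simp: integrable_distr_eq)
  also have "\<dots> \<longleftrightarrow> integrable (lborel \<Otimes>\<^sub>M lborel) ?g"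
  proof
    assume "integrable (lborel \<Otimes>\<^sub>M lborel) (\<lambda>x. ?d *\<^sub>R ?g x)"
    then have "integrable (lborel \<Otimes>\<^sub>M lborel) (\<lambda>x. inverse ?d *\<^sub>R (?d *\<^sub>R ?g x))" by (rule integrable_scaleR_right)
    then show "integrable (lborel \<Otimes>\<^sub>M lborel) ?g" using D by (simp only: scaleR_scaleR) (simp del: times_complex.sel)
  qed (rule integrable_scaleR_right)
  finally show ?thesis .
qed

text \<open>A rotation carries the frame (1, i) to (c, c i), and both frames have determinant
  1.\<close>

lemma integral_rotate:
  fixes f :: "complex \<Rightarrow> 'b::{banach, second_countable_topology}"
  assumes f [measurable]: "f \<in> borel_measurable borel" and c: "cmod c = 1"
  shows "(LINT z|lborel. f (c * z)) = (LINT z|lborel. f z)"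
proof -
  have cc: "cnj c * c = 1" using c by (metis complex_norm_square mult.commute of_real_1 power_one)
  have D: "Im (cnj c * (c * \<i>)) = 1" using cc by (metis mult.assoc mult_1 imaginary_unit.sel(2))
  have D1: "Im (cnj 1 * \<i>) = 1" by simp
  have "(LINT z|lborel. f (c * z)) = (LINT x|(lborel \<Otimes>\<^sub>M lborel). f (c * oblique 1 \<i> x))"
    using integral_oblique[of "\<lambda>z. f (c * z)" 1 \<i>] by simp
  also have "(\<lambda>x. f (c * oblique 1 \<i> x)) = (\<lambda>x. f (oblique c (c * \<i>) x))"
    by (simp add: oblique_def fun_eq_iff algebra_simps)
  also have "(LINT x|(lborel \<Otimes>\<^sub>M lborel). f (oblique c (c * \<i>) x)) = (LINT z|lborel. f z)"
    using integral_oblique[OF f, of c "c * \<i>"] unfolding D by simp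
  finally show ?thesis .
qed

lemma integral_translate:
  fixes f :: "complex \<Rightarrow> 'b::{banach, second_countable_topology}"
  assumes f [measurable]: "f \<in> borel_measurable borel"
  shows "(LINT z|lborel. f (z + c)) = (LINT z|lborel. f z)"
proof -
  have "(LINT z|lborel. f z) = (LINT z|distr lborel borel ((+) c). f z)" by (simp add: lborel_distr_plus)
  also have "\<dots> = (LINT z|lborel. f (c + z))" by (subst integral_distr) auto
  finally show ?thesis by (simp add: add.commute)
qed

section \<open>Gaussian integrals on the line and in the plane\<close>

lemma integrable_gaussian_real:
  assumes "A > 0"
  shows "integrable lborel (\<lambda>x::real. exp (- A * x\<^sup>2))" "(LINT x|lborel. exp (- A * x\<^sup>2)) = sqrt (pi / A)"
proof -
  define s where "s = sqrt (1 / (2 * A))"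
  have s: "s\<^sup>2 = 1 / (2 * A)" using assms by (simp add: s_def)
  have eq: "exp (- A * x\<^sup>2) = sqrt (pi / A) * normal_density 0 s x" for x
    using assms by (simp add: normal_density_def s)
  have "s > 0" using assms by (simp add: s_def)
  then show "integrable lborel (\<lambda>x::real. exp (- A * x\<^sup>2))" "(LINT x|lborel. exp (- A * x\<^sup>2)) = sqrt (pi / A)"
    unfolding eq by simp_all
qed

lemma gaussian_complex:
  assumes "A > 0"
  shows "integrable lborel (\<lambda>z. exp (- A * (cmod z)\<^sup>2))" "(LINT z|lborel. exp (- A * (cmod z)\<^sup>2)) = pi / A"
proof -
  have m: "(\<lambda>z. exp (- A * (cmod z)\<^sup>2)) \<in> borel_measurable borel" by measurable
  have o: "exp (- A * (cmod (oblique 1 \<i> x))\<^sup>2) = (case x of (a, b) \<Rightarrow> exp (- A * a\<^sup>2) * exp (- A * b\<^sup>2))" for x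
    by (simp add: oblique_def cmod_power2 case_prod_beta exp_add[symmetric] algebra_simps)
  have D: "Im (cnj 1 * \<i>) = 1" by simp
  have i: "integrable (lborel \<Otimes>\<^sub>M lborel) (\<lambda>(a, b). exp (- A * a\<^sup>2) * exp (- A * b\<^sup>2))"
    by (rule lborel_pair.Fubini_integrable)
       (use integrable_gaussian_real[OF assms] in \<open>auto simp: abs_mult\<close>)
  show "integrable lborel (\<lambda>z. exp (- A * (cmod z)\<^sup>2))"
    using integrable_oblique[OF m, of 1 \<i>] i unfolding o by simp
  have "(LINT z|lborel. exp (- A * (cmod z)\<^sup>2)) = (LINT x|(lborel \<Otimes>\<^sub>M lborel). (case x of (a, b) \<Rightarrow> exp (- A * a\<^sup>2) * exp (- A * b\<^sup>2)))"
    using integral_oblique[OF m, of 1 \<i>] unfolding o by simp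
  also have "\<dots> = (LINT b|lborel. (LINT a|lborel. exp (- A * a\<^sup>2) * exp (- A * b\<^sup>2)))"
    using lborel_pair.integral_snd[OF i] by simp
  also have "\<dots> = sqrt (pi / A) * sqrt (pi / A)"
    using integrable_gaussian_real[OF assms] by simp
  finally show "(LINT z|lborel. exp (- A * (cmod z)\<^sup>2)) = pi / A" using assms by simp
qed

subsection \<open>Integrals over a fundamental cell\<close>

locale lattice_cell =
  fixes \<tau> :: complex and \<gamma> :: real
  assumes tau: "Im \<tau> > 0" and gam: "\<gamma> > 0"
begin

definition point :: "real \<Rightarrow> real \<Rightarrow> complex" where "point a b = of_real \<gamma> * (of_real a + of_real b * \<tau>)"

lemma point_oblique: "point a b = oblique (of_real \<gamma>) (of_real \<gamma> * \<tau>) (a, b)"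
  by (simp add: point_def oblique_def algebra_simps)

lemma jacobian: "Im (cnj (of_real \<gamma>) * (of_real \<gamma> * \<tau>)) = \<gamma>\<^sup>2 * Im \<tau>" "\<gamma>\<^sup>2 * Im \<tau> > 0"
  using tau gam by (auto simp: power2_eq_square)

lemma point_inj: "point a b = point a' b' \<longleftrightarrow> a = a' \<and> b = b'"
proof -
  have "of_real a + of_real b * \<tau> = of_real a' + of_real b' * \<tau> \<longleftrightarrow> a = a' \<and> b = b'"
    using tau by (auto simp: complex_eq_iff)
  then show ?thesis using gam by (simp add: point_def)
qed

lemma point_surj: "\<exists>a b. z = point a b"
proof -
  define b where "b = Im z / (\<gamma> * Im \<tau>)"
  define a where "a = Re z / \<gamma> - b * Re \<tau>"
  have "z = point a b" using tau gam by (simp add: point_def complex_eq_iff a_def b_def field_simps)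
  then show ?thesis by blast
qed

lemma cell_eq: "cell \<tau> \<gamma> = (\<lambda>(a, b). point a b) ` ({0..1} \<times> {0..1})"
  unfolding cell_def point_def by force

lemma compact_cell: "compact (cell \<tau> \<gamma>)"
  unfolding cell_eq point_def case_prod_beta by (intro compact_continuous_image compact_Times continuous_intros) auto

lemma cell_integrable:
  fixes f :: "complex \<Rightarrow> 'b::{banach, second_countable_topology}"
  shows "continuous_on UNIV f \<Longrightarrow> set_integrable lborel (cell \<tau> \<gamma>) f"
  unfolding set_integrable_def by (rule borel_integrable_compact[OF compact_cell]) (auto intro: continuous_on_subset)

lemma continuous_on_point:
  "continuous_on UNIV f \<Longrightarrow> continuous_on S g \<Longrightarrow> continuous_on S h \<Longrightarrow> continuous_on S (\<lambda>x. f (point (g x) (h x)))"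
  by (rule continuous_on_compose2[of UNIV f]) (auto simp: point_def intro!: continuous_intros)

text \<open>The inner integration runs along the real period \<gamma>, the direction in which the
  theta functions are Fourier series.\<close>

lemma cell_integral:
  fixes f :: "complex \<Rightarrow> 'b::euclidean_space"
  assumes f: "continuous_on UNIV f"
  shows "(LINT z:cell \<tau> \<gamma>|lborel. f z) = (\<gamma>\<^sup>2 * Im \<tau>) *\<^sub>R integral {0..1} (\<lambda>b. integral {0..1} (\<lambda>a. f (point a b)))"
proof -
  have [measurable]: "f \<in> borel_measurable borel" using f by (rule borel_measurable_continuous_onI)
  have [measurable]: "cell \<tau> \<gamma> \<in> sets borel" using compact_cell by (simp add: compact_imp_closed borel_closed)
  have ind: "indicat_real (cell \<tau> \<gamma>) (oblique (of_real \<gamma>) (of_real \<gamma> * \<tau>) x) = indicat_real ({0..1} \<times> {0..1}) x" for x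
  proof -
    obtain a b where x: "x = (a, b)" by (cases x)
    have "point a b \<in> cell \<tau> \<gamma> \<longleftrightarrow> x \<in> {0..1} \<times> {0..1}"
      unfolding cell_eq x by (auto simp: point_inj image_iff)
    then have "oblique (of_real \<gamma>) (of_real \<gamma> * \<tau>) x \<in> cell \<tau> \<gamma> \<longleftrightarrow> x \<in> {0..1} \<times> {0..1}"
      unfolding point_oblique x .
    then show ?thesis by (simp add: indicator_def)
  qed
  define F where "F x = f (point (fst x) (snd x))" for x :: "real \<times> real"
  have cF: "continuous_on S F" for S unfolding F_def by (intro continuous_on_point[OF f] continuous_intros)
  have box: "{0..1} \<times> {0..1} = cbox (0::real, 0::real) (1, 1)" by (simp add: cbox_Pair_eq)
  have "(LINT z:cell \<tau> \<gamma>|lborel. f z) = (\<gamma>\<^sup>2 * Im \<tau>) *\<^sub>R (LINT x|(lborel \<Otimes>\<^sub>M lborel). indicat_real (cell \<tau> \<gamma>) (oblique (of_real \<gamma>) (of_real \<gamma> * \<tau>) x) *\<^sub>R f (oblique (of_real \<gamma>) (of_real \<gamma> * \<tau>) x))"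
  proof -
    have nz: "Im (cnj (of_real \<gamma>) * (of_real \<gamma> * \<tau>)) \<noteq> 0" using jacobian by linarith
    have D: "\<bar>Im (cnj (of_real \<gamma>) * (of_real \<gamma> * \<tau>))\<bar> = \<gamma>\<^sup>2 * Im \<tau>"
      unfolding jacobian(1) using jacobian(2) by (rule abs_of_pos)
    have m: "(\<lambda>z. indicat_real (cell \<tau> \<gamma>) z *\<^sub>R f z) \<in> borel_measurable borel" by measurable
    show ?thesis unfolding set_lebesgue_integral_def integral_oblique[OF m nz] D ..
  qed
  also have "(LINT x|(lborel \<Otimes>\<^sub>M lborel). indicat_real (cell \<tau> \<gamma>) (oblique (of_real \<gamma>) (of_real \<gamma> * \<tau>) x) *\<^sub>R f (oblique (of_real \<gamma>) (of_real \<gamma> * \<tau>) x)) =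
     (LINT x:cbox (0,0) (1,1)|lborel. F x)"
    unfolding ind lborel_prod set_lebesgue_integral_def box[symmetric] F_def point_oblique by simp
  also have "\<dots> = integral (cbox (0,0) (1,1)) F"
    by (rule set_borel_integral_eq_integral) (unfold set_integrable_def, rule borel_integrable_compact, auto simp: cF)
  also have "\<dots> = integral (cbox 0 1) (\<lambda>a. integral (cbox 0 1) (\<lambda>b. F (a, b)))"
    by (rule integral_prod_continuous[OF cF])
  also have "\<dots> = integral (cbox 0 1) (\<lambda>b. integral (cbox 0 1) (\<lambda>a. F (a, b)))"
    by (rule integral_swap_continuous) (simp add: cF)
  finally show ?thesis by (simp add: F_def)
qed

lemma periodic_integral_shift:
  fixes F :: "real \<Rightarrow> 'b::euclidean_space"
  assumes F: "continuous_on UNIV F" and per: "\<And>x. F (x + 1) = F x"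
  shows "integral {0..1} (\<lambda>x. F (x + s)) = integral {0..1} F"
proof -
  \<comment> \<open>The interval contains all points x + r that occur in its interior, so that the
    antiderivative has two-sided derivatives there.\<close>
  define M where "M = \<bar>s\<bar> + 2"
  obtain A where A: "\<And>x. x \<in> {-M..M} \<Longrightarrow> (A has_vector_derivative F x) (at x within {-M..M})"
    using antiderivative_continuous[of "-M" M F] F continuous_on_subset by blast
  have A': "(A has_vector_derivative F x) (at x)" if "x \<in> {-M<..<M}" for x
    using A[of x] that by (simp add: at_within_Icc_at)
  have I: "integral {0..1} (\<lambda>x. F (x + r)) = A (1 + r) - A r" if r: "\<bar>r\<bar> \<le> \<bar>s\<bar>" for r
  proof (rule integral_unique, rule has_integral_eq_rhs, rule fundamental_theorem_of_calculus)
    fix x :: real assume x: "x \<in> {0..1}"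
    have xr: "x + r \<in> {-M<..<M}" using x r unfolding M_def by (smt (verit) atLeastAtMost_iff greaterThanLessThan_iff)
    have "((A \<circ> (\<lambda>x. x + r)) has_vector_derivative 1 *\<^sub>R F (x + r)) (at x)"
      by (rule vector_diff_chain_at) (use A'[OF xr] in \<open>auto intro!: derivative_eq_intros\<close>)
    then show "((\<lambda>x. A (x + r)) has_vector_derivative F (x + r)) (at x within {0..1})"
      by (simp add: o_def has_vector_derivative_at_within)
  qed (auto simp: add.commute)
  have "\<exists>c. \<forall>r\<in>closed_segment 0 s. A (1 + r) - A r = c"
  proof (rule has_derivative_zero_constant)
    fix r assume r: "r \<in> closed_segment 0 s"
    then have r': "\<bar>r\<bar> \<le> \<bar>s\<bar>" by (auto simp: closed_segment_eq_real_ivl split: if_splits)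
    have r1: "1 + r \<in> {-M<..<M}" using r' unfolding M_def by (smt (verit) greaterThanLessThan_iff)
    have "((A \<circ> (\<lambda>r. 1 + r)) has_vector_derivative 1 *\<^sub>R F (1 + r)) (at r)"
      by (rule vector_diff_chain_at) (use A'[OF r1] in \<open>auto intro!: derivative_eq_intros\<close>)
    moreover have "(A has_vector_derivative F r) (at r)" using r' by (intro A') (auto simp: M_def)
    ultimately have "((\<lambda>r. A (1 + r) - A r) has_vector_derivative F (1 + r) - F r) (at r)"
      by (auto simp: o_def intro: has_vector_derivative_diff)
    then show "((\<lambda>r. A (1 + r) - A r) has_derivative (\<lambda>h. 0)) (at r within closed_segment 0 s)"
      using per[of r] by (simp add: has_vector_derivative_def add.commute has_derivative_at_withinI)
  qed simp
  then have "A (1 + s) - A s = A (1 + 0) - A 0" by (metis ends_in_segment)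
  then show ?thesis using I[of s] I[of 0] by simp
qed

text \<open>In the coordinates of the cell a translation shifts each of the two variables, and both
  integrals extend over a full period.\<close>

lemma cell_translate:
  fixes f :: "complex \<Rightarrow> 'b::euclidean_space"
  assumes f: "continuous_on UNIV f" and per: "\<And>z. f (z + of_real \<gamma>) = f z" "\<And>z. f (z + of_real \<gamma> * \<tau>) = f z"
  shows "(LINT z:cell \<tau> \<gamma>|lborel. f (z + w)) = (LINT z:cell \<tau> \<gamma>|lborel. f z)"
proof -
  obtain s t where w: "w = point s t" using point_surj by blast
  have add: "point a b + point s t = point (a + s) (b + t)" for a b by (simp add: point_def algebra_simps)
  have fw: "continuous_on UNIV (\<lambda>z. f (z + w))"
    by (rule continuous_on_compose2[OF f]) (auto intro!: continuous_intros)
  define J where "J b = integral {0..1} (\<lambda>a. f (point a b))" for b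
  have cJ: "continuous_on UNIV J"
  proof -
    have "continuous_on (UNIV \<times> cbox 0 1) (\<lambda>(b, a). f (point a b))"
      unfolding case_prod_beta by (intro continuous_on_point[OF f] continuous_intros)
    then show ?thesis unfolding J_def using integral_continuous_on_param[of UNIV 0 1 "\<lambda>b a. f (point a b)"] by simp
  qed
  have J1: "J (b + 1) = J b" for b
  proof -
    have "f (point a (b + 1)) = f (point a b)" for a using per(2)[of "point a b"] by (simp add: point_def algebra_simps)
    then show ?thesis by (simp add: J_def)
  qed
  have inner: "integral {0..1} (\<lambda>a. f (point (a + s) (b + t))) = J (b + t)" for b
    unfolding J_def
  proof (rule periodic_integral_shift)
    show "continuous_on UNIV (\<lambda>a. f (point a (b + t)))" by (intro continuous_on_point[OF f] continuous_intros)
    show "f (point (x + 1) (b + t)) = f (point x (b + t))" for x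
      using per(1)[of "point x (b + t)"] by (simp add: point_def algebra_simps)
  qed
  have "(LINT z:cell \<tau> \<gamma>|lborel. f (z + w)) = (\<gamma>\<^sup>2 * Im \<tau>) *\<^sub>R integral {0..1} (\<lambda>b. J (b + t))"
  proof -
    have "(LINT z:cell \<tau> \<gamma>|lborel. f (z + w)) = (\<gamma>\<^sup>2 * Im \<tau>) *\<^sub>R integral {0..1} (\<lambda>b. integral {0..1} (\<lambda>a. f (point a b + w)))"
      by (rule cell_integral[OF fw])
    then show ?thesis unfolding w add inner .
  qed
  also have "integral {0..1} (\<lambda>b. J (b + t)) = integral {0..1} J" by (rule periodic_integral_shift[OF cJ J1])
  also have "(\<gamma>\<^sup>2 * Im \<tau>) *\<^sub>R integral {0..1} J = (LINT z:cell \<tau> \<gamma>|lborel. f z)" unfolding cell_integral[OF f] J_def ..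
  finally show ?thesis .
qed

lemma periodic_bounded:
  fixes f :: "complex \<Rightarrow> real"
  assumes f: "continuous_on UNIV f" and per: "\<And>z. f (z + of_real \<gamma>) = f z" "\<And>z. f (z + of_real \<gamma> * \<tau>) = f z"
  shows "\<exists>B. \<forall>z. \<bar>f z\<bar> \<le> B"
proof -
  have "bounded (f ` cell \<tau> \<gamma>)"
    by (intro compact_imp_bounded compact_continuous_image compact_cell continuous_on_subset[OF f]) auto
  then obtain B where B: "\<forall>y\<in>f ` cell \<tau> \<gamma>. norm y \<le> B" unfolding bounded_iff by auto
  have p1: "f (z + of_int m * of_real \<gamma>) = f z" for m z
  proof (induction m rule: int_induct[where k=0])
    case (step1 i) then show ?case using per(1)[of "z + of_int i * of_real \<gamma>"] by (simp add: algebra_simps)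
  next
    case (step2 i) then show ?case using per(1)[of "z + of_int (i - 1) * of_real \<gamma>"] by (simp add: algebra_simps)
  qed simp
  have p2: "f (z + of_int m * (of_real \<gamma> * \<tau>)) = f z" for m z
  proof (induction m rule: int_induct[where k=0])
    case (step1 i) then show ?case using per(2)[of "z + of_int i * (of_real \<gamma> * \<tau>)"] by (simp add: algebra_simps)
  next
    case (step2 i) then show ?case using per(2)[of "z + of_int (i - 1) * (of_real \<gamma> * \<tau>)"] by (simp add: algebra_simps)
  qed simp
  have "\<bar>f z\<bar> \<le> B" for z
  proof -
    obtain a b where z: "z = point a b" using point_surj by blast
    have "z = point (frac a) (frac b) + of_int \<lfloor>a\<rfloor> * of_real \<gamma> + of_int \<lfloor>b\<rfloor> * (of_real \<gamma> * \<tau>)"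
      unfolding z by (simp add: point_def frac_def algebra_simps)
    then have "f z = f (point (frac a) (frac b))" using p1 p2 by simp
    moreover have "point (frac a) (frac b) \<in> cell \<tau> \<gamma>"
      unfolding cell_eq using frac_lt_1[of a] frac_lt_1[of b] frac_ge_0[of a] frac_ge_0[of b] by force
    ultimately show ?thesis using B by simp
  qed
  then show ?thesis by blast
qed

end

subsection \<open>The projection on quasi-periodic functions\<close>

lemma mag_trans_norm: "cmod (mag_trans \<alpha> v z) = cmod (v (z + \<alpha>))"
proof -
  have "Re ((\<alpha> * cnj z - cnj \<alpha> * z) / 2) = 0" by simp
  then show ?thesis unfolding mag_trans_def norm_mult norm_exp_eq_Re by simp
qed

lemma cnj_exponent: "of_real ((cmod z)\<^sup>2) = z * cnj z" by (rule complex_norm_square)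

lemma cnj_borel_measurable [measurable]: "cnj \<in> borel_measurable borel"
  by (intro borel_measurable_continuous_onI continuous_intros)

lemma kernel_norm': "exp (cmod w * cmod z - (cmod w)\<^sup>2 / 2) \<le> exp ((cmod z)\<^sup>2) * exp (- (1/4) * (cmod w)\<^sup>2)"
proof -
  have "cmod w * cmod z - (cmod w)\<^sup>2 / 2 \<le> (cmod z)\<^sup>2 - (1/4) * (cmod w)\<^sup>2"
    using zero_le_power2[of "cmod z - cmod w / 2"] by (simp add: power2_eq_square field_simps)
  then show ?thesis unfolding exp_add[symmetric] by simp
qed

text \<open>exp(conj(w) z) is expanded in powers of z and integrated term by term. All partial sums
  are dominated by exp(|w| |z|), which the Gaussian weight makes integrable, so the integral is an
  everywhere convergent power series with the moments \<open>m n\<close> as coefficients.\<close>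

lemma LLL_proj_holomorphic:
  assumes v: "v \<in> borel_measurable borel" and B: "\<And>w. cmod (v w) \<le> B"
  shows "(\<lambda>z. LINT w|lborel. exp (cnj w * z - of_real ((cmod w)\<^sup>2) / 2) * v w) holomorphic_on UNIV"
proof -
  note v[measurable]
  have B0: "B \<ge> 0" using B[of 0] norm_ge_zero order_trans by blast
  define g where "g w = exp (- of_real ((cmod w)\<^sup>2) / 2) * v w" for w
  have [measurable]: "g \<in> borel_measurable borel" unfolding g_def by measurable
  have gn: "cmod (g w) \<le> B * exp (- (cmod w)\<^sup>2 / 2)" for w
    using mult_left_mono[OF B[of w], of "exp (- (cmod w)\<^sup>2 / 2)"] by (simp add: g_def norm_mult norm_exp_eq_Re mult.commute)
  define m where "m n = (LINT w|lborel. cnj w ^ n / fact n * g w)" for n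
  have expo: "exp (cnj w * z - of_real ((cmod w)\<^sup>2) / 2) * v w = exp (cnj w * z) * g w" for w z
    unfolding g_def mult.assoc[symmetric] exp_add[symmetric] by simp
  have partial: "cmod (\<Sum>i<n. (cnj w * z) ^ i / fact i) \<le> exp (cmod w * cmod z)" for n w z
  proof -
    have "cmod (\<Sum>i<n. (cnj w * z) ^ i / fact i) \<le> (\<Sum>i<n. (cmod w * cmod z) ^ i / fact i)"
      by (rule order.trans[OF norm_sum]) (simp add: norm_divide norm_power norm_mult)
    also have "\<dots> \<le> (\<Sum>i. (cmod w * cmod z) ^ i / fact i)"
      using summable_exp_generic[of "cmod w * cmod z"] by (intro sum_le_suminf) (auto simp: divide_inverse mult.commute)
    also have "\<dots> = exp (cmod w * cmod z)" by (simp add: exp_def divide_inverse mult.commute)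
    finally show ?thesis .
  qed
  have dom: "cmod (a * g w) \<le> (B * exp ((cmod z)\<^sup>2)) * exp (- (1/4) * (cmod w)\<^sup>2)" if a: "cmod a \<le> exp (cmod w * cmod z)" for a w z
  proof -
    have "cmod (a * g w) \<le> exp (cmod w * cmod z) * (B * exp (- (cmod w)\<^sup>2 / 2))"
      unfolding norm_mult using a gn by (intro mult_mono) auto
    also have "\<dots> = B * (exp (cmod w * cmod z) * exp (- (cmod w)\<^sup>2 / 2))" by (simp only: mult_ac)
    also have "exp (cmod w * cmod z) * exp (- (cmod w)\<^sup>2 / 2) = exp (cmod w * cmod z - (cmod w)\<^sup>2 / 2)"
      unfolding exp_add[symmetric] by simp
    also have "B * exp (cmod w * cmod z - (cmod w)\<^sup>2 / 2) \<le> B * (exp ((cmod z)\<^sup>2) * exp (- (1/4) * (cmod w)\<^sup>2))"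
      using kernel_norm' B0 by (intro mult_left_mono) auto
    finally show ?thesis by (simp add: mult.assoc)
  qed
  have gauss: "integrable lborel (\<lambda>w. (B * exp ((cmod z)\<^sup>2)) * exp (- (1/4) * (cmod w)\<^sup>2))" for z :: complex
    using gaussian_complex(1)[of "1/4"] by (intro integrable_mult_right) simp
  have term_int: "integrable lborel (\<lambda>w. (cnj w * z) ^ n / fact n * g w)" for n z
  proof (rule Bochner_Integration.integrable_bound[OF gauss[of z]])
    have "cmod ((cnj w * z) ^ n / fact n) \<le> exp (cmod w * cmod z)" for w
    proof -
      have "cmod ((cnj w * z) ^ n / fact n) = (\<Sum>i\<in>{n}. (cmod w * cmod z) ^ i / fact i)"
        by (simp add: norm_divide norm_power norm_mult)
      also have "\<dots> \<le> (\<Sum>i. (cmod w * cmod z) ^ i / fact i)"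
        using summable_exp_generic[of "cmod w * cmod z"] by (intro sum_le_suminf) (auto simp: divide_inverse mult.commute)
      also have "\<dots> = exp (cmod w * cmod z)" by (simp add: exp_def divide_inverse mult.commute)
      finally show ?thesis .
    qed
    from dom[OF this] B0
    show "AE w in lborel. norm ((cnj w * z) ^ n / fact n * g w) \<le> norm ((B * exp ((cmod z)\<^sup>2)) * exp (- (1/4) * (cmod w)\<^sup>2))"
      by (simp add: abs_mult)
  qed measurable
  have sums: "(\<lambda>n. m n * z ^ n) sums (LINT w|lborel. exp (cnj w * z) * g w)" for z
    unfolding sums_def
  proof -
    have "(\<lambda>n. LINT w|lborel. (\<Sum>i<n. (cnj w * z) ^ i / fact i) * g w) \<longlonglongrightarrow> (LINT w|lborel. exp (cnj w * z) * g w)"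
    proof (rule integral_dominated_convergence[OF _ _ gauss[of z]])
      show "AE w in lborel. (\<lambda>n. (\<Sum>i<n. (cnj w * z) ^ i / fact i) * g w) \<longlonglongrightarrow> exp (cnj w * z) * g w"
      proof (intro AE_I2 tendsto_mult tendsto_const)
        fix w
        show "(\<lambda>n. \<Sum>i<n. (cnj w * z) ^ i / fact i) \<longlonglongrightarrow> exp (cnj w * z)"
          using exp_converges[of "cnj w * z"] unfolding sums_def by (simp add: scaleR_conv_of_real divide_inverse mult.commute)
      qed
      show "AE w in lborel. norm ((\<Sum>i<n. (cnj w * z) ^ i / fact i) * g w) \<le> (B * exp ((cmod z)\<^sup>2)) * exp (- (1/4) * (cmod w)\<^sup>2)" for n
        using dom[OF partial] by simp
    qed measurable
    moreover have "(LINT w|lborel. (\<Sum>i<n. (cnj w * z) ^ i / fact i) * g w) = (\<Sum>i<n. m i * z ^ i)" for n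
    proof -
      have "(LINT w|lborel. (\<Sum>i<n. (cnj w * z) ^ i / fact i) * g w) = (LINT w|lborel. (\<Sum>i<n. (cnj w * z) ^ i / fact i * g w))"
        by (simp add: sum_distrib_right)
      also have "\<dots> = (\<Sum>i<n. LINT w|lborel. (cnj w * z) ^ i / fact i * g w)"
        using term_int by (intro Bochner_Integration.integral_sum) auto
      also have "\<dots> = (\<Sum>i<n. m i * z ^ i)"
      proof (rule sum.cong[OF refl])
        fix i
        have "(LINT w|lborel. (cnj w * z) ^ i / fact i * g w) = (LINT w|lborel. (cnj w ^ i / fact i * g w) * z ^ i)"
          by (simp add: power_mult_distrib mult_ac)
        then show "(LINT w|lborel. (cnj w * z) ^ i / fact i * g w) = m i * z ^ i" unfolding m_def by simp
      qed
      finally show ?thesis .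
    qed
    ultimately show "(\<lambda>n. \<Sum>i<n. m i * z ^ i) \<longlonglongrightarrow> (LINT w|lborel. exp (cnj w * z) * g w)" by simp
  qed
  have "(LINT w|lborel. exp (cnj w * z) * g w) = (\<Sum>n. m n * z ^ n)" for z using sums[of z] by (rule sums_unique)
  then have "(\<lambda>z. LINT w|lborel. exp (cnj w * z) * g w) = (\<lambda>z. \<Sum>n. m n * z ^ n)" by auto
  moreover have "(\<lambda>z. \<Sum>n. m n * z ^ n) holomorphic_on UNIV"
    unfolding holomorphic_on_def field_differentiable_def
    using termdiffs_strong_converges_everywhere[of m, OF sums_summable[OF sums]] by auto
  ultimately show ?thesis unfolding expo by simp
qed

text \<open>Substituting w + \<alpha> for w, the phases of kernel and translation match. So the
  projection preserves quasi-periodicity, and its value at z can be computed at the origin.\<close>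

lemma LLL_proj_mag_trans:
  assumes v [measurable]: "v \<in> borel_measurable borel"
  shows "mag_trans \<alpha> (LLL_proj v) = LLL_proj (mag_trans \<alpha> v)"
proof
  fix z
  have eq: "exp ((\<alpha> * cnj z - cnj \<alpha> * z) / 2) * exp (- of_real ((cmod (z + \<alpha>))\<^sup>2) / 2) * exp (cnj (w + \<alpha>) * (z + \<alpha>) - of_real ((cmod (w + \<alpha>))\<^sup>2) / 2) =
    exp (- of_real ((cmod z)\<^sup>2) / 2) * (exp (cnj w * z - of_real ((cmod w)\<^sup>2) / 2) * exp ((\<alpha> * cnj w - cnj \<alpha> * w) / 2))" for w
    unfolding exp_add[symmetric] cnj_exponent by (rule arg_cong[where f = exp]) (simp add: field_simps)
  have "mag_trans \<alpha> (LLL_proj v) z = of_real (1 / pi) * ((exp ((\<alpha> * cnj z - cnj \<alpha> * z) / 2) * exp (- of_real ((cmod (z + \<alpha>))\<^sup>2) / 2)) *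
     (LINT w|lborel. exp (cnj w * (z + \<alpha>) - of_real ((cmod w)\<^sup>2) / 2) * v w))"
    by (simp add: mag_trans_def LLL_proj_def mult_ac)
  also have "(LINT w|lborel. exp (cnj w * (z + \<alpha>) - of_real ((cmod w)\<^sup>2) / 2) * v w) =
     (LINT w|lborel. exp (cnj (w + \<alpha>) * (z + \<alpha>) - of_real ((cmod (w + \<alpha>))\<^sup>2) / 2) * v (w + \<alpha>))"
    by (rule integral_translate[symmetric]) measurable
  also have "(exp ((\<alpha> * cnj z - cnj \<alpha> * z) / 2) * exp (- of_real ((cmod (z + \<alpha>))\<^sup>2) / 2)) * \<dots> =
     (LINT w|lborel. (exp ((\<alpha> * cnj z - cnj \<alpha> * z) / 2) * exp (- of_real ((cmod (z + \<alpha>))\<^sup>2) / 2)) * (exp (cnj (w + \<alpha>) * (z + \<alpha>) - of_real ((cmod (w + \<alpha>))\<^sup>2) / 2) * v (w + \<alpha>)))"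
    by (rule integral_mult_right_zero[symmetric])
  also have "\<dots> = (LINT w|lborel. exp (- of_real ((cmod z)\<^sup>2) / 2) * (exp (cnj w * z - of_real ((cmod w)\<^sup>2) / 2) * mag_trans \<alpha> v w))"
    unfolding mult.assoc[symmetric] eq mag_trans_def by (simp only: mult.assoc)
  also have "\<dots> = exp (- of_real ((cmod z)\<^sup>2) / 2) * (LINT w|lborel. exp (cnj w * z - of_real ((cmod w)\<^sup>2) / 2) * mag_trans \<alpha> v w)"
    by (rule integral_mult_right_zero)
  also have "of_real (1 / pi) * \<dots> = LLL_proj (mag_trans \<alpha> v) z" by (simp only: LLL_proj_def mult.assoc)
  finally show "mag_trans \<alpha> (LLL_proj v) z = LLL_proj (mag_trans \<alpha> v) z" .
qed

section \<open>Mean value property for the Gaussian weight\<close>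

lemma entire_circle_mean:
  assumes "F holomorphic_on UNIV"
  shows "((\<lambda>t. F (exp (2 * of_real pi * \<i> * of_real t) * w)) has_integral F 0) {0..1}"
proof -
  have "(\<lambda>\<zeta>. F (\<zeta> * w)) holomorphic_on cball 0 1"
    by (rule holomorphic_on_compose_gen[OF _ assms, unfolded o_def]) (auto intro!: holomorphic_intros)
  then have "((\<lambda>u. F (u * w) / (u - 0)) has_contour_integral (2 * of_real pi * \<i> * F (0 * w))) (circlepath 0 1)"
    by (intro Cauchy_integral_circlepath_simple) auto
  then have "((\<lambda>t. F (circlepath 0 1 t * w) / (circlepath 0 1 t - 0) * vector_derivative (circlepath 0 1) (at t within {0..1}))
     has_integral (2 * of_real pi * \<i> * F (0 * w))) {0..1}" by (simp only: has_contour_integral_def)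
  then have "((\<lambda>t. 2 * of_real pi * \<i> * F (exp (2 * of_real pi * \<i> * of_real t) * w)) has_integral (2 * of_real pi * \<i> * F 0)) {0..1}"
  proof (rule has_integral_eq_rhs[OF has_integral_eq[rotated]])
    fix t :: real assume "t \<in> {0..1}"
    then have "vector_derivative (circlepath 0 1) (at t within {0..1}) = 2 * of_real pi * \<i> * exp (2 * of_real pi * \<i> * of_real t)"
      using vector_derivative_circlepath01[of t 0 1] by simp
    then show "F (circlepath 0 1 t * w) / (circlepath 0 1 t - 0) * vector_derivative (circlepath 0 1) (at t within {0..1}) =
      2 * of_real pi * \<i> * F (exp (2 * of_real pi * \<i> * of_real t) * w)"
      by (simp add: circlepath)
  qed simp
  then have "((\<lambda>t. 1 / (2 * of_real pi * \<i>) * (2 * of_real pi * \<i> * F (exp (2 * of_real pi * \<i> * of_real t) * w))) has_integral (1 / (2 * of_real pi * \<i>) * (2 * of_real pi * \<i> * F 0))) {0..1}"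
    by (rule has_integral_mult_right)
  then show ?thesis by simp
qed

text \<open>The weight is rotation invariant, so the integral equals its average over rotations.
  After exchanging the integrals, the mean over each circle is F 0, and the weight has total mass
  pi. The growth condition leaves the integrable factor exp(-|w|^2 / 2) for Fubini.\<close>

lemma gaussian_mean_value:
  assumes F: "F holomorphic_on UNIV" and B: "\<And>w. cmod (F w) \<le> B * exp ((cmod w)\<^sup>2 / 2)"
  shows "(LINT w|lborel. exp (- of_real ((cmod w)\<^sup>2)) * F w) = of_real pi * F 0"
proof -
  have cF: "continuous_on UNIV F" using F by (rule holomorphic_on_imp_continuous_on)
  then have [measurable]: "F \<in> borel_measurable borel" by (rule borel_measurable_continuous_onI)
  define h where "h w = exp (- of_real ((cmod w)\<^sup>2)) * F w" for w
  have [measurable]: "h \<in> borel_measurable borel" unfolding h_def by measurable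
  define c where "c t = exp (2 * of_real pi * \<i> * of_real t)" for t :: real
  have c1: "cmod (c t) = 1" for t by (simp add: c_def norm_exp_eq_Re)
  have [measurable]: "c \<in> borel_measurable borel" unfolding c_def by measurable
  have hb: "cmod (h w) \<le> B * exp (- (1/2) * (cmod w)\<^sup>2)" for w
  proof -
    have "cmod (h w) \<le> exp (- (cmod w)\<^sup>2) * (B * exp ((cmod w)\<^sup>2 / 2))"
      unfolding h_def norm_mult norm_exp_eq_Re by (intro mult_mono B) auto
    also have "\<dots> = B * exp (- (1/2) * (cmod w)\<^sup>2)" by (simp add: exp_add[symmetric] mult.left_commute)
    finally show ?thesis .
  qed
  have hi: "integrable lborel h"
  proof (rule Bochner_Integration.integrable_bound)
    show "integrable lborel (\<lambda>w. B * exp (- (1/2) * (cmod w)\<^sup>2))"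
      using gaussian_complex(1)[of "1/2"] by (intro integrable_mult_right) simp
    show "AE w in lborel. norm (h w) \<le> norm (B * exp (- (1/2) * (cmod w)\<^sup>2))"
      unfolding real_norm_def by (intro AE_I2) (rule order.trans[OF hb abs_ge_self])
  qed measurable
  have hr: "integrable lborel (\<lambda>w. h (c t * w))" for t
  proof (rule Bochner_Integration.integrable_bound)
    show "integrable lborel (\<lambda>w. B * exp (- (1/2) * (cmod w)\<^sup>2))"
      using gaussian_complex(1)[of "1/2"] by (intro integrable_mult_right) simp
    have hb': "norm (h (c t * w)) \<le> B * exp (- (1/2) * (cmod w)\<^sup>2)" for w
      using hb[of "c t * w"] by (simp add: norm_mult c1)
    show "AE w in lborel. norm (h (c t * w)) \<le> norm (B * exp (- (1/2) * (cmod w)\<^sup>2))"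
      unfolding real_norm_def by (intro AE_I2) (rule order.trans[OF hb' abs_ge_self])
  qed measurable
  define J where "J = (LINT w|lborel. h w)"
  let ?g = "\<lambda>t w. indicat_real {0..1} t *\<^sub>R h (c t * w)"
  have int: "integrable (lborel \<Otimes>\<^sub>M lborel) (\<lambda>(t, w). ?g t w)"
  proof (rule lborel_pair.Fubini_integrable)
    show "(\<lambda>(t, w). ?g t w) \<in> borel_measurable (lborel \<Otimes>\<^sub>M lborel)" by measurable
    have "(LINT w|lborel. cmod (h (c t * w))) = (LINT w|lborel. cmod (h w))" for t
      using integral_rotate[of "\<lambda>w. cmod (h w)" "c t"] c1 by simp
    then show "integrable lborel (\<lambda>t. LINT w|lborel. norm (case (t, w) of (t, w) \<Rightarrow> ?g t w))" by simp
    show "AE t in lborel. integrable lborel (\<lambda>w. case (t, w) of (t, w) \<Rightarrow> ?g t w)" using hr by simp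
  qed
  have fub: "(LINT w|lborel. (LINT t|lborel. ?g t w)) = (LINT t|lborel. (LINT w|lborel. ?g t w))"
    using lborel_pair.Fubini_integral[OF int] .
  have rot: "(LINT w|lborel. ?g t w) = indicat_real {0..1} t *\<^sub>R J" for t
    using integral_rotate[of h "c t"] c1 by (simp add: J_def)
  have constJ: "(LINT t|lborel. indicat_real {0..1::real} t *\<^sub>R J) = J"
    by (subst integral_scaleR_left) (auto intro: integrable_real_indicator)
  have avg: "(LINT t|lborel. ?g t w) = of_real (exp (- 1 * (cmod w)\<^sup>2)) * F 0" for w
  proof -
    have e: "?g t w = of_real (exp (- 1 * (cmod w)\<^sup>2)) * (indicat_real {0..1} t *\<^sub>R F (c t * w))" for t
      by (simp add: h_def norm_mult c1 exp_of_real[symmetric] scaleR_conv_of_real)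
    have "(LINT t|lborel. ?g t w) = of_real (exp (- 1 * (cmod w)\<^sup>2)) * (LINT t:{0..1}|lborel. F (c t * w))"
      unfolding e set_lebesgue_integral_def by (rule integral_mult_right_zero)
    also have "(LINT t:{0..1}|lborel. F (c t * w)) = integral {0..1} (\<lambda>t. F (c t * w))"
    proof (rule set_borel_integral_eq_integral)
      have "continuous_on {0..1} (\<lambda>t. F (c t * w))"
        by (rule continuous_on_compose2[OF cF]) (auto simp: c_def intro!: continuous_intros)
      then show "set_integrable lborel {0..1} (\<lambda>t. F (c t * w))"
        unfolding set_integrable_def by (intro borel_integrable_compact) auto
    qed
    also have "\<dots> = F 0" using entire_circle_mean[OF F, of w] by (simp add: c_def integral_unique)
    finally show ?thesis .
  qed
  have gint: "(LINT w|lborel. of_real (exp (- 1 * (cmod w)\<^sup>2)) * F 0) = of_real pi * F 0"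
  proof -
    have "(LINT w|lborel. of_real (exp (- 1 * (cmod w)\<^sup>2)) * F 0) = (LINT w|lborel. complex_of_real (exp (- 1 * (cmod w)\<^sup>2))) * F 0"
      by (rule integral_mult_left_zero)
    also have "(LINT w|lborel. complex_of_real (exp (- 1 * (cmod (w :: complex))\<^sup>2))) = of_real pi"
      using gaussian_complex(2)[of 1] unfolding integral_complex_of_real by simp
    finally show ?thesis .
  qed
  have "J = of_real pi * F 0" using fub unfolding rot avg constJ gint ..
  then show ?thesis by (simp add: J_def h_def)
qed

context lattice_cell
begin

text \<open>Continuity in place of holomorphy: the cubic term |u|^2 u must be included.\<close>

definition quasi :: "(complex \<Rightarrow> complex) \<Rightarrow> bool" where
  "quasi v \<longleftrightarrow> continuous_on UNIV v \<and> mag_trans (of_real \<gamma>) v = v \<and> mag_trans (of_real \<gamma> * \<tau>) v = v"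

lemma quasi_bounded:
  assumes "quasi v" shows "\<exists>B\<ge>0. \<forall>z. cmod (v z) \<le> B"
proof -
  have "\<exists>B. \<forall>z. \<bar>cmod (v z)\<bar> \<le> B"
  proof (rule periodic_bounded)
    show "continuous_on UNIV (\<lambda>z. cmod (v z))" using assms by (auto simp: quasi_def intro!: continuous_intros)
    show "cmod (v (z + of_real \<gamma>)) = cmod (v z)" for z
      using mag_trans_norm[of "of_real \<gamma>" v z] assms by (simp add: quasi_def)
    show "cmod (v (z + of_real \<gamma> * \<tau>)) = cmod (v z)" for z
      using mag_trans_norm[of "of_real \<gamma> * \<tau>" v z] assms by (simp add: quasi_def)
  qed
  then obtain B where "\<forall>z. cmod (v z) \<le> B" by auto
  then show ?thesis by (intro exI[of _ B]) (meson norm_ge_zero order_trans)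
qed

lemma quasi_borel: "quasi v \<Longrightarrow> v \<in> borel_measurable borel"
  unfolding quasi_def by (auto intro: borel_measurable_continuous_onI)

lemma lattice_space_quasi: "u \<in> lattice_space \<tau> \<gamma> \<Longrightarrow> quasi u"
proof -
  assume u: "u \<in> lattice_space \<tau> \<gamma>"
  then obtain f where f: "f holomorphic_on UNIV" "\<And>z. u z = exp (- of_real ((cmod z)\<^sup>2) / 2) * f z"
    unfolding lattice_space_def LLL_space_def by blast
  have "u = (\<lambda>z. exp (- of_real ((cmod z)\<^sup>2) / 2) * f z)" using f(2) by auto
  then have "continuous_on UNIV u"
    using holomorphic_on_imp_continuous_on[OF f(1)] by (auto intro!: continuous_intros)
  then show "quasi u" using u by (simp add: quasi_def lattice_space_def)
qed

text \<open>The growth condition comes for free with exponent 0: |u| is doubly periodic and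
  continuous, hence bounded.\<close>

lemma lattice_spaceI:
  assumes "f holomorphic_on UNIV" "\<And>z. u z = exp (- of_real ((cmod z)\<^sup>2) / 2) * f z"
    "mag_trans (of_real \<gamma>) u = u" "mag_trans (of_real \<gamma> * \<tau>) u = u"
  shows "u \<in> lattice_space \<tau> \<gamma>"
proof -
  have "u = (\<lambda>z. exp (- of_real ((cmod z)\<^sup>2) / 2) * f z)" using assms(2) by auto
  then have "continuous_on UNIV u"
    using holomorphic_on_imp_continuous_on[OF assms(1)] by (auto intro!: continuous_intros)
  then have "quasi u" using assms by (simp add: quasi_def)
  then obtain B where "\<forall>z. cmod (u z) \<le> B" using quasi_bounded by blast
  moreover have "sqrt (1 + (cmod z)\<^sup>2) powr 0 = 1" for z
  proof -
    have "1 + (cmod z)\<^sup>2 > 0" by (intro add_pos_nonneg) auto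
    then have "sqrt (1 + (cmod z)\<^sup>2) > 0" by (simp only: real_sqrt_gt_0_iff)
    then show ?thesis by simp
  qed
  ultimately have "\<exists>M C::real. \<forall>z. cmod (u z) \<le> C * sqrt (1 + (cmod z)\<^sup>2) powr M"
    by (intro exI[of _ 0] exI[of _ B]) auto
  moreover have "\<exists>f. f holomorphic_on UNIV \<and> (\<forall>z. u z = exp (- of_real ((cmod z)\<^sup>2) / 2) * f z)"
    using assms(1,2) by (intro exI[of _ f]) auto
  ultimately show ?thesis using assms(3,4) unfolding lattice_space_def LLL_space_def by simp
qed

lemma LLL_proj_in_lattice_space:
  assumes v: "quasi v"
  shows "LLL_proj v \<in> lattice_space \<tau> \<gamma>"
proof -
  obtain B where B: "\<And>z. cmod (v z) \<le> B" using quasi_bounded[OF v] by auto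
  note m = quasi_borel[OF v]
  show ?thesis
  proof (rule lattice_spaceI)
    show "(\<lambda>z. of_real (1 / pi) * (LINT w|lborel. exp (cnj w * z - of_real ((cmod w)\<^sup>2) / 2) * v w)) holomorphic_on UNIV"
      by (intro holomorphic_intros LLL_proj_holomorphic[OF m B])
    show "LLL_proj v z = exp (- of_real ((cmod z)\<^sup>2) / 2) * (of_real (1 / pi) * (LINT w|lborel. exp (cnj w * z - of_real ((cmod w)\<^sup>2) / 2) * v w))" for z
      by (simp add: LLL_proj_def)
  qed (use v LLL_proj_mag_trans[OF m] in \<open>auto simp: quasi_def\<close>)
qed

text \<open>Translating by z reduces the claim to the value at the origin. The translate of u is
  again exp(-|w|^2 / 2) times an entire function F, and boundedness of u is the growth condition on
  F in the Gaussian mean value.\<close>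

lemma LLL_proj_fixes:
  assumes u: "u \<in> lattice_space \<tau> \<gamma>"
  shows "LLL_proj u = u"
proof
  fix z
  obtain f where f: "f holomorphic_on UNIV" "\<And>z. u z = exp (- of_real ((cmod z)\<^sup>2) / 2) * f z"
    using u unfolding lattice_space_def LLL_space_def by blast
  note q = lattice_space_quasi[OF u]
  obtain B where B: "\<And>z. cmod (u z) \<le> B" using quasi_bounded[OF q] by auto
  define F where "F w = exp (- cnj z * w - of_real ((cmod z)\<^sup>2) / 2) * f (w + z)" for w
  have "(\<lambda>w. f (w + z)) holomorphic_on UNIV"
    by (rule holomorphic_on_compose_gen[OF _ f(1), unfolded o_def]) (auto intro!: holomorphic_intros)
  then have Fh: "F holomorphic_on UNIV" unfolding F_def by (intro holomorphic_intros)
  have FU: "mag_trans z u w = exp (- of_real ((cmod w)\<^sup>2) / 2) * F w" for w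
  proof -
    have "exp ((z * cnj w - cnj z * w) / 2) * exp (- of_real ((cmod (w + z))\<^sup>2) / 2) =
      exp (- of_real ((cmod w)\<^sup>2) / 2) * exp (- cnj z * w - of_real ((cmod z)\<^sup>2) / 2)"
      unfolding exp_add[symmetric] cnj_exponent by (rule arg_cong[where f = exp]) (simp add: field_simps)
    then show ?thesis unfolding mag_trans_def f(2) F_def by (metis mult.assoc)
  qed
  have FB: "cmod (F w) \<le> B * exp ((cmod w)\<^sup>2 / 2)" for w
  proof -
    have "exp (- (cmod w)\<^sup>2 / 2) * cmod (F w) \<le> B"
      using FU[of w] mag_trans_norm[of z u w] B[of "w + z"] by (simp add: norm_mult norm_exp_eq_Re)
    then show ?thesis by (simp add: exp_minus field_simps)
  qed
  have "LLL_proj u z = mag_trans z (LLL_proj u) 0" by (simp add: mag_trans_def)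
  also have "\<dots> = LLL_proj (mag_trans z u) 0" unfolding LLL_proj_mag_trans[OF quasi_borel[OF q]] ..
  also have "\<dots> = of_real (1 / pi) * (LINT w|lborel. exp (- of_real ((cmod w)\<^sup>2)) * F w)"
  proof -
    have pt: "exp (cnj w * 0 - of_real ((cmod w)\<^sup>2) / 2) * (exp (- of_real ((cmod w)\<^sup>2) / 2) * F w) = exp (- of_real ((cmod w)\<^sup>2)) * F w" for w
      unfolding mult.assoc[symmetric] exp_add[symmetric] by simp
    show ?thesis unfolding LLL_proj_def FU pt by simp
  qed
  also have "\<dots> = F 0" unfolding gaussian_mean_value[OF Fh FB] by simp
  also have "\<dots> = u z" unfolding F_def f(2) by (simp del: of_real_power)
  finally show "LLL_proj u z = u z" .
qed

text \<open>The projection kernel with both Gaussian weights included. In this form it is Hermitian,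
  and its modulus is a Gaussian in w - z.\<close>

definition bargmann :: "complex \<Rightarrow> complex \<Rightarrow> complex" where
  "bargmann z w = of_real (1 / pi) * exp (cnj w * z - of_real ((cmod w)\<^sup>2) / 2 - of_real ((cmod z)\<^sup>2) / 2)"

lemma LLL_proj_bargmann: "LLL_proj v z = (LINT w|lborel. bargmann z w * v w)"
proof -
  have "bargmann z w * v w = (of_real (1 / pi) * exp (- of_real ((cmod z)\<^sup>2) / 2)) * (exp (cnj w * z - of_real ((cmod w)\<^sup>2) / 2) * v w)" for w
  proof -
    have "exp (cnj w * z - of_real ((cmod w)\<^sup>2) / 2 - of_real ((cmod z)\<^sup>2) / 2) = exp (- of_real ((cmod z)\<^sup>2) / 2) * exp (cnj w * z - of_real ((cmod w)\<^sup>2) / 2)"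
      unfolding exp_add[symmetric] by simp
    then show ?thesis unfolding bargmann_def by (simp only: mult.assoc)
  qed
  then show ?thesis unfolding LLL_proj_def by simp
qed

lemma bargmann_norm: "cmod (bargmann z w) = 1 / pi * exp (- (1/2) * (cmod (w - z))\<^sup>2)"
proof -
  have "Re (cnj w * z - of_real ((cmod w)\<^sup>2) / 2 - of_real ((cmod z)\<^sup>2) / 2) = - (1/2) * (cmod (w - z))\<^sup>2"
    unfolding cmod_power2 by (simp add: power2_eq_square field_simps)
  then show ?thesis unfolding bargmann_def norm_mult norm_exp_eq_Re by (simp add: norm_divide)
qed

lemma bargmann_cnj: "cnj (bargmann z w) = bargmann w z"
  unfolding bargmann_def by (simp add: exp_cnj mult.commute algebra_simps)

lemma bargmann_continuous: "continuous_on S f \<Longrightarrow> continuous_on S g \<Longrightarrow> continuous_on S (\<lambda>x. bargmann (f x) (g x))"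
  unfolding bargmann_def by (intro continuous_intros) auto

lemma bargmann_shift:
  "bargmann (z + \<alpha>) (w + \<alpha>) * v (w + \<alpha>) * cnj (\<phi> (z + \<alpha>)) = bargmann z w * mag_trans \<alpha> v w * cnj (mag_trans \<alpha> \<phi> z)"
proof -
  have "exp (cnj (w + \<alpha>) * (z + \<alpha>) - of_real ((cmod (w + \<alpha>))\<^sup>2) / 2 - of_real ((cmod (z + \<alpha>))\<^sup>2) / 2) =
    exp (cnj w * z - of_real ((cmod w)\<^sup>2) / 2 - of_real ((cmod z)\<^sup>2) / 2) * exp ((\<alpha> * cnj w - cnj \<alpha> * w) / 2) * cnj (exp ((\<alpha> * cnj z - cnj \<alpha> * z) / 2))"
    unfolding exp_cnj exp_add[symmetric] cnj_exponent by (rule arg_cong[where f = exp]) (simp add: field_simps)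
  then show ?thesis unfolding bargmann_def mag_trans_def by (simp add: mult_ac)
qed

lemma cell_gauss_integrable:
  fixes G :: "complex \<times> complex \<Rightarrow> complex"
  assumes G: "continuous_on UNIV G" and C: "\<And>z \<zeta>. cmod (G (z, \<zeta>)) \<le> C * exp (- (1/2) * (cmod \<zeta>)\<^sup>2)"
  shows "integrable (lborel \<Otimes>\<^sub>M lborel) (\<lambda>(z, \<zeta>). indicat_real (cell \<tau> \<gamma>) z *\<^sub>R G (z, \<zeta>))"
proof (rule Bochner_Integration.integrable_bound)
  have C0: "C \<ge> 0" using order.trans[OF norm_ge_zero C[of 0 0]] by simp
  have [measurable]: "G \<in> borel_measurable (borel \<Otimes>\<^sub>M borel)"
    using borel_measurable_continuous_onI[OF G] by (simp add: borel_prod)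
  have [measurable]: "cell \<tau> \<gamma> \<in> sets borel" using compact_cell by (simp add: compact_imp_closed borel_closed)
  show "(\<lambda>(z, \<zeta>). indicat_real (cell \<tau> \<gamma>) z *\<^sub>R G (z, \<zeta>)) \<in> borel_measurable (lborel \<Otimes>\<^sub>M lborel)" by measurable
  have g: "integrable lborel (\<lambda>\<zeta>::complex. C * exp (- (1/2) * (cmod \<zeta>)\<^sup>2))"
    using gaussian_complex(1)[of "1/2"] by (intro integrable_mult_right) simp
  have ci: "integrable lborel (indicat_real (cell \<tau> \<gamma>))"
    using cell_integrable[of "\<lambda>_. 1::real"] by (simp add: set_integrable_def)
  show "integrable (lborel \<Otimes>\<^sub>M lborel) (\<lambda>(z, \<zeta>). indicat_real (cell \<tau> \<gamma>) z * (C * exp (- (1/2) * (cmod \<zeta>)\<^sup>2)))"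
  proof (rule lborel_pair.Fubini_integrable)
    show "(\<lambda>(z, \<zeta>). indicat_real (cell \<tau> \<gamma>) z * (C * exp (- (1/2) * (cmod \<zeta>)\<^sup>2))) \<in> borel_measurable (lborel \<Otimes>\<^sub>M lborel)"
      by measurable
    have "(LINT \<zeta>|lborel. norm (case (z, \<zeta>) of (z, \<zeta>) \<Rightarrow> indicat_real (cell \<tau> \<gamma>) z * (C * exp (- (1/2) * (cmod \<zeta>)\<^sup>2)))) =
       indicat_real (cell \<tau> \<gamma>) z * (LINT \<zeta>::complex|lborel. C * exp (- (1/2) * (cmod \<zeta>)\<^sup>2))" for z
      using C0 by (simp add: abs_mult)
    then show "integrable lborel (\<lambda>z. LINT \<zeta>|lborel. norm (case (z, \<zeta>) of (z, \<zeta>) \<Rightarrow> indicat_real (cell \<tau> \<gamma>) z * (C * exp (- (1/2) * (cmod \<zeta>)\<^sup>2))))"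
      using ci by simp
    show "AE z in lborel. integrable lborel (\<lambda>\<zeta>. case (z, \<zeta>) of (z, \<zeta>) \<Rightarrow> indicat_real (cell \<tau> \<gamma>) z * (C * exp (- (1/2) * (cmod \<zeta>)\<^sup>2)))"
      using g by simp
  qed
  show "AE x in lborel \<Otimes>\<^sub>M lborel. norm (case x of (z, \<zeta>) \<Rightarrow> indicat_real (cell \<tau> \<gamma>) z *\<^sub>R G (z, \<zeta>)) \<le>
     norm (case x of (z, \<zeta>) \<Rightarrow> indicat_real (cell \<tau> \<gamma>) z * (C * exp (- (1/2) * (cmod \<zeta>)\<^sup>2)))"
    using C C0 by (intro AE_I2) (auto simp: abs_mult indicator_def)
qed

text \<open>One variable runs over the cell and the other over the plane. With w = z + \<zeta> and
  \<zeta> fixed, the integrand is doubly periodic in z, so the cell can be moved by -\<zeta>, which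
  interchanges the roles of z and w. Gaussian decay in \<zeta> justifies the exchanges of
  integrals.\<close>

lemma LLL_proj_self_adjoint:
  assumes v: "quasi v" and \<phi>: "quasi \<phi>"
  shows "(LINT z:cell \<tau> \<gamma>|lborel. LLL_proj v z * cnj (\<phi> z)) = (LINT z:cell \<tau> \<gamma>|lborel. v z * cnj (LLL_proj \<phi> z))"
proof -
  obtain Bv where Bv: "Bv \<ge> 0" "\<And>z. cmod (v z) \<le> Bv" using quasi_bounded[OF v] by auto
  obtain Bp where Bp: "Bp \<ge> 0" "\<And>z. cmod (\<phi> z) \<le> Bp" using quasi_bounded[OF \<phi>] by auto
  have cv: "continuous_on UNIV v" and cp: "continuous_on UNIV \<phi>" using v \<phi> by (auto simp: quasi_def)
  note [measurable] = quasi_borel[OF v] quasi_borel[OF \<phi>]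
  have [measurable]: "bargmann z \<in> borel_measurable borel" "(\<lambda>w. bargmann w z) \<in> borel_measurable borel" for z
    by (intro borel_measurable_continuous_onI bargmann_continuous continuous_intros)+
  define F where "F z \<zeta> = bargmann z (z + \<zeta>) * v (z + \<zeta>) * cnj (\<phi> z)" for z \<zeta>
  have bd: "cmod (bargmann a b) * cmod (v c) * cmod (\<phi> d) \<le> (1 / pi * Bv * Bp) * exp (- (1/2) * (cmod (b - a))\<^sup>2)" for a b c d
  proof -
    have "cmod (bargmann a b) * cmod (v c) * cmod (\<phi> d) \<le> (1 / pi * exp (- (1/2) * (cmod (b - a))\<^sup>2)) * Bv * Bp"
      unfolding bargmann_norm using Bv Bp by (intro mult_mono) auto
    then show ?thesis by (simp add: mult_ac)
  qed
  have int1: "integrable (lborel \<Otimes>\<^sub>M lborel) (\<lambda>(z, \<zeta>). indicat_real (cell \<tau> \<gamma>) z *\<^sub>R F z \<zeta>)"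
  proof -
    have "integrable (lborel \<Otimes>\<^sub>M lborel) (\<lambda>(z, \<zeta>). indicat_real (cell \<tau> \<gamma>) z *\<^sub>R (\<lambda>x. F (fst x) (snd x)) (z, \<zeta>))"
    proof (rule cell_gauss_integrable)
      show "continuous_on UNIV (\<lambda>x. F (fst x) (snd x))" unfolding F_def
        by (intro continuous_intros bargmann_continuous continuous_on_compose2[OF cv] continuous_on_compose2[OF cp]) auto
      show "cmod (F (fst (z, \<zeta>)) (snd (z, \<zeta>))) \<le> (1 / pi * Bv * Bp) * exp (- (1/2) * (cmod \<zeta>)\<^sup>2)" for z \<zeta>
        using bd[of z "z + \<zeta>" "z + \<zeta>" z] by (simp add: F_def norm_mult)
    qed
    then show ?thesis by simp
  qed
  have int2: "integrable (lborel \<Otimes>\<^sub>M lborel) (\<lambda>(z, \<zeta>). indicat_real (cell \<tau> \<gamma>) z *\<^sub>R F (z + - \<zeta>) \<zeta>)"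
  proof -
    have "integrable (lborel \<Otimes>\<^sub>M lborel) (\<lambda>(z, \<zeta>). indicat_real (cell \<tau> \<gamma>) z *\<^sub>R (\<lambda>x. F (fst x + - snd x) (snd x)) (z, \<zeta>))"
    proof (rule cell_gauss_integrable)
      show "continuous_on UNIV (\<lambda>x. F (fst x + - snd x) (snd x))" unfolding F_def
        by (intro continuous_intros bargmann_continuous continuous_on_compose2[OF cv] continuous_on_compose2[OF cp]) auto
      show "cmod (F (fst (z, \<zeta>) + - snd (z, \<zeta>)) (snd (z, \<zeta>))) \<le> (1 / pi * Bv * Bp) * exp (- (1/2) * (cmod \<zeta>)\<^sup>2)" for z \<zeta>
        using bd[of "z - \<zeta>" z z "z - \<zeta>"] by (simp add: F_def norm_mult)
    qed
    then show ?thesis by simp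
  qed
  have A: "LLL_proj v z * cnj (\<phi> z) = (LINT \<zeta>|lborel. F z \<zeta>)" for z
  proof -
    have "(LINT \<zeta>|lborel. F z \<zeta>) = (LINT \<zeta>|lborel. bargmann z (\<zeta> + z) * v (\<zeta> + z)) * cnj (\<phi> z)"
      unfolding F_def by (simp add: add.commute)
    also have "(LINT \<zeta>|lborel. bargmann z (\<zeta> + z) * v (\<zeta> + z)) = LLL_proj v z"
      unfolding LLL_proj_bargmann by (rule integral_translate) measurable
    finally show ?thesis ..
  qed
  have Bq: "v z * cnj (LLL_proj \<phi> z) = (LINT \<zeta>|lborel. F (z + - \<zeta>) \<zeta>)" for z
  proof -
    have "(LINT \<zeta>|lborel. F (z + - \<zeta>) \<zeta>) = (LINT \<zeta>|lborel. v z * (bargmann (z - \<zeta>) z * cnj (\<phi> (z - \<zeta>))))"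
      unfolding F_def by (simp add: mult_ac)
    also have "\<dots> = v z * (LINT \<zeta>|lborel. bargmann (z - \<zeta>) z * cnj (\<phi> (z - \<zeta>)))" by (rule integral_mult_right_zero)
    also have "(LINT \<zeta>|lborel. bargmann (z - \<zeta>) z * cnj (\<phi> (z - \<zeta>))) = (LINT \<zeta>|lborel. bargmann (z + \<zeta>) z * cnj (\<phi> (z + \<zeta>)))"
      using integral_rotate[of "\<lambda>\<zeta>. bargmann (z + \<zeta>) z * cnj (\<phi> (z + \<zeta>))" "-1"] by simp
    also have "\<dots> = (LINT w|lborel. bargmann w z * cnj (\<phi> w))"
      using integral_translate[of "\<lambda>w. bargmann w z * cnj (\<phi> w)" z] by (simp add: add.commute)
    also have "\<dots> = (LINT w|lborel. cnj (bargmann z w * \<phi> w))" by (simp add: bargmann_cnj)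
    also have "\<dots> = cnj (LLL_proj \<phi> z)" unfolding LLL_proj_bargmann by (rule integral_bounded_linear'[OF bounded_linear_cnj bounded_linear_cnj]) simp
    finally show ?thesis ..
  qed
  have tr: "(LINT z:cell \<tau> \<gamma>|lborel. F (z + - \<zeta>) \<zeta>) = (LINT z:cell \<tau> \<gamma>|lborel. F z \<zeta>)" for \<zeta>
  proof (rule cell_translate[of "\<lambda>z. F z \<zeta>"])
    show "continuous_on UNIV (\<lambda>z. F z \<zeta>)" unfolding F_def
      by (intro continuous_intros bargmann_continuous continuous_on_compose2[OF cv] continuous_on_compose2[OF cp]) auto
    show "F (z + of_real \<gamma>) \<zeta> = F z \<zeta>" for z
      using bargmann_shift[of z "of_real \<gamma>" "z + \<zeta>" v \<phi>] v \<phi> by (simp add: F_def quasi_def add_ac)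
    show "F (z + of_real \<gamma> * \<tau>) \<zeta> = F z \<zeta>" for z
      using bargmann_shift[of z "of_real \<gamma> * \<tau>" "z + \<zeta>" v \<phi>] v \<phi> by (simp add: F_def quasi_def add_ac)
  qed
  have "(LINT z:cell \<tau> \<gamma>|lborel. LLL_proj v z * cnj (\<phi> z)) = (LINT z|lborel. (LINT \<zeta>|lborel. indicat_real (cell \<tau> \<gamma>) z *\<^sub>R F z \<zeta>))"
    unfolding set_lebesgue_integral_def A by simp
  also have "\<dots> = (LINT \<zeta>|lborel. (LINT z|lborel. indicat_real (cell \<tau> \<gamma>) z *\<^sub>R F z \<zeta>))"
    by (rule lborel_pair.Fubini_integral[OF int1, symmetric])
  also have "\<dots> = (LINT \<zeta>|lborel. (LINT z|lborel. indicat_real (cell \<tau> \<gamma>) z *\<^sub>R F (z + - \<zeta>) \<zeta>))"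
    using tr unfolding set_lebesgue_integral_def by simp
  also have "\<dots> = (LINT z|lborel. (LINT \<zeta>|lborel. indicat_real (cell \<tau> \<gamma>) z *\<^sub>R F (z + - \<zeta>) \<zeta>))"
    by (rule lborel_pair.Fubini_integral[OF int2])
  also have "\<dots> = (LINT z:cell \<tau> \<gamma>|lborel. v z * cnj (LLL_proj \<phi> z))"
    unfolding set_lebesgue_integral_def Bq by simp
  finally show ?thesis .
qed

end

subsection \<open>Functions of level \<open>N\<close>\<close>

locale LLL_lattice =
  fixes N :: nat and \<gamma> \<tau>\<^sub>1 :: real and \<tau> :: complex
  assumes N: "N \<ge> 1" and gamma: "\<gamma> > 0"
    and tau_eq: "\<tau> = of_real \<tau>\<^sub>1 + \<i> * of_real pi * of_nat N / of_real (\<gamma>\<^sup>2)"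
begin

lemma Im_tau: "Im \<tau> = pi * real N / \<gamma>\<^sup>2"
proof -
  have "\<i> * of_real pi * of_nat N / of_real (\<gamma>\<^sup>2) = \<i> * of_real (pi * real N / \<gamma>\<^sup>2)" by simp
  then show ?thesis unfolding tau_eq by (simp del: of_real_divide of_real_mult of_real_power)
qed

lemma Im_tau_pos: "Im \<tau> > 0" using N gamma by (simp add: Im_tau)

sublocale lattice_cell \<tau> \<gamma>
  by unfold_locales (use Im_tau_pos gamma in auto)

definition \<tau>' :: complex where "\<tau>' = \<tau> / of_nat N"

lemma tau'_N: "of_nat N * \<tau>' = \<tau>" using N by (simp add: \<tau>'_def)

lemma Im_tau': "Im \<tau>' = pi / \<gamma>\<^sup>2" using N by (simp add: \<tau>'_def Im_tau Im_divide_of_nat)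

lemma Im_tau'_pos: "Im \<tau>' > 0" using gamma by (simp add: Im_tau')

text \<open>With exp(z^2 / 2) included, a magnetic translation by a real number acts on the
  remaining factor as a plain translation.\<close>

definition gauge :: "complex \<Rightarrow> complex" where
  "gauge z = exp (z\<^sup>2 / 2 - of_real ((cmod z)\<^sup>2) / 2)"

definition lift :: "(complex \<Rightarrow> complex) \<Rightarrow> complex \<Rightarrow> complex" where
  "lift G z = gauge z * G (z / of_real \<gamma>)"

text \<open>The multiplier for the shift by \<tau> that invariance under the magnetic translation by
  \<gamma> \<tau> imposes on every function of the space.\<close>

definition multiplier :: complex where "multiplier = exp (- \<i> * of_real pi * of_nat N * \<tau>)"

lemma gauge_nonzero: "gauge z \<noteq> 0" by (simp add: gauge_def)

lemma gauge_shift: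
  "exp ((\<alpha> * cnj z - cnj \<alpha> * z) / 2) * gauge (z + \<alpha>) = gauge z * exp ((\<alpha> - cnj \<alpha>) * (z + \<alpha> / 2))"
  unfolding gauge_def exp_add[symmetric] cnj_exponent
  by (rule arg_cong[where f = exp]) (simp add: power2_eq_square field_simps)

lemma mag_trans_lift: "mag_trans \<alpha> (lift G) z = gauge z * (exp ((\<alpha> - cnj \<alpha>) * (z + \<alpha> / 2)) * G ((z + \<alpha>) / of_real \<gamma>))"
proof -
  have "mag_trans \<alpha> (lift G) z = (exp ((\<alpha> * cnj z - cnj \<alpha> * z) / 2) * gauge (z + \<alpha>)) * G ((z + \<alpha>) / of_real \<gamma>)"
    by (simp add: mag_trans_def lift_def)
  then show ?thesis unfolding gauge_shift by (simp add: mult.assoc)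
qed

lemma mag_trans_lift_real: "mag_trans (of_real \<gamma> * of_real r) (lift G) = lift (\<lambda>x. G (x + of_real r))"
proof
  fix z :: complex
  have "(z + of_real \<gamma> * of_real r) / of_real \<gamma> = z / of_real \<gamma> + of_real r" using gamma by (simp add: field_simps)
  then show "mag_trans (of_real \<gamma> * of_real r) (lift G) z = lift (\<lambda>x. G (x + of_real r)) z"
    unfolding mag_trans_lift by (simp add: lift_def)
qed

lemma mag_trans_lift_tau:
  "mag_trans (of_real \<gamma> * (of_real r * \<tau>)) (lift G) = lift (\<lambda>x. exp (2 * of_real pi * \<i> * of_nat N * of_real r * (x + of_real r * \<tau> / 2)) * G (x + of_real r * \<tau>))"
proof
  fix z :: complex
  have a: "(z + of_real \<gamma> * (of_real r * \<tau>)) / of_real \<gamma> = z / of_real \<gamma> + of_real r * \<tau>" using gamma by (simp add: field_simps)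
  \<comment> \<open>Here the value of Im \<tau> enters and produces the exponent 2 pi i N.\<close>
  have im: "\<tau> - cnj \<tau> = 2 * \<i> * of_real (pi * real N / \<gamma>\<^sup>2)" by (simp add: complex_diff_cnj Im_tau)
  have d: "of_real \<gamma> * (of_real r * \<tau>) - cnj (of_real \<gamma> * (of_real r * \<tau>)) = of_real \<gamma> * of_real r * (\<tau> - cnj \<tau>)"
    by (simp add: algebra_simps)
  have "(of_real \<gamma> * (of_real r * \<tau>) - cnj (of_real \<gamma> * (of_real r * \<tau>))) * (z + of_real \<gamma> * (of_real r * \<tau>) / 2) =
    2 * of_real pi * \<i> * of_nat N * of_real r * (z / of_real \<gamma> + of_real r * \<tau> / 2)"
    unfolding d im using gamma by (simp add: power2_eq_square field_simps)
  then show "mag_trans (of_real \<gamma> * (of_real r * \<tau>)) (lift G) z = lift (\<lambda>x. exp (2 * of_real pi * \<i> * of_nat N * of_real r * (x + of_real r * \<tau> / 2)) * G (x + of_real r * \<tau>)) z"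
    unfolding mag_trans_lift a by (simp add: lift_def)
qed

lemma lift_eq_iff: "lift G = lift H \<longleftrightarrow> G = H"
proof
  assume eq: "lift G = lift H"
  show "G = H"
  proof
    fix x :: complex
    have "lift G (x * of_real \<gamma>) = lift H (x * of_real \<gamma>)" using eq by simp
    then show "G x = H x" using gamma gauge_nonzero by (simp add: lift_def)
  qed
qed simp

lemma level_shift_iff:
  "exp (2 * of_real pi * \<i> * of_nat N * (x + \<tau> / 2)) * y = g \<longleftrightarrow> y = multiplier * exp (- (2 * of_real pi * \<i> * of_nat N * x)) * g"
proof -
  define E where "E = exp (2 * of_real pi * \<i> * of_nat N * (x + \<tau> / 2))"
  have "multiplier * exp (- (2 * of_real pi * \<i> * of_nat N * x)) = inverse E"
    unfolding multiplier_def E_def exp_minus[symmetric] exp_add[symmetric] by (rule arg_cong[where f = exp]) (simp add: algebra_simps)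
  moreover have "E \<noteq> 0" by (simp add: E_def)
  then have "E * y = g \<longleftrightarrow> y = inverse E * g" by (auto simp: field_simps)
  ultimately show ?thesis unfolding E_def[symmetric] by simp
qed

lemma lift_in_lattice_space:
  assumes G: "quasi_periodic \<tau> N 1 multiplier G"
  shows "lift G \<in> lattice_space \<tau> \<gamma>"
proof (rule lattice_spaceI)
  have "(\<lambda>z. G (z / of_real \<gamma>)) holomorphic_on UNIV"
    by (rule holomorphic_on_compose_gen[OF _ quasi_periodicD(1)[OF G], unfolded o_def]) (use gamma in \<open>auto intro!: holomorphic_intros\<close>)
  then show "(\<lambda>z. exp (z\<^sup>2 / 2) * G (z / of_real \<gamma>)) holomorphic_on UNIV" by (intro holomorphic_intros) auto
  show "lift G z = exp (- of_real ((cmod z)\<^sup>2) / 2) * (exp (z\<^sup>2 / 2) * G (z / of_real \<gamma>))" for z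
    unfolding lift_def gauge_def mult.assoc[symmetric] exp_add[symmetric] by simp
  show "mag_trans (of_real \<gamma>) (lift G) = lift G"
    using mag_trans_lift_real[of 1 G] quasi_periodicD(4)[OF G] by simp
  have "exp (2 * of_real pi * \<i> * of_nat N * (x + \<tau> / 2)) * G (x + \<tau>) = G x" for x
    unfolding level_shift_iff using quasi_periodicD(5)[OF G] by simp
  then show "mag_trans (of_real \<gamma> * \<tau>) (lift G) = lift G"
    using mag_trans_lift_tau[of 1 G] by simp
qed

lemma lattice_space_lift:
  assumes u: "u \<in> lattice_space \<tau> \<gamma>"
  shows "\<exists>G. quasi_periodic \<tau> N 1 multiplier G \<and> u = lift G"
proof -
  obtain f where f: "f holomorphic_on UNIV" "\<And>z. u z = exp (- of_real ((cmod z)\<^sup>2) / 2) * f z"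
    using u unfolding lattice_space_def LLL_space_def by blast
  define G where "G x = exp (- (of_real \<gamma> * x)\<^sup>2 / 2) * f (of_real \<gamma> * x)" for x
  have "(\<lambda>x. f (of_real \<gamma> * x)) holomorphic_on UNIV"
    by (rule holomorphic_on_compose_gen[OF _ f(1), unfolded o_def]) (auto intro!: holomorphic_intros)
  then have Gh: "G holomorphic_on UNIV" unfolding G_def by (intro holomorphic_intros) auto
  have uG: "u = lift G"
  proof
    fix z :: complex
    have "of_real \<gamma> * (z / of_real \<gamma>) = z" using gamma by simp
    then show "u z = lift G z"
      unfolding lift_def gauge_def G_def f(2) mult.assoc[symmetric] exp_add[symmetric] by simp
  qed
  have "lift (\<lambda>x. G (x + of_real 1)) = lift G" unfolding mag_trans_lift_real[symmetric]
    using u by (simp add: lattice_space_def uG)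
  then have 1: "G (x + 1) = G x" for x unfolding lift_eq_iff by (simp add: fun_eq_iff)
  have "lift (\<lambda>x. exp (2 * of_real pi * \<i> * of_nat N * of_real 1 * (x + of_real 1 * \<tau> / 2)) * G (x + of_real 1 * \<tau>)) = lift G"
    unfolding mag_trans_lift_tau[symmetric] using u by (simp add: lattice_space_def uG)
  then have "exp (2 * of_real pi * \<i> * of_nat N * (x + \<tau> / 2)) * G (x + \<tau>) = G x" for x
    unfolding lift_eq_iff by (simp add: fun_eq_iff)
  then have "G (x + \<tau>) = multiplier * exp (- (2 * of_real pi * \<i> * of_nat N * x)) * G x" for x unfolding level_shift_iff .
  then have "quasi_periodic \<tau> N 1 multiplier G"
    using Gh 1 by (simp add: quasi_periodic_def multiplier_def)
  then show ?thesis using uG by blast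
qed

subsection \<open>Theta products\<close>

lemma theta_product_lift:
  "theta_product N \<tau> \<gamma> k \<mu> zs = lift (\<lambda>x. \<mu> * exp (\<i> * of_real pi * (- of_nat N + 2 * of_int k) * x) * (\<Prod>j=1..N. theta \<tau> (x - zs j / of_real \<gamma>)))"
proof
  fix z :: complex
  have "exp (z\<^sup>2 / 2 + \<i> * of_real pi / of_real \<gamma> * (- of_nat N + 2 * of_int k) * z - of_real ((cmod z)\<^sup>2) / 2) =
    gauge z * exp (\<i> * of_real pi * (- of_nat N + 2 * of_int k) * (z / of_real \<gamma>))"
    unfolding gauge_def exp_add[symmetric] by (rule arg_cong[where f = exp]) (simp add: field_simps)
  then show "theta_product N \<tau> \<gamma> k \<mu> zs z = lift (\<lambda>x. \<mu> * exp (\<i> * of_real pi * (- of_nat N + 2 * of_int k) * x) * (\<Prod>j=1..N. theta \<tau> (x - zs j / of_real \<gamma>))) z"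
    by (simp add: theta_product_def lift_def diff_divide_distrib mult_ac)
qed

text \<open>y is the sum of the zeros in units of \<gamma>. Exponential prefactor, signs and zeros
  combine to the multiplier of the space exactly for these sums; the integer l contributes exp(2 pi
  i l) = 1.\<close>

lemma zero_sum_multiplier:
  assumes "y = (\<tau> - 1) * of_nat N / 2 - of_int k * \<tau> + of_int l"
  shows "multiplier = exp (\<i> * of_real pi * (- of_nat N + 2 * of_int k) * \<tau>) * ((-1) ^ N * exp (- \<i> * of_real pi * of_nat N * \<tau>)) * exp (2 * of_real pi * \<i> * y)"
proof -
  have m1: "(-1) ^ N = exp (\<i> * of_real pi * of_nat N)"
    using exp_of_nat_mult[of N "\<i> * of_real pi"] by (simp add: mult_ac)
  have "exp (\<i> * of_real pi * (- of_nat N + 2 * of_int k) * \<tau>) * ((-1) ^ N * exp (- \<i> * of_real pi * of_nat N * \<tau>)) * exp (2 * of_real pi * \<i> * y) =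
     multiplier * exp (2 * of_real pi * \<i> * of_int l)"
    unfolding m1 multiplier_def assms exp_add[symmetric] by (rule arg_cong[where f = exp]) (simp add: field_simps)
  also have "exp (2 * of_real pi * \<i> * of_int l) = 1"
    using exp_integer_2pi[of "of_int l"] by (simp add: mult_ac)
  finally show ?thesis by simp
qed

lemma zero_sum_scaled:
  assumes "(\<Sum>j=1..N. zs j) = of_real \<gamma> / 2 * (\<tau> - 1) * of_nat N - of_int k * \<tau> * of_real \<gamma> + of_int l * of_real \<gamma>"
  shows "(\<Sum>j=1..N. zs j / of_real \<gamma>) = (\<tau> - 1) * of_nat N / 2 - of_int k * \<tau> + of_int l"
  unfolding sum_divide_distrib[symmetric] assms using gamma by (simp add: field_simps)

lemma theta_product_in_lattice_space:
  assumes sum: "(\<Sum>j=1..N. zs j) = of_real \<gamma> / 2 * (\<tau> - 1) * of_nat N - of_int k * \<tau> * of_real \<gamma> + of_int l * of_real \<gamma>"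
  shows "theta_product N \<tau> \<gamma> k \<mu> zs \<in> lattice_space \<tau> \<gamma>"
proof -
  let ?y = "\<Sum>j=1..N. zs j / of_real \<gamma>"
  let ?P = "\<lambda>x. \<Prod>j=1..N. theta \<tau> (x - zs j / of_real \<gamma>)" and ?e = "\<lambda>x. exp (\<i> * of_real pi * (- of_nat N + 2 * of_int k) * x)"
  note mult = zero_sum_multiplier[OF zero_sum_scaled[OF sum]]
  have m1: "(-1) ^ N = exp (\<i> * of_real pi * of_nat N)"
    using exp_of_nat_mult[of N "\<i> * of_real pi"] by (simp add: mult_ac)
  have e1: "?e (x + 1) * (-1) ^ N = ?e x" for x
  proof -
    have "?e (x + 1) * (-1) ^ N = ?e x * exp (2 * of_real pi * \<i> * of_int k)"
      unfolding m1 exp_add[symmetric] by (rule arg_cong[where f = exp]) (simp add: algebra_simps)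
    also have "exp (2 * of_real pi * \<i> * of_int k) = 1"
      using exp_integer_2pi[of "of_int k"] by (simp add: mult_ac)
    finally show ?thesis by simp
  qed
  have e2: "?e (x + \<tau>) = ?e x * exp (\<i> * of_real pi * (- of_nat N + 2 * of_int k) * \<tau>)" for x
    unfolding exp_add[symmetric] by (simp add: algebra_simps)
  have hol: "(\<lambda>x. theta \<tau> (x - y)) holomorphic_on UNIV" for y
    by (rule holomorphic_on_compose_gen[OF _ quasi_periodicD(1)[OF theta_quasi_periodic[OF tau]], unfolded o_def]) (auto intro!: holomorphic_intros)
  have "quasi_periodic \<tau> N 1 multiplier (\<lambda>x. \<mu> * ?e x * ?P x)"
    unfolding quasi_periodic_def
  proof (intro conjI allI)
    show "(\<lambda>x. \<mu> * ?e x * ?P x) holomorphic_on UNIV" by (intro holomorphic_intros hol)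
    show "\<mu> * ?e (x + 1) * ?P (x + 1) = 1 * (\<mu> * ?e x * ?P x)" for x
      unfolding theta_prod_shift(1)[OF tau] using e1[of x] by (simp add: mult_ac)
    show "\<mu> * ?e (x + \<tau>) * ?P (x + \<tau>) = multiplier * exp (- (2 * of_real pi * \<i> * of_nat N * x)) * (\<mu> * ?e x * ?P x)" for x
      unfolding theta_prod_shift(2)[OF tau] e2 mult by (simp only: mult_ac)
  qed (auto simp: multiplier_def)
  then show ?thesis unfolding theta_product_lift by (rule lift_in_lattice_space)
qed

text \<open>Since k and l can be prescribed, the representation at a later time can use those of the
  initial datum; this is the invariance of the sum of the zeros.\<close>

lemma theta_product_representation:
  assumes u: "u \<in> lattice_space \<tau> \<gamma>"
  shows "\<exists>\<mu> zs. u = theta_product N \<tau> \<gamma> k \<mu> zs \<and>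
    (\<Sum>j=1..N. zs j) = of_real \<gamma> / 2 * (\<tau> - 1) * of_nat N - of_int k * \<tau> * of_real \<gamma> + of_int l * of_real \<gamma>"
proof -
  obtain G where G: "quasi_periodic \<tau> N 1 multiplier G" "u = lift G" using lattice_space_lift[OF u] by blast
  define y where "y = (\<tau> - 1) * of_nat N / 2 - of_int k * \<tau> + of_int l"
  obtain c xs where xs: "(\<Sum>j=1..N. xs j) = y"
    "\<forall>x. G x = c * exp (\<i> * of_real pi * (- of_nat N + 2 * of_int k) * x) * (\<Prod>j=1..N. theta \<tau> (x - xs j))"
    using theta_factorization[OF tau N G(1) zero_sum_multiplier[OF y_def]] by blast
  have "G = (\<lambda>x. c * exp (\<i> * of_real pi * (- of_nat N + 2 * of_int k) * x) * (\<Prod>j=1..N. theta \<tau> (x - (of_real \<gamma> * xs j) / of_real \<gamma>)))"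
    using xs(2) gamma by auto
  then have "u = theta_product N \<tau> \<gamma> k c (\<lambda>j. of_real \<gamma> * xs j)" unfolding theta_product_lift G(2) by simp
  moreover have "(\<Sum>j=1..N. of_real \<gamma> * xs j) = of_real \<gamma> / 2 * (\<tau> - 1) * of_nat N - of_int k * \<tau> * of_real \<gamma> + of_int l * of_real \<gamma>"
    unfolding sum_distrib_left[symmetric] xs(1) y_def by (simp add: field_simps)
  ultimately show ?thesis by blast
qed

subsection \<open>The functions \<open>\<Phi>\<^sub>k\<close> span the space\<close>

text \<open>What remains of the constant prefactor of theta after the shift by z0. The square of its
  modulus, exp(pi^2 / (2 \<gamma>^2)), is the source of the exponential in the constant C_N.\<close>

definition amplitude :: complex where "amplitude = exp (- \<i> * of_real pi * \<tau>' / 4)"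

text \<open>The shift z0 and the factor exp(-i pi z / \<gamma>) are made so that the odd theta
  function turns into the even theta_3.\<close>

lemma Phi0_lift: "Phi0 N \<tau> \<gamma> = lift (\<lambda>x. amplitude * theta3 \<tau>' x)"
proof
  fix z :: complex
  define x where "x = z / of_real \<gamma>"
  define z0 where "z0 = of_real \<gamma> / 2 * (\<tau>' - 1)"
  have a: "(z - z0) / of_real \<gamma> = x - \<tau>' / 2 + 1 / 2" using gamma by (simp add: z0_def x_def field_simps)
  have th: "theta \<tau>' (x - \<tau>' / 2 + 1 / 2) = - \<i> * exp (\<i> * of_real pi * \<tau>' / 4 + \<i> * of_real pi * (x - \<tau>' / 2 + 1 / 2)) * theta3 \<tau>' x"
    unfolding theta_eq_theta3 using theta3_shift_1[of \<tau>' x] by (simp add: algebra_simps)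
  have "exp (\<i> * of_real pi * \<tau>' / 4 + \<i> * of_real pi * (x - \<tau>' / 2 + 1 / 2)) = exp (\<i> * of_real pi / 2) * (amplitude * exp (\<i> * of_real pi * x))"
    unfolding amplitude_def exp_add[symmetric] by (rule arg_cong[where f = exp]) (simp add: field_simps)
  also have "exp (\<i> * of_real pi / 2) = \<i>"
  proof -
    have "exp (\<i> * of_real pi / 2) = cis (pi / 2)" unfolding cis_conv_exp by simp
    then show ?thesis by simp
  qed
  finally have th2: "theta \<tau>' (x - \<tau>' / 2 + 1 / 2) = amplitude * exp (\<i> * of_real pi * x) * theta3 \<tau>' x"
    unfolding th by (simp add: mult.assoc[symmetric])
  have e: "exp (z\<^sup>2 / 2 - \<i> * of_real pi / of_real \<gamma> * z - of_real ((cmod z)\<^sup>2) / 2) * exp (\<i> * of_real pi * x) = gauge z"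
    unfolding gauge_def exp_add[symmetric] x_def by (rule arg_cong[where f = exp]) (simp add: field_simps)
  have "Phi0 N \<tau> \<gamma> z = exp (z\<^sup>2 / 2 - \<i> * of_real pi / of_real \<gamma> * z - of_real ((cmod z)\<^sup>2) / 2) * (amplitude * exp (\<i> * of_real pi * x) * theta3 \<tau>' x)"
    unfolding Phi0_def Let_def \<tau>'_def[symmetric] z0_def[symmetric] a th2 ..
  also have "\<dots> = gauge z * (amplitude * theta3 \<tau>' x)" unfolding e[symmetric] by (simp only: mult_ac)
  finally show "Phi0 N \<tau> \<gamma> z = lift (\<lambda>x. amplitude * theta3 \<tau>' x) z" by (simp add: lift_def x_def)
qed

lemma Phi_lift: "Phi N \<tau> \<gamma> k = lift (\<lambda>x. amplitude * theta3 \<tau>' (x + of_nat k / of_nat N))"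
proof -
  have eq: "of_nat k * of_real \<gamma> / of_nat N = of_real \<gamma> * complex_of_real (real k / real N)" by simp
  show ?thesis unfolding Phi_def Phi0_lift eq mag_trans_lift_real by simp
qed

text \<open>Phi_k has level one for the finer lattice generated by 1 and \<tau> / N. The root of
  unity in the multiplier distinguishes the different k.\<close>

lemma theta3_shifted_quasi_periodic:
  "quasi_periodic \<tau>' 1 1 (exp (- \<i> * of_real pi * \<tau>') * exp (- (2 * of_real pi * \<i> * of_nat k / of_nat N))) (\<lambda>x. theta3 \<tau>' (x + of_nat k / of_nat N))"
  unfolding quasi_periodic_def
proof (intro conjI allI)
  show "(\<lambda>x. theta3 \<tau>' (x + of_nat k / of_nat N)) holomorphic_on UNIV"
    by (rule holomorphic_on_compose_gen[OF _ theta3_holomorphic[OF Im_tau'_pos], unfolded o_def]) (auto intro!: holomorphic_intros)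
  show "theta3 \<tau>' (x + 1 + of_nat k / of_nat N) = 1 * theta3 \<tau>' (x + of_nat k / of_nat N)" for x
    using theta3_shift_1[of \<tau>' "x + of_nat k / of_nat N"] by (simp add: algebra_simps)
  show "theta3 \<tau>' (x + \<tau>' + of_nat k / of_nat N) = exp (- \<i> * of_real pi * \<tau>') * exp (- (2 * of_real pi * \<i> * of_nat k / of_nat N)) * exp (- (2 * of_real pi * \<i> * of_nat 1 * x)) * theta3 \<tau>' (x + of_nat k / of_nat N)" for x
  proof -
    have "theta3 \<tau>' (x + of_nat k / of_nat N + of_int 1 * \<tau>') = exp (- \<i> * of_real pi * \<tau>' * (of_int 1)\<^sup>2 - 2 * of_real pi * \<i> * of_int 1 * (x + of_nat k / of_nat N)) * theta3 \<tau>' (x + of_nat k / of_nat N)"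
      by (rule theta3_shift_tau)
    also have "exp (- \<i> * of_real pi * \<tau>' * (of_int 1)\<^sup>2 - 2 * of_real pi * \<i> * of_int 1 * (x + of_nat k / of_nat N)) =
      exp (- \<i> * of_real pi * \<tau>') * exp (- (2 * of_real pi * \<i> * of_nat k / of_nat N)) * exp (- (2 * of_real pi * \<i> * of_nat 1 * x))"
      unfolding exp_add[symmetric] by (rule arg_cong[where f = exp]) (simp add: algebra_simps)
    finally show ?thesis by (simp add: add_ac)
  qed
qed auto

lemma Phi_in_lattice_space: "Phi N \<tau> \<gamma> k \<in> lattice_space \<tau> \<gamma>"
proof -
  have "quasi_periodic \<tau> N 1 multiplier (\<lambda>x. amplitude * theta3 \<tau>' (x + of_nat k / of_nat N))"
    unfolding quasi_periodic_def
  proof (intro conjI allI)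
    show "(\<lambda>x. amplitude * theta3 \<tau>' (x + of_nat k / of_nat N)) holomorphic_on UNIV"
      by (intro holomorphic_intros quasi_periodicD(1)[OF theta3_shifted_quasi_periodic])
    show "amplitude * theta3 \<tau>' (x + 1 + of_nat k / of_nat N) = 1 * (amplitude * theta3 \<tau>' (x + of_nat k / of_nat N))" for x
      using quasi_periodicD(4)[OF theta3_shifted_quasi_periodic, of x k] by simp
    show "amplitude * theta3 \<tau>' (x + \<tau> + of_nat k / of_nat N) = multiplier * exp (- (2 * of_real pi * \<i> * of_nat N * x)) * (amplitude * theta3 \<tau>' (x + of_nat k / of_nat N))" for x
    proof -
      have "theta3 \<tau>' (x + of_nat k / of_nat N + of_int (int N) * \<tau>') = exp (- \<i> * of_real pi * \<tau>' * (of_int (int N))\<^sup>2 - 2 * of_real pi * \<i> * of_int (int N) * (x + of_nat k / of_nat N)) * theta3 \<tau>' (x + of_nat k / of_nat N)"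
        by (rule theta3_shift_tau)
      also have "exp (- \<i> * of_real pi * \<tau>' * (of_int (int N))\<^sup>2 - 2 * of_real pi * \<i> * of_int (int N) * (x + of_nat k / of_nat N)) =
        multiplier * exp (- (2 * of_real pi * \<i> * of_nat N * x)) * inverse (exp (2 * of_real pi * \<i> * of_nat k))"
        unfolding multiplier_def exp_minus[symmetric] exp_add[symmetric] using N
        by (intro arg_cong[where f = exp]) (simp add: \<tau>'_def power2_eq_square field_simps)
      also have "exp (2 * of_real pi * \<i> * of_nat k) = 1"
        using exp_integer_2pi[of "of_nat k"] by (simp add: mult_ac)
      finally show ?thesis using tau'_N by (simp add: add_ac mult_ac)
    qed
  qed (auto simp: multiplier_def)
  then show ?thesis unfolding Phi_lift by (rule lift_in_lattice_space)
qed

text \<open>\<open>theta_factorization\<close> can give G and H the same exponential and, as the sum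
  over a single zero is prescribed, the same zero. Only a constant is left.\<close>

lemma level_one_unique:
  assumes G: "quasi_periodic \<tau>' 1 1 b G" and H: "quasi_periodic \<tau>' 1 1 b H" and nz: "\<exists>x. H x \<noteq> 0"
  shows "\<exists>c. \<forall>x. G x = c * H x"
proof -
  define a where "a = exp (\<i> * of_real pi * (- of_nat 1 + 2 * of_int 0) * \<tau>') * ((-1) ^ 1 * exp (- \<i> * of_real pi * of_nat 1 * \<tau>'))"
  have a: "a \<noteq> 0" by (simp add: a_def)
  have b: "b \<noteq> 0" using quasi_periodicD(3)[OF G] .
  obtain w where w: "exp w = b / a" using a b by (metis divide_eq_0_iff exp_Ln)
  \<comment> \<open>The position of the zero that the multiplier b dictates.\<close>
  define y where "y = w / (2 * of_real pi * \<i>)"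
  have "b = a * exp (2 * of_real pi * \<i> * y)" using a w by (simp add: y_def)
  note b_eq = this[unfolded a_def]
  obtain c xs where c: "(\<Sum>j=1..1::nat. xs j) = y" "\<forall>x. G x = c * exp (\<i> * of_real pi * (- of_nat 1 + 2 * of_int 0) * x) * (\<Prod>j=1..1::nat. theta \<tau>' (x - xs j))"
    using theta_factorization[OF Im_tau'_pos _ G b_eq] by auto
  obtain d ys where d: "(\<Sum>j=1..1::nat. ys j) = y" "\<forall>x. H x = d * exp (\<i> * of_real pi * (- of_nat 1 + 2 * of_int 0) * x) * (\<Prod>j=1..1::nat. theta \<tau>' (x - ys j))"
    using theta_factorization[OF Im_tau'_pos _ H b_eq] by auto
  have xy: "xs 1 = y" "ys 1 = y" using c(1) d(1) by auto
  have "d \<noteq> 0" using nz d(2) by auto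
  then have "G x = c / d * H x" for x using c(2) d(2) xy by simp
  then show ?thesis by blast
qed

lemma root_sum:
  assumes "j < N"
  shows "(\<Sum>k<N. exp (2 * of_real pi * \<i> * of_nat (j * k) / of_nat N)) = (if j = 0 then of_nat N else 0)"
proof (cases "j = 0")
  case False
  define w where "w = exp (2 * of_real pi * \<i> * of_nat j / of_nat N)"
  have w1: "w \<noteq> 1" unfolding w_def using complex_root_unity_eq_1[OF N, of j] False assms by (auto dest: dvd_imp_le)
  have pow: "exp (2 * of_real pi * \<i> * of_nat (j * k) / of_nat N) = w ^ k" for k
    unfolding w_def exp_of_nat_mult[symmetric] by (simp add: mult_ac)
  have "w ^ N = exp (of_nat N * (2 * of_real pi * \<i> * of_nat j / of_nat N))" unfolding w_def exp_of_nat_mult ..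
  also have "\<dots> = exp (2 * of_real pi * \<i> * of_nat j / of_nat 1)" using N by simp
  also have "\<dots> = 1" using complex_root_unity_eq_1[of 1 j] by simp
  finally have "w ^ N = 1" .
  then have "(\<Sum>k<N. w ^ k) = 0" using w1 geometric_sum[of w N] by simp
  then show ?thesis using False unfolding pow by simp
qed simp

text \<open>On the space, translation by \<gamma> \<tau> / N has the identity as its N-th power. The
  discrete Fourier transform of its powers splits u into eigenfunctions \<open>Gk\<close>; each has
  level one for the finer lattice and is therefore a multiple of a shifted theta_3.\<close>

lemma lattice_space_span:
  assumes u: "u \<in> lattice_space \<tau> \<gamma>"
  shows "\<exists>lam. u = (\<lambda>z. \<Sum>k<N. lam k * Phi N \<tau> \<gamma> k z)"
proof -
  obtain G where G: "quasi_periodic \<tau> N 1 multiplier G" "u = lift G" using lattice_space_lift[OF u] by blast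
  note q = quasi_periodicD[OF G(1)]
  \<comment> \<open>The magnetic translation by j \<gamma> \<tau> / N, expressed on the entire
    factor G.\<close>
  define T where "T j x = exp (2 * of_real pi * \<i> * of_nat j * x + \<i> * of_real pi * (of_nat j)\<^sup>2 * \<tau>') * G (x + of_nat j * \<tau>')" for j x
  have T0: "T 0 x = G x" for x by (simp add: T_def)
  have TN: "T N x = T 0 x" for x
  proof -
    have "T N x = exp (2 * of_real pi * \<i> * of_nat N * x + \<i> * of_real pi * (of_nat N)\<^sup>2 * \<tau>') * (multiplier * exp (- (2 * of_real pi * \<i> * of_nat N * x))) * G x"
      unfolding T_def tau'_N q(5) by simp
    also have "exp (2 * of_real pi * \<i> * of_nat N * x + \<i> * of_real pi * (of_nat N)\<^sup>2 * \<tau>') * (multiplier * exp (- (2 * of_real pi * \<i> * of_nat N * x))) = exp 0"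
    proof -
      have e: "\<i> * of_real pi * (of_nat N)\<^sup>2 * \<tau>' = \<i> * of_real pi * of_nat N * \<tau>"
        using tau'_N by (simp add: power2_eq_square mult.assoc)
      show ?thesis unfolding multiplier_def e exp_add[symmetric] by (rule arg_cong[where f = exp]) simp
    qed
    finally show ?thesis by (simp add: T0)
  qed
  have T1: "T j (x + 1) = T j x" for j x
  proof -
    have "exp (2 * of_real pi * \<i> * of_nat j * (x + 1) + \<i> * of_real pi * (of_nat j)\<^sup>2 * \<tau>') =
       exp (2 * of_real pi * \<i> * of_nat j) * exp (2 * of_real pi * \<i> * of_nat j * x + \<i> * of_real pi * (of_nat j)\<^sup>2 * \<tau>')"
      unfolding exp_add[symmetric] by (rule arg_cong[where f = exp]) (simp add: algebra_simps)
    also have "exp (2 * of_real pi * \<i> * of_nat j) = 1"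
      using exp_integer_2pi[of "of_nat j"] by (simp add: mult_ac)
    finally show ?thesis using q(4)[of "x + of_nat j * \<tau>'"] by (simp add: T_def add_ac)
  qed
  have Tt: "T j (x + \<tau>') = exp (- (2 * of_real pi * \<i> * x) - \<i> * of_real pi * \<tau>') * T (Suc j) x" for j x
  proof -
    have "exp (2 * of_real pi * \<i> * of_nat j * (x + \<tau>') + \<i> * of_real pi * (of_nat j)\<^sup>2 * \<tau>') =
      exp (- (2 * of_real pi * \<i> * x) - \<i> * of_real pi * \<tau>') * exp (2 * of_real pi * \<i> * of_nat (Suc j) * x + \<i> * of_real pi * (of_nat (Suc j))\<^sup>2 * \<tau>')"
      unfolding exp_add[symmetric] by (rule arg_cong[where f = exp]) (simp add: power2_eq_square algebra_simps)
    moreover have "G (x + \<tau>' + of_nat j * \<tau>') = G (x + of_nat (Suc j) * \<tau>')" by (simp add: algebra_simps)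
    ultimately show ?thesis unfolding T_def by simp
  qed
  define om where "om m = exp (2 * of_real pi * \<i> * of_nat m / of_nat N)" for m
  have om_add: "om (m + n) = om m * om n" for m n
    unfolding om_def exp_add[symmetric] by (simp add: add_divide_distrib distrib_left)
  have omN: "om (N * k) = 1" for k
    using complex_root_unity_eq_1[OF N, of "N * k"] by (simp add: om_def)
  define Gk where "Gk k x = (1 / of_nat N) * (\<Sum>j<N. om (j * k) * T j x)" for k x
  have Th: "T j holomorphic_on UNIV" for j
  proof -
    have "(\<lambda>x. G (x + of_nat j * \<tau>')) holomorphic_on UNIV"
      by (rule holomorphic_on_compose_gen[OF _ q(1), unfolded o_def]) (auto intro!: holomorphic_intros)
    then show ?thesis unfolding T_def[abs_def] by (intro holomorphic_intros)
  qed
  have Gk: "quasi_periodic \<tau>' 1 1 (exp (- \<i> * of_real pi * \<tau>') * exp (- (2 * of_real pi * \<i> * of_nat k / of_nat N))) (Gk k)" for k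
    unfolding quasi_periodic_def
  proof (intro conjI allI)
    show "Gk k holomorphic_on UNIV" unfolding Gk_def[abs_def] by (intro holomorphic_intros Th)
    show "Gk k (x + 1) = 1 * Gk k x" for x unfolding Gk_def T1 by simp
    fix x
    have "om k * (\<Sum>j<N. om (j * k) * T (Suc j) x) = (\<Sum>j<N. om (Suc j * k) * T (Suc j) x)"
      by (simp add: sum_distrib_left om_add mult.assoc)
    \<comment> \<open>The sum closes up cyclically since \<open>T N\<close> is \<open>T 0\<close>
      and both carry the weight 1.\<close>
    also have "\<dots> = (\<Sum>j<N. om (j * k) * T j x)"
      using sum.lessThan_Suc_shift[of "\<lambda>j. om (j * k) * T j x" N] sum.lessThan_Suc[of "\<lambda>j. om (j * k) * T j x" N] TN omN[of k] omN[of 0]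
      by simp
    finally have cyc: "(\<Sum>j<N. om (j * k) * T (Suc j) x) = exp (- (2 * of_real pi * \<i> * of_nat k / of_nat N)) * (\<Sum>j<N. om (j * k) * T j x)"
      unfolding om_def[of k] exp_minus by (simp add: field_simps)
    have "Gk k (x + \<tau>') = (1 / of_nat N) * (exp (- (2 * of_real pi * \<i> * x) - \<i> * of_real pi * \<tau>') * (\<Sum>j<N. om (j * k) * T (Suc j) x))"
    proof -
      have "om (j * k) * (E * T (Suc j) x) = E * (om (j * k) * T (Suc j) x)" for j E by (rule mult.left_commute)
      then show ?thesis unfolding Gk_def Tt by (simp only: sum_distrib_left[symmetric])
    qed
    also have "exp (- (2 * of_real pi * \<i> * x) - \<i> * of_real pi * \<tau>') = exp (- \<i> * of_real pi * \<tau>') * exp (- (2 * of_real pi * \<i> * of_nat 1 * x))"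
      unfolding exp_add[symmetric] by (rule arg_cong[where f = exp]) simp
    finally show "Gk k (x + \<tau>') = exp (- \<i> * of_real pi * \<tau>') * exp (- (2 * of_real pi * \<i> * of_nat k / of_nat N)) * exp (- (2 * of_real pi * \<i> * of_nat 1 * x)) * Gk k x"
      unfolding cyc Gk_def by (simp only: mult_ac)
  qed auto
  have ex: "\<exists>c. \<forall>x. Gk k x = c * theta3 \<tau>' (x + of_nat k / of_nat N)" for k
  proof (rule level_one_unique[OF Gk theta3_shifted_quasi_periodic])
    obtain x where "theta3 \<tau>' x \<noteq> 0" using theta3_not_zero[OF Im_tau'_pos] by blast
    then show "\<exists>x. theta3 \<tau>' (x + of_nat k / of_nat N) \<noteq> 0" by (intro exI[of _ "x - of_nat k / of_nat N"]) simp
  qed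
  define c where "c k = (SOME c. \<forall>x. Gk k x = c * theta3 \<tau>' (x + of_nat k / of_nat N))" for k
  have c: "Gk k x = c k * theta3 \<tau>' (x + of_nat k / of_nat N)" for k x
    using someI_ex[OF ex[of k]] unfolding c_def by blast
  have sumG: "(\<Sum>k<N. Gk k x) = G x" for x
  proof -
    have "(\<Sum>k<N. Gk k x) = (1 / of_nat N) * (\<Sum>k<N. \<Sum>j<N. om (j * k) * T j x)" unfolding Gk_def sum_distrib_left[symmetric] ..
    also have "(\<Sum>k<N. \<Sum>j<N. om (j * k) * T j x) = (\<Sum>j<N. \<Sum>k<N. om (j * k) * T j x)" by (rule sum.swap)
    also have "\<dots> = (\<Sum>j<N. (\<Sum>k<N. om (j * k)) * T j x)" by (simp add: sum_distrib_right)
    also have "\<dots> = (\<Sum>j<N. (if j = 0 then of_nat N else 0) * T j x)"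
      unfolding om_def using root_sum by (intro sum.cong refl) auto
    also have "\<dots> = of_nat N * G x"
    proof -
      have "(\<Sum>j<N. (if j = 0 then of_nat N else 0) * T j x) = (\<Sum>j<N. if j = 0 then of_nat N * T j x else 0)"
        by (intro sum.cong) auto
      also have "\<dots> = of_nat N * T 0 x" using N by (subst sum.delta) auto
      finally show ?thesis by (simp add: T0)
    qed
    finally show ?thesis using N by simp
  qed
  have "u z = (\<Sum>k<N. (c k / amplitude) * Phi N \<tau> \<gamma> k z)" for z
  proof -
    have "u z = gauge z * (\<Sum>k<N. Gk k (z / of_real \<gamma>))" unfolding sumG G(2) lift_def ..
    also have "\<dots> = (\<Sum>k<N. (c k / amplitude) * Phi N \<tau> \<gamma> k z)"
      unfolding Phi_lift lift_def c sum_distrib_left by (intro sum.cong refl) (simp add: amplitude_def)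
    finally show ?thesis .
  qed
  then show ?thesis by (intro exI[of _ "\<lambda>k. c k / amplitude"] ext)
qed

end

subsection \<open>Orthogonality and norm of the \<open>\<Phi>\<^sub>k\<close>\<close>

context LLL_lattice
begin

definition inner_cell :: "(complex \<Rightarrow> complex) \<Rightarrow> (complex \<Rightarrow> complex) \<Rightarrow> complex" where
  "inner_cell f g = (LINT z:cell \<tau> \<gamma>|lborel. f z * cnj (g z))"

abbreviation \<Phi> :: "nat \<Rightarrow> complex \<Rightarrow> complex" where "\<Phi> \<equiv> Phi N \<tau> \<gamma>"

lemma Phi_quasi: "quasi (\<Phi> k)" by (rule lattice_space_quasi[OF Phi_in_lattice_space])

lemma Phi_continuous: "continuous_on UNIV (\<Phi> k)" using Phi_quasi by (simp add: quasi_def)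

text \<open>The phase of a magnetic translation has modulus one and cancels between u and the
  conjugate of v.\<close>

lemma mag_trans_pair:
  assumes "mag_trans \<alpha> u = (\<lambda>z. a * u z)" "mag_trans \<alpha> v = (\<lambda>z. b * v z)"
  shows "u (z + \<alpha>) * cnj (v (z + \<alpha>)) = (a * cnj b) * (u z * cnj (v z))"
proof -
  define p where "p = exp ((\<alpha> * cnj z - cnj \<alpha> * z) / 2)"
  have "Re ((\<alpha> * cnj z - cnj \<alpha> * z) / 2) = 0" by simp
  then have "cmod p = 1" unfolding p_def norm_exp_eq_Re by simp
  then have p: "p * cnj p = 1" by (simp add: complex_norm_square[symmetric])
  have "p * u (z + \<alpha>) = a * u z" "p * v (z + \<alpha>) = b * v z"
    using fun_cong[OF assms(1), of z] fun_cong[OF assms(2), of z] by (simp_all add: mag_trans_def p_def)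
  then have "(p * u (z + \<alpha>)) * cnj (p * v (z + \<alpha>)) = (a * u z) * cnj (b * v z)" by simp
  moreover have "(p * u (z + \<alpha>)) * cnj (p * v (z + \<alpha>)) = (p * cnj p) * (u (z + \<alpha>) * cnj (v (z + \<alpha>)))"
    by (simp add: mult_ac)
  ultimately show ?thesis using p by (simp add: mult_ac)
qed

lemma quasi_pair_periodic:
  assumes "quasi u" "quasi v"
  shows "u (z + of_real \<gamma>) * cnj (v (z + of_real \<gamma>)) = u z * cnj (v z)"
    "u (z + of_real \<gamma> * \<tau>) * cnj (v (z + of_real \<gamma> * \<tau>)) = u z * cnj (v z)"
  using mag_trans_pair[of "of_real \<gamma>" u 1 v 1 z] mag_trans_pair[of "of_real \<gamma> * \<tau>" u 1 v 1 z] assms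
  by (simp_all add: quasi_def)

definition root :: "nat \<Rightarrow> complex" where "root k = exp (- (2 * of_real pi * \<i> * of_nat k / of_nat N))"

lemma root_cnj: "cnj (root k) = exp (2 * of_real pi * \<i> * of_nat k / of_nat N)"
  by (simp add: root_def exp_cnj)

lemma mag_trans_Phi: "mag_trans (of_real \<gamma> * \<tau>') (\<Phi> k) = (\<lambda>z. root k * \<Phi> k z)"
proof -
  have t: "complex_of_real (1 / real N) * \<tau> = \<tau>'" by (simp add: \<tau>'_def)
  have n: "of_nat N * complex_of_real (1 / real N) = 1" using N by simp
  have pt: "exp (2 * of_real pi * \<i> * of_nat N * complex_of_real (1 / real N) * (x + \<tau>' / 2)) * (amplitude * theta3 \<tau>' (x + \<tau>' + of_nat k / of_nat N)) =
     root k * (amplitude * theta3 \<tau>' (x + of_nat k / of_nat N))" for x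
  proof -
    have a: "exp (2 * of_real pi * \<i> * of_nat N * complex_of_real (1 / real N) * (x + \<tau>' / 2)) = exp (2 * of_real pi * \<i> * (x + \<tau>' / 2))"
    proof -
      have "2 * of_real pi * \<i> * of_nat N * complex_of_real (1 / real N) = 2 * of_real pi * \<i>"
        unfolding mult.assoc n by simp
      then show ?thesis by (simp only:)
    qed
    have b: "theta3 \<tau>' (x + \<tau>' + of_nat k / of_nat N) = exp (- \<i> * of_real pi * \<tau>') * root k * exp (- (2 * of_real pi * \<i> * x)) * theta3 \<tau>' (x + of_nat k / of_nat N)"
      using quasi_periodicD(5)[OF theta3_shifted_quasi_periodic, of x k] unfolding root_def by simp
    have c: "exp (2 * of_real pi * \<i> * (x + \<tau>' / 2)) * (exp (- \<i> * of_real pi * \<tau>') * exp (- (2 * of_real pi * \<i> * x))) = 1"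
      unfolding exp_add[symmetric] by (simp add: algebra_simps)
    have "e1 * (A * (e2 * r * e3 * t)) = (e1 * (e2 * e3)) * (r * (A * t))" for e1 e2 e3 A r t :: complex
      by (simp only: mult_ac)
    then show ?thesis unfolding a b by (simp only: c mult_1)
  qed
  have "mag_trans (of_real \<gamma> * \<tau>') (\<Phi> k) = lift (\<lambda>x. root k * (amplitude * theta3 \<tau>' (x + of_nat k / of_nat N)))"
    unfolding Phi_lift using mag_trans_lift_tau[of "1 / real N" "\<lambda>x. amplitude * theta3 \<tau>' (x + of_nat k / of_nat N)", unfolded t pt] .
  then show ?thesis unfolding Phi_lift by (simp add: lift_def fun_eq_iff mult_ac)
qed

text \<open>By translation invariance the integral equals c times itself.\<close>

lemma cell_integral_eigen_zero:
  fixes f :: "complex \<Rightarrow> complex"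
  assumes "continuous_on UNIV f" "\<And>z. f (z + of_real \<gamma>) = f z" "\<And>z. f (z + of_real \<gamma> * \<tau>) = f z"
    "\<And>z. f (z + w) = c * f z" "c \<noteq> 1"
  shows "(LINT z:cell \<tau> \<gamma>|lborel. f z) = 0"
proof -
  have "(LINT z:cell \<tau> \<gamma>|lborel. f z) = (LINT z:cell \<tau> \<gamma>|lborel. c * f z)"
    using cell_translate[OF assms(1-3), of w] assms(4) by simp
  also have "\<dots> = c * (LINT z:cell \<tau> \<gamma>|lborel. f z)" by (rule set_integral_mult_right)
  finally show ?thesis using assms(5) by simp
qed

lemma root_phase:
  assumes "exp (2 * of_real pi * \<i> * (of_int m / of_nat N)) = 1"
  shows "int N dvd m"
proof -
  obtain r :: int where "of_int m / of_nat N = (of_int r :: complex)" using exp_eq_1_int[OF assms] by blast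
  then have "(of_int m :: complex) = of_int (r * int N)" using N by (simp add: field_simps)
  then have "m = r * int N" by (simp only: of_int_eq_iff)
  then show ?thesis by simp
qed

lemma Phi_orthogonal:
  assumes "k < N" "l < N" "k \<noteq> l"
  shows "inner_cell (\<Phi> k) (\<Phi> l) = 0"
  unfolding inner_cell_def
proof (rule cell_integral_eigen_zero)
  show "continuous_on UNIV (\<lambda>z. \<Phi> k z * cnj (\<Phi> l z))" by (intro continuous_intros Phi_continuous)
  show "\<Phi> k (z + of_real \<gamma> * \<tau>') * cnj (\<Phi> l (z + of_real \<gamma> * \<tau>')) = (root k * cnj (root l)) * (\<Phi> k z * cnj (\<Phi> l z))" for z
    by (rule mag_trans_pair[OF mag_trans_Phi mag_trans_Phi])
  show "root k * cnj (root l) \<noteq> 1"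
  proof
    assume "root k * cnj (root l) = 1"
    moreover have "root k * cnj (root l) = exp (2 * of_real pi * \<i> * (of_int (int l - int k) / of_nat N))"
      unfolding root_cnj unfolding root_def exp_add[symmetric] by (rule arg_cong[where f = exp]) (simp add: diff_divide_distrib algebra_simps)
    ultimately have "int N dvd int l - int k" by (intro root_phase) simp
    then have "int N \<le> \<bar>int l - int k\<bar>" using assms(3) by (intro zdvd_imp_le) auto
    then show False using assms by auto
  qed
qed (rule quasi_pair_periodic[OF Phi_quasi Phi_quasi])+

definition I4 :: "nat \<Rightarrow> nat \<Rightarrow> nat \<Rightarrow> nat \<Rightarrow> complex" where
  "I4 k l m j = (LINT z:cell \<tau> \<gamma>|lborel. \<Phi> k z * cnj (\<Phi> l z) * \<Phi> m z * cnj (\<Phi> j z))"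

lemma I4_vanishes:
  assumes "\<not> [int k - int l + int m = int j] (mod int N)"
  shows "I4 k l m j = 0"
proof -
  define f where "f z = (\<Phi> k z * cnj (\<Phi> l z)) * (\<Phi> m z * cnj (\<Phi> j z))" for z
  have "(LINT z:cell \<tau> \<gamma>|lborel. f z) = 0"
  proof (rule cell_integral_eigen_zero)
    show "continuous_on UNIV f" unfolding f_def by (intro continuous_intros Phi_continuous)
    show "f (z + of_real \<gamma>) = f z" "f (z + of_real \<gamma> * \<tau>) = f z" for z
      unfolding f_def quasi_pair_periodic[OF Phi_quasi Phi_quasi] by simp_all
    show "f (z + of_real \<gamma> * \<tau>') = ((root k * cnj (root l)) * (root m * cnj (root j))) * f z" for z
      unfolding f_def mag_trans_pair[OF mag_trans_Phi mag_trans_Phi] by (simp only: mult_ac)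
    show "(root k * cnj (root l)) * (root m * cnj (root j)) \<noteq> 1"
    proof
      assume "(root k * cnj (root l)) * (root m * cnj (root j)) = 1"
      moreover have "(root k * cnj (root l)) * (root m * cnj (root j)) = exp (2 * of_real pi * \<i> * (of_int (int j - (int k - int l + int m)) / of_nat N))"
        unfolding root_cnj unfolding root_def exp_add[symmetric]
        by (rule arg_cong[where f = exp]) (simp add: diff_divide_distrib add_divide_distrib algebra_simps)
      ultimately have "int N dvd int j - (int k - int l + int m)" by (intro root_phase) simp
      then show False using assms by (simp add: cong_iff_dvd_diff dvd_diff_commute)
    qed
  qed
  then show ?thesis by (simp add: I4_def f_def mult.assoc)
qed

text \<open>As b runs through [0, 1) and n through the integers, s = n + b N covers the line exactly
  N times, while db = ds / N. The factors N cancel and the plain Gaussian integral remains.\<close>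

lemma nn_integral_gauss_periodized:
  assumes "\<kappa> > 0"
  shows "(\<integral>\<^sup>+b. indicator {0..<1} b * (\<integral>\<^sup>+n. ennreal (exp (- \<kappa> * (real_of_int n + b * real N)\<^sup>2)) \<partial>count_space UNIV) \<partial>lborel) = ennreal (sqrt (pi / \<kappa>))"
proof -
  define g where "g s = ennreal (exp (- \<kappa> * s\<^sup>2))" for s :: real
  have [measurable]: "g \<in> borel_measurable borel" unfolding g_def by measurable
  let ?X = "\<integral>\<^sup>+b. indicator {0..<1} b * (\<integral>\<^sup>+n. g (real_of_int n + b * real N) \<partial>count_space UNIV) \<partial>lborel"
  have shift: "ennreal (real N) * (\<integral>\<^sup>+b. indicator {0..<1} b * g (real_of_int n + b * real N) \<partial>lborel) =
     (\<integral>\<^sup>+s. indicator {real_of_int n..<real_of_int n + real N} s * g s \<partial>lborel)" for n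
  proof -
    have "(\<integral>\<^sup>+s. indicator {real_of_int n..<real_of_int n + real N} s * g s \<partial>lborel) =
      ennreal \<bar>real N\<bar> * (\<integral>\<^sup>+b. indicator {real_of_int n..<real_of_int n + real N} (real_of_int n + real N * b) * g (real_of_int n + real N * b) \<partial>lborel)"
      using N by (intro nn_integral_real_affine) auto
    also have "(\<lambda>b. indicator {real_of_int n..<real_of_int n + real N} (real_of_int n + real N * b) * g (real_of_int n + real N * b)) =
       (\<lambda>b. indicator {0..<1} b * g (real_of_int n + b * real N))"
      using N by (auto simp: fun_eq_iff indicator_def mult.commute zero_le_mult_iff)
    finally show ?thesis by simp
  qed
  have "ennreal (real N) * ?X = ennreal (real N) * (\<integral>\<^sup>+b. \<integral>\<^sup>+n. indicator {0..<1} b * g (real_of_int n + b * real N) \<partial>count_space UNIV \<partial>lborel)"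
    by (simp add: nn_integral_cmult)
  also have "\<dots> = ennreal (real N) * (\<integral>\<^sup>+n. \<integral>\<^sup>+b. indicator {0..<1} b * g (real_of_int n + b * real N) \<partial>lborel \<partial>count_space UNIV)"
    by (subst nn_integral_count_space_nn_integral) auto
  also have "\<dots> = (\<integral>\<^sup>+n. \<integral>\<^sup>+s. indicator {real_of_int n..<real_of_int n + real N} s * g s \<partial>lborel \<partial>count_space UNIV)"
    by (subst nn_integral_cmult[symmetric]) (simp_all add: shift)
  also have "\<dots> = (\<integral>\<^sup>+s. \<integral>\<^sup>+n. indicator {real_of_int n..<real_of_int n + real N} s * g s \<partial>count_space UNIV \<partial>lborel)"
    by (subst nn_integral_count_space_nn_integral) auto
  also have "\<dots> = (\<integral>\<^sup>+s. ennreal (real N) * g s \<partial>lborel)"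
  proof (rule nn_integral_cong)
    fix s :: real
    \<comment> \<open>Exactly N integers n satisfy n \<le> s < n + N.\<close>
    have set: "{n. s \<in> {real_of_int n..<real_of_int n + real N}} = {\<lfloor>s\<rfloor> - int N + 1..\<lfloor>s\<rfloor>}"
      by (auto simp: le_floor_iff) linarith+
    have ind: "indicator {real_of_int n..<real_of_int n + real N} s = (indicator {\<lfloor>s\<rfloor> - int N + 1..\<lfloor>s\<rfloor>} n :: ennreal)" for n
      unfolding set[symmetric] by (simp add: indicator_def)
    have "(\<integral>\<^sup>+n. indicator {real_of_int n..<real_of_int n + real N} s * g s \<partial>count_space UNIV) =
       (\<integral>\<^sup>+n. indicator {\<lfloor>s\<rfloor> - int N + 1..\<lfloor>s\<rfloor>} n \<partial>count_space UNIV) * g s"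
      unfolding ind by (rule nn_integral_multc) simp
    also have "(\<integral>\<^sup>+n. indicator {\<lfloor>s\<rfloor> - int N + 1..\<lfloor>s\<rfloor>} n \<partial>count_space UNIV) = emeasure (count_space UNIV) {\<lfloor>s\<rfloor> - int N + 1..\<lfloor>s\<rfloor>}"
      by (rule nn_integral_indicator) simp
    also have "\<dots> = ennreal (real N)" by (subst emeasure_count_space_finite) (auto simp: ennreal_of_nat_eq_real_of_nat)
    finally show "(\<integral>\<^sup>+n. indicator {real_of_int n..<real_of_int n + real N} s * g s \<partial>count_space UNIV) = ennreal (real N) * g s" .
  qed
  also have "\<dots> = ennreal (real N) * (\<integral>\<^sup>+s. g s \<partial>lborel)" by (rule nn_integral_cmult) simp
  finally have "ennreal (real N) * ?X = ennreal (real N) * (\<integral>\<^sup>+s. g s \<partial>lborel)" .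
  then have "?X = (\<integral>\<^sup>+s. g s \<partial>lborel)"
    using N by (subst (asm) ennreal_mult_cancel_left) auto
  also have "\<dots> = ennreal (LINT s|lborel. exp (- \<kappa> * s\<^sup>2))"
    unfolding g_def using integrable_gaussian_real[OF assms] by (intro nn_integral_eq_integral) auto
  finally show ?thesis unfolding g_def integrable_gaussian_real(2)[OF assms] .
qed

lemma Im_point: "Im (point a b) = b * pi * real N / \<gamma>"
  using gamma by (simp add: point_def Im_tau power2_eq_square)

lemma gauge_norm: "(cmod (gauge z))\<^sup>2 = exp (- 2 * (Im z)\<^sup>2)"
proof -
  have "Re (z\<^sup>2 / 2 - of_real ((cmod z)\<^sup>2) / 2) = - (Im z)\<^sup>2"
    unfolding cmod_power2 by (simp add: power2_eq_square field_simps)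
  then show ?thesis unfolding gauge_def norm_exp_eq_Re by (simp add: power2_eq_square exp_add[symmetric])
qed

text \<open>For fixed b, Parseval in the real direction a replaces the inner integral by a sum over
  n of Gaussians in n + b N. Integrating over b unfolds this sum to a single Gaussian on the
  line.\<close>

lemma Phi_norm: "(LINT z:cell \<tau> \<gamma>|lborel. (cmod (\<Phi> k z))\<^sup>2) = \<gamma> * real N * sqrt (pi / 2) * exp (pi\<^sup>2 / (2 * \<gamma>\<^sup>2))"
proof -
  \<comment> \<open>The rate of exp(-2 (Im z)^2), the square of the gauge factor, in the variable b
    N, where Im z = b N pi / \<gamma>.\<close>
  define \<kappa> where "\<kappa> = 2 * pi\<^sup>2 / \<gamma>\<^sup>2"
  have k0: "\<kappa> > 0" using gamma by (simp add: \<kappa>_def)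
  define A where "A = exp (pi\<^sup>2 / (2 * \<gamma>\<^sup>2))"
  have amp: "(cmod amplitude)\<^sup>2 = A"
  proof -
    have "Re (- \<i> * of_real pi * \<tau>' / 4) = pi\<^sup>2 / (4 * \<gamma>\<^sup>2)" by (simp add: Im_tau' power2_eq_square)
    then have "cmod amplitude = exp (pi\<^sup>2 / (4 * \<gamma>\<^sup>2))" unfolding amplitude_def norm_exp_eq_Re by simp
    then show ?thesis by (simp add: A_def power2_eq_square exp_add[symmetric] field_simps)
  qed
  define J where "J b = integral {0..1} (\<lambda>a. (cmod (\<Phi> k (point a b)))\<^sup>2)" for b
  have cont: "continuous_on UNIV (\<lambda>z. (cmod (\<Phi> k z))\<^sup>2)" by (intro continuous_intros Phi_continuous)
  have cJ: "continuous_on UNIV J"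
  proof -
    have "continuous_on (UNIV \<times> cbox 0 1) (\<lambda>(b, a). (cmod (\<Phi> k (point a b)))\<^sup>2)"
      unfolding case_prod_beta by (intro continuous_on_point[OF cont] continuous_intros)
    then show ?thesis unfolding J_def using integral_continuous_on_param[of UNIV 0 1 "\<lambda>b a. (cmod (\<Phi> k (point a b)))\<^sup>2"] by simp
  qed
  have hs: "((\<lambda>n. exp (- \<kappa> * (real_of_int n + b * real N)\<^sup>2)) has_sum (J b / A)) UNIV" for b
  proof -
    define c where "c n = theta3_term \<tau>' n (of_real b * \<tau> + of_nat k / of_nat N)" for n
    have s: "(\<lambda>n. cmod (c n)) summable_on UNIV" unfolding c_def by (rule theta3_abs_summable[OF Im_tau'_pos])
    have th: "theta3 \<tau>' (of_real a + of_real b * \<tau> + of_nat k / of_nat N) = (\<Sum>\<^sub>\<infinity>n. c n * exp (2 * of_real pi * \<i> * of_int n * of_real a))" for a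
      unfolding theta3_def c_def theta3_term_def exp_add[symmetric] by (intro infsum_cong arg_cong[where f = exp]) (simp add: algebra_simps)
    have pw: "(cmod (\<Phi> k (point a b)))\<^sup>2 = (exp (- \<kappa> * (b * real N)\<^sup>2) * A) * (cmod (theta3 \<tau>' (of_real a + of_real b * \<tau> + of_nat k / of_nat N)))\<^sup>2" for a
    proof -
      have pg: "point a b / of_real \<gamma> = of_real a + of_real b * \<tau>" using gamma by (simp add: point_def)
      have "- 2 * (Im (point a b))\<^sup>2 = - \<kappa> * (b * real N)\<^sup>2" unfolding Im_point by (simp add: \<kappa>_def power_mult_distrib power_divide)
      then show ?thesis unfolding Phi_lift lift_def norm_mult power_mult_distrib gauge_norm pg amp by simp
    qed
    \<comment> \<open>The coefficient supplies the square of n and the mixed term, the gauge factor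
      the square of b N: together a complete square.\<close>
    have cn: "(cmod (c n))\<^sup>2 * exp (- \<kappa> * (b * real N)\<^sup>2) = exp (- \<kappa> * (real_of_int n + b * real N)\<^sup>2)" for n
    proof -
      have "Re (\<i> * of_real pi * \<tau>' * (of_int n)\<^sup>2 + 2 * of_real pi * \<i> * of_int n * (of_real b * \<tau> + of_nat k / of_nat N)) =
         - (\<kappa> / 2) * ((real_of_int n)\<^sup>2 + 2 * real_of_int n * (b * real N))"
        using gamma by (simp add: Im_tau Im_tau' \<kappa>_def Im_divide_of_nat power2_eq_square field_simps flip: of_int_power)
      then have "cmod (c n) = exp (- (\<kappa> / 2) * ((real_of_int n)\<^sup>2 + 2 * real_of_int n * (b * real N)))"
        unfolding c_def theta3_term_def norm_exp_eq_Re by simp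
      then show ?thesis by (simp add: power2_eq_square exp_add[symmetric] algebra_simps)
    qed
    have "((\<lambda>n. (cmod (c n))\<^sup>2) has_sum integral {0..1} (\<lambda>a. (cmod (theta3 \<tau>' (of_real a + of_real b * \<tau> + of_nat k / of_nat N)))\<^sup>2)) UNIV"
      using fourier_parseval(2)[OF s] unfolding th .
    then have "((\<lambda>n. (cmod (c n))\<^sup>2 * exp (- \<kappa> * (b * real N)\<^sup>2)) has_sum integral {0..1} (\<lambda>a. (cmod (theta3 \<tau>' (of_real a + of_real b * \<tau> + of_nat k / of_nat N)))\<^sup>2) * exp (- \<kappa> * (b * real N)\<^sup>2)) UNIV"
      by (rule has_sum_cmult_left)
    moreover have "integral {0..1} (\<lambda>a. (cmod (theta3 \<tau>' (of_real a + of_real b * \<tau> + of_nat k / of_nat N)))\<^sup>2) * exp (- \<kappa> * (b * real N)\<^sup>2) = J b / A"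
      unfolding J_def pw by (simp add: A_def)
    ultimately show ?thesis unfolding cn by simp
  qed
  have Jnn: "J b \<ge> 0" for b
  proof -
    have "continuous_on {0..1} (\<lambda>a. (cmod (\<Phi> k (point a b)))\<^sup>2)"
      by (intro continuous_on_point[OF cont] continuous_intros)
    then show ?thesis unfolding J_def by (intro integral_nonneg integrable_continuous_real) auto
  qed
  have ennJ: "ennreal (J b) = ennreal A * (\<integral>\<^sup>+n. ennreal (exp (- \<kappa> * (real_of_int n + b * real N)\<^sup>2)) \<partial>count_space UNIV)" for b
  proof -
    let ?f = "\<lambda>n. exp (- \<kappa> * (real_of_int n + b * real N)\<^sup>2)"
    have "?f summable_on UNIV" using hs[of b] by (rule has_sum_imp_summable)
    then have "Infinite_Sum.abs_summable_on ?f UNIV" by simp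
    then have ab: "Infinite_Set_Sum.abs_summable_on ?f UNIV" by (simp only: abs_summable_equivalent)
    have "(\<integral>\<^sup>+n. ennreal (?f n) \<partial>count_space UNIV) = ennreal (infsetsum ?f UNIV)"
      by (rule nn_integral_conv_infsetsum[OF ab]) simp
    also have "infsetsum ?f UNIV = infsum ?f UNIV" by (rule infsetsum_infsum[OF ab])
    also have "\<dots> = J b / A" using hs[of b] by (rule infsumI)
    finally show ?thesis using Jnn[of b] by (simp add: ennreal_mult[symmetric] A_def)
  qed
  have int: "integral {0..1} J = A * sqrt (pi / \<kappa>)"
  proof -
    have si: "set_integrable lborel {0..1} J"
      unfolding set_integrable_def by (intro borel_integrable_compact continuous_on_subset[OF cJ]) auto
    have "ennreal (integral {0..1} J) = ennreal (LINT b|lborel. indicat_real {0..1} b *\<^sub>R J b)"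
      using set_borel_integral_eq_integral(2)[OF si] by (simp add: set_lebesgue_integral_def)
    also have "\<dots> = (\<integral>\<^sup>+b. ennreal (indicat_real {0..1} b *\<^sub>R J b) \<partial>lborel)"
      using si Jnn by (intro nn_integral_eq_integral[symmetric]) (auto simp: set_integrable_def)
    also have "\<dots> = (\<integral>\<^sup>+b. ennreal A * (indicator {0..<1} b * (\<integral>\<^sup>+n. ennreal (exp (- \<kappa> * (real_of_int n + b * real N)\<^sup>2)) \<partial>count_space UNIV)) \<partial>lborel)"
    proof (rule nn_integral_cong_AE)
      \<comment> \<open>The cell has closed sides, the unfolding a half-open interval; they differ
        by a null set.\<close>
      have "AE b in lborel. b \<noteq> (1::real)" by (rule AE_lborel_singleton)
      then show "AE b in lborel. ennreal (indicat_real {0..1} b *\<^sub>R J b) = ennreal A * (indicator {0..<1} b * (\<integral>\<^sup>+n. ennreal (exp (- \<kappa> * (real_of_int n + b * real N)\<^sup>2)) \<partial>count_space UNIV))"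
        by eventually_elim (auto simp: indicator_def ennJ)
    qed
    also have "\<dots> = ennreal A * ennreal (sqrt (pi / \<kappa>))"
      unfolding nn_integral_gauss_periodized[OF k0, symmetric]
    proof (rule nn_integral_cmult)
      have "(\<lambda>b. indicator {0..<1} b * ennreal (J b / A)) \<in> borel_measurable lborel"
        using borel_measurable_continuous_onI[OF cJ] by measurable
      moreover have "ennreal (J b / A) = (\<integral>\<^sup>+n. ennreal (exp (- \<kappa> * (real_of_int n + b * real N)\<^sup>2)) \<partial>count_space UNIV)" for b
      proof -
        let ?f = "\<lambda>n. exp (- \<kappa> * (real_of_int n + b * real N)\<^sup>2)"
        have "?f summable_on UNIV" using hs[of b] by (rule has_sum_imp_summable)
        then have "Infinite_Sum.abs_summable_on ?f UNIV" by simp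
        then have ab: "Infinite_Set_Sum.abs_summable_on ?f UNIV" by (simp only: abs_summable_equivalent)
        show ?thesis unfolding nn_integral_conv_infsetsum[OF ab exp_ge_zero] infsetsum_infsum[OF ab] infsumI[OF hs[of b]] ..
      qed
      ultimately show "(\<lambda>b. indicator {0..<1} b * (\<integral>\<^sup>+n. ennreal (exp (- \<kappa> * (real_of_int n + b * real N)\<^sup>2)) \<partial>count_space UNIV)) \<in> borel_measurable lborel"
        by simp
    qed
    also have "\<dots> = ennreal (A * sqrt (pi / \<kappa>))" using k0 by (simp add: ennreal_mult[symmetric] A_def)
    finally show ?thesis
      using k0 by (subst (asm) ennreal_inj) (auto simp: A_def intro!: integral_nonneg integrable_continuous_real continuous_on_subset[OF cJ] Jnn)
  qed
  have "(LINT z:cell \<tau> \<gamma>|lborel. (cmod (\<Phi> k z))\<^sup>2) = (\<gamma>\<^sup>2 * Im \<tau>) * (A * sqrt (pi / \<kappa>))"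
  proof -
    have "J = (\<lambda>b. integral {0..1} (\<lambda>a. (cmod (\<Phi> k (point a b)))\<^sup>2))" by (rule ext) (simp add: J_def)
    then show ?thesis using cell_integral[OF cont] int by simp
  qed
  also have "\<gamma>\<^sup>2 * Im \<tau> = pi * real N" using gamma by (simp add: Im_tau)
  also have "sqrt (pi / \<kappa>) = \<gamma> / pi * sqrt (pi / 2)"
  proof -
    have "pi / \<kappa> = (\<gamma> / pi)\<^sup>2 * (pi / 2)" using gamma by (simp add: \<kappa>_def power2_eq_square field_simps)
    then show ?thesis using gamma by (simp only: real_sqrt_mult) simp
  qed
  finally show ?thesis by (simp add: A_def)
qed

definition C_N :: real where "C_N = 1 / (\<gamma> * real N) * sqrt (2 / pi) * exp (- (pi\<^sup>2 / (2 * \<gamma>\<^sup>2)))"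

lemma C_N_pos: "C_N > 0" using gamma N by (simp add: C_N_def)

lemma Phi_norm_inverse: "inverse (LINT z:cell \<tau> \<gamma>|lborel. (cmod (\<Phi> k z))\<^sup>2) = C_N"
  unfolding Phi_norm C_N_def using gamma N by (simp add: exp_minus real_sqrt_divide field_simps)

lemma Phi_inner_self: "inner_cell (\<Phi> k) (\<Phi> k) = of_real (1 / C_N)"
proof -
  have "inner_cell (\<Phi> k) (\<Phi> k) = (LINT z:cell \<tau> \<gamma>|lborel. complex_of_real ((cmod (\<Phi> k z))\<^sup>2))"
    unfolding inner_cell_def complex_norm_square ..
  also have "\<dots> = of_real (LINT z:cell \<tau> \<gamma>|lborel. (cmod (\<Phi> k z))\<^sup>2)" by (rule set_integral_complex_of_real)
  also have "(LINT z:cell \<tau> \<gamma>|lborel. (cmod (\<Phi> k z))\<^sup>2) = 1 / C_N" using Phi_norm_inverse[of k] by (metis inverse_eq_divide inverse_inverse_eq)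
  finally show ?thesis .
qed

end

subsection \<open>The equation in coordinates\<close>

lemma triple_sum_product:
  fixes a b c :: "nat \<Rightarrow> complex"
  shows "(\<Sum>k<N. a k) * (\<Sum>l<N. b l) * (\<Sum>m<N. c m) = (\<Sum>k<N. \<Sum>l<N. \<Sum>m<N. a k * b l * c m)"
proof -
  have "(\<Sum>k<N. a k) * (\<Sum>l<N. b l) * (\<Sum>m<N. c m) = (\<Sum>k<N. a k * ((\<Sum>l<N. b l) * (\<Sum>m<N. c m)))"
    by (simp only: sum_distrib_right mult.assoc)
  also have "\<dots> = (\<Sum>k<N. a k * (\<Sum>l<N. \<Sum>m<N. b l * c m))" by (simp only: sum_product)
  also have "\<dots> = (\<Sum>k<N. \<Sum>l<N. \<Sum>m<N. a k * (b l * c m))" by (simp only: sum_distrib_left)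
  finally show ?thesis by (simp only: mult.assoc)
qed

lemma frechet_smooth_curve_derivs:
  fixes u :: "real \<Rightarrow> complex \<Rightarrow> complex"
  assumes "frechet_smooth UNIV abs W q u"
  obtains D where "\<And>x. D [] x = u x" "\<And>hs x. D hs x \<in> W"
    "\<And>hs x h r. D ((r *\<^sub>R h) # hs) x = r *\<^sub>R D (h # hs) x"
    "\<And>hs x \<epsilon>. \<epsilon> > 0 \<Longrightarrow> \<exists>\<delta>>0. \<forall>h. \<bar>h\<bar> < \<delta> \<longrightarrow> q (D hs (x + h) - D hs x - D (h # hs) x) \<le> \<epsilon> * \<bar>h\<bar>"
proof -
  from assms obtain D where "(\<forall>x\<in>UNIV. D [] x = u x) \<and>
      (\<forall>hs\<in>lists UNIV. \<forall>x\<in>UNIV.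
        D hs x \<in> W \<and>
        (\<forall>h\<in>UNIV. \<forall>k\<in>UNIV. D ((h + k) # hs) x = D (h # hs) x + D (k # hs) x) \<and>
        (\<forall>h\<in>UNIV. \<forall>r::real. D ((r *\<^sub>R h) # hs) x = r *\<^sub>R D (h # hs) x) \<and>
        (\<forall>\<epsilon>>0. \<exists>\<delta>>0. \<forall>h\<in>UNIV. \<bar>h\<bar> < \<delta> \<longrightarrow>
            q (D hs (x + h) - D hs x - D (h # hs) x) \<le> \<epsilon> * \<bar>h\<bar>))"
    unfolding frechet_smooth_def by (elim exE) (rule that)
  note D = conjunct1[OF this] conjunct2[OF this]
  note D2 = bspec[OF bspec[OF D(2)], unfolded lists_UNIV, OF UNIV_I UNIV_I]
  show thesis
  proof (rule that)
    show "D [] x = u x" for x by (rule bspec[OF D(1) UNIV_I])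
    show "D hs x \<in> W" for hs x by (rule conjunct1[OF D2])
    show "D ((r *\<^sub>R h) # hs) x = r *\<^sub>R D (h # hs) x" for hs x h r
      by (rule spec[OF bspec[OF conjunct1[OF conjunct2[OF conjunct2[OF D2]]] UNIV_I]])
    show "\<exists>\<delta>>0. \<forall>h. \<bar>h\<bar> < \<delta> \<longrightarrow> q (D hs (x + h) - D hs x - D (h # hs) x) \<le> \<epsilon> * \<bar>h\<bar>" if "\<epsilon> > 0" for hs x \<epsilon>
      using conjunct2[OF conjunct2[OF conjunct2[OF D2]], of hs x] that by simp
  qed
qed

context LLL_lattice
begin

lemma I4_swap: "I4 k l m j = I4 m l k j" unfolding I4_def by (simp add: mult_ac)

lemma cell_integral_cnj: "cnj (LINT z:cell \<tau> \<gamma>|lborel. f z) = (LINT z:cell \<tau> \<gamma>|lborel. cnj (f z))"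
  unfolding set_lebesgue_integral_def complex_cnj_scaleR[symmetric]
  by (rule integral_bounded_linear'[OF bounded_linear_cnj bounded_linear_cnj, symmetric]) simp

lemma I4_cnj: "cnj (I4 k l m j) = I4 l k j m" unfolding I4_def cell_integral_cnj by (simp add: mult_ac)

sublocale cs: cubic_system N C_N I4
  by unfold_locales (rule I4_swap, rule I4_cnj)

lemma cell_integral_sum:
  fixes f :: "nat \<Rightarrow> complex \<Rightarrow> complex"
  assumes "\<And>i. i < n \<Longrightarrow> continuous_on UNIV (f i)"
  shows "(LINT z:cell \<tau> \<gamma>|lborel. (\<Sum>i<n. f i z)) = (\<Sum>i<n. LINT z:cell \<tau> \<gamma>|lborel. f i z)"
  unfolding set_lebesgue_integral_def scaleR_sum_right
  by (rule Bochner_Integration.integral_sum) (use cell_integrable assms in \<open>auto simp: set_integrable_def\<close>)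

definition comb :: "(nat \<Rightarrow> complex) \<Rightarrow> complex \<Rightarrow> complex" where
  "comb lam z = (\<Sum>k<N. lam k * \<Phi> k z)"

definition coord :: "(complex \<Rightarrow> complex) \<Rightarrow> nat \<Rightarrow> complex" where
  "coord u j = of_real C_N * inner_cell u (\<Phi> j)"

lemma comb_cong: "(\<And>j. j < N \<Longrightarrow> a j = b j) \<Longrightarrow> comb a = comb b"
  by (auto simp: comb_def fun_eq_iff intro!: sum.cong)

lemma comb_in_space: "comb lam \<in> lattice_space \<tau> \<gamma>"
proof -
  have "\<forall>k. \<exists>G. quasi_periodic \<tau> N 1 multiplier G \<and> \<Phi> k = lift G" using lattice_space_lift[OF Phi_in_lattice_space] by auto
  from choice[OF this] obtain G where G: "\<And>k. quasi_periodic \<tau> N 1 multiplier (G k)" "\<And>k. \<Phi> k = lift (G k)" by auto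
  have "quasi_periodic \<tau> N 1 multiplier (\<lambda>x. \<Sum>k<N. lam k * G k x)"
    unfolding quasi_periodic_def
  proof (intro conjI allI)
    show "(\<lambda>x. \<Sum>k<N. lam k * G k x) holomorphic_on UNIV" by (intro holomorphic_intros quasi_periodicD(1)[OF G(1)])
    show "(\<Sum>k<N. lam k * G k (x + 1)) = 1 * (\<Sum>k<N. lam k * G k x)" for x
      using quasi_periodicD(4)[OF G(1)] by simp
    show "(\<Sum>k<N. lam k * G k (x + \<tau>)) = multiplier * exp (- (2 * of_real pi * \<i> * of_nat N * x)) * (\<Sum>k<N. lam k * G k x)" for x
      unfolding quasi_periodicD(5)[OF G(1)] sum_distrib_left by (intro sum.cong refl) (simp only: mult_ac)
  qed (auto simp: multiplier_def)
  moreover have "comb lam = lift (\<lambda>x. \<Sum>k<N. lam k * G k x)"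
    by (simp add: comb_def G(2) lift_def fun_eq_iff sum_distrib_left mult_ac)
  ultimately show ?thesis using lift_in_lattice_space by simp
qed

lemma space_continuous: "u \<in> lattice_space \<tau> \<gamma> \<Longrightarrow> continuous_on UNIV u"
  using lattice_space_quasi by (simp add: quasi_def)

lemma inner_cell_comb:
  assumes "j < N" shows "inner_cell (comb lam) (\<Phi> j) = lam j / of_real C_N"
proof -
  have "inner_cell (comb lam) (\<Phi> j) = (LINT z:cell \<tau> \<gamma>|lborel. (\<Sum>k<N. lam k * (\<Phi> k z * cnj (\<Phi> j z))))"
    unfolding inner_cell_def comb_def by (simp add: sum_distrib_right mult.assoc)
  also have "\<dots> = (\<Sum>k<N. LINT z:cell \<tau> \<gamma>|lborel. lam k * (\<Phi> k z * cnj (\<Phi> j z)))"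
    by (rule cell_integral_sum) (intro continuous_intros Phi_continuous)
  also have "\<dots> = (\<Sum>k<N. lam k * inner_cell (\<Phi> k) (\<Phi> j))" by (simp add: inner_cell_def)
  also have "\<dots> = (\<Sum>k<N. if k = j then lam j * of_real (1 / C_N) else 0)"
    using assms by (intro sum.cong refl) (auto simp: Phi_orthogonal Phi_inner_self)
  also have "\<dots> = lam j / of_real C_N" using assms by (simp add: divide_inverse)
  finally show ?thesis .
qed

lemma coord_comb: "j < N \<Longrightarrow> coord (comb lam) j = lam j"
  using C_N_pos by (simp add: coord_def inner_cell_comb)

lemma comb_coord: "u \<in> lattice_space \<tau> \<gamma> \<Longrightarrow> comb (coord u) = u"
proof -
  assume "u \<in> lattice_space \<tau> \<gamma>"
  then obtain lam where u: "u = comb lam" using lattice_space_span unfolding comb_def[abs_def] by blast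
  show ?thesis unfolding u by (rule comb_cong) (rule coord_comb)
qed

lemma comb_add: "comb a + comb b = comb (\<lambda>j. a j + b j)"
  by (simp add: comb_def fun_eq_iff sum.distrib distrib_right)

lemma comb_diff: "comb a - comb b = comb (\<lambda>j. a j - b j)"
  by (simp add: comb_def fun_eq_iff sum_subtractf left_diff_distrib)

lemma comb_scale: "r *\<^sub>R comb a = comb (\<lambda>j. of_real r * a j)"
  by (simp add: comb_def fun_eq_iff scaleR_fun_def scaleR_conv_of_real sum_distrib_left mult.assoc)

lemma space_add: "u \<in> lattice_space \<tau> \<gamma> \<Longrightarrow> v \<in> lattice_space \<tau> \<gamma> \<Longrightarrow> u + v \<in> lattice_space \<tau> \<gamma>"
  using comb_in_space comb_coord comb_add by metis

lemma space_scale: "u \<in> lattice_space \<tau> \<gamma> \<Longrightarrow> r *\<^sub>R u \<in> lattice_space \<tau> \<gamma>"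
  using comb_in_space comb_coord comb_scale by metis

lemma coord_add:
  assumes "u \<in> lattice_space \<tau> \<gamma>" "v \<in> lattice_space \<tau> \<gamma>"
  shows "coord (u + v) j = coord u j + coord v j"
proof -
  have "inner_cell (u + v) (\<Phi> j) = (LINT z:cell \<tau> \<gamma>|lborel. u z * cnj (\<Phi> j z) + v z * cnj (\<Phi> j z))"
    unfolding inner_cell_def by (simp add: distrib_right)
  also have "\<dots> = inner_cell u (\<Phi> j) + inner_cell v (\<Phi> j)"
    unfolding inner_cell_def by (rule set_integral_add; rule cell_integrable; intro continuous_intros space_continuous assms Phi_continuous)
  finally show ?thesis by (simp add: coord_def distrib_left)
qed

lemma coord_scale: "coord (r *\<^sub>R u) j = of_real r * coord u j"
proof -
  have "inner_cell (r *\<^sub>R u) (\<Phi> j) = (LINT z:cell \<tau> \<gamma>|lborel. of_real r * (u z * cnj (\<Phi> j z)))"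
    unfolding inner_cell_def scaleR_fun_def scaleR_conv_of_real by (simp add: mult.assoc)
  then show ?thesis by (simp add: coord_def inner_cell_def)
qed

lemma cubic_quasi:
  assumes "u \<in> lattice_space \<tau> \<gamma>"
  shows "quasi (\<lambda>w. of_real ((cmod (u w))\<^sup>2) * u w)"
proof -
  note q = lattice_space_quasi[OF assms]
  have "mag_trans \<alpha> (\<lambda>w. of_real ((cmod (u w))\<^sup>2) * u w) = (\<lambda>w. of_real ((cmod (u w))\<^sup>2) * u w)" if "mag_trans \<alpha> u = u" for \<alpha>
  proof
    fix z
    have "cmod (u (z + \<alpha>)) = cmod (u z)" using mag_trans_norm[of \<alpha> u z] that by simp
    moreover have "exp ((\<alpha> * cnj z - cnj \<alpha> * z) / 2) * u (z + \<alpha>) = u z" using fun_cong[OF that, of z] by (simp add: mag_trans_def)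
    ultimately show "mag_trans \<alpha> (\<lambda>w. of_real ((cmod (u w))\<^sup>2) * u w) z = of_real ((cmod (u z))\<^sup>2) * u z"
      unfolding mag_trans_def by (simp add: mult.left_commute)
  qed
  then show ?thesis using q unfolding quasi_def by (auto intro!: continuous_intros)
qed

lemma inner_cubic:
  "inner_cell (\<lambda>w. of_real ((cmod (comb lam w))\<^sup>2) * comb lam w) (\<Phi> j) = cs.force_field lam j"
proof -
  have e: "of_real ((cmod (comb lam z))\<^sup>2) * comb lam z * cnj (\<Phi> j z) =
    (\<Sum>k<N. \<Sum>l<N. \<Sum>m<N. (lam k * cnj (lam l) * lam m) * (\<Phi> k z * cnj (\<Phi> l z) * \<Phi> m z * cnj (\<Phi> j z)))" for z
  proof -
    have "of_real ((cmod (comb lam z))\<^sup>2) * comb lam z = (\<Sum>k<N. lam k * \<Phi> k z) * (\<Sum>l<N. cnj (lam l * \<Phi> l z)) * (\<Sum>m<N. lam m * \<Phi> m z)"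
      unfolding complex_norm_square comb_def by simp
    then show ?thesis unfolding triple_sum_product by (simp only: sum_distrib_right) (simp add: mult_ac)
  qed
  have "inner_cell (\<lambda>w. of_real ((cmod (comb lam w))\<^sup>2) * comb lam w) (\<Phi> j) =
    (\<Sum>k<N. \<Sum>l<N. \<Sum>m<N. LINT z:cell \<tau> \<gamma>|lborel. (lam k * cnj (lam l) * lam m) * (\<Phi> k z * cnj (\<Phi> l z) * \<Phi> m z * cnj (\<Phi> j z)))"
    unfolding inner_cell_def e
    by (subst cell_integral_sum, (intro continuous_intros Phi_continuous)[1], intro sum.cong refl,
        subst cell_integral_sum, (intro continuous_intros Phi_continuous)[1], intro sum.cong refl,
        subst cell_integral_sum, (intro continuous_intros Phi_continuous)[1], rule refl)
  also have "\<dots> = cs.force_field lam j"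
    unfolding cs.force_field_def sum_distrib_left by (intro sum.cong refl) (simp add: I4_def mult_ac)
  finally show ?thesis .
qed

text \<open>Self-adjointness moves the projection to Phi_j, which it fixes. So the coordinates of
  the projected cubic term are the inner products of the cubic term itself.\<close>

lemma proj_cubic:
  "LLL_proj (\<lambda>w. of_real ((cmod (comb lam w))\<^sup>2) * comb lam w) = comb (\<lambda>j. of_real C_N * cs.force_field lam j)"
proof -
  let ?v = "\<lambda>w. of_real ((cmod (comb lam w))\<^sup>2) * comb lam w"
  note q = cubic_quasi[OF comb_in_space[of lam]]
  have "coord (LLL_proj ?v) j = of_real C_N * cs.force_field lam j" for j
  proof -
    have "inner_cell (LLL_proj ?v) (\<Phi> j) = inner_cell ?v (LLL_proj (\<Phi> j))"
      unfolding inner_cell_def by (rule LLL_proj_self_adjoint[OF q Phi_quasi])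
    then show ?thesis unfolding coord_def LLL_proj_fixes[OF Phi_in_lattice_space] inner_cubic by simp
  qed
  then have "coord (LLL_proj ?v) = (\<lambda>j. of_real C_N * cs.force_field lam j)" by (rule ext)
  then show ?thesis using comb_coord[OF LLL_proj_in_lattice_space[OF q]] by simp
qed

section \<open>Integrals and norms in coordinates\<close>

lemma cell_square_comb: "(LINT z:cell \<tau> \<gamma>|lborel. (cmod (comb lam z))\<^sup>2) = cs.energy lam / C_N"
proof -
  have "of_real (LINT z:cell \<tau> \<gamma>|lborel. (cmod (comb lam z))\<^sup>2) = (LINT z:cell \<tau> \<gamma>|lborel. complex_of_real ((cmod (comb lam z))\<^sup>2))"
    by (rule set_integral_complex_of_real[symmetric])
  also have "\<dots> = (LINT z:cell \<tau> \<gamma>|lborel. (\<Sum>j<N. cnj (lam j) * (comb lam z * cnj (\<Phi> j z))))"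
  proof -
    have "complex_of_real ((cmod (comb lam z))\<^sup>2) = comb lam z * cnj (\<Sum>j<N. lam j * \<Phi> j z)" for z
      unfolding complex_norm_square by (simp add: comb_def)
    then show ?thesis by (simp add: sum_distrib_left mult_ac del: of_real_power)
  qed
  also have "\<dots> = (\<Sum>j<N. LINT z:cell \<tau> \<gamma>|lborel. cnj (lam j) * (comb lam z * cnj (\<Phi> j z)))"
    by (rule cell_integral_sum) (intro continuous_intros Phi_continuous space_continuous comb_in_space)
  also have "\<dots> = (\<Sum>j<N. cnj (lam j) * inner_cell (comb lam) (\<Phi> j))" by (simp add: inner_cell_def)
  also have "\<dots> = (\<Sum>j<N. of_real ((cmod (lam j))\<^sup>2 / C_N))"
    unfolding of_real_divide complex_norm_square by (intro sum.cong refl) (simp add: inner_cell_comb mult.commute)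
  also have "\<dots> = of_real (cs.energy lam / C_N)" by (simp add: cs.energy_def sum_divide_distrib)
  finally show ?thesis by (simp only: of_real_eq_iff)
qed

text \<open>The integral of |u|^4 is the Hamiltonian of the coordinate system, so its conservation
  is that of the Hamiltonian.\<close>

lemma cell_fourth_comb: "of_real (LINT z:cell \<tau> \<gamma>|lborel. (cmod (comb lam z))^4) = cs.hamiltonian lam"
proof -
  have "of_real (LINT z:cell \<tau> \<gamma>|lborel. (cmod (comb lam z))^4) = (LINT z:cell \<tau> \<gamma>|lborel. complex_of_real ((cmod (comb lam z))^4))"
    by (rule set_integral_complex_of_real[symmetric])
  also have "\<dots> = (LINT z:cell \<tau> \<gamma>|lborel. (\<Sum>j<N. cnj (lam j) * (of_real ((cmod (comb lam z))\<^sup>2) * comb lam z * cnj (\<Phi> j z))))"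
  proof -
    have "complex_of_real ((cmod (comb lam z))^4) = of_real ((cmod (comb lam z))\<^sup>2) * (comb lam z * cnj (\<Sum>j<N. lam j * \<Phi> j z))" for z
    proof -
      have "complex_of_real ((cmod (comb lam z))^4) = of_real ((cmod (comb lam z))\<^sup>2) * of_real ((cmod (comb lam z))\<^sup>2)"
        unfolding of_real_mult[symmetric] by (simp only: power_add[symmetric]) simp
      then show ?thesis unfolding complex_norm_square by (simp add: comb_def)
    qed
    then show ?thesis by (simp add: sum_distrib_left mult_ac del: of_real_power)
  qed
  also have "\<dots> = (\<Sum>j<N. LINT z:cell \<tau> \<gamma>|lborel. cnj (lam j) * (of_real ((cmod (comb lam z))\<^sup>2) * comb lam z * cnj (\<Phi> j z)))"
    by (rule cell_integral_sum) (intro continuous_intros Phi_continuous space_continuous comb_in_space)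
  also have "\<dots> = (\<Sum>j<N. cnj (lam j) * inner_cell (\<lambda>w. of_real ((cmod (comb lam w))\<^sup>2) * comb lam w) (\<Phi> j))" by (simp add: inner_cell_def)
  also have "\<dots> = cs.hamiltonian lam" unfolding inner_cubic cs.hamiltonian_force ..
  finally show ?thesis .
qed

lemma cell_norm_comb: "cell_norm \<tau> \<gamma> (comb lam) = sqrt (cs.energy lam / C_N)"
  unfolding cell_norm_def cell_square_comb ..

lemma cell_norm_upper: "cell_norm \<tau> \<gamma> (comb lam) \<le> sqrt (1 / C_N) * (\<Sum>j<N. cmod (lam j))"
proof -
  have "cell_norm \<tau> \<gamma> (comb lam) = sqrt (1 / C_N) * sqrt (cs.energy lam)"
    unfolding cell_norm_comb by (simp add: real_sqrt_divide)
  then show ?thesis using cs.energy_le_sum(2)[of lam] C_N_pos by (simp add: mult_left_mono)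
qed

lemma coord_le_norm:
  assumes "j < N" shows "cmod (lam j) \<le> sqrt C_N * cell_norm \<tau> \<gamma> (comb lam)"
proof -
  have "cmod (lam j) \<le> sqrt (cs.energy lam)"
    using assms by (intro cs.component_le) (auto simp: cs.energy_def sum_nonneg)
  also have "\<dots> = sqrt C_N * cell_norm \<tau> \<gamma> (comb lam)"
    unfolding cell_norm_comb using C_N_pos by (simp add: real_sqrt_divide)
  finally show ?thesis .
qed

lemma cell_norm_nonneg: "u \<in> lattice_space \<tau> \<gamma> \<Longrightarrow> cell_norm \<tau> \<gamma> u \<ge> 0"
  using cell_norm_comb[of "coord u"] comb_coord[of u] C_N_pos by (simp add: cs.energy_def sum_nonneg)

section \<open>Smoothness of trajectories and of the flow\<close>

lemma frechet_smooth_curve: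
  "frechet_smooth UNIV abs (lattice_space \<tau> \<gamma>) (cell_norm \<tau> \<gamma>) (\<lambda>t. comb (cs.flow t lam))"
proof -
  \<comment> \<open>The datum is fixed, so the linear part of the embedding moves the time
    coordinate only.\<close>
  define L :: "real \<Rightarrow> (nat \<times> bool) option \<Rightarrow> complex" where "L h i = (case i of None \<Rightarrow> of_real h | Some _ \<Rightarrow> 0)" for h i
  interpret cx: complexification "UNIV :: real set" abs cs.index_set "\<lambda>t. cs.embed t lam" L 1
  proof unfold_locales
    fix h :: real
    have "coord_dist cs.index_set 0 (L h) = (\<Sum>i\<in>{None}. cmod (L h i))"
      unfolding coord_dist_def by (rule sum.mono_neutral_cong_right) (auto simp: cs.finite_index_set cs.index_set_def L_def)
    then show "coord_dist cs.index_set 0 (L h) \<le> 1 * \<bar>h\<bar>" by (simp add: L_def)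
  qed (auto simp: cs.embed_def L_def fun_eq_iff split: option.splits)
  show ?thesis
  proof (rule cx.frechet_smooth_real_analytic[where N = N and G = "\<lambda>j t. cs.flow t lam j" and b = \<Phi> and C = "sqrt (1 / C_N)"])
    show "cx.real_analytic (\<lambda>t. cs.flow t lam j)" if "j < N" for j
      unfolding cx.real_analytic_def
    proof
      fix t :: real
      show "\<exists>r M f. analytic_bounded cs.index_set (cs.embed t lam) r M f \<and>
        (\<forall>s\<in>UNIV. coord_dist cs.index_set (cs.embed t lam) (cs.embed s lam) < r \<longrightarrow> cs.flow s lam j = f (cs.embed s lam))"
        using cs.flow_analytic[of t lam] that by blast
    qed
    show "comb (cs.flow t lam) = (\<lambda>z. \<Sum>j<N. cs.flow t lam j * \<Phi> j z)" for t by (simp add: comb_def[abs_def])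
    show "(\<lambda>z. \<Sum>j<N. c j * \<Phi> j z) \<in> lattice_space \<tau> \<gamma>" for c using comb_in_space[of c] by (simp add: comb_def[abs_def])
    show "cell_norm \<tau> \<gamma> (\<lambda>z. \<Sum>j<N. c j * \<Phi> j z) \<le> sqrt (1 / C_N) * (\<Sum>j<N. cmod (c j))" for c
      using cell_norm_upper[of c] by (simp add: comb_def[abs_def])
  qed (use C_N_pos in simp)
qed

text \<open>Time and coordinates of the datum both enter the embedding linearly, so here it is its
  own linear part.\<close>

lemma frechet_smooth_flow:
  assumes F: "\<And>t v. v \<in> lattice_space \<tau> \<gamma> \<Longrightarrow> F (t, v) = comb (cs.flow t (coord v))"
  shows "frechet_smooth (UNIV \<times> lattice_space \<tau> \<gamma>) (\<lambda>(t, v). \<bar>t\<bar> + cell_norm \<tau> \<gamma> v) (lattice_space \<tau> \<gamma>) (cell_norm \<tau> \<gamma>) F"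
proof -
  define e where "e x = cs.embed (fst x) (coord (snd x))" for x :: "real \<times> (complex \<Rightarrow> complex)"
  \<comment> \<open>1 accounts for time; each of the N coordinates occurs twice, with its conjugate,
    and is at most sqrt C_N times the cell norm.\<close>
  define B where "B = 1 + 2 * real N * sqrt C_N"
  have B: "B \<ge> 1" "B \<ge> 2 * real N * sqrt C_N" using C_N_pos by (auto simp: B_def)
  interpret cx: complexification "UNIV \<times> lattice_space \<tau> \<gamma>" "\<lambda>(t, v). \<bar>t\<bar> + cell_norm \<tau> \<gamma> v" cs.index_set e e B
  proof unfold_locales
    show "e (x + h) = (\<lambda>i. e x i + e h i)" if "x \<in> UNIV \<times> lattice_space \<tau> \<gamma>" "h \<in> UNIV \<times> lattice_space \<tau> \<gamma>" for x h
      using that by (auto simp: e_def cs.embed_def cs.slice_def coord_add fun_eq_iff split: option.splits)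
    show "e (r *\<^sub>R x) = (\<lambda>i. of_real r * e x i)" for r x
      by (auto simp: e_def cs.embed_def cs.slice_def coord_scale fun_eq_iff split: option.splits)
    show "x + h \<in> UNIV \<times> lattice_space \<tau> \<gamma>" if "x \<in> UNIV \<times> lattice_space \<tau> \<gamma>" "h \<in> UNIV \<times> lattice_space \<tau> \<gamma>" for x h :: "real \<times> (complex \<Rightarrow> complex)"
      using that by (auto intro: space_add)
    show "r *\<^sub>R x \<in> UNIV \<times> lattice_space \<tau> \<gamma>" if "x \<in> UNIV \<times> lattice_space \<tau> \<gamma>" for r and x :: "real \<times> (complex \<Rightarrow> complex)"
      using that by (auto intro: space_scale)
    show "B \<ge> 0" using B by simp
    show "0 \<le> (case h of (t, v) \<Rightarrow> \<bar>t\<bar> + cell_norm \<tau> \<gamma> v)" if "h \<in> UNIV \<times> lattice_space \<tau> \<gamma>" for h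
      using that cell_norm_nonneg by (auto intro!: add_nonneg_nonneg)
    show "coord_dist cs.index_set 0 (e h) \<le> B * (case h of (t, v) \<Rightarrow> \<bar>t\<bar> + cell_norm \<tau> \<gamma> v)" if "h \<in> UNIV \<times> lattice_space \<tau> \<gamma>" for h
    proof -
      obtain t v where h: "h = (t, v)" "v \<in> lattice_space \<tau> \<gamma>" using \<open>h \<in> _\<close> by (cases h) auto
      have cv: "cmod (coord v j) \<le> sqrt C_N * cell_norm \<tau> \<gamma> v" if "j < N" for j
        using coord_le_norm[OF that, of "coord v"] comb_coord[OF h(2)] by simp
      have "coord_dist cs.index_set 0 (e h) = cmod (e h None) + (\<Sum>i\<in>Some ` ({..<N} \<times> UNIV). cmod (e h i))"
        unfolding coord_dist_def cs.index_set_def by (subst sum.insert) auto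
      also have "cmod (e h None) = \<bar>t\<bar>" by (simp add: e_def h cs.embed_def)
      finally have dist: "coord_dist cs.index_set 0 (e h) = \<bar>t\<bar> + (\<Sum>i\<in>Some ` ({..<N} \<times> UNIV). cmod (e h i))" .
      have "(\<Sum>i\<in>Some ` ({..<N} \<times> UNIV). cmod (e h i)) = (\<Sum>i\<in>{..<N} \<times> UNIV. cmod (e h (Some i)))"
        by (subst sum.reindex) auto
      also have "\<dots> \<le> (\<Sum>i\<in>{..<N} \<times> (UNIV :: bool set). sqrt C_N * cell_norm \<tau> \<gamma> v)"
        using cv by (intro sum_mono) (auto simp: e_def h cs.embed_def cs.slice_def)
      also have "\<dots> = 2 * real N * sqrt C_N * cell_norm \<tau> \<gamma> v" by (simp add: card_cartesian_product)
      finally have "coord_dist cs.index_set 0 (e h) \<le> \<bar>t\<bar> + 2 * real N * sqrt C_N * cell_norm \<tau> \<gamma> v" unfolding dist by simp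
      also have "\<dots> \<le> B * \<bar>t\<bar> + B * cell_norm \<tau> \<gamma> v"
        using B cell_norm_nonneg[OF h(2)] mult_right_mono[of 1 B "\<bar>t\<bar>"] by (intro add_mono mult_right_mono) auto
      finally show ?thesis by (simp add: h distrib_left)
    qed
  qed
  show ?thesis
  proof (rule cx.frechet_smooth_real_analytic[where N = N and G = "\<lambda>j x. cs.flow (fst x) (coord (snd x)) j" and b = \<Phi> and C = "sqrt (1 / C_N)"])
    show "cx.real_analytic (\<lambda>x. cs.flow (fst x) (coord (snd x)) j)" if "j < N" for j
      unfolding cx.real_analytic_def
    proof
      fix x :: "real \<times> (complex \<Rightarrow> complex)"
      show "\<exists>r M f. analytic_bounded cs.index_set (e x) r M f \<and>
        (\<forall>y\<in>UNIV \<times> lattice_space \<tau> \<gamma>. coord_dist cs.index_set (e x) (e y) < r \<longrightarrow> cs.flow (fst y) (coord (snd y)) j = f (e y))"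
        using cs.flow_analytic[of "fst x" "coord (snd x)"] that unfolding e_def by blast
    qed
    show "F x = (\<lambda>z. \<Sum>j<N. cs.flow (fst x) (coord (snd x)) j * \<Phi> j z)" if "x \<in> UNIV \<times> lattice_space \<tau> \<gamma>" for x
      using that F[of "snd x" "fst x"] by (auto simp: comb_def[abs_def])
    show "(\<lambda>z. \<Sum>j<N. c j * \<Phi> j z) \<in> lattice_space \<tau> \<gamma>" for c using comb_in_space[of c] by (simp add: comb_def[abs_def])
    show "cell_norm \<tau> \<gamma> (\<lambda>z. \<Sum>j<N. c j * \<Phi> j z) \<le> sqrt (1 / C_N) * (\<Sum>j<N. cmod (c j))" for c
      using cell_norm_upper[of c] by (simp add: comb_def[abs_def])
  qed (use C_N_pos in simp)
qed

section \<open>Solutions of the equation and the coordinate flow\<close>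

lemma comb_has_vector_derivative:
  assumes "\<And>j. j < N \<Longrightarrow> ((\<lambda>s. lam s j) has_vector_derivative d j) (at t)"
  shows "((\<lambda>s. comb (lam s) z) has_vector_derivative comb d z) (at t)"
  unfolding comb_def by (intro has_vector_derivative_sum has_vector_derivative_mult_left assms) auto

lemma rhs_force: "\<i> * cs.rhs y j = of_real C_N * cs.force_field y j"
  by (simp add: cs.rhs_def mult.assoc[symmetric])

lemma flow_is_solution:
  assumes u0: "u\<^sub>0 \<in> lattice_space \<tau> \<gamma>"
  shows "LLL_solution \<tau> \<gamma> u\<^sub>0 (\<lambda>t. comb (cs.flow t (coord u\<^sub>0)))"
  unfolding LLL_solution_def
proof (intro conjI allI frechet_smooth_curve)
  have "comb (cs.flow 0 (coord u\<^sub>0)) = comb (coord u\<^sub>0)" by (rule comb_cong) (rule cs.flow_0)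
  then show "comb (cs.flow 0 (coord u\<^sub>0)) = u\<^sub>0" using comb_coord[OF u0] by simp
  fix t z
  define y where "y = cs.flow t (coord u\<^sub>0)"
  have "((\<lambda>s. comb (cs.flow s (coord u\<^sub>0)) z) has_vector_derivative comb (cs.rhs y) z) (at t)"
    unfolding y_def by (rule comb_has_vector_derivative) (rule cs.flow_deriv)
  then have "((\<lambda>s. \<i> * comb (cs.flow s (coord u\<^sub>0)) z) has_vector_derivative \<i> * comb (cs.rhs y) z) (at t)"
    by (rule has_vector_derivative_mult_right)
  moreover have "\<i> * comb (cs.rhs y) z = LLL_proj (\<lambda>w. of_real ((cmod (comb y w))\<^sup>2) * comb y w) z"
    unfolding proj_cubic by (simp add: comb_def sum_distrib_left mult.assoc[symmetric] rhs_force)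
  ultimately show "((\<lambda>s. \<i> * comb (cs.flow s (coord u\<^sub>0)) z) has_vector_derivative
     LLL_proj (\<lambda>w. of_real ((cmod (comb (cs.flow t (coord u\<^sub>0)) w))\<^sup>2) * comb (cs.flow t (coord u\<^sub>0)) w) z) (at t)"
    by (simp add: y_def)
qed

text \<open>A solution has two derivatives: the Frechet derivative in the cell norm, which controls
  the coordinates and lies in the space, and the pointwise one given by the equation. Evaluated at
  each z they must coincide, so the coordinates of the former satisfy the cubic system.\<close>

lemma coord_deriv:
  assumes u: "LLL_solution \<tau> \<gamma> u\<^sub>0 u" and j: "j < N"
  shows "((\<lambda>s. coord (u s) j) has_vector_derivative cs.rhs (coord (u t)) j) (at t)"
proof -
  have fs: "frechet_smooth UNIV abs (lattice_space \<tau> \<gamma>) (cell_norm \<tau> \<gamma>) u" using u by (simp add: LLL_solution_def)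
  obtain D where D0: "\<And>x. D [] x = u x" and DW: "\<And>hs x. D hs x \<in> lattice_space \<tau> \<gamma>"
    and Dlin: "\<And>hs x h r. D ((r *\<^sub>R h) # hs) x = r *\<^sub>R D (h # hs) x"
    and Drem: "\<And>hs x \<epsilon>. \<epsilon> > 0 \<Longrightarrow> \<exists>\<delta>>0. \<forall>h. \<bar>h\<bar> < \<delta> \<longrightarrow> cell_norm \<tau> \<gamma> (D hs (x + h) - D hs x - D (h # hs) x) \<le> \<epsilon> * \<bar>h\<bar>"
  proof (rule frechet_smooth_curve_derivs[OF fs], goal_cases)
    case (1 D)
    show thesis by (rule that) (fact 1)+
  qed
  have uE: "u s \<in> lattice_space \<tau> \<gamma>" for s using DW[of "[]" s] D0 by simp
  define w where "w = D [1] t"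
  have wE: "w \<in> lattice_space \<tau> \<gamma>" by (simp add: w_def DW)
  have der: "((\<lambda>s. coord (u s) i) has_vector_derivative coord w i) (at t)" if i: "i < N" for i
    unfolding has_vector_derivative_def has_derivative_at_alt
  proof (intro conjI allI impI)
    show "bounded_linear (\<lambda>h. h *\<^sub>R coord w i)" by (rule bounded_linear_scaleR_left)
    fix \<epsilon> :: real assume e: "\<epsilon> > 0"
    define \<epsilon>' where "\<epsilon>' = \<epsilon> / sqrt C_N"
    have e': "\<epsilon>' > 0" using e C_N_pos by (simp add: \<epsilon>'_def)
    obtain \<delta> where \<delta>: "\<delta> > 0" "\<And>h. \<bar>h\<bar> < \<delta> \<Longrightarrow> cell_norm \<tau> \<gamma> (D [] (t + h) - D [] t - D [h] t) \<le> \<epsilon>' * \<bar>h\<bar>"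
      using Drem[OF e', of "[]" t] by auto
    have "norm (coord (u s) i - coord (u t) i - (s - t) *\<^sub>R coord w i) \<le> \<epsilon> * norm (s - t)" if s: "norm (s - t) < \<delta>" for s
    proof -
      define h where "h = s - t"
      have Dh: "D [h] t = h *\<^sub>R w" using Dlin[of h 1 "[]" t] by (simp add: w_def)
      have "u s - u t - h *\<^sub>R w = comb (\<lambda>i. coord (u s) i - coord (u t) i - of_real h * coord w i)"
        unfolding comb_diff[symmetric] comb_scale[symmetric] by (simp only: comb_coord[OF uE] comb_coord[OF wE])
      then have "cmod (coord (u s) i - coord (u t) i - of_real h * coord w i) \<le> sqrt C_N * cell_norm \<tau> \<gamma> (u s - u t - h *\<^sub>R w)"
        using coord_le_norm[OF i, of "\<lambda>i. coord (u s) i - coord (u t) i - of_real h * coord w i"] by simp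
      also have "\<dots> \<le> sqrt C_N * (\<epsilon>' * \<bar>h\<bar>)"
        using \<delta>(2)[of h] s C_N_pos unfolding D0 Dh by (intro mult_left_mono) (auto simp: h_def)
      also have "\<dots> = \<epsilon> * \<bar>h\<bar>" using C_N_pos by (simp add: \<epsilon>'_def)
      finally show ?thesis by (simp add: h_def scaleR_conv_of_real)
    qed
    then show "\<exists>d>0. \<forall>y. norm (y - t) < d \<longrightarrow> norm (coord (u y) i - coord (u t) i - (y - t) *\<^sub>R coord w i) \<le> \<epsilon> * norm (y - t)"
      using \<delta>(1) by blast
  qed
  define y where "y = coord (u t)"
  have "\<i> * w z = comb (\<lambda>j. of_real C_N * cs.force_field y j) z" for z
  proof -
    have "((\<lambda>s. comb (coord (u s)) z) has_vector_derivative comb (coord w) z) (at t)"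
      by (rule comb_has_vector_derivative) (rule der)
    then have "((\<lambda>s. \<i> * u s z) has_vector_derivative \<i> * w z) (at t)"
      unfolding comb_coord[OF uE] comb_coord[OF wE] by (rule has_vector_derivative_mult_right)
    moreover have "((\<lambda>s. \<i> * u s z) has_vector_derivative LLL_proj (\<lambda>w. of_real ((cmod (u t w))\<^sup>2) * u t w) z) (at t)"
      using u by (simp add: LLL_solution_def)
    ultimately have "\<i> * w z = LLL_proj (\<lambda>w. of_real ((cmod (u t w))\<^sup>2) * u t w) z"
      by (rule vector_derivative_unique_at)
    also have "u t = comb y" using comb_coord[OF uE] by (simp add: y_def)
    finally show ?thesis unfolding proj_cubic .
  qed
  then have "w z = comb (cs.rhs y) z" for z
  proof -
    have "\<i> * w z = \<i> * comb (cs.rhs y) z"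
      using \<open>\<i> * w z = _\<close> by (simp add: comb_def sum_distrib_left mult.assoc[symmetric] rhs_force)
    then show ?thesis by simp
  qed
  then have "w = comb (cs.rhs y)" by (rule ext)
  then have "coord w j = cs.rhs y j" using coord_comb[OF j] by simp
  then show ?thesis using der[OF j] by (simp add: y_def)
qed

lemma solution_eq_flow:
  assumes u: "LLL_solution \<tau> \<gamma> u\<^sub>0 u" and u0: "u\<^sub>0 \<in> lattice_space \<tau> \<gamma>"
  shows "u t = comb (cs.flow t (coord u\<^sub>0))"
proof -
  have fs: "frechet_smooth UNIV abs (lattice_space \<tau> \<gamma>) (cell_norm \<tau> \<gamma>) u" using u by (simp add: LLL_solution_def)
  have uE: "u s \<in> lattice_space \<tau> \<gamma>" for s
  proof (rule frechet_smooth_curve_derivs[OF fs], goal_cases)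
    case (1 D)
    show ?case unfolding 1(1)[symmetric] by (rule 1(2))
  qed
  have "coord (u t) j = cs.flow t (coord u\<^sub>0) j" if j: "j < N" for j
  proof (rule cs.solves_on_unique[of t "\<lambda>s. coord (u s)" "\<lambda>s. cs.flow s (coord u\<^sub>0)", OF _ cs.flow_solves _ j])
    show "cs.solves_on t (\<lambda>s. coord (u s))" unfolding cs.solves_on_def using coord_deriv[OF u] by simp
    have "u 0 = u\<^sub>0" using u by (simp add: LLL_solution_def)
    then show "coord (u 0) i = cs.flow 0 (coord u\<^sub>0) i" if "i < N" for i using cs.flow_0[OF that] by simp
  qed
  then have "comb (coord (u t)) = comb (cs.flow t (coord u\<^sub>0))" by (rule comb_cong)
  then show ?thesis using comb_coord[OF uE] by simp
qed

lemma solution_iff_flow: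
  assumes "u\<^sub>0 \<in> lattice_space \<tau> \<gamma>"
  shows "LLL_solution \<tau> \<gamma> u\<^sub>0 u \<longleftrightarrow> u = (\<lambda>t. comb (cs.flow t (coord u\<^sub>0)))"
  using solution_eq_flow[OF _ assms] flow_is_solution[OF assms] by auto

lemma LLL_flow_eq:
  assumes "u\<^sub>0 \<in> lattice_space \<tau> \<gamma>"
  shows "LLL_flow \<tau> \<gamma> (t, u\<^sub>0) = comb (cs.flow t (coord u\<^sub>0))"
proof -
  have "(THE u. LLL_solution \<tau> \<gamma> u\<^sub>0 u) = (\<lambda>t. comb (cs.flow t (coord u\<^sub>0)))"
    by (rule the_equality) (simp_all add: solution_iff_flow[OF assms])
  then show ?thesis by (simp add: LLL_flow_def)
qed

lemma flow_energy: "cs.energy (cs.flow t lam) = cs.energy lam"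
  using cs.energy_conserved[OF cs.flow_solves, of t lam] cs.energy_cong[of "cs.flow 0 lam" lam] by (simp add: cs.flow_0)

lemma flow_hamiltonian: "cs.hamiltonian (cs.flow t lam) = cs.hamiltonian lam"
proof -
  have "cs.hamiltonian (cs.flow 0 lam) = cs.hamiltonian lam"
    unfolding cs.hamiltonian_def by (intro sum.cong refl) (simp add: cs.flow_0)
  then show ?thesis using cs.hamiltonian_conserved[OF cs.flow_solves, of t lam] by simp
qed

lemma solution_conserved:
  assumes u: "LLL_solution \<tau> \<gamma> u\<^sub>0 u" and u0: "u\<^sub>0 \<in> lattice_space \<tau> \<gamma>"
  shows "(LINT z:cell \<tau> \<gamma>|lborel. (cmod (u t z))^2) = (LINT z:cell \<tau> \<gamma>|lborel. (cmod (u\<^sub>0 z))^2)"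
    "(LINT z:cell \<tau> \<gamma>|lborel. (cmod (u t z))^4) = (LINT z:cell \<tau> \<gamma>|lborel. (cmod (u\<^sub>0 z))^4)"
proof -
  have 0: "u\<^sub>0 = comb (coord u\<^sub>0)" using comb_coord[OF u0] by simp
  note t = solution_eq_flow[OF u u0, of t]
  have "(LINT z:cell \<tau> \<gamma>|lborel. (cmod (u t z))^2) = cs.energy (coord u\<^sub>0) / C_N"
    unfolding t cell_square_comb flow_energy ..
  also have "\<dots> = (LINT z:cell \<tau> \<gamma>|lborel. (cmod (u\<^sub>0 z))^2)"
    using cell_square_comb[of "coord u\<^sub>0"] unfolding 0[symmetric] ..
  finally show "(LINT z:cell \<tau> \<gamma>|lborel. (cmod (u t z))^2) = (LINT z:cell \<tau> \<gamma>|lborel. (cmod (u\<^sub>0 z))^2)" .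
  have "complex_of_real (LINT z:cell \<tau> \<gamma>|lborel. (cmod (u t z))^4) = cs.hamiltonian (coord u\<^sub>0)"
    unfolding t cell_fourth_comb flow_hamiltonian ..
  also have "\<dots> = complex_of_real (LINT z:cell \<tau> \<gamma>|lborel. (cmod (u\<^sub>0 z))^4)"
    using cell_fourth_comb[of "coord u\<^sub>0"] unfolding 0[symmetric] ..
  finally show "(LINT z:cell \<tau> \<gamma>|lborel. (cmod (u t z))^4) = (LINT z:cell \<tau> \<gamma>|lborel. (cmod (u\<^sub>0 z))^4)"
    by (simp only: of_real_eq_iff)
qed

text \<open>u(t) lies in the space for every t and is factored at each time separately, with the k
  and l of the datum. The zeros are merely chosen, so the statement contains no regularity of t
  \<mapsto> z_j(t).\<close>

lemma solution_theta_product: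
  assumes u: "LLL_solution \<tau> \<gamma> (theta_product N \<tau> \<gamma> k \<mu>\<^sub>0 zs\<^sub>0) u"
    and sum: "(\<Sum>j=1..N. zs\<^sub>0 j) = of_real \<gamma> / 2 * (\<tau> - 1) * of_nat N - of_int k * \<tau> * of_real \<gamma> + of_int l * of_real \<gamma>"
  shows "\<exists>(\<mu> :: real \<Rightarrow> complex) (zs :: real \<Rightarrow> nat \<Rightarrow> complex). \<mu> 0 = \<mu>\<^sub>0 \<and> (\<forall>j\<in>{1..N}. zs 0 j = zs\<^sub>0 j) \<and>
    (\<forall>t z. u t z = theta_product N \<tau> \<gamma> k (\<mu> t) (zs t) z) \<and>
    (\<forall>t. (\<Sum>j=1..N. zs t j) = (\<Sum>j=1..N. zs\<^sub>0 j) \<and>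
      (\<Sum>j=1..N. zs t j) = of_real \<gamma> / 2 * (\<tau> - 1) * of_nat N - of_int k * \<tau> * of_real \<gamma> + of_int l * of_real \<gamma>)"
proof -
  let ?s = "of_real \<gamma> / 2 * (\<tau> - 1) * of_nat N - of_int k * \<tau> * of_real \<gamma> + of_int l * of_real \<gamma>"
  note u0 = theta_product_in_lattice_space[OF sum, of \<mu>\<^sub>0]
  have uE: "u t \<in> lattice_space \<tau> \<gamma>" for t unfolding solution_eq_flow[OF u u0] by (rule comb_in_space)
  have "\<forall>t. \<exists>p. u t = theta_product N \<tau> \<gamma> k (fst p) (snd p) \<and> (\<Sum>j=1..N. snd p j) = ?s"
  proof
    fix t
    obtain m zs where "u t = theta_product N \<tau> \<gamma> k m zs \<and> (\<Sum>j=1..N. zs j) = ?s"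
      using theta_product_representation[OF uE, of t k l] by auto
    then show "\<exists>p. u t = theta_product N \<tau> \<gamma> k (fst p) (snd p) \<and> (\<Sum>j=1..N. snd p j) = ?s"
      by (intro exI[of _ "(m, zs)"]) simp
  qed
  from choice[OF this] obtain p where p: "\<And>t. u t = theta_product N \<tau> \<gamma> k (fst (p t)) (snd (p t))"
    "\<And>t. (\<Sum>j=1..N. snd (p t) j) = ?s" by auto
  have init: "u 0 = theta_product N \<tau> \<gamma> k \<mu>\<^sub>0 zs\<^sub>0" using u by (simp add: LLL_solution_def)
  \<comment> \<open>At time 0 the chosen factorization is replaced by the given one, whose zeros it
    need not reproduce.\<close>
  define P where "P t = (if t = 0 then (\<mu>\<^sub>0, zs\<^sub>0) else p t)" for t
  have P: "u t = theta_product N \<tau> \<gamma> k (fst (P t)) (snd (P t))" "(\<Sum>j=1..N. snd (P t) j) = ?s" for t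
    using p init sum by (auto simp: P_def)
  have P0: "P 0 = (\<mu>\<^sub>0, zs\<^sub>0)" by (simp add: P_def)
  show ?thesis
    by (intro exI[of _ "\<lambda>t. fst (P t)"] exI[of _ "\<lambda>t. snd (P t)"]) (use P P0 sum in simp)
qed

lemma resonant_force:
  assumes "j < N"
  shows "cs.force_field y j = (\<Sum>(k, l, m) \<in> {(k, l, m). k < N \<and> l < N \<and> m < N \<and> [int k - int l + int m = int j] (mod int N)}.
     I4 k l m j * y k * cnj (y l) * y m)"
proof -
  have "cs.force_field y j = (\<Sum>(k, l, m) \<in> {..<N} \<times> {..<N} \<times> {..<N}. I4 k l m j * y k * cnj (y l) * y m)"
    unfolding cs.force_field_def by (simp add: sum.cartesian_product)
  also have "\<dots> = (\<Sum>(k, l, m) \<in> {(k, l, m). k < N \<and> l < N \<and> m < N \<and> [int k - int l + int m = int j] (mod int N)}.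
     I4 k l m j * y k * cnj (y l) * y m)"
    by (rule sum.mono_neutral_right) (auto intro: I4_vanishes)
  finally show ?thesis .
qed

lemma solution_coordinates:
  assumes u: "LLL_solution \<tau> \<gamma> (\<lambda>z. \<Sum>j<N. lam\<^sub>0 j * \<Phi> j z) u"
  shows "\<exists>lam :: real \<Rightarrow> nat \<Rightarrow> complex. (\<forall>j<N. lam 0 j = lam\<^sub>0 j) \<and>
    (\<forall>t z. u t z = (\<Sum>j<N. lam t j * \<Phi> j z)) \<and>
    (\<forall>t. \<forall>j<N. ((\<lambda>s. \<i> * lam s j) has_vector_derivative of_real C_N *
       (\<Sum>(k, l, m) \<in> {(k, l, m). k < N \<and> l < N \<and> m < N \<and> [int k - int l + int m = int j] (mod int N)}.
          I4 k l m j * lam t k * cnj (lam t l) * lam t m)) (at t)) \<and>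
    (\<forall>t. (\<Sum>j<N. (cmod (lam t j))\<^sup>2) = (\<Sum>j<N. (cmod (lam\<^sub>0 j))\<^sup>2))"
proof (intro exI conjI allI impI)
  have u0: "(\<lambda>z. \<Sum>j<N. lam\<^sub>0 j * \<Phi> j z) = comb lam\<^sub>0" by (simp add: comb_def[abs_def])
  note u' = u[unfolded u0]
  define lam where "lam t = cs.flow t (coord (comb lam\<^sub>0))" for t
  show "lam 0 j = lam\<^sub>0 j" if "j < N" for j using that by (simp add: lam_def cs.flow_0 coord_comb)
  show "u t z = (\<Sum>j<N. lam t j * \<Phi> j z)" for t z
    unfolding solution_eq_flow[OF u' comb_in_space] lam_def comb_def ..
  show "((\<lambda>s. \<i> * lam s j) has_vector_derivative of_real C_N *
       (\<Sum>(k, l, m) \<in> {(k, l, m). k < N \<and> l < N \<and> m < N \<and> [int k - int l + int m = int j] (mod int N)}.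
          I4 k l m j * lam t k * cnj (lam t l) * lam t m)) (at t)" if j: "j < N" for t j
    unfolding resonant_force[OF j, symmetric] rhs_force[symmetric] unfolding lam_def
    by (rule has_vector_derivative_mult_right[OF cs.flow_deriv[OF j]])
  have "cs.energy (coord (comb lam\<^sub>0)) = cs.energy lam\<^sub>0" by (rule cs.energy_cong) (rule coord_comb)
  then show "(\<Sum>j<N. (cmod (lam t j))\<^sup>2) = (\<Sum>j<N. (cmod (lam\<^sub>0 j))\<^sup>2)" for t
    using flow_energy[of t "coord (comb lam\<^sub>0)"] by (simp add: lam_def cs.energy_def)
qed

end

theorem theorem2p9:
  fixes N :: nat and \<gamma> \<tau>\<^sub>1 :: real and \<tau> :: complex
  assumes "N \<ge> 1" and "\<gamma> > 0"
    and "\<tau> = of_real \<tau>\<^sub>1 + \<i> * of_real pi * of_nat N / of_real (\<gamma>\<^sup>2)"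
  shows
    "(\<forall>u\<^sub>0 \<in> lattice_space \<tau> \<gamma>. \<exists>!u. LLL_solution \<tau> \<gamma> u\<^sub>0 u) \<and>

     frechet_smooth (UNIV \<times> lattice_space \<tau> \<gamma>) (\<lambda>(t, v). \<bar>t\<bar> + cell_norm \<tau> \<gamma> v)
       (lattice_space \<tau> \<gamma>) (cell_norm \<tau> \<gamma>) (LLL_flow \<tau> \<gamma>) \<and>

     (\<forall>u\<^sub>0 \<in> lattice_space \<tau> \<gamma>. \<forall>u. LLL_solution \<tau> \<gamma> u\<^sub>0 u \<longrightarrow>
        (\<forall>t. (LINT z:cell \<tau> \<gamma>|lborel. (cmod (u t z))^2) = (LINT z:cell \<tau> \<gamma>|lborel. (cmod (u\<^sub>0 z))^2) \<and>
             (LINT z:cell \<tau> \<gamma>|lborel. (cmod (u t z))^4) = (LINT z:cell \<tau> \<gamma>|lborel. (cmod (u\<^sub>0 z))^4))) \<and>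

     (\<forall>(k::int) (l::int) (zs\<^sub>0 :: nat \<Rightarrow> complex) (\<mu>\<^sub>0::complex).
        (\<Sum>j=1..N. zs\<^sub>0 j) = of_real \<gamma> / 2 * (\<tau> - 1) * of_nat N - of_int k * \<tau> * of_real \<gamma> + of_int l * of_real \<gamma>
        \<longrightarrow> theta_product N \<tau> \<gamma> k \<mu>\<^sub>0 zs\<^sub>0 \<in> lattice_space \<tau> \<gamma> \<and>
            (\<forall>u. LLL_solution \<tau> \<gamma> (theta_product N \<tau> \<gamma> k \<mu>\<^sub>0 zs\<^sub>0) u \<longrightarrow>
              (\<exists>(\<mu> :: real \<Rightarrow> complex) (zs :: real \<Rightarrow> nat \<Rightarrow> complex).
                 \<mu> 0 = \<mu>\<^sub>0 \<and> (\<forall>j\<in>{1..N}. zs 0 j = zs\<^sub>0 j) \<and>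
                 (\<forall>t z. u t z = theta_product N \<tau> \<gamma> k (\<mu> t) (zs t) z) \<and>
                 (\<forall>t. (\<Sum>j=1..N. zs t j) = (\<Sum>j=1..N. zs\<^sub>0 j) \<and>
                      (\<Sum>j=1..N. zs t j) = of_real \<gamma> / 2 * (\<tau> - 1) * of_nat N
                         - of_int k * \<tau> * of_real \<gamma> + of_int l * of_real \<gamma>)))) \<and>

     (let C = 1 / (\<gamma> * real N) * sqrt (2 / pi) * exp (- (pi\<^sup>2 / (2 * \<gamma>\<^sup>2))) in
        (\<forall>j<N. inverse (LINT z:cell \<tau> \<gamma>|lborel. (cmod (Phi N \<tau> \<gamma> j z))\<^sup>2) = C) \<and>
        (\<forall>lam\<^sub>0 :: nat \<Rightarrow> complex.
           (\<lambda>z. \<Sum>j<N. lam\<^sub>0 j * Phi N \<tau> \<gamma> j z) \<in> lattice_space \<tau> \<gamma> \<and>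
           (\<forall>u. LLL_solution \<tau> \<gamma> (\<lambda>z. \<Sum>j<N. lam\<^sub>0 j * Phi N \<tau> \<gamma> j z) u \<longrightarrow>
             (\<exists>lam :: real \<Rightarrow> nat \<Rightarrow> complex.
                (\<forall>j<N. lam 0 j = lam\<^sub>0 j) \<and>
                (\<forall>t z. u t z = (\<Sum>j<N. lam t j * Phi N \<tau> \<gamma> j z)) \<and>
                (\<forall>t. \<forall>j<N. ((\<lambda>s. \<i> * lam s j) has_vector_derivative
                    of_real C *
                    (\<Sum>(k, l, m) \<in> {(k, l, m). k < N \<and> l < N \<and> m < N \<and>
                                      [int k - int l + int m = int j] (mod int N)}.
                       (LINT z:cell \<tau> \<gamma>|lborel. Phi N \<tau> \<gamma> k z * cnj (Phi N \<tau> \<gamma> l z) *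
                                                 Phi N \<tau> \<gamma> m z * cnj (Phi N \<tau> \<gamma> j z)) *
                       lam t k * cnj (lam t l) * lam t m)) (at t)) \<and>
                (\<forall>t. (\<Sum>j<N. (cmod (lam t j))\<^sup>2) = (\<Sum>j<N. (cmod (lam\<^sub>0 j))\<^sup>2))))))"
proof -
  interpret LLL_lattice N \<gamma> \<tau>\<^sub>1 \<tau> by unfold_locales (use assms in auto)
  show ?thesis
    unfolding Let_def C_N_def[symmetric] I4_def[symmetric]
  proof (intro conjI ballI allI impI)
    show "\<exists>!u. LLL_solution \<tau> \<gamma> u\<^sub>0 u" if "u\<^sub>0 \<in> lattice_space \<tau> \<gamma>" for u\<^sub>0
      unfolding solution_iff_flow[OF that] by simp
    show "frechet_smooth (UNIV \<times> lattice_space \<tau> \<gamma>) (\<lambda>(t, v). \<bar>t\<bar> + cell_norm \<tau> \<gamma> v)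
       (lattice_space \<tau> \<gamma>) (cell_norm \<tau> \<gamma>) (LLL_flow \<tau> \<gamma>)"
      by (rule frechet_smooth_flow) (rule LLL_flow_eq)
    show "(\<lambda>z. \<Sum>j<N. lam\<^sub>0 j * Phi N \<tau> \<gamma> j z) \<in> lattice_space \<tau> \<gamma>" for lam\<^sub>0
      using comb_in_space[of lam\<^sub>0] by (simp add: comb_def[abs_def])
  qed (rule solution_conserved Phi_norm_inverse theta_product_in_lattice_space solution_theta_product solution_coordinates; assumption)+
qed

end
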